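(* Let $M$ be a countable $\omega$-categorical structure in a countable relational language, let $G=\mathrm{Aut}(M)$, and let $T$ be the complete first-order theory of $M$. Then: (i) the group $\mathcal B(T)$ is totally disconnected and locally compact; (ii) $\mathcal B(T)$ is topologically isomorphic to $\mathrm{Out}(G)=\mathrm{Aut}(G)/\mathrm{Inn}(G)$.
   Context: $\mathrm{Aut}(G)$ is the group of continuous automorphisms of $G$, carrying the unique Polish group topology that makes its action $(\Phi,g)\mapsto \Phi(g)$ on $G$ continuous (such a topology exists for such $G$), $\mathrm{Inn}(G)$ is the subgroup of inner automorphisms, and $\mathrm{Out}(G)$ carries the quotient topology. Interpretations of theories: all theories are $\omega$-categorical complete theories in countable relational languages. Formulas are taken modulo equivalence under the theory: fix a well-ordering of type $\omega$ of the formulas (e.g. length-lexicographic) and always use the least formula in its $T$-equivalence class. An interpretation $\alpha\colon T\rightsquigarrow U$ of $U$ in $T$ consists of: a dimension $k\ge1$; formulas $\phi_D(\bar x)$, $\phi_E(\bar x,\bar y)$ of the language of $T$ ($\bar x,\bar y$ $k$-tuples) such that $T$ proves that $D$ (defined by $\phi_D$) is nonempty and $E$ (defined by $\phi_E$) is an equivalence relation on $D$; and for each relation symbol $R$ (arity $n$) of the language of $U$, a formula $\alpha.R(\bar x_1,\dots,\bar x_n)$ of the language of $T$ which $T$ proves to be $E$-invariant. For any formula $\phi$ of the language of $U$, $\alpha.\phi$ is obtained by replacing each atomic $R(y_1,\dots,y_n)$ by $\alpha.R(\bar y_1,\dots,\bar y_n)$, each $x=y$ by $\phi_E(\bar x,\bar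 y)$, and each quantifier over $x$ by $k$ quantifiers of the same type over the components of $\bar x$. It is required that $\alpha.\psi\in T$ for every sentence $\psi\in U$. Interpretations compose in the usual way (substituting translations), and $1_T$ is the identity interpretation ($k=1$, $\phi_D$ is $x=x$, $\phi_E$ is $x=y$, $1_T.R=R$). Homotopy: for $\alpha_0,\alpha_1\colon T\rightsquigarrow U$ with domains $D_i/E_i$, write $\alpha_0\approx_T\alpha_1$ if there is a formula $\phi_\Theta$ such that $T$ proves that $\phi_\Theta$ defines a bijection $\Theta\colon D_0/E_0\to D_1/E_1$ and, for each $n$-ary relation symbol $R$ of the language of $U$, $T$ proves $\Theta^n(\alpha_0.R)=\alpha_1.R$. $\mathrm{Mor}(T,U)$ is the set of $\approx_T$-classes of interpretations $T\rightsquigarrow U$; composition is well defined on classes. Topology: fix an enumeration $R_0,R_1,\dots$ of the relation symbols of $U$. The set of interpretations $T\rightsquigarrow U$ carries the topology whose basic open sets consist of all interpretations agreeing with a given one on $(k,\phi_D,\phi_E)$ and on $\alpha.R_0,\dots,\alpha.R_{n-1}$ for some $n$; $\mathrm{Mor}(T,U)$ carries the quotient topology. $\mathcal B(T)$ is the group of two-sided invertible elements of the monoid $\mathrm{Mor}(T,T)$, topologised via its identification with the subspace $\{(a,b)\in \mathrm{Mor}(T,T)^2: ab=ba=1\}$ (an element $a$ corresponds to the pair $(a,a^{-1})$).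
   Formalization: In α.φ the k quantifiers over the components of x̄ are relativised to D; taken unrelativised as written, α.(∀x x=x) ∈ T forces D to be all k-tuples and (ii) fails, e.g. for an infinite set with a 6-point unary predicate (outer automorphism of S_6). *)

theory Defs
  imports "HOL-Analysis.Analysis" "HOL-Algebra.Bij" "HOL-Algebra.Coset"
begin

section \<open>Relational first-order logic\<close>

text \<open>Formulas use de Bruijn indices: variable \<open>0\<close> is the one bound by the innermost enclosing
  quantifier. Disjunction and implication are definable.\<close>

datatype 'r fm =
    Eq nat nat
  | Rel 'r "nat list"
  | Neg "'r fm"
  | Conj "'r fm" "'r fm"
  | Ex "'r fm"
  | All "'r fm"

abbreviation Imp :: "'r fm \<Rightarrow> 'r fm \<Rightarrow> 'r fm" where
  "Imp \<phi> \<psi> \<equiv> Neg (Conj \<phi> (Neg \<psi>))"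

text \<open>Besides the signature, a language carries the two enumerations that have to be fixed:
  \<open>sym_index\<close> lists the relation symbols, and \<open>fm_rank\<close> induces the well-ordering of the formulas.\<close>

record 'r language =
  symbols :: "'r set"
  arity :: "'r \<Rightarrow> nat"
  sym_index :: "'r \<Rightarrow> nat"
  fm_rank :: "'r fm \<Rightarrow> nat"

primrec wff :: "'r language \<Rightarrow> nat \<Rightarrow> 'r fm \<Rightarrow> bool" where
  "wff L n (Eq i j) \<longleftrightarrow> i < n \<and> j < n"
| "wff L n (Rel r vs) \<longleftrightarrow> r \<in> symbols L \<and> length vs = arity L r \<and> set vs \<subseteq> {..<n}"
| "wff L n (Neg \<phi>) \<longleftrightarrow> wff L n \<phi>"
| "wff L n (Conj \<phi> \<psi>) \<longleftrightarrow> wff L n \<phi> \<and> wff L n \<psi>"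
| "wff L n (Ex \<phi>) \<longleftrightarrow> wff L (Suc n) \<phi>"
| "wff L n (All \<phi>) \<longleftrightarrow> wff L (Suc n) \<phi>"

text \<open>The formulas \<open>\<phi>(x\<^sub>0, \<dots>, x\<^sub>n\<^sub>-\<^sub>1)\<close>, i.e. with free variables among the first \<open>n\<close>.\<close>

definition formulas :: "'r language \<Rightarrow> nat \<Rightarrow> 'r fm set" where
  "formulas L n = {\<phi>. wff L n \<phi>}"

abbreviation sentences :: "'r language \<Rightarrow> 'r fm set" where
  "sentences L \<equiv> formulas L 0"

text \<open>As the set of formulas is infinite, a well-ordering of type \<open>\<omega>\<close> of it is the same as the order
  induced by an injection into the natural numbers.\<close>

definition countable_language :: "'r language \<Rightarrow> bool" where
  "countable_language L \<longleftrightarrow>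
     inj_on (sym_index L) (symbols L) \<and> inj_on (fm_rank L) (\<Union>n. formulas L n)"

record ('a, 'r) struct =
  universe :: "'a set"
  interp_rel :: "'r \<Rightarrow> 'a list set"

definition tuples :: "('a, 'r) struct \<Rightarrow> nat \<Rightarrow> 'a list set" where
  "tuples M n = {xs. set xs \<subseteq> universe M \<and> length xs = n}"

definition is_structure :: "'r language \<Rightarrow> ('a, 'r) struct \<Rightarrow> bool" where
  "is_structure L M \<longleftrightarrow>
     universe M \<noteq> {} \<and> (\<forall>r\<in>symbols L. interp_rel M r \<subseteq> tuples M (arity L r))"

primrec sat :: "('a, 'r) struct \<Rightarrow> 'a list \<Rightarrow> 'r fm \<Rightarrow> bool" where
  "sat M xs (Eq i j) \<longleftrightarrow> xs ! i = xs ! j"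
| "sat M xs (Rel r vs) \<longleftrightarrow> map ((!) xs) vs \<in> interp_rel M r"
| "sat M xs (Neg \<phi>) \<longleftrightarrow> \<not> sat M xs \<phi>"
| "sat M xs (Conj \<phi> \<psi>) \<longleftrightarrow> sat M xs \<phi> \<and> sat M xs \<psi>"
| "sat M xs (Ex \<phi>) \<longleftrightarrow> (\<exists>x\<in>universe M. sat M (x # xs) \<phi>)"
| "sat M xs (All \<phi>) \<longleftrightarrow> (\<forall>x\<in>universe M. sat M (x # xs) \<phi>)"

definition Th :: "'r language \<Rightarrow> ('a, 'r) struct \<Rightarrow> 'r fm set" where
  "Th L M = {\<psi> \<in> sentences L. sat M [] \<psi>}"

definition is_model :: "'r language \<Rightarrow> 'r fm set \<Rightarrow> ('a, 'r) struct \<Rightarrow> bool" where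
  "is_model L T N \<longleftrightarrow> is_structure L N \<and> (\<forall>\<psi>\<in>T. sat N [] \<psi>)"

text \<open>Every countable structure is isomorphic to one whose universe is a set of natural numbers, so
  the members of \<open>countable_models L T\<close> represent all countable models of \<open>T\<close>.
  By the completeness and the downward Loewenheim-Skolem theorems, a first-order property is
  provable from \<open>T\<close> iff it holds in each of them, and provability is rendered in this way
  throughout.\<close>

definition countable_models :: "'r language \<Rightarrow> 'r fm set \<Rightarrow> (nat, 'r) struct set" where
  "countable_models L T = {N. is_model L T N}"

definition isomorphic :: "'r language \<Rightarrow> ('a, 'r) struct \<Rightarrow> ('b, 'r) struct \<Rightarrow> bool" where
  "isomorphic L M N \<longleftrightarrow> (\<exists>f. bij_betw f (universe M) (universe N) \<and>
     (\<forall>r\<in>symbols L. \<forall>xs\<in>tuples M (arity L r). map f xs \<in> interp_rel N r \<longleftrightarrow> xs \<in> interp_rel M r))"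

definition omega_categorical :: "'r language \<Rightarrow> 'r fm set \<Rightarrow> bool" where
  "omega_categorical L T \<longleftrightarrow>
     (\<forall>N\<in>countable_models L T. \<forall>N'\<in>countable_models L T. isomorphic L N N')"

definition equivalent_fm :: "'r language \<Rightarrow> 'r fm set \<Rightarrow> nat \<Rightarrow> 'r fm \<Rightarrow> 'r fm \<Rightarrow> bool" where
  "equivalent_fm L T n \<phi> \<psi> \<longleftrightarrow> \<phi> \<in> formulas L n \<and> \<psi> \<in> formulas L n \<and>
     (\<forall>N\<in>countable_models L T. \<forall>xs\<in>tuples N n. sat N xs \<phi> \<longleftrightarrow> sat N xs \<psi>)"

definition least_fm :: "'r language \<Rightarrow> 'r fm set \<Rightarrow> nat \<Rightarrow> 'r fm \<Rightarrow> 'r fm" where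
  "least_fm L T n \<phi> = arg_min (fm_rank L) (equivalent_fm L T n \<phi>)"

definition reduced_formulas :: "'r language \<Rightarrow> 'r fm set \<Rightarrow> nat \<Rightarrow> 'r fm set" where
  "reduced_formulas L T n = {\<phi> \<in> formulas L n. least_fm L T n \<phi> = \<phi>}"

primrec rename :: "(nat \<Rightarrow> nat) \<Rightarrow> 'r fm \<Rightarrow> 'r fm" where
  "rename f (Eq i j) = Eq (f i) (f j)"
| "rename f (Rel r vs) = Rel r (map f vs)"
| "rename f (Neg \<phi>) = Neg (rename f \<phi>)"
| "rename f (Conj \<phi> \<psi>) = Conj (rename f \<phi>) (rename f \<psi>)"
| "rename f (Ex \<phi>) = Ex (rename (case_nat 0 (Suc \<circ> f)) \<phi>)"
| "rename f (All \<phi>) = All (rename (case_nat 0 (Suc \<circ> f)) \<phi>)"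


section \<open>Interpretations\<close>

text \<open>An interpretation in a theory over \<open>'r\<close> of a theory over \<open>'s\<close>.\<close>

record ('r, 's) interp =
  idim :: nat
  dom_fm :: "'r fm"
  eq_fm :: "'r fm"
  sym_fm :: "'s \<Rightarrow> 'r fm"

text \<open>The variable \<open>i\<close> of the interpreted language is translated to the \<open>k\<close>-tuple of variables
  \<open>i * k, \<dots>, i * k + k - 1\<close>. Accordingly \<open>rename (block k [y\<^sub>1, \<dots>, y\<^sub>n]) \<phi>\<close> is
  \<open>\<phi>(\<bar>y\<^sub>1, \<dots>, \<bar>y\<^sub>n)\<close>. This is compatible with de Bruijn indices, since one
  quantifier becomes \<open>k\<close> nested quantifiers, which bind the variables \<open>0, \<dots>, k - 1\<close>.\<close>

definition block :: "nat \<Rightarrow> nat list \<Rightarrow> nat \<Rightarrow> nat" where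
  "block k vs m = (vs ! (m div k)) * k + m mod k"

text \<open>The elements of an interpreted model are classes of tuples from the domain \<open>D\<close>, so the
  translated quantifiers are relativised to \<open>D\<close>. (Unrelativised quantifiers would make the
  translation of \<open>\<forall>x. x = x\<close> say that all tuples belong to \<open>D\<close>.)\<close>

primrec translate :: "('r, 's) interp \<Rightarrow> 's fm \<Rightarrow> 'r fm" where
  "translate \<alpha> (Eq i j) = rename (block (idim \<alpha>) [i, j]) (eq_fm \<alpha>)"
| "translate \<alpha> (Rel r vs) = rename (block (idim \<alpha>) vs) (sym_fm \<alpha> r)"
| "translate \<alpha> (Neg \<phi>) = Neg (translate \<alpha> \<phi>)"
| "translate \<alpha> (Conj \<phi> \<psi>) = Conj (translate \<alpha> \<phi>) (translate \<alpha> \<psi>)"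
| "translate \<alpha> (Ex \<phi>) = (Ex ^^ idim \<alpha>) (Conj (dom_fm \<alpha>) (translate \<alpha> \<phi>))"
| "translate \<alpha> (All \<phi>) = (All ^^ idim \<alpha>) (Imp (dom_fm \<alpha>) (translate \<alpha> \<phi>))"

definition dom_set :: "('r, 's) interp \<Rightarrow> ('a, 'r) struct \<Rightarrow> 'a list set" where
  "dom_set \<alpha> N = {xs \<in> tuples N (idim \<alpha>). sat N xs (dom_fm \<alpha>)}"

definition eq_rel :: "('r, 's) interp \<Rightarrow> ('a, 'r) struct \<Rightarrow> ('a list \<times> 'a list) set" where
  "eq_rel \<alpha> N = {(xs, ys). xs \<in> tuples N (idim \<alpha>) \<and> ys \<in> tuples N (idim \<alpha>) \<and>
                          sat N (xs @ ys) (eq_fm \<alpha>)}"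

definition interpretations ::
    "'r language \<Rightarrow> 'r fm set \<Rightarrow> 's language \<Rightarrow> 's fm set \<Rightarrow> ('r, 's) interp set" where
  "interpretations L T L' U = {\<alpha>.
     idim \<alpha> \<ge> 1 \<and>
     dom_fm \<alpha> \<in> reduced_formulas L T (idim \<alpha>) \<and>
     eq_fm \<alpha> \<in> reduced_formulas L T (2 * idim \<alpha>) \<and>
     sym_fm \<alpha> \<in> (\<Pi>\<^sub>E r\<in>symbols L'. reduced_formulas L T (arity L' r * idim \<alpha>)) \<and>
     (\<forall>N\<in>countable_models L T.
        dom_set \<alpha> N \<noteq> {} \<and>
        equiv (dom_set \<alpha> N) (eq_rel \<alpha> N) \<and>
        (\<forall>r\<in>symbols L'. \<forall>xss yss.
           length xss = arity L' r \<longrightarrow> list_all2 (\<lambda>xs ys. (xs, ys) \<in> eq_rel \<alpha> N) xss yss \<longrightarrow>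
           (sat N (concat xss) (sym_fm \<alpha> r) \<longleftrightarrow> sat N (concat yss) (sym_fm \<alpha> r)))) \<and>
     (\<forall>\<psi>\<in>U. translate \<alpha> \<psi> \<in> T)}"

definition id_interp :: "'r language \<Rightarrow> 'r fm set \<Rightarrow> ('r, 'r) interp" where
  "id_interp L T =
     \<lparr>idim = 1,
      dom_fm = least_fm L T 1 (Eq 0 0),
      eq_fm = least_fm L T 2 (Eq 0 1),
      sym_fm = (\<lambda>r\<in>symbols L. least_fm L T (arity L r) (Rel r [0..<arity L r]))\<rparr>"

text \<open>\<open>in_dom \<alpha> n \<phi>\<close> is \<open>\<phi>\<close> in conjunction with \<open>D(\<bar>x\<^sub>i)\<close> for all \<open>i < n\<close>.\<close>

definition in_dom :: "('r, 's) interp \<Rightarrow> nat \<Rightarrow> 'r fm \<Rightarrow> 'r fm" where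
  "in_dom \<alpha> n \<phi> = foldr (\<lambda>i. Conj (rename (block (idim \<alpha>) [i]) (dom_fm \<alpha>))) [0..<n] \<phi>"

text \<open>For \<open>\<alpha>\<close> interpreting \<open>U\<close> in \<open>T\<close> and \<open>\<beta>\<close> interpreting \<open>V\<close> in \<open>U\<close>,
  the composite interprets the \<open>L''\<close>-theory \<open>V\<close> in the \<open>L\<close>-theory \<open>T\<close>.\<close>

definition comp_interp ::
    "'r language \<Rightarrow> 'r fm set \<Rightarrow> 't language \<Rightarrow> ('r, 's) interp \<Rightarrow> ('s, 't) interp \<Rightarrow> ('r, 't) interp"
  where
  "comp_interp L T L'' \<alpha> \<beta> =
     (let k = idim \<alpha> * idim \<beta> in
      \<lparr>idim = k,
       dom_fm = least_fm L T k (in_dom \<alpha> (idim \<beta>) (translate \<alpha> (dom_fm \<beta>))),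
       eq_fm = least_fm L T (2 * k) (in_dom \<alpha> (2 * idim \<beta>) (translate \<alpha> (eq_fm \<beta>))),
       sym_fm = (\<lambda>r\<in>symbols L''. least_fm L T (arity L'' r * k) (translate \<alpha> (sym_fm \<beta> r)))\<rparr>)"

text \<open>The relation on \<open>D/E\<close> defined by \<open>\<alpha>.R\<close>.\<close>

definition quot_rel ::
    "'s language \<Rightarrow> ('r, 's) interp \<Rightarrow> ('a, 'r) struct \<Rightarrow> 's \<Rightarrow> 'a list set list set" where
  "quot_rel L' \<alpha> N r =
     {map (\<lambda>xs. eq_rel \<alpha> N `` {xs}) xss | xss.
        length xss = arity L' r \<and> set xss \<subseteq> dom_set \<alpha> N \<and> sat N (concat xss) (sym_fm \<alpha> r)}"

definition homotopic ::
    "'r language \<Rightarrow> 'r fm set \<Rightarrow> 's language \<Rightarrow> ('r, 's) interp \<Rightarrow> ('r, 's) interp \<Rightarrow> bool" where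
  "homotopic L T L' \<alpha> \<beta> \<longleftrightarrow>
     (\<exists>\<theta>\<in>formulas L (idim \<alpha> + idim \<beta>). \<forall>N\<in>countable_models L T.
        \<exists>\<Theta>. bij_betw \<Theta> (dom_set \<alpha> N // eq_rel \<alpha> N) (dom_set \<beta> N // eq_rel \<beta> N) \<and>
            {(xs, ys). xs \<in> tuples N (idim \<alpha>) \<and> ys \<in> tuples N (idim \<beta>) \<and> sat N (xs @ ys) \<theta>} =
            {(xs, ys). xs \<in> dom_set \<alpha> N \<and> ys \<in> dom_set \<beta> N \<and>
                       \<Theta> (eq_rel \<alpha> N `` {xs}) = eq_rel \<beta> N `` {ys}} \<and>
            (\<forall>r\<in>symbols L'. map \<Theta> ` quot_rel L' \<alpha> N r = quot_rel L' \<beta> N r))"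

definition homotopy_rel ::
    "'r language \<Rightarrow> 'r fm set \<Rightarrow> 's language \<Rightarrow> 's fm set \<Rightarrow> (('r, 's) interp \<times> ('r, 's) interp) set"
  where
  "homotopy_rel L T L' U = {(\<alpha>, \<beta>). \<alpha> \<in> interpretations L T L' U \<and>
     \<beta> \<in> interpretations L T L' U \<and> homotopic L T L' \<alpha> \<beta>}"

definition Mor ::
    "'r language \<Rightarrow> 'r fm set \<Rightarrow> 's language \<Rightarrow> 's fm set \<Rightarrow> ('r, 's) interp set set" where
  "Mor L T L' U = interpretations L T L' U // homotopy_rel L T L' U"

definition Mor_monoid :: "'r language \<Rightarrow> 'r fm set \<Rightarrow> ('r, 'r) interp set monoid" where
  "Mor_monoid L T =
     \<lparr>carrier = Mor L T L T,
      mult = (\<lambda>a b. \<Union>\<alpha>\<in>a. \<Union>\<beta>\<in>b. homotopy_rel L T L T `` {comp_interp L T L \<alpha> \<beta>}),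
      one = homotopy_rel L T L T `` {id_interp L T}\<rparr>"

definition BT :: "'r language \<Rightarrow> 'r fm set \<Rightarrow> ('r, 'r) interp set monoid" where
  "BT L T = units_of (Mor_monoid L T)"


section \<open>Topologies\<close>

definition quotient_topology :: "'a topology \<Rightarrow> ('a \<Rightarrow> 'b) \<Rightarrow> 'b topology" where
  "quotient_topology X q =
     topology (\<lambda>U. U \<subseteq> q ` topspace X \<and> openin X {x \<in> topspace X. q x \<in> U})"

definition interp_topology ::
    "'r language \<Rightarrow> 'r fm set \<Rightarrow> 's language \<Rightarrow> 's fm set \<Rightarrow> ('r, 's) interp topology" where
  "interp_topology L T L' U = topology_generated_by
     {{\<beta> \<in> interpretations L T L' U.
         idim \<beta> = idim \<alpha> \<and> dom_fm \<beta> = dom_fm \<alpha> \<and> eq_fm \<beta> = eq_fm \<alpha> \<and>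
         (\<forall>r\<in>symbols L'. sym_index L' r < n \<longrightarrow> sym_fm \<beta> r = sym_fm \<alpha> r)}
      | \<alpha> n. \<alpha> \<in> interpretations L T L' U}"

definition Mor_topology ::
    "'r language \<Rightarrow> 'r fm set \<Rightarrow> 's language \<Rightarrow> 's fm set \<Rightarrow> ('r, 's) interp set topology" where
  "Mor_topology L T L' U =
     quotient_topology (interp_topology L T L' U) (\<lambda>\<alpha>. homotopy_rel L T L' U `` {\<alpha>})"

definition BT_topology :: "'r language \<Rightarrow> 'r fm set \<Rightarrow> ('r, 'r) interp set topology" where
  "BT_topology L T =
     pullback_topology (carrier (BT L T)) (\<lambda>a. (a, inv\<^bsub>Mor_monoid L T\<^esub> a))
       (prod_topology (Mor_topology L T L T) (Mor_topology L T L T))"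

definition totally_disconnected_space :: "'a topology \<Rightarrow> bool" where
  "totally_disconnected_space X \<longleftrightarrow> (\<forall>S. connectedin X S \<longrightarrow> (\<exists>x. S \<subseteq> {x}))"

definition topological_group :: "('a, 'm) monoid_scheme \<Rightarrow> 'a topology \<Rightarrow> bool" where
  "topological_group G X \<longleftrightarrow> group G \<and> topspace X = carrier G \<and>
     continuous_map (prod_topology X X) X (\<lambda>(x, y). x \<otimes>\<^bsub>G\<^esub> y) \<and>
     continuous_map X X (\<lambda>x. inv\<^bsub>G\<^esub> x)"

definition polish_group :: "('a, 'm) monoid_scheme \<Rightarrow> 'a topology \<Rightarrow> bool" where
  "polish_group G X \<longleftrightarrow>
     topological_group G X \<and> completely_metrizable_space X \<and> second_countable X"

definition topologically_isomorphic ::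
    "('a, 'm) monoid_scheme \<Rightarrow> 'a topology \<Rightarrow> ('b, 'n) monoid_scheme \<Rightarrow> 'b topology \<Rightarrow> bool" where
  "topologically_isomorphic G X H Y \<longleftrightarrow> (\<exists>h \<in> iso G H. homeomorphic_map X Y h)"


section \<open>Automorphism groups\<close>

definition automorphism_group :: "'r language \<Rightarrow> ('a, 'r) struct \<Rightarrow> ('a \<Rightarrow> 'a) monoid" where
  "automorphism_group L M = BijGroup (universe M)
     \<lparr>carrier := {f \<in> Bij (universe M). \<forall>r\<in>symbols L. \<forall>xs\<in>tuples M (arity L r).
        map f xs \<in> interp_rel M r \<longleftrightarrow> xs \<in> interp_rel M r}\<rparr>"

text \<open>The topology of pointwise convergence, where \<open>M\<close> is discrete.\<close>

definition automorphism_topology :: "'r language \<Rightarrow> ('a, 'r) struct \<Rightarrow> ('a \<Rightarrow> 'a) topology" where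
  "automorphism_topology L M =
     subtopology (product_topology (\<lambda>_. discrete_topology (universe M)) (universe M))
       (carrier (automorphism_group L M))"

text \<open>In the following, \<open>X\<close> is the topology of the group \<open>G\<close>.\<close>

definition Aut :: "('g, 'm) monoid_scheme \<Rightarrow> 'g topology \<Rightarrow> ('g \<Rightarrow> 'g) monoid" where
  "Aut G X = AutoGroup G\<lparr>carrier := {\<Phi> \<in> auto G. continuous_map X X \<Phi>}\<rparr>"

definition Aut_topology :: "('g, 'm) monoid_scheme \<Rightarrow> 'g topology \<Rightarrow> ('g \<Rightarrow> 'g) topology" where
  "Aut_topology G X = (THE Y. polish_group (Aut G X) Y \<and>
     continuous_map (prod_topology Y X) X (\<lambda>(\<Phi>, g). \<Phi> g))"

definition Inn :: "('g, 'm) monoid_scheme \<Rightarrow> ('g \<Rightarrow> 'g) set" where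
  "Inn G = {\<lambda>x\<in>carrier G. g \<otimes>\<^bsub>G\<^esub> x \<otimes>\<^bsub>G\<^esub> inv\<^bsub>G\<^esub> g | g. g \<in> carrier G}"

definition Out :: "('g, 'm) monoid_scheme \<Rightarrow> 'g topology \<Rightarrow> ('g \<Rightarrow> 'g) set monoid" where
  "Out G X = Aut G X Mod Inn G"

definition Out_topology :: "('g, 'm) monoid_scheme \<Rightarrow> 'g topology \<Rightarrow> ('g \<Rightarrow> 'g) set topology" where
  "Out_topology G X = quotient_topology (Aut_topology G X) (\<lambda>\<Phi>. Inn G #>\<^bsub>Aut G X\<^esub> \<Phi>)"

end

theory Submission
 imports Defs
begin

text \<open>By the Ryll-Nardzewski theorem, \<open>G\<close> has finitely many orbits on tuples of each length and the
 definable relations are the \<open>G\<close>-invariant ones. Hence an interpretation \<open>\<a>\<close> of \<open>T\<close> in itself amounts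
 to a surjection \<open>\<pi>\<close> from a \<open>G\<close>-invariant set of tuples onto \<open>M\<close> together with a continuous
 endomorphism \<open>\<F>\<close> of \<open>G\<close> such that \<open>\<pi>\<close> is \<open>\<F>\<close>-equivariant. Homotopy of interpretations is
 conjugacy of the endomorphisms under \<open>G\<close>, composition is composition in the opposite order, and
 every continuous automorphism arises. This identifies the group of invertible classes with the
 continuous automorphisms modulo inner ones.

 The Polish topology of \<open>Aut(G)\<close> is that of the action on the countable set of open cosets; it is
 the only one by an open mapping theorem. Interpretations are close iff their endomorphisms are
 conjugate under a permutation of \<open>M\<close> preserving the first \<open>n\<close> relation symbols (\<open>near n\<close>).
 These sets are clopen and form a basis; for \<open>n = 0\<close> they are the images of sets of interpretations
 with fixed dimension, domain and equality, which are compact since there are finitely many formulas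
 for each relation symbol.\<close>

text \<open>An interpretation yields only an endomorphism of \<open>G\<close>, and the permutation
  witnessing \<open>near n\<close> is in general no automorphism of \<open>M\<close>. Both obstacles
  are overcome by counting: for each length there are finitely many \<open>G\<close>-invariant sets
  of tuples. Hence, if conjugation by a permutation maps \<open>G\<close> into itself, it maps
  \<open>G\<close> onto itself; so every interpretation that shares dimension, domain and equality
  with one inducing an automorphism induces an automorphism as well. Likewise, only finitely many
  permutations conjugate one automorphism to another, since they differ by permutations with
  invariant graph. If for each \<open>n\<close> one of them preserves the first \<open>n\<close>
  symbols, then a single one preserves all symbols and lies in \<open>G\<close>; this separates
  points. The quotient map is open because a permutation preserving enough symbols can be corrected
  by an element of \<open>G\<close> until conjugation fixes finitely many given open cosets. It is
  continuous because an automorphism of \<open>G\<close> fixing suitable cosets of point stabilizers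
  is conjugation by a permutation of \<open>M\<close>.\<close>

abbreviation (input) iff2 :: "bool => bool => bool" (infixr "<->" 25) where "P <-> Q \<equiv> P = Q"

section \<open>Infinite assignments\<close>

text \<open>Total assignments replace lists: renaming of variables becomes precomposition, and no
  lengths have to be tracked under quantifiers.\<close>

primrec satf :: "('a, 'r) struct => (nat => 'a) => 'r fm => bool" where
 "satf M s (Eq i j) <-> s i = s j"
| "satf M s (Rel r vs) <-> map s vs \<in> interp_rel M r"
| "satf M s (Neg \<f>) <-> \<not> satf M s \<f>"
| "satf M s (Conj \<f> \<p>) <-> satf M s \<f> \<and> satf M s \<p>"
| "satf M s (Ex \<f>) <-> (\<exists>x\<in>universe M. satf M (case_nat x s) \<f>)"
| "satf M s (All \<f>) <-> (\<forall>x\<in>universe M. satf M (case_nat x s) \<f>)"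

lemma satf_cong:
 assumes "wff L n \<f>" "!!i. i < n ==> s i = t i"
 shows "satf M s \<f> = satf M t \<f>"
 using assms
proof (induction \<f> arbitrary: n s t)
 case (Rel r vs)
 then have "map s vs = map t vs" by (intro map_cong) auto
 then show ?case by (simp only: satf.simps sat.simps)
next
 case (Conj \<f> \<p>)
 have "satf M s \<f> = satf M t \<f>" using Conj.prems by (intro Conj.IH(1)[of n]) simp_all
 moreover have "satf M s \<p> = satf M t \<p>" using Conj.prems by (intro Conj.IH(2)[of n]) simp_all
 ultimately show ?case by (simp only: satf.simps)
next
 case (Neg \<f>)
 have "satf M s \<f> = satf M t \<f>" using Neg.prems by (intro Neg.IH[of n]) simp_all
 then show ?case by (simp only: satf.simps)
next
 case (Eq i j)
 then show ?case by simp
next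
 case (Ex \<f>)
 have "satf M (case_nat x s) \<f> = satf M (case_nat x t) \<f>" for x
  using Ex.prems by (intro Ex.IH[of "Suc n"]) (auto split: nat.split)
 then show ?case by (simp only: satf.simps)
next
 case (All \<f>)
 have "satf M (case_nat x s) \<f> = satf M (case_nat x t) \<f>" for x
  using All.prems by (intro All.IH[of "Suc n"]) (auto split: nat.split)
 then show ?case by (simp only: satf.simps)
qed

lemma sat_conv_satf:
 assumes "wff L n \<f>" "!!i. i < n ==> xs ! i = s i"
 shows "sat M xs \<f> = satf M s \<f>"
 using assms
proof (induction \<f> arbitrary: n s xs)
 case (Rel r vs)
 then have "map ((!) xs) vs = map s vs" by (intro map_cong) auto
 then show ?case by (simp only: satf.simps sat.simps)
next
 case (Conj \<f> \<p>)
 then show ?case using Conj.IH(1)[of n xs s] Conj.IH(2)[of n xs s] by simp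
next
 case (Ex \<f>)
 have "sat M (x # xs) \<f> = satf M (case_nat x s) \<f>" for x
  using Ex.prems by (intro Ex.IH[of "Suc n"]) (auto split: nat.split)
 then show ?case by simp
next
 case (All \<f>)
 have "sat M (x # xs) \<f> = satf M (case_nat x s) \<f>" for x
  using All.prems by (intro All.IH[of "Suc n"]) (auto split: nat.split)
 then show ?case by simp
qed simp_all

lemma sat_map_upt: "wff L n \<f> ==> sat M (map s [0..<n]) \<f> = satf M s \<f>"
 by (rule sat_conv_satf[of L n]) auto

lemma comp_case_nat: "case_nat x s \<circ> case_nat 0 (Suc \<circ> f) = case_nat x (s \<circ> f)"
 by (rule ext) (simp split: nat.split)

lemma satf_rename: "satf M s (rename f \<f>) = satf M (s \<circ> f) \<f>"
proof (induction \<f> arbitrary: s f)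
 case (Ex \<f>)
 then show ?case by (simp only: rename.simps satf.simps comp_case_nat)
next
 case (All \<f>)
 then show ?case by (simp only: rename.simps satf.simps comp_case_nat)
qed simp_all

lemma wff_rename: "wff L n \<f> ==> (!!i. i < n ==> f i < m) ==> wff L m (rename f \<f>)"
proof (induction \<f> arbitrary: n m f)
 case (Conj \<f> \<p>)
 then show ?case using Conj.IH(1)[of n f m] Conj.IH(2)[of n f m] by simp
next
 case (Ex \<f>)
 then show ?case by (simp, intro Ex.IH[of "Suc n"]) (auto split: nat.split)
next
 case (All \<f>)
 then show ?case by (simp, intro All.IH[of "Suc n"]) (auto split: nat.split)
qed auto

lemma rename_rename: "rename f (rename g \<f>) = rename (f \<circ> g) \<f>"
proof (induction \<f> arbitrary: f g)
 case (Ex \<f>)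
 then show ?case by (simp only: rename.simps comp_case_nat comp_assoc)
next
 case (All \<f>)
 then show ?case by (simp only: rename.simps comp_case_nat comp_assoc)
qed simp_all

lemma rename_id: "rename id \<f> = \<f>"
proof -
 have "case_nat 0 Suc = id" by (rule ext) (simp split: nat.split)
 then show ?thesis by (induction \<f>) simp_all
qed

lemma wff_mono: "wff L n \<f> ==> n \<le> m ==> wff L m \<f>"
 using wff_rename[of L n \<f> id m] by (simp add: rename_id)

lemma countable_formulas:
 assumes "countable_language L" shows "countable {\<f>. \<exists>n. wff L n \<f>}"
proof -
 have "{\<f>. \<exists>n. wff L n \<f>} = (\<Union>n. formulas L n)" by (auto simp: formulas_def)
 then show ?thesis using assms unfolding countable_language_def
  by (metis countableI)
qed

section \<open>Generic models\<close>

abbreviation asgs :: "('a, 'r) struct => (nat => 'a) set" where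
 "asgs M \<equiv> UNIV \<rightarrow> universe M"

definition dfs :: "('a, 'r) struct => 'r fm => (nat => 'a) set" where
 "dfs M \<f> = {s \<in> asgs M. satf M s \<f>}"

definition prj :: "nat => (nat => 'a) set => 'a list set" where
 "prj k A = (\<lambda>s. map s [0..<k]) ` A"

text \<open>A Henkin construction in which the conditions are formulas \<open>\<f>\<close> such that the first \<open>k\<close>
 coordinates of the solutions of \<open>\<f>\<close> in \<open>M\<close> form a large set of tuples. Meeting
 the countably many dense sets \<open>D i\<close> omits types or realises them.\<close>

locale generic_model =
 fixes L :: "'r language" and M :: "('a, 'r) struct" and k :: nat
  and large :: "'a list set => bool" and D :: "nat => 'r fm set"
 assumes struct: "is_structure L M"
  and lang: "countable_language L"
  and large_empty: "\<not> large {}"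
  and large_mono: "!!S S'. large S ==> S \<subseteq> S' ==> large S'"
  and large_Un: "!!S S'. large (S \<union> S') ==> large S \<or> large S'"
  and large_all: "large (tuples M k)"
  and dense: "!!i n \<f>. wff L n \<f> ==> large (prj k (dfs M \<f>)) ==>
   \<exists>m. \<exists>\<p>\<in>D i. wff L m \<p> \<and> large (prj k (dfs M (Conj \<f> \<p>)))"
begin

definition cond :: "'r fm => bool" where
 "cond \<f> <-> (\<exists>n. wff L n \<f>) \<and> large (prj k (dfs M \<f>))"

lemma wff_Conj: "\<exists>n. wff L n \<f> ==> \<exists>n. wff L n \<p> ==> \<exists>n. wff L n (Conj \<f> \<p>)"
proof -
 assume "\<exists>n. wff L n \<f>" "\<exists>n. wff L n \<p>"
 then obtain n m where "wff L n \<f>" "wff L m \<p>" by blast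
 then have "wff L (max n m) (Conj \<f> \<p>)"
  using wff_mono[of L n \<f> "max n m"] wff_mono[of L m \<p> "max n m"] by simp
 then show ?thesis by blast
qed

lemma dfs_Conj: "dfs M (Conj \<f> \<p>) = dfs M \<f> \<inter> dfs M \<p>"
 by (auto simp: dfs_def)

text \<open>The projection of the solutions of \<open>\<f>\<close> is the union of those from
  solutions that satisfy \<open>\<e>\<close> and those from solutions that do not; by
  \<open>large_Un\<close> one of the two parts is large.\<close>

lemma cond_decide:
 assumes "cond \<f>" "\<exists>n. wff L n \<e>"
 shows "\<exists>\<f>'. cond \<f>' \<and> dfs M \<f>' \<subseteq> dfs M \<f> \<and> (dfs M \<f>' \<subseteq> dfs M \<e> \<or> dfs M \<f>' \<subseteq> dfs M (Neg \<e>))"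
proof -
 have "prj k (dfs M \<f>) = prj k (dfs M (Conj \<f> \<e>)) \<union> prj k (dfs M (Conj \<f> (Neg \<e>)))"
  by (auto simp: prj_def dfs_def)
 then have "large (prj k (dfs M (Conj \<f> \<e>))) \<or> large (prj k (dfs M (Conj \<f> (Neg \<e>))))"
  using assms(1) large_Un by (metis cond_def)
 moreover have "\<exists>n. wff L n (Conj \<f> \<e>)" "\<exists>n. wff L n (Conj \<f> (Neg \<e>))"
  using assms wff_Conj cond_def by auto
 ultimately consider "cond (Conj \<f> \<e>)" | "cond (Conj \<f> (Neg \<e>))"
  unfolding cond_def by blast
 then show ?thesis
  by cases (use dfs_Conj in blast)+
qed

text \<open>If the condition forces the existential formula, a variable \<open>j\<close> beyond all
  variables of both formulas and beyond the first \<open>k\<close> coordinates can name a witness.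
  Changing an assignment at \<open>j\<close> affects neither the truth of the condition nor the
  projection, so the projection stays large.\<close>

lemma cond_witness:
 assumes "cond \<f>" "\<exists>n. wff L n (Ex \<p>)"
 shows "\<exists>\<f>'. cond \<f>' \<and> dfs M \<f>' \<subseteq> dfs M \<f> \<and>
  (dfs M \<f>' \<subseteq> dfs M (Neg (Ex \<p>)) \<or> (\<exists>j. dfs M \<f>' \<subseteq> dfs M (rename (case_nat j id) \<p>)))"
proof -
 obtain \<f>1 where \<f>1: "cond \<f>1" "dfs M \<f>1 \<subseteq> dfs M \<f>"
  and dec: "dfs M \<f>1 \<subseteq> dfs M (Ex \<p>) \<or> dfs M \<f>1 \<subseteq> dfs M (Neg (Ex \<p>))"
  using cond_decide[OF assms] by blast
 show ?thesis
 proof (cases "dfs M \<f>1 \<subseteq> dfs M (Ex \<p>)")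
  case True
  obtain n m where n: "wff L n \<f>1" and m: "wff L m (Ex \<p>)"
   using \<f>1 assms(2) cond_def by blast
  define j where "j = max n (max m k)"
  let ?\<p> = "rename (case_nat j id) \<p>"
  have w: "wff L (Suc j) ?\<p>"
   using m by (intro wff_rename[of L "Suc m"]) (auto simp: j_def split: nat.split)
  have "prj k (dfs M \<f>1) \<subseteq> prj k (dfs M (Conj \<f>1 ?\<p>))"
  proof
   fix xs assume "xs \<in> prj k (dfs M \<f>1)"
   then obtain s where s: "s \<in> dfs M \<f>1" "xs = map s [0..<k]" by (auto simp: prj_def)
   with True obtain x where x: "x \<in> universe M" "satf M (case_nat x s) \<p>"
    by (auto simp: dfs_def)
   let ?t = "s(j := x)"
   have t: "?t \<in> asgs M" using s x by (auto simp: dfs_def)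
   have "satf M ?t \<f>1 = satf M s \<f>1"
    by (rule satf_cong[OF n]) (auto simp: j_def)
   moreover have "satf M (?t \<circ> case_nat j id) \<p> = satf M (case_nat x s) \<p>"
    using m by (intro satf_cong[of L "Suc m"]) (auto simp: j_def split: nat.split)
   ultimately have "?t \<in> dfs M (Conj \<f>1 ?\<p>)"
    using t s x by (simp add: dfs_def satf_rename)
   moreover have "xs = map ?t [0..<k]" using s by (auto simp: j_def)
   ultimately show "xs \<in> prj k (dfs M (Conj \<f>1 ?\<p>))" by (auto simp: prj_def)
  qed
  moreover have "large (prj k (dfs M \<f>1))" using \<f>1(1) by (simp add: cond_def)
  ultimately have "large (prj k (dfs M (Conj \<f>1 ?\<p>)))" by (rule large_mono[rotated])
  moreover have "\<exists>n. wff L n (Conj \<f>1 ?\<p>)" using n w wff_Conj by blast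
  ultimately have "cond (Conj \<f>1 ?\<p>)" unfolding cond_def by simp
  moreover have "dfs M (Conj \<f>1 ?\<p>) \<subseteq> dfs M \<f>" "dfs M (Conj \<f>1 ?\<p>) \<subseteq> dfs M ?\<p>"
   using \<f>1(2) by (auto simp: dfs_Conj)
  ultimately show ?thesis by (intro exI[of _ "Conj \<f>1 ?\<p>"] conjI disjI2 exI[of _ j])
 next
  case False
  with dec have "dfs M \<f>1 \<subseteq> dfs M (Neg (Ex \<p>))" by simp
  then show ?thesis using \<f>1 by (intro exI[of _ "\<f>1"]) simp
 qed
qed

lemma cond_dense: "cond \<f> ==> \<exists>\<f>'. cond \<f>' \<and> dfs M \<f>' \<subseteq> dfs M \<f> \<and> (\<exists>\<p>\<in>D i. (\<exists>m. wff L m \<p>) \<and> dfs M \<f>' \<subseteq> dfs M \<p>)"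
proof -
 assume \<f>: "cond \<f>"
 then obtain n where n: "wff L n \<f>" and l: "large (prj k (dfs M \<f>))" by (auto simp: cond_def)
 obtain m \<p> where "\<p> \<in> D i" "wff L m \<p>" "large (prj k (dfs M (Conj \<f> \<p>)))"
  using dense[OF n l, of i] by blast
 moreover have "\<exists>n. wff L n (Conj \<f> \<p>)" using n calculation(2) wff_Conj by blast
 ultimately have "cond (Conj \<f> \<p>)" unfolding cond_def by simp
 moreover have "dfs M (Conj \<f> \<p>) \<subseteq> dfs M \<f>" "dfs M (Conj \<f> \<p>) \<subseteq> dfs M \<p>"
  by (auto simp: dfs_Conj)
 ultimately show ?thesis using \<open>\<p> \<in> D i\<close> \<open>wff L m \<p>\<close>
  by (intro exI[of _ "Conj \<f> \<p>"] conjI bexI[of _ \<p>] exI[of _ m])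
qed

text \<open>Requirement number \<open>i\<close> of the construction. It treats the
  \<open>i\<close>-th formula of the enumeration and the dense set \<open>D i\<close> together, so
  one sequence of conditions serves all purposes.\<close>

definition forced_at :: "nat => 'r fm => bool" where
 "forced_at i \<f> <->
  (let \<e> = from_nat_into {\<f>. \<exists>n. wff L n \<f>} i in
   (dfs M \<f> \<subseteq> dfs M \<e> \<or> dfs M \<f> \<subseteq> dfs M (Neg \<e>)) \<and>
   (\<forall>\<p>. \<e> = Ex \<p> --> dfs M \<f> \<subseteq> dfs M (Neg (Ex \<p>)) \<or>
     (\<exists>j. dfs M \<f> \<subseteq> dfs M (rename (case_nat j id) \<p>)))) \<and>
  (\<exists>\<p>\<in>D i. (\<exists>m. wff L m \<p>) \<and> dfs M \<f> \<subseteq> dfs M \<p>)"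

lemma cond_step:
 assumes "cond \<f>"
 shows "\<exists>\<f>'. cond \<f>' \<and> dfs M \<f>' \<subseteq> dfs M \<f> \<and> forced_at i \<f>'"
proof -
 define \<e> where "\<e> = from_nat_into {\<f>. \<exists>n. wff L n \<f>} i"
 have "\<e> \<in> {\<f>. \<exists>n. wff L n \<f>}"
  unfolding \<e>_def using assms cond_def by (intro from_nat_into) blast
 then have \<e>: "\<exists>n. wff L n \<e>" by simp
 obtain \<f>1 where 1: "cond \<f>1" "dfs M \<f>1 \<subseteq> dfs M \<f>" "dfs M \<f>1 \<subseteq> dfs M \<e> \<or> dfs M \<f>1 \<subseteq> dfs M (Neg \<e>)"
  using cond_decide[OF assms \<e>] by blast
 obtain \<f>2 where 2: "cond \<f>2" "dfs M \<f>2 \<subseteq> dfs M \<f>1"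
  "\<forall>\<p>. \<e> = Ex \<p> --> dfs M \<f>2 \<subseteq> dfs M (Neg (Ex \<p>)) \<or>
     (\<exists>j. dfs M \<f>2 \<subseteq> dfs M (rename (case_nat j id) \<p>))"
 proof (cases "\<exists>\<p>. \<e> = Ex \<p>")
  case True
  then obtain \<p> where \<p>: "\<e> = Ex \<p>" by blast
  show ?thesis using cond_witness[OF 1(1), of \<p>] \<e> that unfolding \<p> by blast
 next
  case False
  then show ?thesis using that 1 by blast
 qed
 obtain \<f>3 where 3: "cond \<f>3" "dfs M \<f>3 \<subseteq> dfs M \<f>2" "\<exists>\<p>\<in>D i. (\<exists>m. wff L m \<p>) \<and> dfs M \<f>3 \<subseteq> dfs M \<p>"
  using cond_dense[OF 2(1)] by blast
 have "forced_at i \<f>3"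
  unfolding forced_at_def Let_def \<e>_def[symmetric]
 proof (intro conjI allI impI)
  show "dfs M \<f>3 \<subseteq> dfs M \<e> \<or> dfs M \<f>3 \<subseteq> dfs M (Neg \<e>)"
   using 1(3) order_trans[OF order_trans[OF 3(2) 2(2)]] by blast
  show "dfs M \<f>3 \<subseteq> dfs M (Neg (Ex \<p>)) \<or> (\<exists>j. dfs M \<f>3 \<subseteq> dfs M (rename (case_nat j id) \<p>))"
   if "\<e> = Ex \<p>" for \<p>
   using 2(3) that order_trans[OF 3(2)] by metis
 qed (rule 3(3))
 moreover have "dfs M \<f>3 \<subseteq> dfs M \<f>" using 1(2) 2(2) 3(2) by (meson order_trans)
 ultimately show ?thesis using 3(1) by (intro exI[of _ \<f>3]) simp
qed

text \<open>The sequence starts from a valid sentence: since the universe is nonempty, every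
  \<open>k\<close>-tuple extends to an assignment, so the projection contains the large set
  \<open>tuples M k\<close>.\<close>

lemma generic_sequence:
 obtains f where "!!i. cond (f i)" "!!i. dfs M (f (Suc i)) \<subseteq> dfs M (f i)"
  "!!i. forced_at i (f (Suc i))"
proof -
 have "dfs M (All (Eq 0 0)) = asgs M" by (auto simp: dfs_def)
 moreover have "tuples M k \<subseteq> prj k (asgs M)"
 proof
  fix xs assume xs: "xs \<in> tuples M k"
  obtain a where a: "a \<in> universe M" using struct by (auto simp: is_structure_def)
  let ?s = "\<lambda>i. if i < k then xs ! i else a"
  have "?s \<in> asgs M" using xs a by (auto simp: tuples_def) (metis nth_mem subsetD)
  moreover have "map ?s [0..<k] = xs" using xs by (auto simp: tuples_def intro: nth_equalityI)
  ultimately show "xs \<in> prj k (asgs M)" by (metis (no_types, lifting) image_eqI prj_def)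
 qed
 moreover have "wff L 0 (All (Eq 0 0))" by simp
 ultimately have "cond (All (Eq 0 0))"
  unfolding cond_def using large_mono[OF large_all] by metis
 then have "\<exists>f. \<forall>i. cond (f i) \<and> (dfs M (f (Suc i)) \<subseteq> dfs M (f i) \<and> forced_at i (f (Suc i)))"
  using cond_step by (intro dependent_nat_choice) auto
 then show thesis using that by blast
qed

text \<open>The formulas that hold throughout some condition of the sequence form a complete
  consistent set \<open>U\<close> in which every existential formula has a variable as witness. The
  model is made of the variables modulo the equalities in \<open>U\<close>, and \<open>e\<close>
  sends a variable to its class.\<close>

lemma generic_model:
 obtains N :: "(nat, 'r) struct" and e :: "nat => nat"
 where "is_structure L N" "universe N = range e"
  "!!\<p>. wff L 0 \<p> ==> sat M [] \<p> ==> sat N [] \<p>"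
  "!!i. \<exists>\<p>\<in>D i. satf N e \<p>"
proof -
 obtain f where f: "!!i. cond (f i)" "!!i. dfs M (f (Suc i)) \<subseteq> dfs M (f i)"
  "!!i. forced_at i (f (Suc i))" using generic_sequence by blast
 have anti: "i \<le> j ==> dfs M (f j) \<subseteq> dfs M (f i)" for i j
  using lift_Suc_antimono_le[of "\<lambda>i. dfs M (f i)"] f(2) by blast
 have ne: "dfs M (f i) \<noteq> {}" for i
  using f(1)[of i] large_empty by (auto simp: cond_def prj_def)
 define U where "U \<e> <-> (\<forall>\<^sub>F i in sequentially. dfs M (f i) \<subseteq> dfs M \<e>)" for \<e>
 have UI: "dfs M (f i) \<subseteq> dfs M \<e> ==> U \<e>" for i \<e>
  unfolding U_def eventually_sequentially using anti by blast
 have U_mono: "U \<e> ==> dfs M \<e> \<subseteq> dfs M \<e>' ==> U \<e>'" for \<e> \<e>'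
  unfolding U_def by (erule eventually_mono) blast
 have forced: "\<exists>i. from_nat_into {\<f>. \<exists>n. wff L n \<f>} i = \<e>" if "wff L n \<e>" for n \<e>
  using from_nat_into_surj[OF countable_formulas[OF lang], of \<e>] that by blast
 have U_dec: "U \<e> \<or> U (Neg \<e>)" if w: "wff L n \<e>" for n \<e>
 proof -
  obtain i where i: "from_nat_into {\<f>. \<exists>n. wff L n \<f>} i = \<e>" using forced[OF w] by blast
  have "dfs M (f (Suc i)) \<subseteq> dfs M \<e> \<or> dfs M (f (Suc i)) \<subseteq> dfs M (Neg \<e>)"
   using f(3)[of i] unfolding forced_at_def Let_def i by (rule conjunct1[OF conjunct1])
  then show ?thesis using UI by auto
 qed
 have U_cons: "\<not> (U \<e> \<and> U (Neg \<e>))" for \<e>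
 proof
  assume "U \<e> \<and> U (Neg \<e>)"
  then have "\<forall>\<^sub>F i in sequentially. dfs M (f i) \<subseteq> dfs M \<e> \<and> dfs M (f i) \<subseteq> dfs M (Neg \<e>)"
   unfolding U_def by (auto intro: eventually_conj)
  then obtain i where "dfs M (f i) \<subseteq> dfs M \<e>" "dfs M (f i) \<subseteq> dfs M (Neg \<e>)"
   unfolding eventually_sequentially by blast
  with ne[of i] show False by (auto simp: dfs_def)
 qed
 have U_Neg: "U (Neg \<e>) <-> \<not> U \<e>" if "wff L n \<e>" for n \<e>
  using U_dec[OF that] U_cons by blast
 have U_Conj: "U (Conj \<e> \<e>') <-> U \<e> \<and> U \<e>'" for \<e> \<e>'
  unfolding U_def dfs_Conj le_inf_iff by (rule eventually_conj_iff)
 have U_Ex: "U (Ex \<p>) <-> (\<exists>j. U (rename (case_nat j id) \<p>))" if w: "wff L n (Ex \<p>)" for n \<p>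
 proof
  assume U: "U (Ex \<p>)"
  obtain i where i: "from_nat_into {\<f>. \<exists>n. wff L n \<f>} i = Ex \<p>" using forced[OF w] by blast
  have "\<not> dfs M (f (Suc i)) \<subseteq> dfs M (Neg (Ex \<p>))"
   using U_cons[of "Ex \<p>"] U UI by blast
  then obtain j where "dfs M (f (Suc i)) \<subseteq> dfs M (rename (case_nat j id) \<p>)"
   using f(3)[of i] i unfolding forced_at_def Let_def by auto
  then show "\<exists>j. U (rename (case_nat j id) \<p>)" using UI by blast
 next
  assume "\<exists>j. U (rename (case_nat j id) \<p>)"
  then obtain j where j: "U (rename (case_nat j id) \<p>)" by blast
  have "s \<circ> case_nat j id = case_nat (s j) s" for s :: "nat => 'a"
   by (rule ext) (simp split: nat.split)
  then have "dfs M (rename (case_nat j id) \<p>) \<subseteq> dfs M (Ex \<p>)"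
   by (auto simp: dfs_def satf_rename)
  then show "U (Ex \<p>)" using j U_mono by blast
 qed
 have U_All: "U (All \<p>) <-> (\<forall>j. U (rename (case_nat j id) \<p>))" if w: "wff L n (All \<p>)" for n \<p>
 proof -
  have w': "wff L (Suc (max j n)) (rename (case_nat j id) \<p>)" for j
   using w by (intro wff_rename[of L "Suc n"]) (auto split: nat.split)
  have eq: "dfs M (Neg (Ex (Neg \<p>))) = dfs M (All \<p>)" by (auto simp: dfs_def)
  have "U (All \<p>) <-> U (Neg (Ex (Neg \<p>)))" unfolding U_def eq ..
  also have "\<dots> <-> \<not> U (Ex (Neg \<p>))" using w by (intro U_Neg[of n]) simp
  also have "\<dots> <-> (\<forall>j. \<not> U (rename (case_nat j id) (Neg \<p>)))"
   using U_Ex[of n "Neg \<p>"] w by simp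
  also have "\<dots> <-> (\<forall>j. U (rename (case_nat j id) \<p>))"
   using U_Neg[OF w'] by simp
  finally show ?thesis .
 qed
 \<comment> \<open>A class is represented by its least variable, so the universe is a set of natural
   numbers.\<close>
 define e where "e i = (LEAST j. U (Eq i j))" for i
 have U_all: "dfs M \<e> = asgs M ==> U \<e>" for \<e> by (rule UI[of 0]) (auto simp: dfs_def)
 have U_refl: "U (Eq i i)" for i by (rule U_all) (auto simp: dfs_def)
 have U_sym: "U (Eq i j) ==> U (Eq j i)" for i j
  by (erule U_mono) (auto simp: dfs_def)
 have U_trans: "U (Eq i j) ==> U (Eq j l) ==> U (Eq i l)" for i j l
 proof -
  assume "U (Eq i j)" "U (Eq j l)"
  then have "U (Conj (Eq i j) (Eq j l))" by (simp add: U_Conj)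
  then show "U (Eq i l)" by (rule U_mono) (auto simp: dfs_def)
 qed
 have e_eq: "e i = e j <-> U (Eq i j)" for i j
 proof
  have l: "U (Eq i (e i))" for i unfolding e_def by (rule LeastI) (rule U_refl)
  assume "e i = e j" then show "U (Eq i j)" using l[of i] l[of j] U_sym U_trans by metis
 next
  assume "U (Eq i j)"
  then have "U (Eq i l) = U (Eq j l)" for l using U_sym U_trans by blast
  then show "e i = e j" by (simp add: e_def)
 qed
 define N :: "(nat, 'r) struct" where
  "N = \<lparr>universe = range e, interp_rel = (\<lambda>r. {map e vs | vs. U (Rel r vs) \<and> length vs = arity L r})\<rparr>"
 have rel: "map e vs \<in> interp_rel N r <-> U (Rel r vs)" if len: "length vs = arity L r" for r vs
 proof
  assume "map e vs \<in> interp_rel N r"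
  then obtain ws where ws: "map e vs = map e ws" "U (Rel r ws)" by (auto simp: N_def)
  then have lw: "length ws = length vs" by (metis length_map)
  have "U (Eq (vs ! i) (ws ! i))" if "i < length vs" for i
   using ws(1) that lw e_eq by (metis nth_map)
  \<comment> \<open>There is one equality for each of the finitely many positions, so from some
    condition on they hold simultaneously.\<close>
  then have "\<forall>\<^sub>F n in sequentially. \<forall>i\<in>{..<length vs}. dfs M (f n) \<subseteq> dfs M (Eq (vs ! i) (ws ! i))"
   unfolding U_def by (intro eventually_ball_finite) auto
  then show "U (Rel r vs)" using ws(2) unfolding U_def
  proof eventually_elim
   case (elim n)
   show ?case
   proof
    fix s assume s: "s \<in> dfs M (f n)"
    have "map s vs = map s ws"
     using elim(1) s lw by (intro nth_equalityI) (auto simp: dfs_def)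
    then show "s \<in> dfs M (Rel r vs)" using elim(2) s by (auto simp: dfs_def)
   qed
  qed
 qed (use len in \<open>auto simp: N_def\<close>)
 \<comment> \<open>The truth lemma is stated for all renamings \<open>s\<close>, because passing
   under a quantifier substitutes the variable \<open>j\<close> that names an element for the bound
   variable.\<close>
 have truth: "satf N (e \<circ> s) \<f> <-> U (rename s \<f>)" if "wff L n \<f>" for n s \<f>
  using that
 proof (induction \<f> arbitrary: n s)
  case (Eq i j)
  then show ?case by (simp add: e_eq)
 next
  case (Rel r vs)
  then show ?case using rel[of "map s vs" r] by (simp add: comp_def)
 next
  case (Neg \<f>)
  have w: "wff L (Suc (Max (s ` {..<n}))) (rename s \<f>)"
   using Neg.prems by (intro wff_rename[of L n]) (auto intro: le_imp_less_Suc Max_ge)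
  show ?case using Neg.IH[of n s] Neg.prems U_Neg[OF w] by simp
 next
  case (Conj \<f> \<p>)
  then show ?case using Conj.IH[of n s] by (simp add: U_Conj)
 next
  case (Ex \<f>)
  have w: "wff L (Suc (Max (s ` {..<n}))) (rename s (Ex \<f>))"
   using Ex.prems by (intro wff_rename[of L n]) (auto intro: le_imp_less_Suc Max_ge)
  have c: "case_nat (e j) (e \<circ> s) = e \<circ> case_nat j s" for j by (rule ext) (simp split: nat.split)
  have r: "case_nat j id \<circ> case_nat 0 (Suc \<circ> s) = case_nat j s" for j
   by (rule ext) (simp split: nat.split)
  have "satf N (e \<circ> s) (Ex \<f>) <-> (\<exists>j. satf N (e \<circ> case_nat j s) \<f>)"
   unfolding c[symmetric] by (auto simp: N_def)
  also have "\<dots> <-> (\<exists>j. U (rename (case_nat j s) \<f>))"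
   using Ex.IH[of "Suc n"] Ex.prems by (simp only: wff.simps)
  finally show ?case using U_Ex[OF w[unfolded rename.simps]] by (simp only: rename.simps rename_rename r)
 next
  case (All \<f>)
  have w: "wff L (Suc (Max (s ` {..<n}))) (rename s (All \<f>))"
   using All.prems by (intro wff_rename[of L n]) (auto intro: le_imp_less_Suc Max_ge)
  have c: "case_nat (e j) (e \<circ> s) = e \<circ> case_nat j s" for j by (rule ext) (simp split: nat.split)
  have r: "case_nat j id \<circ> case_nat 0 (Suc \<circ> s) = case_nat j s" for j
   by (rule ext) (simp split: nat.split)
  have "satf N (e \<circ> s) (All \<f>) <-> (\<forall>j. satf N (e \<circ> case_nat j s) \<f>)"
   unfolding c[symmetric] by (auto simp: N_def)
  also have "\<dots> <-> (\<forall>j. U (rename (case_nat j s) \<f>))"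
   using All.IH[of "Suc n"] All.prems by (simp only: wff.simps)
  finally show ?case using U_All[OF w[unfolded rename.simps]] by (simp only: rename.simps rename_rename r)
 qed
 have truth': "satf N e \<f> <-> U \<f>" if "wff L n \<f>" for n \<f>
  using truth[OF that, of id] by (simp add: rename_id)
 show thesis
 proof
  show "is_structure L N"
   unfolding is_structure_def by (auto simp: N_def tuples_def)
  show "universe N = range e" by (simp add: N_def)
  show "sat N [] \<p>" if "wff L 0 \<p>" "sat M [] \<p>" for \<p>
  proof -
   have "dfs M \<p> = asgs M" using that sat_conv_satf[OF that(1), of "[]"]
    by (auto simp: dfs_def)
   then show ?thesis using U_all truth'[OF that(1)] sat_conv_satf[OF that(1), of "[]" e N] by simp
  qed
  show "\<exists>\<p>\<in>D i. satf N e \<p>" for i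
   using f(3)[of i] UI truth' unfolding forced_at_def by blast
 qed
qed

end

section \<open>The Ryll-Nardzewski theorem\<close>

lemma tuple_asg:
 assumes "xs \<in> tuples M n" "universe M \<noteq> {}"
 obtains s where "s \<in> asgs M" "xs = map s [0..<n]"
proof -
 obtain a where a: "a \<in> universe M" using assms(2) by blast
 let ?s = "\<lambda>i. if i < n then xs ! i else a"
 have "?s i \<in> universe M" for i
  using assms(1) a nth_mem[of i xs] by (auto simp: tuples_def)
 then have "?s \<in> asgs M" by auto
 moreover have "xs = map ?s [0..<n]" using assms(1) by (auto simp: tuples_def intro: nth_equalityI)
 ultimately show thesis using that by blast
qed

lemma map_asg_tuples: "s \<in> asgs M ==> map s [0..<n] \<in> tuples M n"
 by (auto simp: tuples_def)

definition prepend_asg :: "'a list => (nat => 'a) => nat => 'a" where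
 "prepend_asg xs s i = (if i < length xs then xs ! i else s (i - length xs))"

lemma prepend_asg_Nil [simp]: "prepend_asg [] s = s"
 by (rule ext) (simp add: prepend_asg_def)

lemma prepend_asg_snoc: "prepend_asg (xs @ [x]) s = prepend_asg xs (case_nat x s)"
proof
 fix i show "prepend_asg (xs @ [x]) s i = prepend_asg xs (case_nat x s) i"
 proof (cases "i < length xs")
  case True then show ?thesis by (simp add: prepend_asg_def nth_append)
 next
  case False
  then obtain j where "i = length xs + j" using le_Suc_ex not_less by blast
  then show ?thesis by (cases j) (simp_all add: prepend_asg_def nth_append)
 qed
qed

lemma prepend_asg_asgs: "xs \<in> tuples M n ==> s \<in> asgs M ==> prepend_asg xs s \<in> asgs M"
 using nth_mem[of _ xs] by (auto simp: prepend_asg_def tuples_def Pi_iff)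

text \<open>The outermost of the nested quantifiers binds the highest index, so peeling it off
  appends its value at the end of the tuple.\<close>

lemma satf_Ex_pow:
 "satf M s ((Ex ^^ k) \<f>) <-> (\<exists>xs\<in>tuples M k. satf M (prepend_asg xs s) \<f>)"
proof (induction k arbitrary: s)
 case 0
 have "tuples M 0 = {[]}" by (auto simp: tuples_def)
 then show ?case by simp
next
 case (Suc k)
 have "satf M s ((Ex ^^ Suc k) \<f>) <->
   (\<exists>x\<in>universe M. \<exists>xs\<in>tuples M k. satf M (prepend_asg (xs @ [x]) s) \<f>)"
  by (simp add: Suc.IH prepend_asg_snoc)
 also have "\<dots> <-> (\<exists>xs\<in>tuples M (Suc k). satf M (prepend_asg xs s) \<f>)"
 proof
  assume "\<exists>x\<in>universe M. \<exists>xs\<in>tuples M k. satf M (prepend_asg (xs @ [x]) s) \<f>"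
  then obtain x xs where "x \<in> universe M" "xs \<in> tuples M k" "satf M (prepend_asg (xs @ [x]) s) \<f>"
   by blast
  then show "\<exists>xs\<in>tuples M (Suc k). satf M (prepend_asg xs s) \<f>"
   by (intro bexI[of _ "xs @ [x]"]) (auto simp: tuples_def)
 next
  assume "\<exists>xs\<in>tuples M (Suc k). satf M (prepend_asg xs s) \<f>"
  then obtain ys where ys: "ys \<in> tuples M (Suc k)" "satf M (prepend_asg ys s) \<f>" by blast
  then obtain xs x where "ys = xs @ [x]" by (cases ys rule: rev_cases) (auto simp: tuples_def)
  then show "\<exists>x\<in>universe M. \<exists>xs\<in>tuples M k. satf M (prepend_asg (xs @ [x]) s) \<f>"
   using ys by (intro bexI[of _ x] bexI[of _ xs]) (auto simp: tuples_def)
 qed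
 finally show ?case .
qed

lemma satf_All_pow:
 "satf M s ((All ^^ k) \<f>) <-> (\<forall>xs\<in>tuples M k. satf M (prepend_asg xs s) \<f>)"
proof -
 have "satf M s ((All ^^ k) \<f>) <-> \<not> satf M s ((Ex ^^ k) (Neg \<f>))" for s
  by (induction k arbitrary: s) simp_all
 then show ?thesis by (simp add: satf_Ex_pow)
qed

lemma wff_Ex_pow: "wff L n ((Ex ^^ k) \<f>) = wff L (k + n) \<f>"
 by (induction k arbitrary: n) simp_all

lemma wff_All_pow: "wff L n ((All ^^ k) \<f>) = wff L (k + n) \<f>"
 by (induction k arbitrary: n) simp_all

definition conjs :: "'r fm list => 'r fm" where
 "conjs \<f>s = foldr Conj \<f>s (All (Eq 0 0))"

lemma satf_conjs: "satf M s (conjs \<f>s) <-> (\<forall>\<f>\<in>set \<f>s. satf M s \<f>)"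
 by (induction \<f>s) (simp_all add: conjs_def)

lemma wff_conjs: "wff L n (conjs \<f>s) <-> (\<forall>\<f>\<in>set \<f>s. wff L n \<f>)"
 by (induction \<f>s) (simp_all add: conjs_def)

section \<open>Isomorphisms, transfer of truth, and copies on the natural numbers\<close>

definition iso_by :: "'r language => ('a => 'b) => ('a, 'r) struct => ('b, 'r) struct => bool" where
 "iso_by L f M N <-> bij_betw f (universe M) (universe N) \<and>
   (\<forall>r\<in>symbols L. \<forall>xs\<in>tuples M (arity L r). map f xs \<in> interp_rel N r <-> xs \<in> interp_rel M r)"

lemma isomorphic_iff: "isomorphic L M N <-> (\<exists>f. iso_by L f M N)"
 by (simp add: isomorphic_def iso_by_def)

lemma iso_by_tuples: "iso_by L f M N ==> xs \<in> tuples M n ==> map f xs \<in> tuples N n"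
 using bij_betwE[of f "universe M" "universe N"] by (auto simp: tuples_def iso_by_def)

lemma iso_by_comp: "iso_by L f M N ==> iso_by L g N K ==> iso_by L (g \<circ> f) M K"
 using iso_by_tuples[of L f M N] unfolding iso_by_def
 by (auto intro: bij_betw_trans simp flip: map_map)

lemma iso_by_inv:
 assumes "iso_by L f M N" shows "iso_by L (inv_into (universe M) f) N M"
proof -
 let ?g = "inv_into (universe M) f"
 have b: "bij_betw f (universe M) (universe N)" using assms by (simp add: iso_by_def)
 have "bij_betw ?g (universe N) (universe M)" using b by (rule bij_betw_inv_into)
 moreover have "map ?g xs \<in> interp_rel M r <-> xs \<in> interp_rel N r"
  if "r \<in> symbols L" "xs \<in> tuples N (arity L r)" for r xs
 proof -
  have "map ?g xs \<in> tuples M (arity L r)"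
   using that(2) bij_betwE[OF bij_betw_inv_into[OF b]] by (auto simp: tuples_def)
  moreover have "map f (map ?g xs) = xs"
   using that(2) b by (auto simp: tuples_def bij_betw_inv_into_right intro!: map_idI)
  ultimately show ?thesis using assms that(1) unfolding iso_by_def by metis
 qed
 ultimately show ?thesis by (simp add: iso_by_def)
qed

lemma satf_iso:
 assumes "iso_by L f M N" "wff L n \<f>" "s \<in> asgs M"
 shows "satf N (f \<circ> s) \<f> = satf M s \<f>"
 using assms(2,3)
proof (induction \<f> arbitrary: n s)
 case (Eq i j)
 have "inj_on f (universe M)" using assms(1) by (simp add: iso_by_def bij_betw_def)
 then show ?case using Eq by (auto simp: inj_on_def)
next
 case (Rel r vs)
 have "map s vs \<in> tuples M (arity L r)" using Rel by (auto simp: tuples_def)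
 then have "map f (map s vs) \<in> interp_rel N r <-> map s vs \<in> interp_rel M r"
  using Rel assms(1) unfolding iso_by_def wff.simps by blast
 then show ?case by (simp add: comp_def)
next
 case (Neg \<f>)
 show ?case using Neg.IH[of n s] Neg.prems by simp
next
 case (Conj \<f> \<p>)
 show ?case using Conj.IH(1)[of n s] Conj.IH(2)[of n s] Conj.prems by simp
next
 case (Ex \<f>)
 have c: "case_nat (f x) (f \<circ> s) = f \<circ> case_nat x s" for x by (rule ext) (simp split: nat.split)
 have "satf N (f \<circ> case_nat x s) \<f> = satf M (case_nat x s) \<f>" if "x \<in> universe M" for x
  using Ex.prems that by (intro Ex.IH[of "Suc n"]) (auto simp: Pi_iff split: nat.split)
 moreover have "universe N = f ` universe M" using assms(1) by (auto simp: iso_by_def bij_betw_def)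
 ultimately show ?case by (simp add: c del: comp_apply)
next
 case (All \<f>)
 have c: "case_nat (f x) (f \<circ> s) = f \<circ> case_nat x s" for x by (rule ext) (simp split: nat.split)
 have "satf N (f \<circ> case_nat x s) \<f> = satf M (case_nat x s) \<f>" if "x \<in> universe M" for x
  using All.prems that by (intro All.IH[of "Suc n"]) (auto simp: Pi_iff split: nat.split)
 moreover have "universe N = f ` universe M" using assms(1) by (auto simp: iso_by_def bij_betw_def)
 ultimately show ?case by (simp add: c del: comp_apply)
qed

lemma sat_iso:
 assumes "iso_by L f M N" "wff L n \<f>" "xs \<in> tuples M n" "universe M \<noteq> {}"
 shows "sat N (map f xs) \<f> = sat M xs \<f>"
proof -
 obtain s where s: "s \<in> asgs M" "xs = map s [0..<n]" using tuple_asg[OF assms(3,4)] .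
 have "sat N (map f xs) \<f> = satf N (f \<circ> s) \<f>"
  unfolding s(2) map_map by (rule sat_map_upt[OF assms(2)])
 also have "\<dots> = satf M s \<f>" by (rule satf_iso[OF assms(1,2) s(1)])
 also have "\<dots> = sat M xs \<f>" unfolding s(2) by (rule sat_map_upt[OF assms(2), symmetric])
 finally show ?thesis .
qed

text \<open>\<open>countable_models\<close> consists of structures on sets of natural numbers; this
  brings an arbitrary countable structure into their reach.\<close>

lemma nat_copy:
 assumes "is_structure L M" "countable (universe M)"
 obtains N :: "(nat, 'r) struct" and f where "is_structure L N" "iso_by L f M N"
proof -
 let ?f = "to_nat_on (universe M)"
 let ?N = "\<lparr>universe = ?f ` universe M, interp_rel = (\<lambda>r. map ?f ` interp_rel M r)\<rparr>"
 have inj: "inj_on ?f (universe M)" using assms(2) by (rule inj_on_to_nat_on)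
 have "is_structure L ?N"
  using assms(1) by (fastforce simp: is_structure_def tuples_def)
 moreover have "map ?f xs \<in> map ?f ` interp_rel M r <-> xs \<in> interp_rel M r"
  if "r \<in> symbols L" "xs \<in> tuples M (arity L r)" for r xs
 proof
  assume "map ?f xs \<in> map ?f ` interp_rel M r"
  then obtain ys where ys: "map ?f xs = map ?f ys" "ys \<in> interp_rel M r" by auto
  then have "ys \<in> tuples M (arity L r)" using assms(1) that(1) by (auto simp: is_structure_def)
  then have "xs = ys" using that(2) ys(1) inj_on_map_eq_map[of ?f xs ys] inj
   by (auto simp: tuples_def intro: inj_on_subset)
  then show "xs \<in> interp_rel M r" using ys(2) by simp
 qed simp
 then have "iso_by L ?f M ?N" using inj by (auto simp: iso_by_def bij_betw_def)
 ultimately show thesis using that by blast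
qed

locale omega_cat =
 fixes L :: "'r language" and M :: "('a, 'r) struct"
 assumes lang: "countable_language L"
  and struct: "is_structure L M"
  and cnt: "countable (universe M)"
  and cat: "omega_categorical L (Th L M)"
begin

abbreviation "U \<equiv> universe M"

abbreviation "T \<equiv> Th L M"

abbreviation "G \<equiv> automorphism_group L M"

abbreviation "\<G> \<equiv> carrier G"

abbreviation "\<iota> \<equiv> m_inv G"

abbreviation gmult (infixl "\<cdot>" 70) where "g \<cdot> h \<equiv> g \<otimes>\<^bsub>G\<^esub> h"

lemma ne: "U \<noteq> {}"
 using struct by (simp add: is_structure_def)

lemma G_iff: "g \<in> \<G> <-> g \<in> extensional U \<and> iso_by L g M M"
 by (auto simp: automorphism_group_def iso_by_def Bij_def)

lemma sat_transfer:
 "iso_by L f M N ==> wff L n \<f> ==> xs \<in> tuples M n ==> sat N (map f xs) \<f> = sat M xs \<f>"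
 using sat_iso ne by blast

lemma sat_invariant:
 "g \<in> \<G> ==> wff L n \<f> ==> xs \<in> tuples M n ==> sat M (map g xs) \<f> = sat M xs \<f>"
 using sat_transfer G_iff by blast

lemma map_G_tuples: "g \<in> \<G> ==> xs \<in> tuples M n ==> map g xs \<in> tuples M n"
 using iso_by_tuples G_iff by blast

lemma Th_iff: "\<p> \<in> T <-> wff L 0 \<p> \<and> sat M [] \<p>"
 by (simp add: Th_def formulas_def)

lemma iso_model:
 assumes "iso_by L f M N" "is_structure L N" shows "is_model L T N"
 using sat_transfer[OF assms(1), of 0 _ "[]"] assms(2)
 by (auto simp: is_model_def Th_iff tuples_def)

lemma model_iso_nat:
 assumes "N \<in> countable_models L T" obtains f where "iso_by L f M N"
proof -
 obtain N0 :: "(nat, 'r) struct" and f0 where N0: "is_structure L N0" "iso_by L f0 M N0"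
  using nat_copy[OF struct cnt] .
 then have "N0 \<in> countable_models L T" using iso_model by (simp add: countable_models_def)
 then obtain h where "iso_by L h N0 N"
  using cat assms unfolding omega_categorical_def isomorphic_iff by blast
 then show thesis using that iso_by_comp[OF N0(2)] by blast
qed

lemma model_iso:
 assumes "is_model L T M'" "countable (universe M')"
 obtains f where "iso_by L f M' M"
proof -
 have s: "is_structure L M'" using assms(1) by (simp add: is_model_def)
 obtain N :: "(nat, 'r) struct" and f where N: "is_structure L N" "iso_by L f M' N"
  using nat_copy[OF s assms(2)] .
 have "sat N [] \<p>" if "\<p> \<in> T" for \<p>
  using sat_iso[OF N(2), of 0 \<p> "[]"] that assms(1) s
  by (auto simp: is_model_def Th_iff tuples_def is_structure_def)
 then have "N \<in> countable_models L T" using N(1) by (simp add: countable_models_def is_model_def)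
 then obtain h where "iso_by L h M N" using model_iso_nat by blast
 then show thesis using that iso_by_comp[OF N(2) iso_by_inv] by blast
qed

lemma nat_model:
 obtains N0 f0 where "N0 \<in> countable_models L T" "iso_by L f0 M N0"
proof -
 obtain N0 :: "(nat, 'r) struct" and f0 where "is_structure L N0" "iso_by L f0 M N0"
  using nat_copy[OF struct cnt] .
 then show thesis using that iso_model unfolding countable_models_def by blast
qed

section \<open>Types: isolation, finiteness, homogeneity and definability\<close>

definition tp :: "nat => 'a list => 'r fm set" where
 "tp n a = {\<f>. wff L n \<f> \<and> sat M a \<f>}"

definition isolates :: "nat => 'r fm => 'a list => bool" where
 "isolates n \<t> a <-> wff L n \<t> \<and> sat M a \<t> \<and>
   (\<forall>b\<in>tuples M n. sat M b \<t> --> tp n b = tp n a)"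

lemma tp_subset_eq: "tp n a \<subseteq> tp n b ==> tp n a = tp n b"
proof (rule ccontr)
 assume "tp n a \<subseteq> tp n b" "tp n a \<noteq> tp n b"
 then obtain \<f> where "wff L n \<f>" "sat M b \<f>" "\<not> sat M a \<f>" by (auto simp: tp_def)
 then have "Neg \<f> \<in> tp n a" "Neg \<f> \<notin> tp n b" by (auto simp: tp_def)
 with \<open>tp n a \<subseteq> tp n b\<close> show False by blast
qed

text \<open>Otherwise \<open>\<f>\<close> implies every formula of the type of \<open>a\<close> at
  the variables \<open>f 0\<close>, \<open>f 1\<close> and so on. Quantifying away all variables of
  \<open>\<f>\<close>, with these identified with the free ones, then leaves a single formula
  isolating the type.\<close>

lemma unisolated_dense:
 assumes a: "a \<in> tuples M n" and not_isolated: "\<not> (\<exists>\<t>. isolates n \<t> a)"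
  and \<f>: "wff L m \<f>" "dfs M \<f> \<noteq> {}"
 shows "\<exists>\<e>\<in>tp n a. dfs M (Conj \<f> (rename f (Neg \<e>))) \<noteq> {}"
proof (rule ccontr)
 assume "\<not> ?thesis"
 then have empty: "!!\<e>. \<e> \<in> tp n a ==> dfs M (Conj \<f> (rename f (Neg \<e>))) = {}" by blast
 define m' where "m' = max m (Suc (Max (f ` {..<n})))"
 have "m \<le> m'" by (simp add: m'_def)
 have f: "f j < m'" if "j < n" for j
  using that Max_ge[of "f ` {..<n}" "f j"] unfolding m'_def by (simp add: less_max_iff_disj le_imp_less_Suc)
 \<comment> \<open>The \<open>m'\<close> quantified variables are those of \<open>\<f>\<close>;
   under the quantifiers the free variable \<open>j\<close> has index \<open>m' + j\<close>.\<close>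
 define \<t> where "\<t> = (Ex ^^ m') (Conj \<f> (conjs (map (\<lambda>j. Eq (f j) (m' + j)) [0..<n])))"
 have w: "wff L n \<t>"
  using \<f>(1) f by (auto simp: \<t>_def wff_Ex_pow wff_conjs m'_def less_max_iff_disj intro: wff_mono trans_less_add1)
 have \<t>: "sat M (map s [0..<n]) \<t> <->
   (\<exists>xs\<in>tuples M m'. satf M (prepend_asg xs s) \<f> \<and> (\<forall>j<n. prepend_asg xs s (f j) = s j))" for s
 proof -
  have "prepend_asg xs s (m' + j) = s j" if "xs \<in> tuples M m'" for xs j
   using that by (simp add: prepend_asg_def tuples_def)
  then show ?thesis unfolding sat_map_upt[OF w] unfolding \<t>_def satf_Ex_pow
   by (simp add: satf_conjs) (simp only: Ball_def atLeastLessThan_iff le0 simp_thms)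
 qed
 have iso: "tp n b = tp n a" if b: "b \<in> tuples M n" "sat M b \<t>" for b
 proof -
  obtain s where s: "s \<in> asgs M" "b = map s [0..<n]" using tuple_asg[OF b(1) ne] .
  obtain xs where xs: "xs \<in> tuples M m'" "satf M (prepend_asg xs s) \<f>"
   "!!j. j < n ==> prepend_asg xs s (f j) = s j"
   using b(2) \<t> unfolding s(2) by blast
  have "\<e> \<in> tp n b" if \<e>: "\<e> \<in> tp n a" for \<e>
  proof -
   have w\<e>: "wff L n \<e>" using \<e> by (simp add: tp_def)
   have "prepend_asg xs s \<in> asgs M" using xs(1) s(1) by (rule prepend_asg_asgs)
   then have "satf M (prepend_asg xs s \<circ> f) \<e>"
    using empty[OF \<e>] xs(2) by (auto simp: dfs_def satf_rename simp del: comp_apply)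
   also have "satf M (prepend_asg xs s \<circ> f) \<e> = satf M s \<e>"
    by (rule satf_cong[OF w\<e>]) (simp add: xs(3))
   finally have "sat M b \<e>" unfolding s(2) by (subst sat_map_upt[OF w\<e>])
   then show ?thesis using w\<e> by (simp add: tp_def)
  qed
  then show ?thesis using tp_subset_eq by blast
 qed
 \<comment> \<open>A solution \<open>t\<close> of \<open>\<f>\<close> produces one tuple satisfying
   \<open>\<t>\<close>. That tuple has the type of \<open>a\<close>, so \<open>a\<close> satisfies
   \<open>\<t>\<close> too.\<close>
 obtain t where t: "t \<in> asgs M" "satf M t \<f>" using \<f>(2) by (auto simp: dfs_def)
 let ?s = "t \<circ> f"
 have "sat M (map ?s [0..<n]) \<t>"
  unfolding \<t>
 proof (intro bexI conjI allI impI)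
  let ?xs = "map t [0..<m']"
  show "?xs \<in> tuples M m'" using t(1) by (rule map_asg_tuples)
  show "prepend_asg ?xs ?s (f j) = ?s j" if "j < n" for j
   using f[OF that] by (simp add: prepend_asg_def)
  have "satf M (prepend_asg ?xs ?s) \<f> = satf M t \<f>"
   using \<open>m \<le> m'\<close> by (intro satf_cong[OF \<f>(1)]) (simp add: prepend_asg_def)
  then show "satf M (prepend_asg ?xs ?s) \<f>" using t(2) by simp
 qed
 moreover have "map ?s [0..<n] \<in> tuples M n" using t(1) by (intro map_asg_tuples) auto
 ultimately have "tp n (map ?s [0..<n]) = tp n a" "\<t> \<in> tp n (map ?s [0..<n])"
  using iso w by (auto simp: tp_def)
 then have "sat M a \<t>" by (auto simp: tp_def)
 then have "isolates n \<t> a" using iso w by (simp add: isolates_def)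
 then show False using not_isolated by blast
qed

lemma wff_ex_rename: "\<exists>m. wff L n \<f> --> wff L m (rename f \<f>)"
proof -
 have "wff L n \<f> --> wff L (Suc (Max (f ` {..<n}))) (rename f \<f>)"
  by (auto intro!: wff_rename[of L n] le_imp_less_Suc Max_ge)
 then show ?thesis by blast
qed

text \<open>Omitting types: if the type of \<open>a\<close> were not isolated, some countable model
  would omit it. That model is isomorphic to \<open>M\<close> by categoricity, whereas
  \<open>M\<close> realises the type by \<open>a\<close>. Here a condition is large as soon as it
  has a solution.\<close>

lemma types_isolated:
 assumes a: "a \<in> tuples M n" shows "\<exists>\<t>. isolates n \<t> a"
proof (rule ccontr)
 assume not_isolated: "\<not> (\<exists>\<t>. isolates n \<t> a)"
 \<comment> \<open>The number \<open>i\<close> codes a list of variables, padded with 0, so that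
   \<open>D i\<close> runs over all tuples of variables and asks each of them to violate some
   formula of the type.\<close>
 define f where "f i j = (let t = from_nat i in if j < length t then t ! j else (0::nat))" for i j
 define D where "D i = (\<lambda>\<e>. rename (f i) (Neg \<e>)) ` tp n a" for i
 interpret gm: generic_model L M 0 "\<lambda>S. S \<noteq> {}" D
 proof
  fix i m and \<f> :: "'r fm" assume \<f>: "wff L m \<f>" "prj 0 (dfs M \<f>) \<noteq> {}"
  then have "dfs M \<f> \<noteq> {}" by (auto simp: prj_def)
  then obtain \<e> where \<e>: "\<e> \<in> tp n a" "dfs M (Conj \<f> (rename (f i) (Neg \<e>))) \<noteq> {}"
   using unisolated_dense[OF a not_isolated \<f>(1)] by blast
  moreover have "\<exists>m. wff L m (rename (f i) (Neg \<e>))"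
   using wff_ex_rename[of n "Neg \<e>" "f i"] \<e>(1) by (auto simp: tp_def)
  ultimately show "\<exists>m. \<exists>\<p>\<in>D i. wff L m \<p> \<and> prj 0 (dfs M (Conj \<f> \<p>)) \<noteq> {}"
   unfolding D_def prj_def by blast
 qed (use struct lang ne in \<open>auto simp: tuples_def\<close>)
 obtain N :: "(nat, 'r) struct" and e where N: "is_structure L N" "universe N = range e"
  "!!\<p>. wff L 0 \<p> ==> sat M [] \<p> ==> sat N [] \<p>"
  "!!i. \<exists>\<p>\<in>D i. satf N e \<p>"
  by (rule gm.generic_model) (rule that)
 have "is_model L T N" using N(1,3) by (auto simp: is_model_def Th_iff)
 then obtain g where g: "iso_by L g N M" using model_iso by blast
 then have "g ` range e = U" using N(2) by (auto simp: iso_by_def bij_betw_def)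
 moreover have "set a \<subseteq> U" using a by (simp add: tuples_def)
 ultimately have "\<forall>x\<in>set a. \<exists>i. g (e i) = x" by (metis (no_types, opaque_lifting) imageE subsetD)
 then obtain h where h: "!!x. x \<in> set a ==> g (e (h x)) = x" by metis
 define i where "i = to_nat (map h a)"
 have len: "length a = n" using a by (simp add: tuples_def)
 have fi: "g (e (f i j)) = a ! j" if "j < n" for j
  using that h[of "a ! j"] by (simp add: f_def i_def len)
 obtain \<e> where \<e>: "\<e> \<in> tp n a" "satf N e (rename (f i) (Neg \<e>))"
  using N(4)[of i] by (auto simp: D_def)
 have w: "wff L n \<e>" using \<e>(1) by (simp add: tp_def)
 have "\<not> satf N (e \<circ> f i) \<e>" using \<e>(2) by (simp add: satf_rename del: comp_apply)
 then have "\<not> satf M (g \<circ> (e \<circ> f i)) \<e>"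
  using satf_iso[OF g w, of "e \<circ> f i"] N(2) by auto
 moreover have "sat M a \<e> = satf M (g \<circ> (e \<circ> f i)) \<e>"
  by (rule sat_conv_satf[OF w]) (simp add: fi)
 ultimately show False using \<e>(1) by (simp add: tp_def)
qed

lemma countable_fms: "countable {\<f>. \<exists>n. wff L n \<f>}"
 using lang by (rule countable_formulas)

text \<open>With infinitely many \<open>n\<close>-types, call a condition large if its solutions
  realise infinitely many of them in the first \<open>n\<close> coordinates. Negating an isolating
  formula removes only one type, so a generic model can avoid all isolated types in these
  coordinates, contradicting \<open>types_isolated\<close> in the isomorphic structure
  \<open>M\<close>.\<close>

lemma finite_types: "finite (tp n ` tuples M n)"
proof (rule ccontr)
 assume inf: "infinite (tp n ` tuples M n)"
 define isol where "isol \<t> <-> (\<exists>a\<in>tuples M n. isolates n \<t> a)" for \<t>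
 define D where "D i = (let \<t> = from_nat_into {\<f>. \<exists>n. wff L n \<f>} i in
  if isol \<t> then {Neg \<t>} else {All (Eq 0 0)})" for i
 interpret gm: generic_model L M n "\<lambda>S. infinite (tp n ` S)" D
 proof
  fix i m and \<f> :: "'r fm" assume \<f>: "wff L m \<f>" "infinite (tp n ` prj n (dfs M \<f>))"
  define \<t> where "\<t> = from_nat_into {\<f>. \<exists>n. wff L n \<f>} i"
  show "\<exists>m. \<exists>\<p>\<in>D i. wff L m \<p> \<and> infinite (tp n ` prj n (dfs M (Conj \<f> \<p>)))"
  proof (cases "isol \<t>")
   case True
   then obtain a where a: "a \<in> tuples M n" "isolates n \<t> a" by (auto simp: isol_def)
   then have w: "wff L n \<t>" by (simp add: isolates_def)
   have "tp n ` prj n (dfs M \<f>) \<subseteq> insert (tp n a) (tp n ` prj n (dfs M (Conj \<f> (Neg \<t>))))"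
   proof
    fix p assume "p \<in> tp n ` prj n (dfs M \<f>)"
    then obtain s where s: "s \<in> asgs M" "satf M s \<f>" "p = tp n (map s [0..<n])"
     by (auto simp: prj_def dfs_def)
    show "p \<in> insert (tp n a) (tp n ` prj n (dfs M (Conj \<f> (Neg \<t>))))"
    proof (cases "satf M s \<t>")
     case True
     then have "sat M (map s [0..<n]) \<t>" using sat_map_upt[OF w] by blast
     then show ?thesis using a(2) map_asg_tuples[OF s(1)] s(3) by (simp add: isolates_def)
    next
     case False
     then have "s \<in> dfs M (Conj \<f> (Neg \<t>))" using s by (simp add: dfs_def)
     then show ?thesis using s(3) by (auto simp: prj_def)
    qed
   qed
   then have "infinite (tp n ` prj n (dfs M (Conj \<f> (Neg \<t>))))"
    using \<f>(2) by (meson finite_insert finite_subset)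
   moreover have "D i = {Neg \<t>}" using True by (simp add: D_def \<t>_def Let_def)
   ultimately show ?thesis using w by auto
  next
   case False
   then have "D i = {All (Eq 0 0)}" by (simp add: D_def \<t>_def Let_def)
   moreover have "dfs M (Conj \<f> (All (Eq 0 0))) = dfs M \<f>" by (simp add: dfs_def)
   ultimately show ?thesis using \<f>(2) by simp
  qed
 next
  show "infinite (tp n ` S')" if "infinite (tp n ` S)" "S \<subseteq> S'" for S S'
   using that by (meson finite_subset image_mono)
 qed (use struct lang inf in \<open>auto simp: image_Un\<close>)
 obtain N :: "(nat, 'r) struct" and e where N: "is_structure L N" "universe N = range e"
  "!!\<p>. wff L 0 \<p> ==> sat M [] \<p> ==> sat N [] \<p>"
  "!!i. \<exists>\<p>\<in>D i. satf N e \<p>"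
  by (rule gm.generic_model) (rule that)
 have "is_model L T N" using N(1,3) by (auto simp: is_model_def Th_iff)
 then obtain g where g: "iso_by L g N M" using model_iso by blast
 have e: "e \<in> asgs N" using N(2) by auto
 define b where "b = map (g \<circ> e) [0..<n]"
 have "g \<circ> e \<in> asgs M" using e g bij_betwE[of g "universe N" U] by (auto simp: iso_by_def Pi_iff)
 then have b: "b \<in> tuples M n" unfolding b_def by (rule map_asg_tuples)
 then obtain \<t> where \<t>: "isolates n \<t> b" using types_isolated by blast
 then have w: "wff L n \<t>" by (simp add: isolates_def)
 then obtain i where i: "from_nat_into {\<f>. \<exists>n. wff L n \<f>} i = \<t>"
  using from_nat_into_surj[OF countable_fms, of \<t>] by blast
 have "D i = {Neg \<t>}" using \<t> b by (auto simp: D_def i isol_def)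
 then have "\<not> satf N e \<t>" using N(4)[of i] by simp
 then have "\<not> satf M (g \<circ> e) \<t>" using satf_iso[OF g w e] by simp
 then have "\<not> sat M b \<t>" unfolding b_def using sat_map_upt[OF w] by blast
 then show False using \<t> by (simp add: isolates_def)
qed

text \<open>Quantifying the first variable of a formula that isolates the type of
  \<open>c # a\<close> gives a formula in the common type of \<open>a\<close> and \<open>b\<close>;
  a witness over \<open>b\<close> has the isolated type.\<close>

lemma tp_extend:
 assumes "tp n a = tp n b" "a \<in> tuples M n" "b \<in> tuples M n" "c \<in> U"
 obtains d where "d \<in> U" "tp (Suc n) (c # a) = tp (Suc n) (d # b)"
proof -
 have "c # a \<in> tuples M (Suc n)" using assms by (simp add: tuples_def)
 then obtain \<t> where \<t>: "isolates (Suc n) \<t> (c # a)" using types_isolated by blast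
 then have "Ex \<t> \<in> tp n a" using assms(4) by (auto simp: isolates_def tp_def)
 then have "Ex \<t> \<in> tp n b" using assms(1) by simp
 then obtain d where d: "d \<in> U" "sat M (d # b) \<t>" by (auto simp: tp_def)
 moreover have "d # b \<in> tuples M (Suc n)" using assms d by (simp add: tuples_def)
 ultimately have "tp (Suc n) (d # b) = tp (Suc n) (c # a)" using \<t> by (simp add: isolates_def)
 then show thesis using that d(1) by metis
qed

definition same_tp :: "'a list \<times> 'a list => bool" where
 "same_tp = (\<lambda>(a, b). \<exists>n. a \<in> tuples M n \<and> b \<in> tuples M n \<and> tp n a = tp n b)"

lemma same_tp_extend:
 assumes "same_tp (a, b)" "u \<in> U"
 shows "\<exists>c d. same_tp (c # u # a, u # d # b)"
proof -
 obtain n where n: "a \<in> tuples M n" "b \<in> tuples M n" "tp n a = tp n b"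
  using assms(1) by (auto simp: same_tp_def)
 obtain d where d: "d \<in> U" "tp (Suc n) (u # a) = tp (Suc n) (d # b)"
  using tp_extend[OF n(3,1,2) assms(2)] .
 have t: "u # a \<in> tuples M (Suc n)" "d # b \<in> tuples M (Suc n)"
  using n d assms(2) by (auto simp: tuples_def)
 obtain c where c: "c \<in> U" "tp (Suc (Suc n)) (u # d # b) = tp (Suc (Suc n)) (c # u # a)"
  using tp_extend[OF d(2)[symmetric] t(2,1) assms(2)] .
 have "c # u # a \<in> tuples M (Suc (Suc n))" "u # d # b \<in> tuples M (Suc (Suc n))"
  using c(1) t assms(2) by (auto simp: tuples_def)
 then show ?thesis using c(2) unfolding same_tp_def by auto
qed

lemma same_tp_nth:
 assumes "same_tp (a, b)" "i < length a" "j < length a"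
 shows "a ! i = a ! j <-> b ! i = b ! j"
proof -
 obtain n where n: "a \<in> tuples M n" "tp n a = tp n b"
  using assms(1) by (auto simp: same_tp_def)
 then have "Eq i j \<in> tp n a <-> Eq i j \<in> tp n b" by simp
 then show ?thesis using assms n(1) by (simp add: tp_def tuples_def)
qed

lemma same_tp_rel:
 assumes "same_tp (a, b)" "r \<in> symbols L" "length vs = arity L r" "set vs \<subseteq> {..<length a}"
 shows "map ((!) a) vs \<in> interp_rel M r <-> map ((!) b) vs \<in> interp_rel M r"
proof -
 obtain n where n: "a \<in> tuples M n" "tp n a = tp n b"
  using assms(1) by (auto simp: same_tp_def)
 then have "Rel r vs \<in> tp n a <-> Rel r vs \<in> tp n b" by simp
 then show ?thesis using assms n(1) by (simp add: tp_def tuples_def)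
qed

text \<open>Back and forth: stage \<open>i\<close> puts the \<open>i\<close>-th element of the
  universe into both tuples of a pair of equal type. The finite correspondences \<open>Z i\<close>
  increase, and their union is the graph of the automorphism.\<close>

lemma homogeneous:
 assumes "a \<in> tuples M n" "b \<in> tuples M n" "tp n a = tp n b"
 obtains g where "g \<in> \<G>" "map g a = b"
proof -
 define u where "u = from_nat_into U"
 have u: "u i \<in> U" for i unfolding u_def using ne by (rule from_nat_into)
 have "\<exists>f. \<forall>i. (same_tp (f i) \<and> (i = 0 --> f i = (a, b))) \<and>
  (\<exists>c d. f (Suc i) = (c # u i # fst (f i), u i # d # snd (f i)))"
 proof (intro dependent_nat_choice)
  show "\<exists>x. same_tp x \<and> (0 = 0 --> x = (a, b))" using assms by (auto simp: same_tp_def)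
  show "\<exists>y. (same_tp y \<and> (Suc i = 0 --> y = (a, b))) \<and> (\<exists>c d. y = (c # u i # fst x, u i # d # snd x))"
   if "same_tp x \<and> (i = 0 --> x = (a, b))" for x i
   using same_tp_extend[of "fst x" "snd x" "u i"] u that by auto
 qed
 then obtain f where f: "!!i. same_tp (f i)" "f 0 = (a, b)"
  "!!i. \<exists>c d. f (Suc i) = (c # u i # fst (f i), u i # d # snd (f i))" by blast
 define Z where "Z i = set (zip (fst (f i)) (snd (f i)))" for i
 have "Z i \<subseteq> Z (Suc i)" for i using f(3)[of i] by (auto simp: Z_def)
 then have mono: "i \<le> j ==> Z i \<subseteq> Z j" for i j by (rule lift_Suc_mono_le)
 have len: "length (snd (f i)) = length (fst (f i))" for i
  using f(1)[of i] by (auto simp: same_tp_def tuples_def split: prod.splits)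
 have nthZ: "\<exists>k<length (fst (f i)). p = (fst (f i) ! k, snd (f i) ! k)" if "p \<in> Z i" for p i
  using that len[of i] by (auto simp: Z_def in_set_zip prod_eq_iff)
 have nthZ': "(fst (f i) ! k, snd (f i) ! k) \<in> Z i" if "k < length (fst (f i))" for i k
  using that len[of i] by (auto simp: Z_def in_set_zip)
 have eq: "x = x' <-> y = y'" if xy: "(x, y) \<in> \<Union>(range Z)" "(x', y') \<in> \<Union>(range Z)" for x y x' y'
 proof -
  obtain i j where "(x, y) \<in> Z i" "(x', y') \<in> Z j" using xy by blast
  then have "(x, y) \<in> Z (max i j)" "(x', y') \<in> Z (max i j)"
   using mono[of i "max i j"] mono[of j "max i j"] by auto
  then show ?thesis using nthZ[of "(x, y)"] nthZ[of "(x', y')"]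
    same_tp_nth[of "fst (f (max i j))" "snd (f (max i j))"] f(1)[of "max i j"] by fastforce
 qed
 have surj: "\<exists>i. x = u i" if "x \<in> U" for x
  using from_nat_into_surj[OF cnt that] by (auto simp: u_def)
 have dom: "\<exists>y. (x, y) \<in> \<Union>(range Z)" if x: "x \<in> U" for x
 proof -
  obtain i where i: "x = u i" using surj[OF x] by blast
  obtain c d where "f (Suc i) = (c # u i # fst (f i), u i # d # snd (f i))" using f(3) by blast
  then have "(u i, d) \<in> Z (Suc i)" by (simp add: Z_def)
  then show ?thesis using i by blast
 qed
 have ran: "\<exists>x. (x, y) \<in> \<Union>(range Z)" if y: "y \<in> U" for y
 proof -
  obtain i where i: "y = u i" using surj[OF y] by blast
  obtain c d where "f (Suc i) = (c # u i # fst (f i), u i # d # snd (f i))" using f(3) by blast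
  then have "(c, u i) \<in> Z (Suc i)" by (simp add: Z_def)
  then show ?thesis using i by blast
 qed
 have sub: "x \<in> U \<and> y \<in> U" if "(x, y) \<in> \<Union>(range Z)" for x y
 proof -
  from that obtain i where "(x, y) \<in> Z i" by blast
  then have "x \<in> set (fst (f i))" "y \<in> set (snd (f i))"
   unfolding Z_def by (auto dest: set_zip_leftD set_zip_rightD)
  then show ?thesis using f(1)[of i] by (auto simp: same_tp_def tuples_def split: prod.splits)
 qed
 define g where "g = (\<lambda>x\<in>U. THE y. (x, y) \<in> \<Union>(range Z))"
 have g_eq: "g x = y" if "(x, y) \<in> \<Union>(range Z)" for x y
 proof -
  have "x \<in> U" using sub[OF that] by blast
  moreover have "(THE y. (x, y) \<in> \<Union>(range Z)) = y"
   using that eq[of x _ x y] by (intro the_equality) blast+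
  ultimately show ?thesis by (simp add: g_def)
 qed
 have gZ: "(x, g x) \<in> \<Union>(range Z)" if "x \<in> U" for x
  using dom[OF that] g_eq by metis
 have "bij_betw g U U"
  unfolding bij_betw_def
 proof (intro conjI inj_onI equalityI subsetI)
  show "x = y" if "x \<in> U" "y \<in> U" "g x = g y" for x y using gZ that eq by metis
  show "y \<in> U" if "y \<in> g ` U" for y using that gZ sub by blast
  show "y \<in> g ` U" if "y \<in> U" for y using ran[OF that] g_eq sub by (metis image_eqI)
 qed
 moreover have "map g xs \<in> interp_rel M r <-> xs \<in> interp_rel M r"
  if r: "r \<in> symbols L" and xs: "xs \<in> tuples M (arity L r)" for r xs
 proof -
  have "\<exists>i. \<forall>x\<in>set xs. (x, g x) \<in> Z i"
  proof -
   have "\<forall>x\<in>set xs. \<exists>i. (x, g x) \<in> Z i" using xs gZ by (auto simp: tuples_def)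
   then obtain k where k: "!!x. x \<in> set xs ==> (x, g x) \<in> Z (k x)" by metis
   have "(x, g x) \<in> Z (Max (k ` set xs))" if "x \<in> set xs" for x
    using k[OF that] mono[of "k x" "Max (k ` set xs)"] that by auto
   then show ?thesis by blast
  qed
  then obtain i where i: "!!x. x \<in> set xs ==> (x, g x) \<in> Z i" by blast
  then have "\<forall>x\<in>set xs. \<exists>k<length (fst (f i)). (x, g x) = (fst (f i) ! k, snd (f i) ! k)"
   using nthZ by blast
  then obtain k where k: "!!x. x \<in> set xs ==> k x < length (fst (f i)) \<and> (x, g x) = (fst (f i) ! k x, snd (f i) ! k x)"
   by metis
  have "map ((!) (fst (f i))) (map k xs) \<in> interp_rel M r <-> map ((!) (snd (f i))) (map k xs) \<in> interp_rel M r"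
   using f(1)[of i] r xs k by (intro same_tp_rel) (auto simp: tuples_def)
  moreover have "map ((!) (fst (f i))) (map k xs) = xs" using k by (auto intro!: map_idI)
  moreover have "map ((!) (snd (f i))) (map k xs) = map g xs" using k by auto
  ultimately show ?thesis by (simp only:)
 qed
 ultimately have "g \<in> \<G>" unfolding G_iff iso_by_def g_def by auto
 moreover have "map g a = b"
 proof (rule nth_equalityI)
  show "length (map g a) = length b" using assms by (simp add: tuples_def)
  show "map g a ! k = b ! k" if "k < length (map g a)" for k
   using nthZ'[of k 0] f(2) that g_eq by force
 qed
 ultimately show thesis using that by blast
qed

text \<open>By homogeneity an invariant set contains every realisation of each type that it meets.
  There are finitely many types, so the disjunction of their isolating formulas defines it.\<close>

lemma definable:
 assumes "S \<subseteq> tuples M n" "!!g xs. g \<in> \<G> ==> xs \<in> S ==> map g xs \<in> S"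
 obtains \<f> where "wff L n \<f>" "!!xs. xs \<in> tuples M n ==> sat M xs \<f> <-> xs \<in> S"
proof -
 have disj: "\<exists>\<f>. wff L n \<f> \<and> (\<forall>xs. sat M xs \<f> <-> (\<exists>\<t>\<in>F. sat M xs \<t>))"
  if "finite F" "\<forall>\<t>\<in>F. wff L n \<t>" for F
  using that
 proof (induction F)
  case empty
  have "\<not> sat M xs (All (Neg (Eq 0 0)))" for xs using ne by auto
  then show ?case by (intro exI[of _ "All (Neg (Eq 0 0))"]) simp
 next
  case (insert \<t> F)
  then obtain \<f> where "wff L n \<f>" "\<forall>xs. sat M xs \<f> <-> (\<exists>\<t>\<in>F. sat M xs \<t>)" by auto
  then show ?case using insert.prems by (intro exI[of _ "Neg (Conj (Neg \<t>) (Neg \<f>))"]) auto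
 qed
 have "\<forall>p\<in>tp n ` S. \<exists>\<t>. \<exists>a\<in>S. p = tp n a \<and> isolates n \<t> a"
  using types_isolated assms(1) by blast
 then obtain \<t> where \<t>: "!!p. p \<in> tp n ` S ==> \<exists>a\<in>S. p = tp n a \<and> isolates n (\<t> p) a" by metis
 have "finite (tp n ` S)" using finite_types[of n] assms(1) by (meson finite_subset image_mono)
 then have fin: "finite (\<t> ` tp n ` S)" by simp
 have wff: "\<forall>\<p>\<in>\<t> ` tp n ` S. wff L n \<p>"
 proof
  fix \<p> assume "\<p> \<in> \<t> ` tp n ` S"
  then obtain p where "p \<in> tp n ` S" "\<p> = \<t> p" by blast
  then show "wff L n \<p>" using \<t>[of p] by (auto simp: isolates_def)
 qed
 obtain \<f> where \<f>: "wff L n \<f>" "\<forall>xs. sat M xs \<f> <-> (\<exists>\<p>\<in>\<t> ` tp n ` S. sat M xs \<p>)"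
  using disj[OF fin wff] by blast
 have "sat M xs \<f> <-> xs \<in> S" if xs: "xs \<in> tuples M n" for xs
 proof
  assume "sat M xs \<f>"
  then obtain p where p: "p \<in> tp n ` S" "sat M xs (\<t> p)" using \<f>(2) by auto
  then obtain a where a: "a \<in> S" "isolates n (\<t> p) a" using \<t>[of p] by blast
  then have "tp n a = tp n xs" using p(2) xs by (simp add: isolates_def)
  then obtain g where "g \<in> \<G>" "map g a = xs"
   using homogeneous[of a n xs] a(1) assms(1) xs by blast
  then show "xs \<in> S" using assms(2) a(1) by blast
 next
  assume "xs \<in> S"
  then have p: "tp n xs \<in> tp n ` S" by blast
  then obtain a where a: "tp n xs = tp n a" "isolates n (\<t> (tp n xs)) a" using \<t> by blast
  then have "\<t> (tp n xs) \<in> tp n xs" by (simp add: isolates_def tp_def)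
  then show "sat M xs \<f>" using p \<f>(2) by (auto simp: tp_def)
 qed
 then show thesis using that \<f>(1) by blast
qed

text \<open>Tuples of equal type are conjugate by homogeneity, so one tuple for each of the finitely
  many types suffices.\<close>

lemma finite_orbit_reps:
 obtains R where "finite R" "R \<subseteq> tuples M n"
  "!!xs. xs \<in> tuples M n ==> \<exists>r\<in>R. \<exists>g\<in>\<G>. xs = map g r"
proof -
 obtain R where R: "R \<subseteq> tuples M n" "finite R" "tp n ` tuples M n = tp n ` R"
  using finite_subset_image[OF finite_types, of n "tp n" "tuples M n"] by (metis subset_refl)
 have "\<exists>r\<in>R. \<exists>g\<in>\<G>. xs = map g r" if xs: "xs \<in> tuples M n" for xs
 proof -
  obtain r where r: "r \<in> R" "tp n r = tp n xs" using R(3) xs by (metis imageE imageI)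
  then show ?thesis using homogeneous[of r n xs] R(1) xs by blast
 qed
 then show thesis using that R by blast
qed

end

section \<open>Coordinates on interpretations\<close>

text \<open>The \<open>k\<close>-tuple that encodes the value of variable \<open>i\<close> of the
  interpreted language.\<close>

definition blk :: "nat => (nat => 'a) => nat => 'a list" where
 "blk k s i = map (\<lambda>j. s (i * k + j)) [0..<k]"

lemma length_blk [simp]: "length (blk k s i) = k"
 by (simp add: blk_def)

lemma map_block:
 assumes "k \<ge> 1"
 shows "map (s \<circ> block k vs) [0..<length vs * k] = concat (map (blk k s) vs)"
proof (induction vs)
 case (Cons v vs)
 have "map (s \<circ> block k (v # vs)) [0..<length (v # vs) * k] =
   map (s \<circ> block k (v # vs)) [0..<k] @ map (s \<circ> block k (v # vs)) [k..<k + length vs * k]"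
  by (simp add: upt_add_eq_append[of 0 k "length vs * k", simplified])
 also have "map (s \<circ> block k (v # vs)) [0..<k] = blk k s v"
  by (simp add: blk_def block_def)
 also have "map (s \<circ> block k (v # vs)) [k..<k + length vs * k] =
   map (s \<circ> block k (v # vs)) (map (\<lambda>m. m + k) [0..<length vs * k])"
  by (simp add: map_add_upt add.commute)
 also have "\<dots> = map (s \<circ> block k vs) [0..<length vs * k]"
  using assms by (simp add: block_def)
 finally show ?case using Cons by simp
qed simp

lemma concat_blk: "k \<ge> 1 ==> map s [0..<n * k] = concat (map (blk k s) [0..<n])"
proof -
 assume k: "k \<ge> 1"
 have "(block k [0..<n]) m = m" if "m < n * k" for m
  using that k by (simp add: block_def less_mult_imp_div_less)
 then have "map s [0..<n * k] = map (s \<circ> block k [0..<n]) [0..<length [0..<n] * k]" by simp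
 then show ?thesis using map_block[OF k] by metis
qed

lemma concat_uniform_inj:
 assumes "concat xss = concat yss" "length xss = length yss"
  "!!xs. xs \<in> set xss ==> length xs = k" "!!xs. xs \<in> set yss ==> length xs = k"
 shows "xss = yss"
proof (rule concat_injective[OF assms(1,2)])
 show "\<forall>(x, y)\<in>set (zip xss yss). length x = length y"
 proof (intro ballI, clarify)
  fix x y assume xy: "(x, y) \<in> set (zip xss yss)"
  show "length x = length y"
   using assms(3)[OF set_zip_leftD[OF xy]] assms(4)[OF set_zip_rightD[OF xy]] by simp
 qed
qed

lemma length_concat_uniform: "(!!xs. xs \<in> set xss ==> length xs = k) ==> length (concat xss) = length xss * k"
 by (induction xss) simp_all

text \<open>The inverse of \<open>concat\<close> on lists of \<open>n\<close> tuples of length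
  \<open>k\<close>.\<close>

definition chunks :: "nat => nat => 'a list => 'a list list" where
 "chunks k n xs = map (blk k ((!) xs)) [0..<n]"

lemma length_chunks [simp]: "length (chunks k n xs) = n"
 by (simp add: chunks_def)

lemma concat_chunks: "k \<ge> 1 ==> length xs = n * k ==> concat (chunks k n xs) = xs"
 unfolding chunks_def using concat_blk[of k "(!) xs" n] by (metis map_nth)

lemma length_chunk: "xs \<in> set (chunks k n ys) ==> length xs = k"
 by (auto simp: chunks_def)

lemma chunks_concat:
 assumes "k \<ge> 1" "length xss = n" "!!xs. xs \<in> set xss ==> length xs = k"
 shows "chunks k n (concat xss) = xss"
proof (rule concat_uniform_inj[where k = k])
 show "concat (chunks k n (concat xss)) = concat xss"
  using assms length_concat_uniform[of xss k] by (intro concat_chunks) auto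
qed (use assms length_chunk in auto)

lemma concat_tuples:
 "set xss \<subseteq> tuples M k ==> length xss = n ==> concat xss \<in> tuples M (n * k)"
 by (auto simp: tuples_def intro!: length_concat_uniform)

lemma tuples_chunks:
 assumes "k \<ge> 1" "zs \<in> tuples M (n * k)"
 obtains xss where "zs = concat xss" "length xss = n" "set xss \<subseteq> tuples M k"
proof (rule that[of "chunks k n zs"])
 have c: "concat (chunks k n zs) = zs" using assms by (intro concat_chunks) (auto simp: tuples_def)
 then show "zs = concat (chunks k n zs)" by simp
 have "\<Union> (set ` set (chunks k n zs)) \<subseteq> universe M"
  using assms(2) c by (metis (no_types, lifting) mem_Collect_eq set_concat tuples_def)
 then show "set (chunks k n zs) \<subseteq> tuples M k" by (auto simp: tuples_def length_chunk)
qed simp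

text \<open>A coordinate map: \<open>\<pi>\<close> induces an isomorphism from the interpreted
  structure, that is the domain modulo the equality of \<open>\<a>\<close> in \<open>N\<close>, onto
  \<open>M'\<close>. Working with \<open>\<pi>\<close> on tuples avoids handling classes.\<close>

definition coord :: "'s language => ('b, 's) struct => ('r, 's) interp => ('a, 'r) struct => ('a list => 'b) => bool"
 where
 "coord L' M' \<a> N \<pi> <-> \<pi> ` dom_set \<a> N = universe M' \<and>
   (\<forall>xs ys. (xs, ys) \<in> eq_rel \<a> N <-> xs \<in> dom_set \<a> N \<and> ys \<in> dom_set \<a> N \<and> \<pi> xs = \<pi> ys) \<and>
   (\<forall>r\<in>symbols L'. \<forall>xss. length xss = arity L' r --> set xss \<subseteq> dom_set \<a> N -->
    (sat N (concat xss) (sym_fm \<a> r) <-> map \<pi> xss \<in> interp_rel M' r))"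

text \<open>The syntactic part of being an interpretation, without reducedness; it is what
  translating formulas relies on.\<close>

definition wf_interp :: "'r language => 's language => ('r, 's) interp => bool" where
 "wf_interp L L' \<a> <-> idim \<a> \<ge> 1 \<and> wff L (idim \<a>) (dom_fm \<a>) \<and> wff L (2 * idim \<a>) (eq_fm \<a>) \<and>
   (\<forall>r\<in>symbols L'. wff L (arity L' r * idim \<a>) (sym_fm \<a> r))"

lemma coord_dom: "coord L' M' \<a> N \<pi> ==> xs \<in> dom_set \<a> N ==> \<pi> xs \<in> universe M'"
 by (auto simp: coord_def)

lemma coord_onto: "coord L' M' \<a> N \<pi> ==> y \<in> universe M' ==> \<exists>xs\<in>dom_set \<a> N. \<pi> xs = y"
 unfolding coord_def by (metis imageE)

lemma coord_onto_list:
 assumes "coord L' M' \<a> N \<pi>" "set ys \<subseteq> universe M'"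
 obtains xss where "length xss = length ys" "set xss \<subseteq> dom_set \<a> N" "map \<pi> xss = ys"
proof -
 obtain f where f: "!!y. y \<in> universe M' ==> f y \<in> dom_set \<a> N \<and> \<pi> (f y) = y"
  using coord_onto[OF assms(1)] by metis
 then show thesis using assms(2) by (intro that[of "map f ys"]) (auto intro!: map_idI)
qed

lemma coord_eq:
 "coord L' M' \<a> N \<pi> ==> (xs, ys) \<in> eq_rel \<a> N <-> xs \<in> dom_set \<a> N \<and> ys \<in> dom_set \<a> N \<and> \<pi> xs = \<pi> ys"
 unfolding coord_def by blast

lemma coord_rel:
 "coord L' M' \<a> N \<pi> ==> r \<in> symbols L' ==> length xss = arity L' r ==> set xss \<subseteq> dom_set \<a> N ==>
  sat N (concat xss) (sym_fm \<a> r) <-> map \<pi> xss \<in> interp_rel M' r"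
 unfolding coord_def by blast

lemma coord_class:
 assumes "coord L' M' \<a> N \<pi>" "xs \<in> dom_set \<a> N" "ys \<in> dom_set \<a> N"
 shows "eq_rel \<a> N `` {xs} = eq_rel \<a> N `` {ys} <-> \<pi> xs = \<pi> ys"
proof -
 have e: "eq_rel \<a> N `` {zs} = {ws \<in> dom_set \<a> N. \<pi> zs = \<pi> ws}" if "zs \<in> dom_set \<a> N" for zs
  using coord_eq[OF assms(1)] that by auto
 show ?thesis unfolding e[OF assms(2)] e[OF assms(3)] using assms(2,3) by auto
qed

lemma dom_set_tuples: "dom_set \<a> N \<subseteq> tuples N (idim \<a>)"
 by (auto simp: dom_set_def)

lemma satf_dom_fm:
 assumes "wff L (idim \<a>) (dom_fm \<a>)" "blk (idim \<a>) s i \<in> tuples N (idim \<a>)" "idim \<a> \<ge> 1"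
 shows "satf N (s \<circ> block (idim \<a>) [i]) (dom_fm \<a>) <-> blk (idim \<a>) s i \<in> dom_set \<a> N"
proof -
 have "map (s \<circ> block (idim \<a>) [i]) [0..<idim \<a>] = blk (idim \<a>) s i"
  using map_block[OF assms(3), of s "[i]"] by simp
 then show ?thesis using sat_map_upt[OF assms(1), of N "s \<circ> block (idim \<a>) [i]"] assms(2)
  by (simp add: dom_set_def)
qed

lemma blk_asgs: "s \<in> asgs N ==> blk k s i \<in> tuples N k"
 by (auto simp: blk_def tuples_def Pi_iff)

lemma blk_prepend_0: "length xs = k ==> blk k (prepend_asg xs s) 0 = xs"
 by (auto simp: blk_def prepend_asg_def intro: nth_equalityI)

lemma blk_prepend_Suc: "length xs = k ==> blk k (prepend_asg xs s) (Suc i) = blk k s i"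
 by (auto simp: blk_def prepend_asg_def)

text \<open>The interpretation theorem, by induction on the formula. The map \<open>\<pi>\<close>
  takes care of equality and relations by \<open>coord\<close>; as it is onto, quantifiers
  relativised to the domain become quantifiers over \<open>M'\<close>.\<close>

lemma satf_translate:
 assumes \<a>: "wf_interp L L' \<a>" and c: "coord L' M' \<a> N \<pi>"
 shows "wff L' n \<f> ==> s \<in> asgs N ==> (!!i. i < n ==> blk (idim \<a>) s i \<in> dom_set \<a> N) ==>
  satf N s (translate \<a> \<f>) = satf M' (\<lambda>i. \<pi> (blk (idim \<a>) s i)) \<f>"
proof (induction \<f> arbitrary: n s)
 let ?k = "idim \<a>"
 have k: "?k \<ge> 1" and dom: "wff L ?k (dom_fm \<a>)" and eq: "wff L (2 * ?k) (eq_fm \<a>)"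
  and sym: "!!r. r \<in> symbols L' ==> wff L (arity L' r * ?k) (sym_fm \<a> r)"
  using \<a> by (auto simp: wf_interp_def)
 have ex: "satf N (prepend_asg xs s) (dom_fm \<a>) <-> xs \<in> dom_set \<a> N" if "xs \<in> tuples N ?k" for xs s
 proof -
  have len: "length xs = ?k" using that by (simp add: tuples_def)
  have "sat N xs (dom_fm \<a>) = satf N (prepend_asg xs s) (dom_fm \<a>)"
   by (rule sat_conv_satf[OF dom]) (simp add: prepend_asg_def len)
  then show ?thesis using that by (simp add: dom_set_def)
 qed
 have cons: "(\<lambda>i. \<pi> (blk ?k (prepend_asg xs s) i)) = case_nat (\<pi> xs) (\<lambda>i. \<pi> (blk ?k s i))"
  if "length xs = ?k" for xs s
  by (rule ext) (simp add: blk_prepend_0 blk_prepend_Suc that split: nat.split)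
 have blks: "blk ?k (prepend_asg xs s) i \<in> dom_set \<a> N"
  if "xs \<in> dom_set \<a> N" "i < Suc n" "!!i. i < n ==> blk ?k s i \<in> dom_set \<a> N" for xs s i n
 proof -
  have "length xs = ?k" using that(1) by (simp add: dom_set_def tuples_def)
  then show ?thesis using that by (cases i) (simp_all add: blk_prepend_0 blk_prepend_Suc)
 qed
 {
  case (Eq i j)
  have "satf N s (translate \<a> (Eq i j)) = satf N (s \<circ> block ?k [i, j]) (eq_fm \<a>)"
   by (simp add: satf_rename del: comp_apply)
  also have "\<dots> = sat N (map (s \<circ> block ?k [i, j]) [0..<2 * ?k]) (eq_fm \<a>)"
   by (rule sat_map_upt[OF eq, symmetric])
  also have "map (s \<circ> block ?k [i, j]) [0..<2 * ?k] = blk ?k s i @ blk ?k s j"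
   using map_block[OF k, of s "[i, j]"] by (simp add: numeral_2_eq_2)
  also have "sat N (blk ?k s i @ blk ?k s j) (eq_fm \<a>) <-> (blk ?k s i, blk ?k s j) \<in> eq_rel \<a> N"
   using blk_asgs[OF Eq.prems(2)] by (simp add: eq_rel_def)
  also have "\<dots> <-> \<pi> (blk ?k s i) = \<pi> (blk ?k s j)"
   using Eq.prems by (simp add: coord_eq[OF c])
  finally show ?case by simp
 next
  case (Rel r vs)
  have "satf N s (translate \<a> (Rel r vs)) = satf N (s \<circ> block ?k vs) (sym_fm \<a> r)"
   by (simp add: satf_rename del: comp_apply)
  also have "\<dots> = sat N (map (s \<circ> block ?k vs) [0..<arity L' r * ?k]) (sym_fm \<a> r)"
   using Rel.prems(1) by (intro sat_map_upt[of L, symmetric] sym) simp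
  also have "map (s \<circ> block ?k vs) [0..<arity L' r * ?k] = concat (map (blk ?k s) vs)"
   using map_block[OF k, of s vs] Rel.prems(1) by simp
  also have "sat N (concat (map (blk ?k s) vs)) (sym_fm \<a> r) <-> map \<pi> (map (blk ?k s) vs) \<in> interp_rel M' r"
   using Rel.prems by (intro coord_rel[OF c]) auto
  finally show ?case by (simp add: comp_def)
 next
  case (Neg \<f>)
  show ?case using Neg.IH[of n s] Neg.prems by simp
 next
  case (Conj \<f> \<p>)
  show ?case using Conj.IH(1)[of n s] Conj.IH(2)[of n s] Conj.prems by simp
 next
  case (Ex \<f>)
  have IH: "satf N (prepend_asg xs s) (translate \<a> \<f>) = satf M' (case_nat (\<pi> xs) (\<lambda>i. \<pi> (blk ?k s i))) \<f>"
   if xs: "xs \<in> dom_set \<a> N" for xs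
  proof -
   have t: "xs \<in> tuples N ?k" using xs by (simp add: dom_set_def)
   then have "length xs = ?k" by (simp add: tuples_def)
   then show ?thesis unfolding cons[symmetric, OF \<open>length xs = ?k\<close>]
    using Ex.prems prepend_asg_asgs[OF t Ex.prems(2)] blks[OF xs]
    by (intro Ex.IH[of "Suc n"]) auto
  qed
  have "satf N s (translate \<a> (Ex \<f>)) <->
    (\<exists>xs\<in>dom_set \<a> N. satf N (prepend_asg xs s) (translate \<a> \<f>))"
   using ex dom_set_tuples[of \<a> N] by (auto simp: satf_Ex_pow)
  also have "\<dots> <-> (\<exists>xs\<in>dom_set \<a> N. satf M' (case_nat (\<pi> xs) (\<lambda>i. \<pi> (blk ?k s i))) \<f>)"
   using IH by blast
  also have "\<dots> <-> (\<exists>y\<in>universe M'. satf M' (case_nat y (\<lambda>i. \<pi> (blk ?k s i))) \<f>)"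
   using coord_dom[OF c] coord_onto[OF c] by metis
  finally show ?case by simp
 next
  case (All \<f>)
  have IH: "satf N (prepend_asg xs s) (translate \<a> \<f>) = satf M' (case_nat (\<pi> xs) (\<lambda>i. \<pi> (blk ?k s i))) \<f>"
   if xs: "xs \<in> dom_set \<a> N" for xs
  proof -
   have t: "xs \<in> tuples N ?k" using xs by (simp add: dom_set_def)
   then have "length xs = ?k" by (simp add: tuples_def)
   then show ?thesis unfolding cons[symmetric, OF \<open>length xs = ?k\<close>]
    using All.prems prepend_asg_asgs[OF t All.prems(2)] blks[OF xs]
    by (intro All.IH[of "Suc n"]) auto
  qed
  have "satf N s (translate \<a> (All \<f>)) <->
    (\<forall>xs\<in>dom_set \<a> N. satf N (prepend_asg xs s) (translate \<a> \<f>))"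
   using ex dom_set_tuples[of \<a> N] by (auto simp: satf_All_pow)
  also have "\<dots> <-> (\<forall>xs\<in>dom_set \<a> N. satf M' (case_nat (\<pi> xs) (\<lambda>i. \<pi> (blk ?k s i))) \<f>)"
   using IH by blast
  also have "\<dots> <-> (\<forall>y\<in>universe M'. satf M' (case_nat y (\<lambda>i. \<pi> (blk ?k s i))) \<f>)"
   using coord_dom[OF c] coord_onto[OF c] by metis
  finally show ?case by simp
 }
qed

lemma block_less:
 assumes "k \<ge> 1" "set vs \<subseteq> {..<n}" "m < length vs * k"
 shows "block k vs m < n * k"
proof -
 have "m div k < length vs" using assms by (simp add: less_mult_imp_div_less)
 then have "Suc (vs ! (m div k)) \<le> n" using assms(2) nth_mem by fastforce
 then have "Suc (vs ! (m div k)) * k \<le> n * k" by (rule mult_le_mono1)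
 moreover have "m mod k < k" using assms(1) by simp
 ultimately show ?thesis by (simp add: block_def)
qed

lemma wff_translate:
 assumes \<a>: "wf_interp L L' \<a>"
 shows "wff L' n \<f> ==> wff L (n * idim \<a>) (translate \<a> \<f>)"
proof (induction \<f> arbitrary: n)
 case (Eq i j)
 show ?case using \<a> Eq block_less[of "idim \<a>" "[i, j]" n]
  by (simp, intro wff_rename[of L "2 * idim \<a>"]) (auto simp: wf_interp_def numeral_2_eq_2)
next
 case (Rel r vs)
 show ?case using \<a> Rel block_less[of "idim \<a>" vs n]
  by (simp, intro wff_rename[of L "arity L' r * idim \<a>"]) (auto simp: wf_interp_def)
next
 case (Ex \<f>)
 show ?case using \<a> Ex.prems Ex.IH[of "Suc n"]
  by (auto simp: wff_Ex_pow wf_interp_def intro: wff_mono)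
next
 case (All \<f>)
 show ?case using \<a> All.prems All.IH[of "Suc n"]
  by (auto simp: wff_All_pow wf_interp_def intro: wff_mono)
qed simp_all

lemma sat_translate:
 assumes \<a>: "wf_interp L L' \<a>" and c: "coord L' M' \<a> N \<pi>" and N: "universe N \<noteq> {}"
  and \<f>: "wff L' n \<f>" and xss: "length xss = n" "set xss \<subseteq> dom_set \<a> N"
 shows "sat N (concat xss) (translate \<a> \<f>) = sat M' (map \<pi> xss) \<f>"
proof -
 let ?k = "idim \<a>"
 have k: "?k \<ge> 1" using \<a> by (simp add: wf_interp_def)
 have len: "!!xs. xs \<in> set xss ==> length xs = ?k" using xss(2) by (auto simp: dom_set_def tuples_def)
 have "concat xss \<in> tuples N (n * ?k)" using xss dom_set_tuples by (intro concat_tuples) auto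
 then obtain s where s: "s \<in> asgs N" "concat xss = map s [0..<n * ?k]" using tuple_asg N by blast
 have "map (blk ?k s) [0..<n] = xss"
  using s(2) concat_blk[OF k, of s n] len xss(1) by (intro concat_uniform_inj[where k = ?k]) auto
 then have blk: "blk ?k s i = xss ! i" if "i < n" for i using that by (metis add_0 diff_zero nth_map_upt)
 have "sat N (concat xss) (translate \<a> \<f>) = satf N s (translate \<a> \<f>)"
  unfolding s(2) by (rule sat_map_upt[OF wff_translate[OF \<a> \<f>]])
 also have "\<dots> = satf M' (\<lambda>i. \<pi> (blk ?k s i)) \<f>"
  using xss by (intro satf_translate[OF \<a> c \<f> s(1)]) (auto simp: blk)
 also have "\<dots> = sat M' (map \<pi> xss) \<f>"
  using xss(1) by (intro sat_conv_satf[OF \<f>, symmetric]) (simp add: blk)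
 finally show ?thesis .
qed

text \<open>Isomorphisms preserve the formulas that make up the interpretation, so coordinates can
  be pulled back along them. This moves coordinates between \<open>M\<close> and the models on
  natural numbers.\<close>

lemma coord_source_iso:
 assumes g: "iso_by L g M2 M1" and \<a>: "wf_interp L L' \<a>" and c: "coord L' M' \<a> M1 \<pi>"
  and ne: "universe M1 \<noteq> {}"
 shows "coord L' M' \<a> M2 (\<pi> \<circ> map g)"
  and "!!xs. xs \<in> tuples M2 (idim \<a>) ==> map g xs \<in> dom_set \<a> M1 <-> xs \<in> dom_set \<a> M2"
proof -
 have dom: "wff L (idim \<a>) (dom_fm \<a>)" and eq: "wff L (2 * idim \<a>) (eq_fm \<a>)"
  and sym: "!!r. r \<in> symbols L' ==> wff L (arity L' r * idim \<a>) (sym_fm \<a> r)"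
  using \<a> by (auto simp: wf_interp_def)
 have ne2: "universe M2 \<noteq> {}" using g ne by (auto simp: iso_by_def bij_betw_def)
 define f where "f = inv_into (universe M2) g"
 have f: "iso_by L f M1 M2" unfolding f_def by (rule iso_by_inv[OF g])
 have gf: "map g (map f xs) = xs" if "xs \<in> tuples M1 n" for xs n
  using that g unfolding f_def
  by (auto simp: tuples_def iso_by_def bij_betw_inv_into_right intro!: map_idI)
 show D: "map g xs \<in> dom_set \<a> M1 <-> xs \<in> dom_set \<a> M2" if "xs \<in> tuples M2 (idim \<a>)" for xs
  using that iso_by_tuples[OF g that] sat_iso[OF g dom that ne2] by (simp add: dom_set_def)
 have D': "map g xs \<in> dom_set \<a> M1" if "xs \<in> dom_set \<a> M2" for xs
  using that D by (auto simp: dom_set_def)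
 show "coord L' M' \<a> M2 (\<pi> \<circ> map g)"
  unfolding coord_def
 proof (intro conjI ballI allI impI)
  show "(\<pi> \<circ> map g) ` dom_set \<a> M2 = universe M'"
  proof (intro equalityI subsetI)
   fix y assume "y \<in> (\<pi> \<circ> map g) ` dom_set \<a> M2"
   then show "y \<in> universe M'" using D' coord_dom[OF c] by auto
  next
   fix y assume "y \<in> universe M'"
   then obtain xs where xs: "xs \<in> dom_set \<a> M1" "\<pi> xs = y" using coord_onto[OF c] by blast
   have t: "xs \<in> tuples M1 (idim \<a>)" using xs(1) by (simp add: dom_set_def)
   have "map f xs \<in> dom_set \<a> M2" using D[OF iso_by_tuples[OF f t]] gf[OF t] xs(1) by simp
   moreover have "(\<pi> \<circ> map g) (map f xs) = y" using gf[OF t] xs(2) by simp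
   ultimately show "y \<in> (\<pi> \<circ> map g) ` dom_set \<a> M2" by (metis imageI)
  qed
  fix xs ys
  show "(xs, ys) \<in> eq_rel \<a> M2 <-> xs \<in> dom_set \<a> M2 \<and> ys \<in> dom_set \<a> M2 \<and> (\<pi> \<circ> map g) xs = (\<pi> \<circ> map g) ys"
  proof (cases "xs \<in> tuples M2 (idim \<a>) \<and> ys \<in> tuples M2 (idim \<a>)")
   case True
   then have "xs @ ys \<in> tuples M2 (2 * idim \<a>)" by (auto simp: tuples_def)
   then have "sat M1 (map g xs @ map g ys) (eq_fm \<a>) = sat M2 (xs @ ys) (eq_fm \<a>)"
    using sat_iso[OF g eq _ ne2] by fastforce
   then have "(xs, ys) \<in> eq_rel \<a> M2 <-> (map g xs, map g ys) \<in> eq_rel \<a> M1"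
    using True iso_by_tuples[OF g] by (auto simp: eq_rel_def)
   then show ?thesis using D True by (simp add: coord_eq[OF c])
  next
   case False
   then show ?thesis by (auto simp: eq_rel_def dom_set_def)
  qed
 next
  fix r xss assume r: "r \<in> symbols L'" "length xss = arity L' r" "set xss \<subseteq> dom_set \<a> M2"
  have "concat xss \<in> tuples M2 (arity L' r * idim \<a>)"
   using r(2,3) dom_set_tuples by (intro concat_tuples) auto
  from sat_iso[OF g sym[OF r(1)] this ne2]
  have "sat M2 (concat xss) (sym_fm \<a> r) = sat M1 (concat (map (map g) xss)) (sym_fm \<a> r)"
   by (simp only: map_concat)
  also have "\<dots> <-> map \<pi> (map (map g) xss) \<in> interp_rel M' r"
   using r D' by (intro coord_rel[OF c]) auto
  finally show "sat M2 (concat xss) (sym_fm \<a> r) <-> map (\<pi> \<circ> map g) xss \<in> interp_rel M' r" by simp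
 qed
qed

lemma coord_target_iso:
 assumes h: "iso_by L' h M' M''" and c: "coord L' M' \<a> N \<pi>"
 shows "coord L' M'' \<a> N (h \<circ> \<pi>)"
 unfolding coord_def
proof (intro conjI ballI allI impI)
 have bij: "bij_betw h (universe M') (universe M'')" using h by (simp add: iso_by_def)
 have "\<pi> ` dom_set \<a> N = universe M'" using c by (simp add: coord_def)
 then show "(h \<circ> \<pi>) ` dom_set \<a> N = universe M''" using bij by (simp add: bij_betw_def flip: image_image)
 fix xs ys
 show "(xs, ys) \<in> eq_rel \<a> N <-> xs \<in> dom_set \<a> N \<and> ys \<in> dom_set \<a> N \<and> (h \<circ> \<pi>) xs = (h \<circ> \<pi>) ys"
  using coord_eq[OF c, of xs ys] coord_dom[OF c] bij by (auto simp: bij_betw_def inj_on_def)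
next
 fix r xss assume r: "r \<in> symbols L'" "length xss = arity L' r" "set xss \<subseteq> dom_set \<a> N"
 have "map \<pi> xss \<in> tuples M' (arity L' r)" using r coord_dom[OF c] by (auto simp: tuples_def)
 then have "map h (map \<pi> xss) \<in> interp_rel M'' r <-> map \<pi> xss \<in> interp_rel M' r"
  using h r(1) unfolding iso_by_def by blast
 then show "sat N (concat xss) (sym_fm \<a> r) <-> map (h \<circ> \<pi>) xss \<in> interp_rel M'' r"
  using coord_rel[OF c r] by simp
qed

text \<open>\<open>quot_rel\<close> asks for some representatives of the classes; since
  \<open>\<pi>\<close> is constant on classes, any representatives decide membership.\<close>

lemma coord_quot_rel:
 assumes c: "coord L' M' \<a> N \<pi>" and r: "r \<in> symbols L'" "length xss = arity L' r" "set xss \<subseteq> dom_set \<a> N"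
 shows "map (\<lambda>xs. eq_rel \<a> N `` {xs}) xss \<in> quot_rel L' \<a> N r <-> map \<pi> xss \<in> interp_rel M' r"
proof
 assume "map (\<lambda>xs. eq_rel \<a> N `` {xs}) xss \<in> quot_rel L' \<a> N r"
 then obtain yss where yss: "map (\<lambda>xs. eq_rel \<a> N `` {xs}) xss = map (\<lambda>xs. eq_rel \<a> N `` {xs}) yss"
  "length yss = arity L' r" "set yss \<subseteq> dom_set \<a> N" "sat N (concat yss) (sym_fm \<a> r)"
  by (auto simp: quot_rel_def)
 have "\<pi> (xss ! i) = \<pi> (yss ! i)" if i: "i < arity L' r" for i
 proof -
  have "eq_rel \<a> N `` {xss ! i} = eq_rel \<a> N `` {yss ! i}"
   using yss(1,2) r(2) i by (metis (no_types, lifting) nth_map)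
  moreover have "xss ! i \<in> dom_set \<a> N" "yss ! i \<in> dom_set \<a> N"
   using r yss(2,3) i nth_mem by (metis subsetD)+
  ultimately show ?thesis using coord_class[OF c] by blast
 qed
 then have "map \<pi> xss = map \<pi> yss" using r(2) yss(2) by (intro nth_equalityI) auto
 then show "map \<pi> xss \<in> interp_rel M' r" using coord_rel[OF c r(1) yss(2,3)] yss(4) by simp
next
 assume "map \<pi> xss \<in> interp_rel M' r"
 then have "sat N (concat xss) (sym_fm \<a> r)" using coord_rel[OF c r] by simp
 then show "map (\<lambda>xs. eq_rel \<a> N `` {xs}) xss \<in> quot_rel L' \<a> N r"
  using r by (auto simp: quot_rel_def)
qed

section \<open>Interpretations of the theory in itself\<close>

context omega_cat
begin

abbreviation "Itp \<equiv> interpretations L T L T"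

section \<open>Provable equivalence tested in the given model, and reduced formulas\<close>

lemma all_models_sat_eq:
 assumes "wff L n \<f>" "wff L n \<p>"
 shows "(\<forall>N\<in>countable_models L T. \<forall>xs\<in>tuples N n. sat N xs \<f> <-> sat N xs \<p>) <->
  (\<forall>xs\<in>tuples M n. sat M xs \<f> <-> sat M xs \<p>)"
proof
 assume all: "\<forall>N\<in>countable_models L T. \<forall>xs\<in>tuples N n. sat N xs \<f> <-> sat N xs \<p>"
 obtain N0 f0 where N0: "N0 \<in> countable_models L T" "iso_by L f0 M N0" using nat_model .
 show "\<forall>xs\<in>tuples M n. sat M xs \<f> <-> sat M xs \<p>"
 proof
  fix xs assume xs: "xs \<in> tuples M n"
  then have "sat N0 (map f0 xs) \<f> <-> sat N0 (map f0 xs) \<p>"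
   using all N0 iso_by_tuples by blast
  then show "sat M xs \<f> <-> sat M xs \<p>"
   using sat_transfer[OF N0(2) assms(1) xs] sat_transfer[OF N0(2) assms(2) xs] by simp
 qed
next
 assume M: "\<forall>xs\<in>tuples M n. sat M xs \<f> <-> sat M xs \<p>"
 show "\<forall>N\<in>countable_models L T. \<forall>xs\<in>tuples N n. sat N xs \<f> <-> sat N xs \<p>"
 proof (intro ballI)
  fix N xs assume N: "N \<in> countable_models L T" and xs: "xs \<in> tuples N n"
  obtain f where f: "iso_by L f M N" using model_iso_nat[OF N] .
  define g where "g = inv_into U f"
  have g: "iso_by L g N M" unfolding g_def by (rule iso_by_inv[OF f])
  have neN: "universe N \<noteq> {}" using f ne by (auto simp: iso_by_def bij_betw_def)
  show "sat N xs \<f> <-> sat N xs \<p>"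
   using M iso_by_tuples[OF g xs] sat_iso[OF g assms(1) xs neN] sat_iso[OF g assms(2) xs neN] by simp
 qed
qed

lemma equivalent_fm_iff:
 "equivalent_fm L T n \<f> \<p> <-> wff L n \<f> \<and> wff L n \<p> \<and> (\<forall>xs\<in>tuples M n. sat M xs \<f> <-> sat M xs \<p>)"
 using all_models_sat_eq[of n \<f> \<p>] by (auto simp: equivalent_fm_def formulas_def)

lemma least_fm:
 assumes "wff L n \<f>"
 shows wff_least_fm: "wff L n (least_fm L T n \<f>)"
  and sat_least_fm: "!!xs. xs \<in> tuples M n ==> sat M xs (least_fm L T n \<f>) <-> sat M xs \<f>"
  and reduced_least_fm: "least_fm L T n \<f> \<in> reduced_formulas L T n"
proof -
 have "equivalent_fm L T n \<f> \<f>" using assms by (simp add: equivalent_fm_iff)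
 then have e: "equivalent_fm L T n \<f> (least_fm L T n \<f>)"
  unfolding least_fm_def by (rule arg_min_natI)
 then show w: "wff L n (least_fm L T n \<f>)"
  and "!!xs. xs \<in> tuples M n ==> sat M xs (least_fm L T n \<f>) <-> sat M xs \<f>"
  by (auto simp: equivalent_fm_iff)
 have "equivalent_fm L T n (least_fm L T n \<f>) = equivalent_fm L T n \<f>"
  using e by (auto simp: equivalent_fm_iff fun_eq_iff)
 then have "least_fm L T n (least_fm L T n \<f>) = least_fm L T n \<f>"
  unfolding least_fm_def[of L T n "least_fm L T n \<f>"] by (simp add: least_fm_def)
 then show "least_fm L T n \<f> \<in> reduced_formulas L T n"
  using w by (simp add: reduced_formulas_def formulas_def)
qed

lemma reduced_wff: "\<f> \<in> reduced_formulas L T n ==> wff L n \<f>"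
 by (simp add: reduced_formulas_def formulas_def)

lemma reduced_unique:
 assumes "\<f> \<in> reduced_formulas L T n" "\<p> \<in> reduced_formulas L T n"
  "!!xs. xs \<in> tuples M n ==> sat M xs \<f> <-> sat M xs \<p>"
 shows "\<f> = \<p>"
proof -
 have "equivalent_fm L T n \<f> = equivalent_fm L T n \<p>"
  using assms by (auto simp: equivalent_fm_iff fun_eq_iff reduced_wff)
 then have "least_fm L T n \<f> = least_fm L T n \<p>" by (simp add: least_fm_def)
 then show ?thesis using assms by (simp add: reduced_formulas_def)
qed

lemma definable_reduced:
 assumes "S \<subseteq> tuples M n" "!!g xs. g \<in> \<G> ==> xs \<in> S ==> map g xs \<in> S"
 obtains \<f> where "\<f> \<in> reduced_formulas L T n" "!!xs. xs \<in> tuples M n ==> sat M xs \<f> <-> xs \<in> S"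
proof (rule definable[OF assms(1)])
 show "map g xs \<in> S" if "g \<in> \<G>" "xs \<in> S" for g xs using assms(2) that by blast
 fix \<p> assume "wff L n \<p>" "!!xs. xs \<in> tuples M n ==> sat M xs \<p> <-> xs \<in> S"
 then show thesis using that[of "least_fm L T n \<p>"] reduced_least_fm sat_least_fm by simp
qed

text \<open>A reduced formula is determined by its solution set, and this set by the orbit
  representatives that it contains.\<close>

lemma finite_reduced_formulas: "finite (reduced_formulas L T n)"
proof -
 obtain R where R: "finite R" "R \<subseteq> tuples M n"
  "!!xs. xs \<in> tuples M n ==> \<exists>r\<in>R. \<exists>g\<in>\<G>. xs = map g r"
  by (rule finite_orbit_reps[of n]) (rule that)
 define F where "F \<f> = {r \<in> R. sat M r \<f>}" for \<f>
 have "inj_on F (reduced_formulas L T n)"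
 proof (rule inj_onI)
  fix \<f> \<p> assume \<f>: "\<f> \<in> reduced_formulas L T n" and \<p>: "\<p> \<in> reduced_formulas L T n" and eq: "F \<f> = F \<p>"
  have "sat M xs \<f> <-> sat M xs \<p>" if xs: "xs \<in> tuples M n" for xs
  proof -
   obtain r g where r: "r \<in> R" "g \<in> \<G>" "xs = map g r" using R(3)[OF xs] by blast
   have "sat M r \<f> <-> sat M r \<p>" using eq r(1) by (auto simp: F_def)
   then show ?thesis unfolding r(3)
    using sat_invariant[OF r(2) reduced_wff[OF \<f>]] sat_invariant[OF r(2) reduced_wff[OF \<p>]] r(1) R(2)
    by blast
  qed
  then show "\<f> = \<p>" using reduced_unique \<f> \<p> by blast
 qed
 moreover have "finite (F ` reduced_formulas L T n)"
  by (rule finite_subset[of _ "Pow R"]) (auto simp: F_def R(1))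
 ultimately show ?thesis using finite_imageD by blast
qed

text \<open>The conditions on the formulas themselves. The semantic conditions of
  \<open>interpretations\<close> are replaced by the existence of coordinates in
  \<open>interp_iff\<close>.\<close>

definition red_interp :: "('r, 'r) interp => bool" where
 "red_interp \<a> <-> idim \<a> \<ge> 1 \<and> dom_fm \<a> \<in> reduced_formulas L T (idim \<a>) \<and>
   eq_fm \<a> \<in> reduced_formulas L T (2 * idim \<a>) \<and>
   sym_fm \<a> \<in> (\<Pi>\<^sub>E r\<in>symbols L. reduced_formulas L T (arity L r * idim \<a>))"

lemma red_wf: "red_interp \<a> ==> wf_interp L L \<a>"
 by (auto simp: red_interp_def wf_interp_def intro: reduced_wff dest: PiE_mem)

lemma coord_quotient:
 assumes ne: "dom_set \<a> N \<noteq> {}" and eq: "equiv (dom_set \<a> N) (eq_rel \<a> N)"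
  and inv: "!!r xss yss. r \<in> symbols L ==> length xss = arity L r ==>
   list_all2 (\<lambda>xs ys. (xs, ys) \<in> eq_rel \<a> N) xss yss ==>
   sat N (concat xss) (sym_fm \<a> r) <-> sat N (concat yss) (sym_fm \<a> r)"
 shows "coord L \<lparr>universe = dom_set \<a> N // eq_rel \<a> N, interp_rel = quot_rel L \<a> N\<rparr> \<a> N
  (\<lambda>xs. eq_rel \<a> N `` {xs})"
 unfolding coord_def
proof (intro conjI ballI allI impI)
 show "(\<lambda>xs. eq_rel \<a> N `` {xs}) ` dom_set \<a> N =
   universe \<lparr>universe = dom_set \<a> N // eq_rel \<a> N, interp_rel = quot_rel L \<a> N\<rparr>"
  by (auto simp: quotient_def)
 show "(xs, ys) \<in> eq_rel \<a> N <-> xs \<in> dom_set \<a> N \<and> ys \<in> dom_set \<a> N \<and>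
   eq_rel \<a> N `` {xs} = eq_rel \<a> N `` {ys}" for xs ys
  using eq_equiv_class_iff[OF eq, of xs ys] eq by (auto simp: equiv_def)
 fix r xss assume r: "r \<in> symbols L" "length xss = arity L r" "set xss \<subseteq> dom_set \<a> N"
 have "sat N (concat xss) (sym_fm \<a> r) <->
   map (\<lambda>xs. eq_rel \<a> N `` {xs}) xss \<in> quot_rel L \<a> N r"
 proof
  assume "sat N (concat xss) (sym_fm \<a> r)"
  then show "map (\<lambda>xs. eq_rel \<a> N `` {xs}) xss \<in> quot_rel L \<a> N r" using r by (auto simp: quot_rel_def)
 next
  assume "map (\<lambda>xs. eq_rel \<a> N `` {xs}) xss \<in> quot_rel L \<a> N r"
  then obtain yss where yss: "map (\<lambda>xs. eq_rel \<a> N `` {xs}) xss = map (\<lambda>xs. eq_rel \<a> N `` {xs}) yss"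
   "length yss = arity L r" "set yss \<subseteq> dom_set \<a> N" "sat N (concat yss) (sym_fm \<a> r)"
   by (auto simp: quot_rel_def)
  have "(xss ! i, yss ! i) \<in> eq_rel \<a> N" if i: "i < length xss" for i
  proof -
   have "eq_rel \<a> N `` {xss ! i} = eq_rel \<a> N `` {yss ! i}"
    using yss(1,2) r(2) i by (metis (no_types, lifting) nth_map)
   moreover have "xss ! i \<in> dom_set \<a> N" "yss ! i \<in> dom_set \<a> N"
    using r yss(2,3) i nth_mem by (metis subsetD)+
   ultimately show ?thesis using eq_equiv_class_iff[OF eq] by blast
  qed
  then have "list_all2 (\<lambda>xs ys. (xs, ys) \<in> eq_rel \<a> N) xss yss"
   using r(2) yss(2) by (simp add: list_all2_conv_all_nth)
  then show "sat N (concat xss) (sym_fm \<a> r)" using inv[OF r(1,2)] yss(4) by blast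
 qed
 then show "sat N (concat xss) (sym_fm \<a> r) <-> map (\<lambda>xs. eq_rel \<a> N `` {xs}) xss \<in>
   interp_rel \<lparr>universe = dom_set \<a> N // eq_rel \<a> N, interp_rel = quot_rel L \<a> N\<rparr> r" by simp
qed

text \<open>The interpreted structure inside a countable model satisfies \<open>T\<close>, because
  the translations of the sentences of \<open>T\<close> hold in that model. Being countable, it is
  isomorphic to \<open>M\<close> by categoricity, and the isomorphism composed with the class map
  gives coordinates.\<close>

lemma interp_coord:
 assumes "\<a> \<in> Itp" obtains \<pi> where "coord L M \<a> M \<pi>"
proof -
 obtain N0 f0 where N0: "N0 \<in> countable_models L T" "iso_by L f0 M N0" using nat_model .
 have red: "red_interp \<a>" and T: "!!\<p>. \<p> \<in> T ==> translate \<a> \<p> \<in> T"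
  and ne0: "dom_set \<a> N0 \<noteq> {}" and eq: "equiv (dom_set \<a> N0) (eq_rel \<a> N0)"
  and inv: "!!r xss yss. r \<in> symbols L ==> length xss = arity L r ==>
   list_all2 (\<lambda>xs ys. (xs, ys) \<in> eq_rel \<a> N0) xss yss ==>
   sat N0 (concat xss) (sym_fm \<a> r) <-> sat N0 (concat yss) (sym_fm \<a> r)"
  using assms N0(1) unfolding interpretations_def red_interp_def by blast+
 let ?Q = "\<lparr>universe = dom_set \<a> N0 // eq_rel \<a> N0, interp_rel = quot_rel L \<a> N0\<rparr>"
 have cQ: "coord L ?Q \<a> N0 (\<lambda>xs. eq_rel \<a> N0 `` {xs})"
  using ne0 eq inv by (rule coord_quotient)
 have neN: "universe N0 \<noteq> {}" using N0(2) ne by (auto simp: iso_by_def bij_betw_def)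
 have "is_model L T ?Q"
  unfolding is_model_def
 proof (intro conjI ballI)
  show "is_structure L ?Q"
   using ne0 eq by (auto simp: is_structure_def quot_rel_def tuples_def intro!: quotientI)
  fix \<p> assume \<p>: "\<p> \<in> T"
  have "sat N0 [] (translate \<a> \<p>)"
   using T[OF \<p>] N0(1) by (auto simp: countable_models_def is_model_def)
  moreover have "wff L 0 \<p>" using \<p> Th_iff by blast
  ultimately show "sat ?Q [] \<p>"
   using sat_translate[OF red_wf[OF red] cQ neN, of 0 \<p> "[]"] by simp
 qed
 moreover have "countable (universe ?Q)"
 proof -
  have "universe ?Q = (\<lambda>xs. eq_rel \<a> N0 `` {xs}) ` dom_set \<a> N0" by (auto simp: quotient_def)
  then show ?thesis by simp
 qed
 ultimately obtain h where h: "iso_by L h ?Q M" using model_iso by blast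
 have "coord L M \<a> M ((h \<circ> (\<lambda>xs. eq_rel \<a> N0 `` {xs})) \<circ> map f0)"
  by (rule coord_source_iso(1)[OF N0(2) red_wf[OF red] coord_target_iso[OF h cQ] neN])
 then show thesis by (rule that)
qed

lemma coord_model:
 assumes c: "coord L M \<a> M \<pi>" and red: "red_interp \<a>" and f: "iso_by L f M N"
 shows "coord L M \<a> N (\<pi> \<circ> map (inv_into U f))"
 by (rule coord_source_iso(1)[OF iso_by_inv[OF f] red_wf[OF red] c ne])

text \<open>Coordinates in \<open>M\<close> alone suffice: they transfer to every countable model,
  where they turn \<open>eq_rel\<close> into the kernel of a map and make the relations invariant,
  and the interpretation theorem puts the translated sentences into \<open>T\<close>.\<close>

lemma interp_iff: "\<a> \<in> Itp <-> red_interp \<a> \<and> (\<exists>\<pi>. coord L M \<a> M \<pi>)"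
proof
 assume \<a>: "\<a> \<in> Itp"
 then have "red_interp \<a>" by (auto simp: interpretations_def red_interp_def)
 then show "red_interp \<a> \<and> (\<exists>\<pi>. coord L M \<a> M \<pi>)" using interp_coord[OF \<a>] by metis
next
 assume "red_interp \<a> \<and> (\<exists>\<pi>. coord L M \<a> M \<pi>)"
 then obtain \<pi> where red: "red_interp \<a>" and c: "coord L M \<a> M \<pi>" by blast
 have "dom_set \<a> N \<noteq> {} \<and> equiv (dom_set \<a> N) (eq_rel \<a> N) \<and>
    (\<forall>r\<in>symbols L. \<forall>xss yss.
      length xss = arity L r --> list_all2 (\<lambda>xs ys. (xs, ys) \<in> eq_rel \<a> N) xss yss -->
      (sat N (concat xss) (sym_fm \<a> r) <-> sat N (concat yss) (sym_fm \<a> r)))"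
  if N: "N \<in> countable_models L T" for N
 proof -
  obtain f where f: "iso_by L f M N" using model_iso_nat[OF N] .
  obtain \<v> where \<v>: "coord L M \<a> N \<v>" using coord_model[OF c red f] by blast
  have "dom_set \<a> N \<noteq> {}" using \<v> ne by (auto simp: coord_def)
  moreover have "equiv (dom_set \<a> N) (eq_rel \<a> N)"
   using coord_eq[OF \<v>] by (auto intro!: equivI simp: refl_on_def sym_def trans_def)
  moreover have "sat N (concat xss) (sym_fm \<a> r) <-> sat N (concat yss) (sym_fm \<a> r)"
   if r: "r \<in> symbols L" "length xss = arity L r"
    and E: "list_all2 (\<lambda>xs ys. (xs, ys) \<in> eq_rel \<a> N) xss yss" for r xss yss
  proof -
   have D: "set xss \<subseteq> dom_set \<a> N" "set yss \<subseteq> dom_set \<a> N" "map \<v> xss = map \<v> yss"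
    using E coord_eq[OF \<v>] by (induction rule: list_all2_induct) auto
   have "length yss = arity L r" using E r(2) by (simp add: list_all2_lengthD)
   then show ?thesis using coord_rel[OF \<v> r D(1)] coord_rel[OF \<v> r(1) _ D(2)] D(3) by simp
  qed
  ultimately show ?thesis by blast
 qed
 moreover have "translate \<a> \<p> \<in> T" if "\<p> \<in> T" for \<p>
  using sat_translate[OF red_wf[OF red] c ne, of 0 \<p> "[]"] wff_translate[OF red_wf[OF red], of 0 \<p>] that
  by (simp add: Th_iff)
 ultimately show "\<a> \<in> Itp"
  using red unfolding interpretations_def red_interp_def by blast
qed

lemma interp_red: "\<a> \<in> Itp ==> red_interp \<a>"
 using interp_iff by blast

lemma interp_wf: "\<a> \<in> Itp ==> wf_interp L L \<a>"
 using interp_red red_wf by blast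

section \<open>Homotopies\<close>

text \<open>Read through the coordinates, the bijection of classes that underlies a homotopy becomes
  a permutation of \<open>U\<close> preserving all relations, hence an element of
  \<open>\<G>\<close>; the formula of the homotopy defines its graph.\<close>

lemma homotopic_imp_graph:
 assumes \<a>: "\<a> \<in> Itp" "coord L M \<a> M \<pi>" and \<b>: "\<b> \<in> Itp" "coord L M \<b> M \<v>"
  and hom: "homotopic L T L \<a> \<b>"
 obtains h \<t> where "h \<in> \<G>" "wff L (idim \<a> + idim \<b>) \<t>"
  "!!xs ys. xs \<in> dom_set \<a> M ==> ys \<in> dom_set \<b> M ==> sat M (xs @ ys) \<t> <-> h (\<pi> xs) = \<v> ys"
proof -
 \<comment> \<open>Homotopies are given in models on the natural numbers. The argument runs in a
   copy \<open>N\<close> of \<open>M\<close> and is carried back along \<open>g\<close>.\<close>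
 obtain N f where N: "N \<in> countable_models L T" and f: "iso_by L f M N" using nat_model .
 define g where "g = inv_into U f"
 have g: "iso_by L g N M" unfolding g_def by (rule iso_by_inv[OF f])
 define \<pi>' where "\<pi>' = \<pi> \<circ> map g"
 define \<v>' where "\<v>' = \<v> \<circ> map g"
 have c: "coord L M \<a> N \<pi>'" and c': "coord L M \<b> N \<v>'"
  unfolding \<pi>'_def \<v>'_def g_def using coord_model[OF _ interp_red f] \<a> \<b> by auto
 obtain \<t> where \<t>: "wff L (idim \<a> + idim \<b>) \<t>" and "\<exists>\<T>. bij_betw \<T> (dom_set \<a> N // eq_rel \<a> N) (dom_set \<b> N // eq_rel \<b> N) \<and>
      {(xs, ys). xs \<in> tuples N (idim \<a>) \<and> ys \<in> tuples N (idim \<b>) \<and> sat N (xs @ ys) \<t>} =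
      {(xs, ys). xs \<in> dom_set \<a> N \<and> ys \<in> dom_set \<b> N \<and>
            \<T> (eq_rel \<a> N `` {xs}) = eq_rel \<b> N `` {ys}} \<and>
      (\<forall>r\<in>symbols L. map \<T> ` quot_rel L \<a> N r = quot_rel L \<b> N r)"
  using hom N unfolding homotopic_def formulas_def by blast
 then obtain \<T> where bij: "bij_betw \<T> (dom_set \<a> N // eq_rel \<a> N) (dom_set \<b> N // eq_rel \<b> N)"
  and graph: "{(xs, ys). xs \<in> tuples N (idim \<a>) \<and> ys \<in> tuples N (idim \<b>) \<and> sat N (xs @ ys) \<t>} =
      {(xs, ys). xs \<in> dom_set \<a> N \<and> ys \<in> dom_set \<b> N \<and>
            \<T> (eq_rel \<a> N `` {xs}) = eq_rel \<b> N `` {ys}}"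
  and rel: "\<forall>r\<in>symbols L. map \<T> ` quot_rel L \<a> N r = quot_rel L \<b> N r" by blast
 define cl where "cl xs = eq_rel \<a> N `` {xs}" for xs
 define cl' where "cl' xs = eq_rel \<b> N `` {xs}" for xs
 have cl_in: "cl xs \<in> dom_set \<a> N // eq_rel \<a> N" if "xs \<in> dom_set \<a> N" for xs
  using that by (simp add: cl_def quotientI)
 have cl'_in: "cl' xs \<in> dom_set \<b> N // eq_rel \<b> N" if "xs \<in> dom_set \<b> N" for xs
  using that by (simp add: cl'_def quotientI)
 have cl_eq: "cl xs = cl ys <-> \<pi>' xs = \<pi>' ys" if "xs \<in> dom_set \<a> N" "ys \<in> dom_set \<a> N" for xs ys
  unfolding cl_def by (rule coord_class[OF c that])
 have cl'_eq: "cl' xs = cl' ys <-> \<v>' xs = \<v>' ys" if "xs \<in> dom_set \<b> N" "ys \<in> dom_set \<b> N" for xs ys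
  unfolding cl'_def by (rule coord_class[OF c' that])
 have ex: "\<exists>ys\<in>dom_set \<b> N. \<T> (cl xs) = cl' ys" if "xs \<in> dom_set \<a> N" for xs
  using bij_betwE[OF bij] cl_in[OF that] unfolding cl'_def by (metis quotientE)
 have ex': "\<exists>xs\<in>dom_set \<a> N. \<T> (cl xs) = cl' ys" if "ys \<in> dom_set \<b> N" for ys
 proof -
  have "cl' ys \<in> \<T> ` (dom_set \<a> N // eq_rel \<a> N)" using cl'_in[OF that] bij by (simp add: bij_betw_def)
  then show ?thesis unfolding cl_def by (metis imageE quotientE)
 qed
 have inj: "\<T> (cl xs) = \<T> (cl ys) <-> cl xs = cl ys" if "xs \<in> dom_set \<a> N" "ys \<in> dom_set \<a> N" for xs ys
  by (rule inj_on_eq_iff[OF bij_betw_imp_inj_on[OF bij] cl_in[OF that(1)] cl_in[OF that(2)]])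
 have "\<forall>x\<in>U. \<exists>y. \<exists>xs\<in>dom_set \<a> N. \<exists>ys\<in>dom_set \<b> N. x = \<pi>' xs \<and> y = \<v>' ys \<and> \<T> (cl xs) = cl' ys"
  using coord_onto[OF c] ex by metis
 from bchoice[OF this] obtain h0 where h0: "\<forall>x\<in>U. \<exists>xs\<in>dom_set \<a> N. \<exists>ys\<in>dom_set \<b> N.
  x = \<pi>' xs \<and> h0 x = \<v>' ys \<and> \<T> (cl xs) = cl' ys" by blast
 define h where "h = restrict h0 U"
 have key: "h (\<pi>' xs) = \<v>' ys <-> \<T> (cl xs) = cl' ys" if xs: "xs \<in> dom_set \<a> N" and ys: "ys \<in> dom_set \<b> N" for xs ys
 proof -
  have "\<pi>' xs \<in> U" by (rule coord_dom[OF c xs])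
  then obtain xs1 ys1 where 1: "xs1 \<in> dom_set \<a> N" "ys1 \<in> dom_set \<b> N" "\<pi>' xs = \<pi>' xs1"
   "h (\<pi>' xs) = \<v>' ys1" "\<T> (cl xs1) = cl' ys1" using h0 unfolding h_def by (metis restrict_apply')
  have "cl xs = cl xs1" using cl_eq[OF xs 1(1)] 1(3) by simp
  then show ?thesis using 1 cl'_eq[OF 1(2) ys] by simp
 qed
 have "bij_betw h U U"
  unfolding bij_betw_def
 proof (intro conjI inj_onI equalityI subsetI)
  fix x y assume xy: "x \<in> U" "y \<in> U" "h x = h y"
  obtain xs ys where xs: "xs \<in> dom_set \<a> N" "\<pi>' xs = x" and ys: "ys \<in> dom_set \<a> N" "\<pi>' ys = y"
   using coord_onto[OF c] xy by metis
  obtain zs where zs: "zs \<in> dom_set \<b> N" "\<T> (cl xs) = cl' zs" using ex[OF xs(1)] by blast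
  then have "h x = \<v>' zs" using key[OF xs(1) zs(1)] xs(2) by simp
  then have "\<T> (cl ys) = cl' zs" using key[OF ys(1) zs(1)] ys(2) xy(3) by simp
  then show "x = y" using zs(2) inj[OF xs(1) ys(1)] cl_eq[OF xs(1) ys(1)] xs(2) ys(2) by simp
 next
  fix y assume "y \<in> h ` U"
  then obtain x where x: "x \<in> U" "y = h x" by blast
  obtain xs where xs: "xs \<in> dom_set \<a> N" "\<pi>' xs = x" using coord_onto[OF c x(1)] by blast
  obtain zs where zs: "zs \<in> dom_set \<b> N" "\<T> (cl xs) = cl' zs" using ex[OF xs(1)] by blast
  then show "y \<in> U" using key[OF xs(1) zs(1)] xs(2) x(2) coord_dom[OF c' zs(1)] by simp
 next
  fix y assume "y \<in> U"
  then obtain ys where ys: "ys \<in> dom_set \<b> N" "\<v>' ys = y" using coord_onto[OF c'] by blast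
  obtain xs where xs: "xs \<in> dom_set \<a> N" "\<T> (cl xs) = cl' ys" using ex'[OF ys(1)] by blast
  then have "h (\<pi>' xs) = y" using key[OF xs(1) ys(1)] ys(2) by simp
  then show "y \<in> h ` U" using coord_dom[OF c xs(1)] by blast
 qed
 moreover have "map h zs \<in> interp_rel M r <-> zs \<in> interp_rel M r"
  if r: "r \<in> symbols L" and zs: "zs \<in> tuples M (arity L r)" for r zs
 proof -
  have zs': "set zs \<subseteq> U" "length zs = arity L r" using zs by (auto simp: tuples_def)
  obtain xss where xss: "length xss = length zs" "set xss \<subseteq> dom_set \<a> N" "map \<pi>' xss = zs"
   using coord_onto_list[OF c zs'(1)] .
  have "\<forall>xs\<in>dom_set \<a> N. \<exists>ys. ys \<in> dom_set \<b> N \<and> \<T> (cl xs) = cl' ys" using ex by blast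
  from bchoice[OF this] obtain p where p: "\<forall>xs\<in>dom_set \<a> N. p xs \<in> dom_set \<b> N \<and> \<T> (cl xs) = cl' (p xs)"
   by blast
  define yss where "yss = map p xss"
  have yss: "length yss = arity L r" "set yss \<subseteq> dom_set \<b> N"
   using xss p zs'(2) by (auto simp: yss_def)
  have hz: "map h zs = map \<v>' yss"
   unfolding xss(3)[symmetric] yss_def using xss(2) p key by (auto simp: subset_iff)
  have \<T>c: "map \<T> (map cl xss) = map cl' yss"
   unfolding yss_def using xss(2) p by (auto simp: subset_iff)
  have sub: "quot_rel L \<a> N r \<subseteq> lists (dom_set \<a> N // eq_rel \<a> N)"
   by (auto simp: quot_rel_def lists_eq_set intro!: quotientI)
  have "zs \<in> interp_rel M r <-> map cl xss \<in> quot_rel L \<a> N r"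
   using coord_quot_rel[OF c r, of xss] xss zs'(2) unfolding cl_def by simp
  \<comment> \<open>\<open>\<T>\<close> is injective on the classes that occur, so it can be
    cancelled.\<close>
  also have "\<dots> <-> map \<T> (map cl xss) \<in> map \<T> ` quot_rel L \<a> N r"
  proof
   assume "map \<T> (map cl xss) \<in> map \<T> ` quot_rel L \<a> N r"
   then obtain cs where cs: "cs \<in> quot_rel L \<a> N r" "map \<T> (map cl xss) = map \<T> cs" by blast
   have "inj_on \<T> (set (map cl xss) \<union> set cs)"
   proof (rule inj_on_subset)
    show "inj_on \<T> (dom_set \<a> N // eq_rel \<a> N)" using bij by (simp add: bij_betw_def)
    have "set cs \<subseteq> dom_set \<a> N // eq_rel \<a> N" using cs(1) sub by (auto simp: lists_eq_set)
    moreover have "set (map cl xss) \<subseteq> dom_set \<a> N // eq_rel \<a> N" using xss(2) cl_in by auto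
    ultimately show "set (map cl xss) \<union> set cs \<subseteq> dom_set \<a> N // eq_rel \<a> N" by blast
   qed
   then have "map cl xss = cs" using cs(2) inj_on_map_eq_map by blast
   then show "map cl xss \<in> quot_rel L \<a> N r" using cs(1) by simp
  qed blast
  also have "\<dots> <-> map cl' yss \<in> quot_rel L \<b> N r" unfolding \<T>c using rel r by simp
  also have "\<dots> <-> map \<v>' yss \<in> interp_rel M r"
   unfolding cl'_def by (rule coord_quot_rel[OF c' r yss])
  finally show ?thesis using hz by simp
 qed
 ultimately have "h \<in> \<G>" unfolding G_iff iso_by_def by (auto simp: h_def)
 moreover have "sat M (xs @ ys) \<t> <-> h (\<pi> xs) = \<v> ys"
  if xs: "xs \<in> dom_set \<a> M" and ys: "ys \<in> dom_set \<b> M" for xs ys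
 proof -
  have txs: "xs \<in> tuples M (idim \<a>)" and tys: "ys \<in> tuples M (idim \<b>)"
   using xs ys dom_set_tuples by auto
  have gf: "map g (map f zs) = zs" if "zs \<in> tuples M n" for zs n
   using that f unfolding g_def by (auto simp: tuples_def iso_by_def bij_betw_def intro!: map_idI)
  have D: "map f xs \<in> dom_set \<a> N" "map f ys \<in> dom_set \<b> N"
   using coord_source_iso(2)[OF g interp_wf[OF \<a>(1)] \<a>(2) ne iso_by_tuples[OF f txs]] xs gf[OF txs]
    coord_source_iso(2)[OF g interp_wf[OF \<b>(1)] \<b>(2) ne iso_by_tuples[OF f tys]] ys gf[OF tys] by auto
  have "xs @ ys \<in> tuples M (idim \<a> + idim \<b>)" using txs tys by (auto simp: tuples_def)
  then have "sat M (xs @ ys) \<t> = sat N (map f xs @ map f ys) \<t>"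
   using sat_transfer[OF f \<t>, of "xs @ ys"] by simp
  also have "\<dots> <-> \<T> (cl (map f xs)) = cl' (map f ys)"
   using graph D iso_by_tuples[OF f txs] iso_by_tuples[OF f tys] unfolding cl_def cl'_def
   by (auto simp: set_eq_iff)
  also have "\<dots> <-> h (\<pi>' (map f xs)) = \<v>' (map f ys)" using key[OF D] by simp
  finally show ?thesis using gf[OF txs] gf[OF tys] by (simp add: \<pi>'_def \<v>'_def)
 qed
 ultimately show thesis using that \<t> by blast
qed

text \<open>An isomorphism carries the coordinates and the formula to each model; there
  \<open>h\<close> induces the bijection of classes, and it respects the relations because it is an
  automorphism.\<close>

lemma graph_imp_homotopic:
 assumes \<a>: "\<a> \<in> Itp" "coord L M \<a> M \<pi>" and \<b>: "\<b> \<in> Itp" "coord L M \<b> M \<v>"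
  and h: "h \<in> \<G>" and \<t>: "wff L (idim \<a> + idim \<b>) \<t>"
  and graph: "!!xs ys. xs \<in> tuples M (idim \<a>) ==> ys \<in> tuples M (idim \<b>) ==>
   sat M (xs @ ys) \<t> <-> xs \<in> dom_set \<a> M \<and> ys \<in> dom_set \<b> M \<and> h (\<pi> xs) = \<v> ys"
 shows "homotopic L T L \<a> \<b>"
 unfolding homotopic_def
proof (intro bexI ballI)
 show "\<t> \<in> formulas L (idim \<a> + idim \<b>)" using \<t> by (simp add: formulas_def)
 fix N assume N: "N \<in> countable_models L T"
 obtain f where f: "iso_by L f M N" using model_iso_nat[OF N] .
 define g where "g = inv_into U f"
 have g: "iso_by L g N M" unfolding g_def by (rule iso_by_inv[OF f])
 have neN: "universe N \<noteq> {}" using f ne by (auto simp: iso_by_def bij_betw_def)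
 define \<pi>' where "\<pi>' = \<pi> \<circ> map g"
 define \<v>' where "\<v>' = \<v> \<circ> map g"
 have c: "coord L M \<a> N \<pi>'" and c': "coord L M \<b> N \<v>'"
  unfolding \<pi>'_def \<v>'_def g_def using coord_model[OF _ interp_red f] \<a> \<b> by auto
 have hbij: "bij_betw h U U" and hrel: "!!r zs. r \<in> symbols L ==> zs \<in> tuples M (arity L r) ==>
   map h zs \<in> interp_rel M r <-> zs \<in> interp_rel M r"
  using h by (auto simp: G_iff iso_by_def)
 have hU: "h x \<in> U" if "x \<in> U" for x using bij_betwE[OF hbij] that by blast
 have hinj: "h x = h y <-> x = y" if "x \<in> U" "y \<in> U" for x y
  using hbij that by (auto simp: bij_betw_def inj_on_def)
 have hsurj: "\<exists>x\<in>U. h x = y" if "y \<in> U" for y using hbij that unfolding bij_betw_def by (metis imageE)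
 define cl where "cl xs = eq_rel \<a> N `` {xs}" for xs
 define cl' where "cl' xs = eq_rel \<b> N `` {xs}" for xs
 have cl_eq: "cl xs = {zs \<in> dom_set \<a> N. \<pi>' xs = \<pi>' zs}" if "xs \<in> dom_set \<a> N" for xs
  using coord_eq[OF c] that by (auto simp: cl_def)
 have cl'_eq: "cl' xs = {zs \<in> dom_set \<b> N. \<v>' xs = \<v>' zs}" if "xs \<in> dom_set \<b> N" for xs
  using coord_eq[OF c'] that by (auto simp: cl'_def)
 \<comment> \<open>Defined for arbitrary sets of tuples, so that no representative has to be chosen;
   on a class it yields exactly one class of \<open>\<b>\<close>.\<close>
 define \<T> where "\<T> C = {ys \<in> dom_set \<b> N. \<exists>xs\<in>C. h (\<pi>' xs) = \<v>' ys}" for C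
 have \<T>: "\<T> (cl xs) = {ys \<in> dom_set \<b> N. h (\<pi>' xs) = \<v>' ys}" if "xs \<in> dom_set \<a> N" for xs
  unfolding \<T>_def cl_eq[OF that] using that by auto
 have ex: "\<exists>ys\<in>dom_set \<b> N. h (\<pi>' xs) = \<v>' ys" if "xs \<in> dom_set \<a> N" for xs
  using coord_onto[OF c' hU[OF coord_dom[OF c that]]] by metis
 have ex': "\<exists>xs\<in>dom_set \<a> N. h (\<pi>' xs) = \<v>' ys" if "ys \<in> dom_set \<b> N" for ys
  using coord_onto[OF c] hsurj[OF coord_dom[OF c' that]] by metis
 have key: "\<T> (cl xs) = cl' ys <-> h (\<pi>' xs) = \<v>' ys" if xs: "xs \<in> dom_set \<a> N" and ys: "ys \<in> dom_set \<b> N" for xs ys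
  unfolding \<T>[OF xs] cl'_eq[OF ys] using ys by auto
 have quot: "dom_set \<a> N // eq_rel \<a> N = cl ` dom_set \<a> N" "dom_set \<b> N // eq_rel \<b> N = cl' ` dom_set \<b> N"
  by (auto simp: quotient_def cl_def cl'_def)
 show "\<exists>\<T>. bij_betw \<T> (dom_set \<a> N // eq_rel \<a> N) (dom_set \<b> N // eq_rel \<b> N) \<and>
      {(xs, ys). xs \<in> tuples N (idim \<a>) \<and> ys \<in> tuples N (idim \<b>) \<and> sat N (xs @ ys) \<t>} =
      {(xs, ys). xs \<in> dom_set \<a> N \<and> ys \<in> dom_set \<b> N \<and>
            \<T> (eq_rel \<a> N `` {xs}) = eq_rel \<b> N `` {ys}} \<and>
      (\<forall>r\<in>symbols L. map \<T> ` quot_rel L \<a> N r = quot_rel L \<b> N r)"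
 proof (intro exI[of _ \<T>] conjI ballI)
  show "bij_betw \<T> (dom_set \<a> N // eq_rel \<a> N) (dom_set \<b> N // eq_rel \<b> N)"
   unfolding quot bij_betw_def
  proof
   show "inj_on \<T> (cl ` dom_set \<a> N)"
   proof (rule inj_onI)
   fix C C' assume "C \<in> cl ` dom_set \<a> N" "C' \<in> cl ` dom_set \<a> N" and eq: "\<T> C = \<T> C'"
   then obtain xs xs' where xs: "xs \<in> dom_set \<a> N" "C = cl xs" "xs' \<in> dom_set \<a> N" "C' = cl xs'" by blast
   obtain ys where ys: "ys \<in> dom_set \<b> N" "h (\<pi>' xs) = \<v>' ys" using ex[OF xs(1)] by blast
   then have "ys \<in> \<T> (cl xs)" using \<T>[OF xs(1)] by blast
   then have "ys \<in> \<T> C'" using xs(2) eq by simp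
   then have "h (\<pi>' xs) = h (\<pi>' xs')" using \<T>[OF xs(3)] xs(4) ys(2) by simp
   then have "\<pi>' xs = \<pi>' xs'" using hinj coord_dom[OF c] xs by blast
   then show "C = C'" using xs cl_eq by simp
   qed
   show "\<T> ` cl ` dom_set \<a> N = cl' ` dom_set \<b> N"
   proof (intro equalityI subsetI)
   fix C assume "C \<in> \<T> ` cl ` dom_set \<a> N"
   then obtain xs where xs: "xs \<in> dom_set \<a> N" "C = \<T> (cl xs)" by blast
   obtain ys where ys: "ys \<in> dom_set \<b> N" "h (\<pi>' xs) = \<v>' ys" using ex[OF xs(1)] by blast
   then have "C = cl' ys" using key[OF xs(1) ys(1)] xs(2) by simp
   then show "C \<in> cl' ` dom_set \<b> N" using ys(1) by blast
  next
   fix C assume "C \<in> cl' ` dom_set \<b> N"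
   then obtain ys where ys: "ys \<in> dom_set \<b> N" "C = cl' ys" by blast
   obtain xs where xs: "xs \<in> dom_set \<a> N" "h (\<pi>' xs) = \<v>' ys" using ex'[OF ys(1)] by blast
   then have "C = \<T> (cl xs)" using key[OF xs(1) ys(1)] ys(2) by simp
   then show "C \<in> \<T> ` cl ` dom_set \<a> N" using xs(1) by blast
   qed
  qed
  have "xs \<in> tuples N (idim \<a>) \<and> ys \<in> tuples N (idim \<b>) \<and> sat N (xs @ ys) \<t> <->
    xs \<in> dom_set \<a> N \<and> ys \<in> dom_set \<b> N \<and> \<T> (cl xs) = cl' ys" for xs ys
  proof (cases "xs \<in> tuples N (idim \<a>) \<and> ys \<in> tuples N (idim \<b>)")
   case True
   then have t: "xs @ ys \<in> tuples N (idim \<a> + idim \<b>)" by (auto simp: tuples_def)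
   have "sat N (xs @ ys) \<t> = sat M (map g xs @ map g ys) \<t>"
    using sat_iso[OF g \<t> t neN] by simp
   also have "\<dots> <-> map g xs \<in> dom_set \<a> M \<and> map g ys \<in> dom_set \<b> M \<and> h (\<pi>' xs) = \<v>' ys"
    using graph True iso_by_tuples[OF g] by (simp add: \<pi>'_def \<v>'_def)
   also have "\<dots> <-> xs \<in> dom_set \<a> N \<and> ys \<in> dom_set \<b> N \<and> h (\<pi>' xs) = \<v>' ys"
    using coord_source_iso(2)[OF g interp_wf[OF \<a>(1)] \<a>(2) ne]
     coord_source_iso(2)[OF g interp_wf[OF \<b>(1)] \<b>(2) ne] True by blast
   finally show ?thesis using True key by blast
  next
   case False
   then show ?thesis using dom_set_tuples by blast
  qed
  then show "{(xs, ys). xs \<in> tuples N (idim \<a>) \<and> ys \<in> tuples N (idim \<b>) \<and> sat N (xs @ ys) \<t>} =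
      {(xs, ys). xs \<in> dom_set \<a> N \<and> ys \<in> dom_set \<b> N \<and>
            \<T> (eq_rel \<a> N `` {xs}) = eq_rel \<b> N `` {ys}}"
   unfolding cl_def cl'_def by blast
  fix r assume r: "r \<in> symbols L"
  have pair: "map \<T> (map cl xss) = map cl' yss \<and> map h (map \<pi>' xss) = map \<v>' yss"
   if pq: "length xss = length yss" "!!i. i < length xss ==> h (\<pi>' (xss ! i)) = \<v>' (yss ! i)"
    "set xss \<subseteq> dom_set \<a> N" "set yss \<subseteq> dom_set \<b> N" for xss yss
  proof -
   have "\<T> (cl (xss ! i)) = cl' (yss ! i)" if i: "i < length xss" for i
   proof -
    have "xss ! i \<in> dom_set \<a> N" "yss ! i \<in> dom_set \<b> N"
     using nth_mem[of i xss] nth_mem[of i yss] i pq(1,3,4) by auto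
    then show ?thesis using key pq(2)[OF i] by blast
   qed
   then show ?thesis using pq(1,2) by (simp add: list_eq_iff_nth_eq)
  qed
  have rel: "map cl xss \<in> quot_rel L \<a> N r <-> map cl' yss \<in> quot_rel L \<b> N r"
   if "length xss = arity L r" "length yss = arity L r" "map h (map \<pi>' xss) = map \<v>' yss"
    "set xss \<subseteq> dom_set \<a> N" "set yss \<subseteq> dom_set \<b> N" for xss yss
  proof -
   have "map \<pi>' xss \<in> tuples M (arity L r)" using that coord_dom[OF c] by (auto simp: tuples_def)
   from hrel[OF r this] have "map \<pi>' xss \<in> interp_rel M r <-> map \<v>' yss \<in> interp_rel M r"
    unfolding that(3) by (rule sym)
   then show ?thesis
    using coord_quot_rel[OF c r that(1,4)] coord_quot_rel[OF c' r that(2,5)]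
    unfolding cl_def cl'_def by simp
  qed
  show "map \<T> ` quot_rel L \<a> N r = quot_rel L \<b> N r"
  proof (intro equalityI subsetI)
   fix cs assume "cs \<in> map \<T> ` quot_rel L \<a> N r"
   then obtain ds where ds: "cs = map \<T> ds" "ds \<in> quot_rel L \<a> N r" by blast
   have "\<exists>xss. ds = map cl xss \<and> length xss = arity L r \<and> set xss \<subseteq> dom_set \<a> N"
    using ds(2) unfolding quot_rel_def cl_def by blast
   then obtain xss where "ds = map cl xss" "length xss = arity L r" "set xss \<subseteq> dom_set \<a> N" by blast
   then have xss: "cs = map \<T> (map cl xss)" "map cl xss \<in> quot_rel L \<a> N r"
    "length xss = arity L r" "set xss \<subseteq> dom_set \<a> N" using ds by auto
   from ex obtain p where p: "!!xs. xs \<in> dom_set \<a> N ==> p xs \<in> dom_set \<b> N \<and> h (\<pi>' xs) = \<v>' (p xs)"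
    by metis
   have yss: "set (map p xss) \<subseteq> dom_set \<b> N" using xss(4) p by auto
   have eqs: "map \<T> (map cl xss) = map cl' (map p xss) \<and> map h (map \<pi>' xss) = map \<v>' (map p xss)"
    using xss(4) p yss subsetD[OF xss(4) nth_mem] by (intro pair) auto
   have "map cl' (map p xss) \<in> quot_rel L \<b> N r"
    using rel[OF xss(3) _ conjunct2[OF eqs] xss(4) yss] xss(2,3) by (simp only: length_map)
   then show "cs \<in> quot_rel L \<b> N r" unfolding xss(1) conjunct1[OF eqs] .
  next
   fix cs assume "cs \<in> quot_rel L \<b> N r"
   moreover from this have "\<exists>yss. cs = map cl' yss \<and> length yss = arity L r \<and> set yss \<subseteq> dom_set \<b> N"
    unfolding quot_rel_def cl'_def by blast
   ultimately obtain yss where yss: "cs = map cl' yss" "map cl' yss \<in> quot_rel L \<b> N r"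
    "length yss = arity L r" "set yss \<subseteq> dom_set \<b> N" by blast
   from ex' obtain p where p: "!!ys. ys \<in> dom_set \<b> N ==> p ys \<in> dom_set \<a> N \<and> h (\<pi>' (p ys)) = \<v>' ys"
    by metis
   have xss: "set (map p yss) \<subseteq> dom_set \<a> N" using yss(4) p by auto
   have eqs: "map \<T> (map cl (map p yss)) = map cl' yss \<and> map h (map \<pi>' (map p yss)) = map \<v>' yss"
    using yss(4) p xss subsetD[OF yss(4) nth_mem] by (intro pair) auto
   have "map cl (map p yss) \<in> quot_rel L \<a> N r"
    using rel[OF _ yss(3) conjunct2[OF eqs] xss yss(4)] yss(2,3) by (simp only: length_map)
   then show "cs \<in> map \<T> ` quot_rel L \<a> N r"
    unfolding yss(1) conjunct1[OF eqs, symmetric] by (rule imageI)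
  qed
 qed
qed

end

lemma iso_by_cong:
 assumes "!!x. x \<in> universe M ==> f x = h x" shows "iso_by L f M N = iso_by L h M N"
proof -
 have m: "map f xs = map h xs" if "xs \<in> tuples M n" for xs n
  using that assms by (auto simp: tuples_def)
 have b: "bij_betw f (universe M) (universe N) = bij_betw h (universe M) (universe N)"
  using assms by (rule bij_betw_cong)
 show ?thesis unfolding iso_by_def b by (intro conj_cong refl ball_cong) (simp only: m)
qed

context omega_cat
begin

section \<open>The automorphism group\<close>

lemma G_bij: "g \<in> \<G> ==> bij_betw g U U"
 by (simp add: G_iff iso_by_def)

lemma G_closed: "g \<in> \<G> ==> x \<in> U ==> g x \<in> U"
 using G_bij bij_betwE by blast

lemma G_Bij: "\<G> \<subseteq> Bij U"
 by (auto simp: automorphism_group_def)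

lemma G_mult: "g \<in> \<G> ==> h \<in> \<G> ==> g \<cdot> h = compose U g h"
 using G_Bij by (auto simp: automorphism_group_def BijGroup_def)

lemma G_group: "group G"
proof -
 have "subgroup (\<G>) (BijGroup U)"
 proof (rule subgroup.intro)
  show "\<G> \<subseteq> carrier (BijGroup U)" using G_Bij by (simp add: BijGroup_def)
  show "\<one>\<^bsub>BijGroup U\<^esub> \<in> \<G>"
  proof -
   have "map (\<lambda>x\<in>U. x) xs = xs" if "xs \<in> tuples M n" for xs n
    using that by (auto simp: tuples_def intro!: map_idI)
   then show ?thesis by (auto simp: BijGroup_def G_iff iso_by_def bij_betw_def inj_on_def)
  qed
  fix g assume g: "g \<in> \<G>"
  have B: "g \<in> Bij U" using g G_Bij by blast
  have i: "iso_by L (inv_into U g) M M" using g by (intro iso_by_inv) (simp add: G_iff)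
  have "iso_by L (restrict (inv_into U g) U) M M" using i by (subst iso_by_cong[of M _ "inv_into U g"]) auto
  then show "inv\<^bsub>BijGroup U\<^esub> g \<in> \<G>"
   unfolding inv_BijGroup[OF B] G_iff by simp
  fix h assume h: "h \<in> \<G>"
  have "g \<otimes>\<^bsub>BijGroup U\<^esub> h = compose U g h" using g h G_Bij by (auto simp: BijGroup_def)
  moreover have "iso_by L (g \<circ> h) M M" using g h by (intro iso_by_comp[of L h M M g M]) (simp_all add: G_iff)
  then have "iso_by L (compose U g h) M M"
   by (subst iso_by_cong[of M _ "g \<circ> h"]) (auto simp: compose_def)
  ultimately show "g \<otimes>\<^bsub>BijGroup U\<^esub> h \<in> \<G>" unfolding G_iff by simp
 qed
 then have "group (BijGroup U\<lparr>carrier := \<G>\<rparr>)"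
  by (rule subgroup.subgroup_is_group[OF _ group_BijGroup])
 moreover have "BijGroup U\<lparr>carrier := \<G>\<rparr> = G" by (simp add: automorphism_group_def)
 ultimately show ?thesis by simp
qed

sublocale G: group G by (rule G_group)

lemma G_one: "x \<in> U ==> \<one>\<^bsub>G\<^esub> x = x"
 by (simp add: automorphism_group_def BijGroup_def)

lemma G_mult_apply: "g \<in> \<G> ==> h \<in> \<G> ==> x \<in> U ==> (g \<cdot> h) x = g (h x)"
 by (simp add: G_mult compose_def)

lemma G_inv_apply: "g \<in> \<G> ==> x \<in> U ==> (\<iota> g) (g x) = x"
 using G_mult_apply[of "\<iota> g" g x] by (simp add: G_one)

lemma G_apply_inv: "g \<in> \<G> ==> x \<in> U ==> g ((\<iota> g) x) = x"
 using G_mult_apply[of g "\<iota> g" x] by (simp add: G_one)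

lemma G_ext: "g \<in> \<G> ==> h \<in> \<G> ==> (!!x. x \<in> U ==> g x = h x) ==> g = h"
 by (rule extensionalityI[of _ U]) (simp_all add: G_iff)

lemma G_inj: "g \<in> \<G> ==> x \<in> U ==> y \<in> U ==> g x = g y <-> x = y"
 using G_inv_apply by metis

lemma G_rel: "g \<in> \<G> ==> r \<in> symbols L ==> zs \<in> tuples M (arity L r) ==>
 map g zs \<in> interp_rel M r <-> zs \<in> interp_rel M r"
 by (simp add: G_iff iso_by_def)

lemma G_map_mult: "g \<in> \<G> ==> h \<in> \<G> ==> set xs \<subseteq> U ==> map (g \<cdot> h) xs = map g (map h xs)"
 using G_mult_apply by auto

lemma G_map_inv: "g \<in> \<G> ==> set xs \<subseteq> U ==> map (\<iota> g) (map g xs) = xs"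
 using G_inv_apply by (auto intro!: map_idI)

lemma dom_set_closed: "xs \<in> dom_set \<a> M ==> set xs \<subseteq> U"
 by (auto simp: dom_set_def tuples_def)

lemma dom_set_invariant:
 assumes "wf_interp L L \<a>" "g \<in> \<G>" "xs \<in> dom_set \<a> M"
 shows "map g xs \<in> dom_set \<a> M"
 using assms sat_invariant[of g "idim \<a>" "dom_fm \<a>" xs] map_G_tuples[of g xs]
 by (simp add: dom_set_def wf_interp_def)

section \<open>The action on the interpreted structure\<close>

text \<open>Equivariance of the coordinates. Only the values of \<open>\<F>\<close> on
  \<open>\<G>\<close> enter, so lambda terms such as \<open>\<lambda>g. \<H> (\<F> g)\<close> can
  serve directly.\<close>

definition acts :: "('r, 'r) interp => ('a list => 'a) => (('a => 'a) => 'a => 'a) => bool" where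
 "acts \<a> \<pi> \<F> <-> (\<forall>g\<in>\<G>. \<F> g \<in> \<G> \<and> (\<forall>xs\<in>dom_set \<a> M. \<pi> (map g xs) = \<F> g (\<pi> xs)))"

text \<open>Uniform continuity for pointwise convergence: the finite set \<open>F\<close> depends on
  \<open>x\<close> but not on the group elements.\<close>

definition loc_const :: "(('a => 'a) => 'a => 'a) => bool" where
 "loc_const \<F> <-> (\<forall>x\<in>U. \<exists>F. finite F \<and> F \<subseteq> U \<and>
   (\<forall>g\<in>\<G>. \<forall>h\<in>\<G>. (\<forall>z\<in>F. g z = h z) --> \<F> g x = \<F> h x))"

text \<open>The equality of the interpretation is definable, hence invariant under
  \<open>\<G>\<close>. This makes the induced action on coordinates well defined.\<close>

lemma coord_invariant:
 assumes \<a>: "wf_interp L L \<a>" and c: "coord L M \<a> M \<pi>" and g: "g \<in> \<G>"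
  and xs: "xs \<in> dom_set \<a> M" "ys \<in> dom_set \<a> M" "\<pi> xs = \<pi> ys"
 shows "\<pi> (map g xs) = \<pi> (map g ys)"
proof -
 have "(xs, ys) \<in> eq_rel \<a> M" using coord_eq[OF c] xs by simp
 moreover have "xs @ ys \<in> tuples M (2 * idim \<a>)" using xs by (auto simp: dom_set_def tuples_def)
 ultimately have "(map g xs, map g ys) \<in> eq_rel \<a> M"
  using sat_invariant[OF g, of "2 * idim \<a>" "eq_fm \<a>" "xs @ ys"] \<a> map_G_tuples[OF g]
  by (simp add: eq_rel_def wf_interp_def)
 then show ?thesis using coord_eq[OF c] by simp
qed

text \<open>A permutation \<open>g\<close> acts on tuples of the domain, and a section
  \<open>s\<close> of \<open>\<pi>\<close> transports the action to \<open>U\<close>. The inverse of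
  \<open>g\<close> induces the inverse permutation, and relations are preserved because the formulas
  defining their preimages are invariant.\<close>

lemma coord_imp_acts:
 assumes \<a>: "wf_interp L L \<a>" and c: "coord L M \<a> M \<pi>"
 obtains \<F> where "\<F> \<in> extensional (\<G>)" "acts \<a> \<pi> \<F>"
proof -
 obtain s where s: "!!y. y \<in> U ==> s y \<in> dom_set \<a> M \<and> \<pi> (s y) = y"
  using coord_onto[OF c] by metis
 define \<F> where "\<F> = (\<lambda>g\<in>\<G>. \<lambda>y\<in>U. \<pi> (map g (s y)))"
 have \<F>: "\<F> g (\<pi> xs) = \<pi> (map g xs)" if "g \<in> \<G>" "xs \<in> dom_set \<a> M" for g xs
 proof -
  have "\<pi> (map g (s (\<pi> xs))) = \<pi> (map g xs)"
   using s[OF coord_dom[OF c that(2)]] that(2) by (intro coord_invariant[OF \<a> c that(1)]) auto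
  then show ?thesis using that(1) coord_dom[OF c that(2)] by (simp add: \<F>_def)
 qed
 have U: "\<F> g y \<in> U" if "g \<in> \<G>" "y \<in> U" for g y
  using \<F>[OF that(1), of "s y"] s[OF that(2)] dom_set_invariant[OF \<a> that(1)] coord_dom[OF c] by metis
 have inv: "\<F> (\<iota> g) (\<F> g y) = y" if g: "g \<in> \<G>" and y: "y \<in> U" for g y
 proof -
  have "\<F> g y = \<pi> (map g (s y))" using \<F>[OF g, of "s y"] s[OF y] by simp
  then have "\<F> (\<iota> g) (\<F> g y) = \<pi> (map (\<iota> g) (map g (s y)))"
   using \<F>[of "\<iota> g" "map g (s y)"] g s[OF y] dom_set_invariant[OF \<a> g] by simp
  then show ?thesis using G_map_inv[OF g] dom_set_closed s[OF y] by metis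
 qed
 have "\<F> g \<in> \<G>" if g: "g \<in> \<G>" for g
 proof -
  have "bij_betw (\<F> g) U U"
  proof (rule bij_betw_byWitness[where f' = "\<F> (\<iota> g)"])
   show "\<forall>y\<in>U. \<F> (\<iota> g) (\<F> g y) = y" using inv[OF g] by blast
   show "\<forall>y\<in>U. \<F> g (\<F> (\<iota> g) y) = y" using inv[of "\<iota> g"] g by simp
  qed (use U g in auto)
  moreover have "map (\<F> g) zs \<in> interp_rel M r <-> zs \<in> interp_rel M r"
   if r: "r \<in> symbols L" and zs: "zs \<in> tuples M (arity L r)" for r zs
  proof -
   define xss where "xss = map s zs"
   have xss: "length xss = arity L r" "set xss \<subseteq> dom_set \<a> M" "map \<pi> xss = zs"
    using zs s by (auto simp: xss_def tuples_def intro!: map_idI)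
   have "map \<pi> (map (map g) xss) = map (\<F> g) (map \<pi> xss)" using xss(2) \<F>[OF g] by auto
   then have "map (\<F> g) zs \<in> interp_rel M r <-> map \<pi> (map (map g) xss) \<in> interp_rel M r"
    using xss(3) by simp
   also have "\<dots> <-> sat M (concat (map (map g) xss)) (sym_fm \<a> r)"
    using r xss dom_set_invariant[OF \<a> g] by (intro coord_rel[OF c, symmetric]) auto
   also have "concat (map (map g) xss) = map g (concat xss)" by (simp add: map_concat)
   also have "sat M (map g (concat xss)) (sym_fm \<a> r) <-> sat M (concat xss) (sym_fm \<a> r)"
   proof (rule sat_invariant[OF g])
    show "wff L (arity L r * idim \<a>) (sym_fm \<a> r)" using \<a> r by (simp add: wf_interp_def)
    show "concat xss \<in> tuples M (arity L r * idim \<a>)"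
     using xss(1,2) dom_set_tuples by (intro concat_tuples) auto
   qed
   also have "\<dots> <-> map \<pi> xss \<in> interp_rel M r" by (rule coord_rel[OF c r xss(1,2)])
   finally show ?thesis using xss(3) by simp
  qed
  ultimately show ?thesis unfolding G_iff iso_by_def using g by (simp add: \<F>_def)
 qed
 then have "acts \<a> \<pi> \<F>" using \<F> by (simp add: acts_def)
 moreover have "\<F> \<in> extensional (\<G>)" by (simp add: \<F>_def)
 ultimately show thesis using that by blast
qed

lemma acts_hom:
 assumes \<a>: "wf_interp L L \<a>" and c: "coord L M \<a> M \<pi>" and a: "acts \<a> \<pi> \<F>"
 shows "\<F> \<in> hom G G"
proof (rule homI)
 show "\<F> g \<in> \<G>" if "g \<in> \<G>" for g using a that by (simp add: acts_def)
 fix g h assume g: "g \<in> \<G>" and h: "h \<in> \<G>"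
 have \<F>: "\<F> g \<in> \<G>" "\<F> h \<in> \<G>" "\<F> (g \<cdot> h) \<in> \<G>"
  using a g h by (simp_all add: acts_def)
 show "\<F> (g \<cdot> h) = \<F> g \<cdot> \<F> h"
 proof (rule G_ext)
  fix y assume y: "y \<in> U"
  obtain xs where xs: "xs \<in> dom_set \<a> M" "\<pi> xs = y" using coord_onto[OF c y] by blast
  have "\<F> (g \<cdot> h) y = \<pi> (map (g \<cdot> h) xs)" using a g h xs by (simp add: acts_def)
  also have "\<dots> = \<pi> (map g (map h xs))"
   by (simp only: G_map_mult[OF g h dom_set_closed[OF xs(1)]])
  also have "\<dots> = \<F> g (\<F> h y)"
   using a g h xs dom_set_invariant[OF \<a> h xs(1)] by (simp add: acts_def del: map_map)
  finally show "\<F> (g \<cdot> h) y = (\<F> g \<cdot> \<F> h) y" using G_mult_apply[OF \<F>(1,2) y] by simp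
 qed (use \<F> in auto)
qed

text \<open>The value of \<open>\<F> g\<close> at \<open>\<pi> xs\<close> depends only on the values
  of \<open>g\<close> at the entries of \<open>xs\<close>.\<close>

lemma acts_loc_const:
 assumes c: "coord L M \<a> M \<pi>" and a: "acts \<a> \<pi> \<F>"
 shows "loc_const \<F>"
 unfolding loc_const_def
proof
 fix y assume "y \<in> U"
 then obtain xs where xs: "xs \<in> dom_set \<a> M" "\<pi> xs = y" using coord_onto[OF c] by blast
 have loc: "\<F> g y = \<F> h y" if "g \<in> \<G>" "h \<in> \<G>" "\<forall>z\<in>set xs. g z = h z" for g h
 proof -
  have "map g xs = map h xs" using that(3) by simp
  then show ?thesis using a that xs unfolding acts_def by metis
 qed
 show "\<exists>F. finite F \<and> F \<subseteq> U \<and>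
   (\<forall>g\<in>\<G>. \<forall>h\<in>\<G>. (\<forall>z\<in>F. g z = h z) --> \<F> g y = \<F> h y)"
 proof (intro exI[of _ "set xs"] conjI ballI impI)
  show "set xs \<subseteq> U" by (rule dom_set_closed[OF xs(1)])
 qed (simp, rule loc)
qed

text \<open>The graph of \<open>h\<close> in coordinates is definable iff it is invariant under
  \<open>\<G>\<close>, and invariance of the graph says that \<open>h\<close> intertwines the two
  actions.\<close>

lemma homotopic_iff_conj:
 assumes \<a>: "\<a> \<in> Itp" "coord L M \<a> M \<pi>" "acts \<a> \<pi> \<F>" and \<b>: "\<b> \<in> Itp" "coord L M \<b> M \<v>" "acts \<b> \<v> \<H>"
 shows "homotopic L T L \<a> \<b> <-> (\<exists>h\<in>\<G>. \<forall>g\<in>\<G>. \<forall>y\<in>U. \<H> g (h y) = h (\<F> g y))"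
proof
 assume "homotopic L T L \<a> \<b>"
 then obtain h \<t> where h: "h \<in> \<G>" and \<t>: "wff L (idim \<a> + idim \<b>) \<t>"
  and graph: "!!xs ys. xs \<in> dom_set \<a> M ==> ys \<in> dom_set \<b> M ==> sat M (xs @ ys) \<t> <-> h (\<pi> xs) = \<v> ys"
  using homotopic_imp_graph[OF \<a>(1,2) \<b>(1,2)] by metis
 have "\<H> g (h y) = h (\<F> g y)" if g: "g \<in> \<G>" and y: "y \<in> U" for g y
 proof -
  obtain xs where xs: "xs \<in> dom_set \<a> M" "\<pi> xs = y" using coord_onto[OF \<a>(2) y] by blast
  obtain ys where ys: "ys \<in> dom_set \<b> M" "\<v> ys = h y" using coord_onto[OF \<b>(2) G_closed[OF h y]] by blast
  have D: "map g xs \<in> dom_set \<a> M" "map g ys \<in> dom_set \<b> M"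
   using dom_set_invariant g xs(1) ys(1) interp_wf \<a>(1) \<b>(1) by blast+
  have t: "xs @ ys \<in> tuples M (idim \<a> + idim \<b>)" using xs ys by (auto simp: dom_set_def tuples_def)
  have "sat M (xs @ ys) \<t>" using graph[OF xs(1) ys(1)] xs(2) ys(2) by simp
  then have "sat M (map g xs @ map g ys) \<t>" using sat_invariant[OF g \<t> t] by simp
  then have "h (\<pi> (map g xs)) = \<v> (map g ys)" using graph[OF D] by simp
  then show ?thesis using \<a>(3) \<b>(3) g xs ys by (simp add: acts_def)
 qed
 then show "\<exists>h\<in>\<G>. \<forall>g\<in>\<G>. \<forall>y\<in>U. \<H> g (h y) = h (\<F> g y)" using h by blast
next
 assume "\<exists>h\<in>\<G>. \<forall>g\<in>\<G>. \<forall>y\<in>U. \<H> g (h y) = h (\<F> g y)"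
 then obtain h where h: "h \<in> \<G>" "!!g y. g \<in> \<G> ==> y \<in> U ==> \<H> g (h y) = h (\<F> g y)" by blast
 define S where "S = {xs @ ys | xs ys. xs \<in> dom_set \<a> M \<and> ys \<in> dom_set \<b> M \<and> h (\<pi> xs) = \<v> ys}"
 have S: "xs @ ys \<in> S <-> xs \<in> dom_set \<a> M \<and> ys \<in> dom_set \<b> M \<and> h (\<pi> xs) = \<v> ys"
  if "xs \<in> tuples M (idim \<a>)" for xs ys
 proof
  assume "xs @ ys \<in> S"
  then obtain xs' ys' where "xs @ ys = xs' @ ys'" "xs' \<in> dom_set \<a> M" "ys' \<in> dom_set \<b> M" "h (\<pi> xs') = \<v> ys'"
   by (auto simp: S_def)
  moreover have "length xs = length xs'" using that calculation(2) by (simp add: dom_set_def tuples_def)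
  ultimately show "xs \<in> dom_set \<a> M \<and> ys \<in> dom_set \<b> M \<and> h (\<pi> xs) = \<v> ys" by simp
 qed (auto simp: S_def)
 show "homotopic L T L \<a> \<b>"
 proof (rule definable[of S "idim \<a> + idim \<b>"])
  show "S \<subseteq> tuples M (idim \<a> + idim \<b>)" by (auto simp: S_def dom_set_def tuples_def)
  fix g zs assume g: "g \<in> \<G>" and "zs \<in> S"
  then obtain xs ys where zs: "zs = xs @ ys" "xs \<in> dom_set \<a> M" "ys \<in> dom_set \<b> M" "h (\<pi> xs) = \<v> ys"
   by (auto simp: S_def)
  have "map g xs \<in> dom_set \<a> M" "map g ys \<in> dom_set \<b> M"
   using dom_set_invariant g zs(2,3) interp_wf \<a>(1) \<b>(1) by blast+
  moreover have "h (\<pi> (map g xs)) = \<v> (map g ys)"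
   using \<a>(3) \<b>(3) g zs(2-4) h(2)[OF g coord_dom[OF \<a>(2) zs(2)]] by (simp add: acts_def)
  ultimately show "map g zs \<in> S" unfolding zs(1) S_def by (auto simp: zs(1))
 next
  fix \<t> assume \<t>: "wff L (idim \<a> + idim \<b>) \<t>"
   and sat: "!!xs. xs \<in> tuples M (idim \<a> + idim \<b>) ==> sat M xs \<t> <-> xs \<in> S"
  show ?thesis
  proof (rule graph_imp_homotopic[OF \<a>(1,2) \<b>(1,2) h(1) \<t>])
   fix xs ys assume "xs \<in> tuples M (idim \<a>)" "ys \<in> tuples M (idim \<b>)"
   moreover from this have "xs @ ys \<in> tuples M (idim \<a> + idim \<b>)" by (auto simp: tuples_def)
   ultimately show "sat M (xs @ ys) \<t> <-> xs \<in> dom_set \<a> M \<and> ys \<in> dom_set \<b> M \<and> h (\<pi> xs) = \<v> ys"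
    using sat S by simp
  qed
 qed
qed

section \<open>Constructing interpretations\<close>

lemma rel_formula:
 assumes D: "D \<subseteq> tuples M k" "!!g xs. g \<in> \<G> ==> xs \<in> D ==> map g xs \<in> D"
  and \<pi>: "!!xs. xs \<in> D ==> \<pi> xs \<in> U"
  and \<F>: "!!g. g \<in> \<G> ==> \<F> g \<in> \<G>"
  "!!g xs. g \<in> \<G> ==> xs \<in> D ==> \<pi> (map g xs) = \<F> g (\<pi> xs)"
  and r: "r \<in> symbols L"
 obtains \<f> where "\<f> \<in> reduced_formulas L T (arity L r * k)"
  "!!xss. length xss = arity L r ==> set xss \<subseteq> D ==> sat M (concat xss) \<f> <-> map \<pi> xss \<in> interp_rel M r"
proof -
 define S where "S = {concat xss | xss. length xss = arity L r \<and> set xss \<subseteq> D \<and> map \<pi> xss \<in> interp_rel M r}"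
 show thesis
 proof (rule definable_reduced[of S "arity L r * k"])
  have "concat xss \<in> tuples M (arity L r * k)" if "length xss = arity L r" "set xss \<subseteq> D" for xss
   using that D(1) by (intro concat_tuples) auto
  then show "S \<subseteq> tuples M (arity L r * k)" by (auto simp: S_def)
  fix g zs assume g: "g \<in> \<G>" and "zs \<in> S"
  then obtain xss where xss: "zs = concat xss" "length xss = arity L r" "set xss \<subseteq> D" "map \<pi> xss \<in> interp_rel M r"
   by (auto simp: S_def)
  have "map \<pi> xss \<in> tuples M (arity L r)" using xss \<pi> by (auto simp: tuples_def)
  then have "map (\<F> g) (map \<pi> xss) \<in> interp_rel M r" using G_rel[OF \<F>(1)[OF g] r] xss(4) by blast
  moreover have "map (\<F> g) (map \<pi> xss) = map \<pi> (map (map g) xss)" using xss(3) \<F>(2)[OF g] by auto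
  moreover have "map g zs = concat (map (map g) xss)" unfolding xss(1) by (rule map_concat)
  moreover have "set (map (map g) xss) \<subseteq> D" using xss(3) D(2)[OF g] by auto
  ultimately show "map g zs \<in> S" unfolding S_def using xss(2)
   by (intro CollectI exI[of _ "map (map g) xss"]) (simp del: map_map)
 next
  fix \<f> assume \<f>: "\<f> \<in> reduced_formulas L T (arity L r * k)"
   and sat: "!!xs. xs \<in> tuples M (arity L r * k) ==> sat M xs \<f> <-> xs \<in> S"
  show thesis
  proof (rule that[OF \<f>])
   fix xss assume xss: "length xss = arity L r" "set xss \<subseteq> D"
   have len: "length xs = k" if "xs \<in> D" for xs using that D(1) by (auto simp: tuples_def)
   have "concat xss \<in> S <-> map \<pi> xss \<in> interp_rel M r"
   proof
    assume "concat xss \<in> S"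
    then obtain yss where yss: "concat xss = concat yss" "length yss = arity L r" "set yss \<subseteq> D" "map \<pi> yss \<in> interp_rel M r"
     by (auto simp: S_def)
    have "xss = yss" using yss xss len by (intro concat_uniform_inj[where k = k]) auto
    then show "map \<pi> xss \<in> interp_rel M r" using yss(4) by simp
   qed (use xss in \<open>auto simp: S_def\<close>)
   moreover have "concat xss \<in> tuples M (arity L r * k)" using xss D(1) by (intro concat_tuples) auto
   ultimately show "sat M (concat xss) \<f> <-> map \<pi> xss \<in> interp_rel M r" using sat by simp
  qed
 qed
qed

text \<open>By equivariance the domain, the kernel of \<open>\<pi>\<close> and the preimages of the
  relations are invariant under \<open>\<G>\<close>. Invariant sets are definable, and the defining
  formulas can be taken reduced.\<close>

lemma realize:
 assumes k: "k \<ge> 1" and D: "D \<subseteq> tuples M k" "!!g xs. g \<in> \<G> ==> xs \<in> D ==> map g xs \<in> D"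
  and \<pi>: "\<pi> ` D = U"
  and \<F>: "!!g. g \<in> \<G> ==> \<F> g \<in> \<G>"
  "!!g xs. g \<in> \<G> ==> xs \<in> D ==> \<pi> (map g xs) = \<F> g (\<pi> xs)"
 obtains \<a> where "\<a> \<in> Itp" "coord L M \<a> M \<pi>" "acts \<a> \<pi> \<F>"
proof -
 obtain \<f>D where \<f>D: "\<f>D \<in> reduced_formulas L T k" "!!xs. xs \<in> tuples M k ==> sat M xs \<f>D <-> xs \<in> D"
  by (rule definable_reduced[OF D]) (assumption | rule that)+
 define S where "S = {xs @ ys | xs ys. xs \<in> D \<and> ys \<in> D \<and> \<pi> xs = \<pi> ys}"
 have "S \<subseteq> tuples M (2 * k)" using D(1) by (auto simp: S_def tuples_def subset_iff)
 moreover have "map g zs \<in> S" if "g \<in> \<G>" "zs \<in> S" for g zs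
 proof -
  obtain xs ys where "zs = xs @ ys" "xs \<in> D" "ys \<in> D" "\<pi> xs = \<pi> ys" using \<open>zs \<in> S\<close> by (auto simp: S_def)
  then show ?thesis unfolding S_def using D(2) \<F>(2) that(1)
   by (intro CollectI exI[of _ "map g xs"] exI[of _ "map g ys"]) simp
 qed
 ultimately obtain \<f>E where \<f>E: "\<f>E \<in> reduced_formulas L T (2 * k)"
  "!!xs. xs \<in> tuples M (2 * k) ==> sat M xs \<f>E <-> xs \<in> S"
  by (rule definable_reduced) (assumption | rule that)+
 have "\<forall>r\<in>symbols L. \<exists>\<f>. \<f> \<in> reduced_formulas L T (arity L r * k) \<and>
  (\<forall>xss. length xss = arity L r --> set xss \<subseteq> D --> (sat M (concat xss) \<f> <-> map \<pi> xss \<in> interp_rel M r))"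
 proof
  fix r assume r: "r \<in> symbols L"
  have "\<pi> xs \<in> U" if "xs \<in> D" for xs using \<pi> that by blast
  from rel_formula[OF D this \<F> r]
  show "\<exists>\<f>. \<f> \<in> reduced_formulas L T (arity L r * k) \<and>
   (\<forall>xss. length xss = arity L r --> set xss \<subseteq> D --> (sat M (concat xss) \<f> <-> map \<pi> xss \<in> interp_rel M r))"
   by metis
 qed
 from bchoice[OF this] obtain \<f>R where \<f>R: "\<forall>r\<in>symbols L. \<f>R r \<in> reduced_formulas L T (arity L r * k) \<and>
  (\<forall>xss. length xss = arity L r --> set xss \<subseteq> D --> (sat M (concat xss) (\<f>R r) <-> map \<pi> xss \<in> interp_rel M r))"
  by blast
 define \<a> where "\<a> = \<lparr>idim = k, dom_fm = \<f>D, eq_fm = \<f>E, sym_fm = restrict \<f>R (symbols L)\<rparr>"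
 have dom: "dom_set \<a> M = D" using \<f>D(2) D(1) by (auto simp: dom_set_def \<a>_def)
 have "red_interp \<a>" using k \<f>D(1) \<f>E(1) \<f>R by (simp add: red_interp_def \<a>_def)
 moreover have c: "coord L M \<a> M \<pi>"
  unfolding coord_def dom
 proof (intro conjI allI ballI impI)
  fix xs ys
  show "(xs, ys) \<in> eq_rel \<a> M <-> xs \<in> D \<and> ys \<in> D \<and> \<pi> xs = \<pi> ys"
  proof (cases "xs \<in> tuples M k \<and> ys \<in> tuples M k")
   case True
   then have "xs @ ys \<in> tuples M (2 * k)" by (auto simp: tuples_def)
   then have "(xs, ys) \<in> eq_rel \<a> M <-> xs @ ys \<in> S" using True \<f>E(2) by (simp add: eq_rel_def \<a>_def)
   also have "\<dots> <-> xs \<in> D \<and> ys \<in> D \<and> \<pi> xs = \<pi> ys"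
   proof
    assume "xs @ ys \<in> S"
    then obtain xs' ys' where *: "xs @ ys = xs' @ ys'" "xs' \<in> D" "ys' \<in> D" "\<pi> xs' = \<pi> ys'" by (auto simp: S_def)
    have "length xs = length xs'" using True *(2) D(1) by (auto simp: tuples_def)
    then show "xs \<in> D \<and> ys \<in> D \<and> \<pi> xs = \<pi> ys" using * by simp
   qed (auto simp: S_def)
   finally show ?thesis .
  next
   case False
   then show ?thesis using D(1) by (auto simp: eq_rel_def \<a>_def)
  qed
 next
  fix r xss assume "r \<in> symbols L" "length xss = arity L r" "set xss \<subseteq> D"
  then show "sat M (concat xss) (sym_fm \<a> r) <-> map \<pi> xss \<in> interp_rel M r" using \<f>R by (simp add: \<a>_def)
 qed (rule \<pi>)
 ultimately have "\<a> \<in> Itp" using interp_iff by blast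
 moreover have "acts \<a> \<pi> \<F>" using \<F> by (simp add: acts_def dom)
 ultimately show thesis using that c by blast
qed

section \<open>Permutations preserving finitely many symbols, and nearby interpretations\<close>

definition preserves :: "nat => ('a => 'a) => bool" where
 "preserves n s <-> (\<forall>r\<in>symbols L. sym_index L r < n -->
   (\<forall>zs\<in>tuples M (arity L r). map s zs \<in> interp_rel M r <-> zs \<in> interp_rel M r))"

definition basic_nbhd :: "('r, 'r) interp => nat => ('r, 'r) interp set" where
 "basic_nbhd \<a> n = {\<b> \<in> Itp. idim \<b> = idim \<a> \<and> dom_fm \<b> = dom_fm \<a> \<and> eq_fm \<b> = eq_fm \<a> \<and>
     (\<forall>r\<in>symbols L. sym_index L r < n --> sym_fm \<b> r = sym_fm \<a> r)}"

lemma basic_nbhd_dom: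
 assumes "\<b> \<in> basic_nbhd \<a> n"
 shows "dom_set \<b> N = dom_set \<a> N" "eq_rel \<b> N = eq_rel \<a> N"
 using assms by (auto simp: basic_nbhd_def dom_set_def eq_rel_def)

text \<open>Composing the coordinates with the bijection \<open>s\<close> changes neither the domain
  nor the kernel. For the first \<open>n\<close> symbols the old formulas stay correct since
  \<open>s\<close> preserves these relations; for the others the preimages are invariant because the
  new coordinates are equivariant for \<open>\<H>\<close>.\<close>

lemma realize_nearby:
 assumes \<a>: "\<a> \<in> Itp" "coord L M \<a> M \<pi>" "acts \<a> \<pi> \<F>"
  and s: "bij_betw s U U" "preserves n s"
  and \<H>: "!!g. g \<in> \<G> ==> \<H> g \<in> \<G>"
  "!!g x. g \<in> \<G> ==> x \<in> U ==> \<H> g (s x) = s (\<F> g x)"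
 obtains \<b> where "\<b> \<in> basic_nbhd \<a> n" "coord L M \<b> M (s \<circ> \<pi>)" "acts \<b> (s \<circ> \<pi>) \<H>"
proof -
 let ?D = "dom_set \<a> M" and ?k = "idim \<a>"
 have red: "red_interp \<a>" using \<a>(1) by (rule interp_red)
 have D: "?D \<subseteq> tuples M ?k" "!!g xs. g \<in> \<G> ==> xs \<in> ?D ==> map g xs \<in> ?D"
  using dom_set_tuples dom_set_invariant interp_wf[OF \<a>(1)] by blast+
 have \<pi>U: "!!xs. xs \<in> ?D ==> \<pi> xs \<in> U" using coord_dom[OF \<a>(2)] by blast
 then have s\<pi>: "!!xs. xs \<in> ?D ==> (s \<circ> \<pi>) xs \<in> U" using bij_betwE[OF s(1)] by simp
 have equiv: "(s \<circ> \<pi>) (map g xs) = \<H> g ((s \<circ> \<pi>) xs)" if "g \<in> \<G>" "xs \<in> ?D" for g xs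
  using that \<a>(3) \<H>(2)[OF that(1) \<pi>U[OF that(2)]] by (simp add: acts_def)
 have "\<forall>r\<in>symbols L. \<exists>\<f>. \<f> \<in> reduced_formulas L T (arity L r * ?k) \<and>
  (sym_index L r < n --> \<f> = sym_fm \<a> r) \<and>
  (\<forall>xss. length xss = arity L r --> set xss \<subseteq> ?D --> (sat M (concat xss) \<f> <-> map (s \<circ> \<pi>) xss \<in> interp_rel M r))"
 proof
  fix r assume r: "r \<in> symbols L"
  show "\<exists>\<f>. \<f> \<in> reduced_formulas L T (arity L r * ?k) \<and>
  (sym_index L r < n --> \<f> = sym_fm \<a> r) \<and>
  (\<forall>xss. length xss = arity L r --> set xss \<subseteq> ?D --> (sat M (concat xss) \<f> <-> map (s \<circ> \<pi>) xss \<in> interp_rel M r))"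
  proof (cases "sym_index L r < n")
   case True
   have "sat M (concat xss) (sym_fm \<a> r) <-> map (s \<circ> \<pi>) xss \<in> interp_rel M r"
    if xss: "length xss = arity L r" "set xss \<subseteq> ?D" for xss
   proof -
    have "map \<pi> xss \<in> tuples M (arity L r)" using xss \<pi>U by (auto simp: tuples_def)
    then have "map s (map \<pi> xss) \<in> interp_rel M r <-> map \<pi> xss \<in> interp_rel M r"
     using s(2) r True unfolding preserves_def by blast
    then show ?thesis using coord_rel[OF \<a>(2) r xss] by simp
   qed
   moreover have "sym_fm \<a> r \<in> reduced_formulas L T (arity L r * ?k)"
    using red r by (auto simp: red_interp_def dest: PiE_mem)
   ultimately show ?thesis by (intro exI[of _ "sym_fm \<a> r"]) simp
  next
   case False
   then show ?thesis using rel_formula[OF D s\<pi> \<H>(1) equiv r] by metis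
  qed
 qed
 from bchoice[OF this] obtain \<f>R where \<f>R: "\<forall>r\<in>symbols L. \<f>R r \<in> reduced_formulas L T (arity L r * ?k) \<and>
  (sym_index L r < n --> \<f>R r = sym_fm \<a> r) \<and>
  (\<forall>xss. length xss = arity L r --> set xss \<subseteq> ?D --> (sat M (concat xss) (\<f>R r) <-> map (s \<circ> \<pi>) xss \<in> interp_rel M r))"
  by blast
 define \<b> where "\<b> = \<a>\<lparr>sym_fm := restrict \<f>R (symbols L)\<rparr>"
 have dom: "dom_set \<b> M = ?D" and eq: "eq_rel \<b> M = eq_rel \<a> M"
  by (auto simp: dom_set_def eq_rel_def \<b>_def)
 have c: "coord L M \<b> M (s \<circ> \<pi>)"
  unfolding coord_def dom eq
 proof (intro conjI allI ballI impI)
  have "\<pi> ` ?D = U" using \<a>(2) by (simp add: coord_def)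
  then show "(s \<circ> \<pi>) ` ?D = U" using s(1) by (simp add: bij_betw_def flip: image_image)
  fix xs ys
  show "(xs, ys) \<in> eq_rel \<a> M <-> xs \<in> ?D \<and> ys \<in> ?D \<and> (s \<circ> \<pi>) xs = (s \<circ> \<pi>) ys"
   using coord_eq[OF \<a>(2), of xs ys] \<pi>U s(1) by (auto simp: bij_betw_def inj_on_def)
 next
  fix r xss assume "r \<in> symbols L" "length xss = arity L r" "set xss \<subseteq> ?D"
  then show "sat M (concat xss) (sym_fm \<b> r) <-> map (s \<circ> \<pi>) xss \<in> interp_rel M r" using \<f>R by (simp add: \<b>_def)
 qed
 moreover have "red_interp \<b>" using red \<f>R by (simp add: red_interp_def \<b>_def)
 ultimately have "\<b> \<in> Itp" using interp_iff by blast
 then have "\<b> \<in> basic_nbhd \<a> n" using \<f>R by (simp add: basic_nbhd_def \<b>_def)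
 moreover have "acts \<b> (s \<circ> \<pi>) \<H>" using \<H>(1) equiv unfolding acts_def dom by blast
 ultimately show thesis using that c by blast
qed

lemma id_interp:
 obtains \<pi> where "id_interp L T \<in> Itp" "coord L M (id_interp L T) M \<pi>" "acts (id_interp L T) \<pi> (\<lambda>g. g)"
proof -
 let ?i = "id_interp L T"
 have w: "wff L 1 (Eq 0 0)" "wff L 2 (Eq 0 1)" "!!r. r \<in> symbols L ==> wff L (arity L r) (Rel r [0..<arity L r])"
  by auto
 have red: "red_interp ?i"
  using reduced_least_fm[OF w(1)] reduced_least_fm[OF w(2)] reduced_least_fm[OF w(3)]
  by (auto simp: red_interp_def id_interp_def)
 have dom: "dom_set ?i M = tuples M (Suc 0)"
  using sat_least_fm[OF w(1)] by (auto simp: dom_set_def id_interp_def)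
 have t1: "xs \<in> tuples M (Suc 0) <-> (\<exists>x\<in>U. xs = [x])" for xs
  by (auto simp: tuples_def length_Suc_conv)
 define \<pi> where "\<pi> = (\<lambda>xs. xs ! 0 :: 'a)"
 have c: "coord L M ?i M \<pi>"
  unfolding coord_def dom
 proof (intro conjI allI ballI impI)
  have "tuples M (Suc 0) = (\<lambda>x. [x]) ` U" by (auto simp: t1)
  then show "\<pi> ` tuples M (Suc 0) = U" by (simp add: image_image \<pi>_def)
  fix xs ys
  have "sat M (xs @ ys) (least_fm L T 2 (Eq 0 1)) <-> \<pi> xs = \<pi> ys" if "xs \<in> tuples M (Suc 0)" "ys \<in> tuples M (Suc 0)"
  proof -
   have "xs @ ys \<in> tuples M 2" using that by (auto simp: t1) (auto simp: tuples_def)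
   then show ?thesis using sat_least_fm[OF w(2)] that by (auto simp: t1 \<pi>_def)
  qed
  then show "(xs, ys) \<in> eq_rel ?i M <-> xs \<in> tuples M (Suc 0) \<and> ys \<in> tuples M (Suc 0) \<and> \<pi> xs = \<pi> ys"
   by (auto simp: eq_rel_def id_interp_def)
 next
  fix r xss assume r: "r \<in> symbols L" "length xss = arity L r" "set xss \<subseteq> tuples M (Suc 0)"
  have eq: "concat xss = map \<pi> xss"
   using r(3) by (induction xss) (auto simp: t1 \<pi>_def)
  have t: "map \<pi> xss \<in> tuples M (arity L r)" using r(2,3) by (auto simp: tuples_def t1 \<pi>_def subset_iff)
  then have "map ((!) (map \<pi> xss)) [0..<arity L r] = map \<pi> xss"
   using map_nth[of "map \<pi> xss"] r(2) by simp
  then show "sat M (concat xss) (sym_fm ?i r) <-> map \<pi> xss \<in> interp_rel M r"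
   unfolding eq using sat_least_fm[OF w(3)[OF r(1)] t] r(1) by (simp add: id_interp_def del: map_map)
 qed
 moreover have "acts ?i \<pi> (\<lambda>g. g)" unfolding acts_def dom by (auto simp: t1 \<pi>_def)
 ultimately show thesis using that red interp_iff by blast
qed

end

lemma satf_in_dom:
 "satf N s (in_dom \<a> n \<f>) <->
  (\<forall>i<n. satf N (s \<circ> block (idim \<a>) [i]) (dom_fm \<a>)) \<and> satf N s \<f>"
proof -
 have "satf N s (foldr (\<lambda>i. Conj (rename (block (idim \<a>) [i]) (dom_fm \<a>))) is \<f>) <->
   (\<forall>i\<in>set is. satf N s (rename (block (idim \<a>) [i]) (dom_fm \<a>))) \<and> satf N s \<f>" for "is"
  by (induction "is") auto
 from this[of "[0..<n]"] show ?thesis unfolding in_dom_def satf_rename by auto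
qed

lemma wff_in_dom:
 assumes "wf_interp L L' \<a>" "wff L (n * idim \<a>) \<f>" shows "wff L (n * idim \<a>) (in_dom \<a> n \<f>)"
proof -
 have d: "wff L (idim \<a>) (dom_fm \<a>)" "idim \<a> \<ge> 1" using assms(1) by (auto simp: wf_interp_def)
 have "wff L (n * idim \<a>) (rename (block (idim \<a>) [i]) (dom_fm \<a>))" if "i < n" for i
  using that block_less[OF d(2), of "[i]" n] by (intro wff_rename[OF d(1)]) auto
 then have f: "wff L (n * idim \<a>) (foldr (\<lambda>i. Conj (rename (block (idim \<a>) [i]) (dom_fm \<a>))) is \<f>)"
  if "set is \<subseteq> {..<n}" for "is"
  using that assms(2) by (induction "is") auto
 show ?thesis unfolding in_dom_def by (rule f) auto
qed

lemma sat_in_dom: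
 assumes \<a>: "wf_interp L L' \<a>" and N: "universe N \<noteq> {}" and \<f>: "wff L (n * idim \<a>) \<f>"
  and xss: "length xss = n" "set xss \<subseteq> tuples N (idim \<a>)"
 shows "sat N (concat xss) (in_dom \<a> n \<f>) <-> set xss \<subseteq> dom_set \<a> N \<and> sat N (concat xss) \<f>"
proof -
 let ?k = "idim \<a>"
 have k: "?k \<ge> 1" and d: "wff L ?k (dom_fm \<a>)" using \<a> by (auto simp: wf_interp_def)
 have len: "!!xs. xs \<in> set xss ==> length xs = ?k" using xss(2) by (auto simp: tuples_def)
 have "concat xss \<in> tuples N (n * ?k)" using xss by (intro concat_tuples) auto
 then obtain s where s: "s \<in> asgs N" "concat xss = map s [0..<n * ?k]" using tuple_asg N by blast
 have xss_eq: "map (blk ?k s) [0..<n] = xss"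
  using s(2) concat_blk[OF k, of s n] len xss(1) by (intro concat_uniform_inj[where k = ?k]) auto
 have "sat N (concat xss) (in_dom \<a> n \<f>) <-> satf N s (in_dom \<a> n \<f>)"
  unfolding s(2) by (rule sat_map_upt[OF wff_in_dom[OF \<a> \<f>]])
 also have "\<dots> <-> (\<forall>i<n. blk ?k s i \<in> dom_set \<a> N) \<and> satf N s \<f>"
  unfolding satf_in_dom using satf_dom_fm[OF d blk_asgs[OF s(1)] k] by simp
 also have "(\<forall>i<n. blk ?k s i \<in> dom_set \<a> N) <-> set xss \<subseteq> dom_set \<a> N"
  unfolding xss_eq[symmetric] by auto
 also have "satf N s \<f> <-> sat N (concat xss) \<f>" unfolding s(2) by (rule sat_map_upt[OF \<f>, symmetric])
 finally show ?thesis .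
qed

lemma concat_map_concat: "concat (map concat xsss) = concat (concat xsss)"
 by (induction xsss) simp_all

context omega_cat
begin

section \<open>Composition of interpretations\<close>

text \<open>To evaluate the coordinates of the composite, a tuple is cut into blocks,
  \<open>\<pi>\<close> is applied to each of them and \<open>\<v>\<close> to the resulting tuple. A
  permutation \<open>g\<close> thus acts through \<open>\<F>\<close> on the inner level and then
  through \<open>\<H>\<close>, which reverses the order of composition.\<close>

lemma comp_interp_coord:
 assumes \<a>: "\<a> \<in> Itp" "coord L M \<a> M \<pi>" "acts \<a> \<pi> \<F>" and \<b>: "\<b> \<in> Itp" "coord L M \<b> M \<v>" "acts \<b> \<v> \<H>"
 obtains \<k> where "comp_interp L T L \<a> \<b> \<in> Itp" "coord L M (comp_interp L T L \<a> \<b>) M \<k>"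
  "acts (comp_interp L T L \<a> \<b>) \<k> (\<lambda>g. \<H> (\<F> g))"
proof -
 define \<c> where "\<c> = comp_interp L T L \<a> \<b>"
 define a b where "a = idim \<a>" and "b = idim \<b>"
 define \<k> where "\<k> zs = \<v> (map \<pi> (chunks a b zs))" for zs
 have wa: "wf_interp L L \<a>" and wb: "wf_interp L L \<b>" using \<a>(1) \<b>(1) interp_wf by auto
 have a1: "a \<ge> 1" and b1: "b \<ge> 1" using wa wb by (auto simp: wf_interp_def a_def b_def)
 have fb: "wff L b (dom_fm \<b>)" "wff L (2 * b) (eq_fm \<b>)" "!!r. r \<in> symbols L ==> wff L (arity L r * b) (sym_fm \<b> r)"
  using wb by (auto simp: wf_interp_def b_def)
 have w1: "wff L (b * a) (in_dom \<a> b (translate \<a> (dom_fm \<b>)))"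
  using wff_in_dom[OF wa] wff_translate[OF wa fb(1)] unfolding a_def by blast
 have w2: "wff L ((2 * b) * a) (in_dom \<a> (2 * b) (translate \<a> (eq_fm \<b>)))"
  using wff_in_dom[OF wa] wff_translate[OF wa fb(2)] unfolding a_def by blast
 have w3: "wff L ((arity L r * b) * a) (translate \<a> (sym_fm \<b> r))" if "r \<in> symbols L" for r
  using wff_translate[OF wa fb(3)[OF that]] unfolding a_def .
 \<comment> \<open>The products are written with \<open>b\<close> first, because a tuple of the
   composite consists of \<open>b\<close> blocks of length \<open>a\<close>.\<close>
 have \<c>: "idim \<c> = b * a" "dom_fm \<c> = least_fm L T (b * a) (in_dom \<a> b (translate \<a> (dom_fm \<b>)))"
  "eq_fm \<c> = least_fm L T ((2 * b) * a) (in_dom \<a> (2 * b) (translate \<a> (eq_fm \<b>)))"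
  "sym_fm \<c> = (\<lambda>r\<in>symbols L. least_fm L T ((arity L r * b) * a) (translate \<a> (sym_fm \<b> r)))"
  unfolding \<c>_def comp_interp_def Let_def a_def b_def
  by (simp_all add: mult.commute[of "idim \<a>"] mult.assoc)
 have red: "red_interp \<c>"
  unfolding red_interp_def \<c>
  using a1 b1 reduced_least_fm[OF w1] reduced_least_fm[OF w2] reduced_least_fm[OF w3]
  by (auto simp: mult.assoc)
 have \<pi>t: "map \<pi> xss \<in> tuples M (length xss)" if "set xss \<subseteq> dom_set \<a> M" for xss
  using that coord_dom[OF \<a>(2)] by (auto simp: tuples_def)
 have dom: "concat xss \<in> dom_set \<c> M <-> set xss \<subseteq> dom_set \<a> M \<and> map \<pi> xss \<in> dom_set \<b> M"
  if xss: "length xss = b" "set xss \<subseteq> tuples M a" for xss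
 proof -
  have t: "concat xss \<in> tuples M (b * a)" using xss(2,1) by (rule concat_tuples)
  have "concat xss \<in> dom_set \<c> M <-> sat M (concat xss) (in_dom \<a> b (translate \<a> (dom_fm \<b>)))"
   using t sat_least_fm[OF w1 t] by (simp add: dom_set_def \<c>)
  also have "\<dots> <-> set xss \<subseteq> dom_set \<a> M \<and> sat M (concat xss) (translate \<a> (dom_fm \<b>))"
   using xss by (intro sat_in_dom[OF wa ne wff_translate[OF wa fb(1)]]) (auto simp: a_def)
  also have "\<dots> <-> set xss \<subseteq> dom_set \<a> M \<and> sat M (map \<pi> xss) (dom_fm \<b>)"
   using sat_translate[OF wa \<a>(2) ne fb(1) xss(1)] by blast
  also have "\<dots> <-> set xss \<subseteq> dom_set \<a> M \<and> map \<pi> xss \<in> dom_set \<b> M"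
   using \<pi>t[of xss] xss(1) by (auto simp: dom_set_def b_def)
  finally show ?thesis .
 qed
 have split: "\<exists>xss. zs = concat xss \<and> length xss = b \<and> set xss \<subseteq> tuples M a" if "zs \<in> tuples M (b * a)" for zs
  using tuples_chunks[OF a1 that] by metis
 have \<k>: "\<k> (concat xss) = \<v> (map \<pi> xss)" "chunks a b (concat xss) = xss"
  if "length xss = b" "set xss \<subseteq> tuples M a" for xss
 proof -
  show "chunks a b (concat xss) = xss" using that by (intro chunks_concat[OF a1]) (auto simp: tuples_def)
  then show "\<k> (concat xss) = \<v> (map \<pi> xss)" by (simp add: \<k>_def)
 qed
 have D: "\<exists>xss. zs = concat xss \<and> length xss = b \<and> set xss \<subseteq> tuples M a \<and> set xss \<subseteq> dom_set \<a> M \<and> map \<pi> xss \<in> dom_set \<b> M"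
  if "zs \<in> dom_set \<c> M" for zs
 proof -
  have "zs \<in> tuples M (b * a)" using that by (simp add: dom_set_def \<c>)
  then obtain xss where "zs = concat xss" "length xss = b" "set xss \<subseteq> tuples M a" using split by blast
  then show ?thesis using dom that by blast
 qed
 have \<a>t: "dom_set \<a> M \<subseteq> tuples M a" unfolding a_def by (rule dom_set_tuples)
 have \<b>len: "length ys = b" "set ys \<subseteq> U" if "ys \<in> dom_set \<b> M" for ys
  using that by (auto simp: dom_set_def tuples_def b_def)
 have c: "coord L M \<c> M \<k>"
  unfolding coord_def
 proof (intro conjI allI ballI impI)
  show "\<k> ` dom_set \<c> M = U"
  proof (intro equalityI subsetI)
   fix y assume "y \<in> \<k> ` dom_set \<c> M"
   then obtain zs where zs: "zs \<in> dom_set \<c> M" "y = \<k> zs" by blast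
   obtain xss where xss: "zs = concat xss" "length xss = b" "set xss \<subseteq> tuples M a" "map \<pi> xss \<in> dom_set \<b> M"
    using D[OF zs(1)] by blast
   then show "y \<in> U" using \<k>(1)[OF xss(2,3)] zs(2) coord_dom[OF \<b>(2) xss(4)] by simp
  next
   fix y assume "y \<in> U"
   then obtain ys where ys: "ys \<in> dom_set \<b> M" "\<v> ys = y" using coord_onto[OF \<b>(2)] by blast
   obtain xss where xss: "length xss = length ys" "set xss \<subseteq> dom_set \<a> M" "map \<pi> xss = ys"
    using coord_onto_list[OF \<a>(2) \<b>len(2)[OF ys(1)]] .
   have "length xss = b" "set xss \<subseteq> tuples M a" using xss(1,2) \<b>len(1)[OF ys(1)] \<a>t by auto
   then have "concat xss \<in> dom_set \<c> M" "\<k> (concat xss) = y" using dom \<k>(1) xss ys by auto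
   then show "y \<in> \<k> ` dom_set \<c> M" by blast
  qed
  fix zs ws
  show "(zs, ws) \<in> eq_rel \<c> M <-> zs \<in> dom_set \<c> M \<and> ws \<in> dom_set \<c> M \<and> \<k> zs = \<k> ws"
  proof (cases "zs \<in> tuples M (b * a) \<and> ws \<in> tuples M (b * a)")
   case True
   obtain xss where xss: "zs = concat xss" "length xss = b" "set xss \<subseteq> tuples M a" using split True by blast
   obtain yss where yss: "ws = concat yss" "length yss = b" "set yss \<subseteq> tuples M a" using split True by blast
   have xy: "length (xss @ yss) = 2 * b" "set (xss @ yss) \<subseteq> tuples M a" using xss yss by auto
   have t: "concat (xss @ yss) \<in> tuples M ((2 * b) * a)" using xy(2,1) by (rule concat_tuples)
   have "(zs, ws) \<in> eq_rel \<c> M <-> sat M (concat (xss @ yss)) (in_dom \<a> (2 * b) (translate \<a> (eq_fm \<b>)))"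
    using True sat_least_fm[OF w2 t] by (simp add: eq_rel_def \<c> xss yss)
   also have "\<dots> <-> set (xss @ yss) \<subseteq> dom_set \<a> M \<and> sat M (concat (xss @ yss)) (translate \<a> (eq_fm \<b>))"
    using xy by (intro sat_in_dom[OF wa ne wff_translate[OF wa fb(2)]]) (auto simp: a_def)
   also have "\<dots> <-> set (xss @ yss) \<subseteq> dom_set \<a> M \<and> sat M (map \<pi> (xss @ yss)) (eq_fm \<b>)"
    using sat_translate[OF wa \<a>(2) ne fb(2) xy(1)] by blast
   also have "\<dots> <-> set (xss @ yss) \<subseteq> dom_set \<a> M \<and> (map \<pi> xss, map \<pi> yss) \<in> eq_rel \<b> M"
    using \<pi>t[of xss] \<pi>t[of yss] xss(2) yss(2) by (auto simp: eq_rel_def b_def)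
   also have "\<dots> <-> zs \<in> dom_set \<c> M \<and> ws \<in> dom_set \<c> M \<and> \<k> zs = \<k> ws"
    unfolding coord_eq[OF \<b>(2)] xss(1) yss(1) dom[OF xss(2,3)] dom[OF yss(2,3)] \<k>(1)[OF xss(2,3)] \<k>(1)[OF yss(2,3)]
    by auto
   finally show ?thesis .
  next
   case False
   then show ?thesis by (auto simp: eq_rel_def dom_set_def \<c>)
  qed
 next
  fix r zss assume r: "r \<in> symbols L" "length zss = arity L r" "set zss \<subseteq> dom_set \<c> M"
  define xsss where "xsss = map (chunks a b) zss"
  have x: "zs = concat (chunks a b zs) \<and> set (chunks a b zs) \<subseteq> dom_set \<a> M \<and> map \<pi> (chunks a b zs) \<in> dom_set \<b> M"
   if zs: "zs \<in> set zss" for zs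
  proof -
   have "zs \<in> dom_set \<c> M" using zs r(3) by blast
   then obtain xss where "zs = concat xss" "length xss = b" "set xss \<subseteq> tuples M a"
    "set xss \<subseteq> dom_set \<a> M" "map \<pi> xss \<in> dom_set \<b> M" using D by blast
   then show ?thesis using \<k>(2) by auto
  qed
  have zss: "concat zss = concat (concat xsss)"
  proof -
   have "map concat xsss = zss" unfolding xsss_def using x by (auto intro!: map_idI)
   then show ?thesis using concat_map_concat by metis
  qed
  have len: "length (concat xsss) = arity L r * b"
  proof -
   have "length xs = b" if "xs \<in> set xsss" for xs using that by (auto simp: xsss_def)
   moreover have "length xsss = arity L r" using r(2) by (simp add: xsss_def)
   ultimately show ?thesis using length_concat_uniform[of xsss b] by simp
  qed
  have sub: "set (concat xsss) \<subseteq> dom_set \<a> M" using x by (auto simp: xsss_def)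
  have t: "concat (concat xsss) \<in> tuples M ((arity L r * b) * a)"
   using sub \<a>t len by (intro concat_tuples) auto
  have "sat M (concat zss) (sym_fm \<c> r) <-> sat M (concat (concat xsss)) (translate \<a> (sym_fm \<b> r))"
   unfolding zss using sat_least_fm[OF w3[OF r(1)] t] r(1) by (simp add: \<c>)
  also have "\<dots> <-> sat M (map \<pi> (concat xsss)) (sym_fm \<b> r)"
   by (rule sat_translate[OF wa \<a>(2) ne fb(3)[OF r(1)] len sub])
  also have "map \<pi> (concat xsss) = concat (map (map \<pi>) xsss)" by (rule map_concat)
  also have "sat M (concat (map (map \<pi>) xsss)) (sym_fm \<b> r) <-> map \<v> (map (map \<pi>) xsss) \<in> interp_rel M r"
   using r x by (intro coord_rel[OF \<b>(2)]) (auto simp: xsss_def)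
  also have "map \<v> (map (map \<pi>) xsss) = map \<k> zss" by (simp add: xsss_def \<k>_def)
  finally show "sat M (concat zss) (sym_fm \<c> r) <-> map \<k> zss \<in> interp_rel M r" .
 qed
 have "acts \<c> \<k> (\<lambda>g. \<H> (\<F> g))"
  unfolding acts_def
 proof (intro ballI conjI)
  fix g assume g: "g \<in> \<G>"
  have \<F>g: "\<F> g \<in> \<G>" using \<a>(3) g by (simp add: acts_def)
  then show "\<H> (\<F> g) \<in> \<G>" using \<b>(3) by (simp add: acts_def)
  fix zs assume "zs \<in> dom_set \<c> M"
  then obtain xss where xss: "zs = concat xss" "length xss = b" "set xss \<subseteq> tuples M a"
   "set xss \<subseteq> dom_set \<a> M" "map \<pi> xss \<in> dom_set \<b> M" using D by blast
  have "map g zs = concat (map (map g) xss)" unfolding xss(1) by (rule map_concat)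
  moreover have "set (map (map g) xss) \<subseteq> tuples M a" using xss(3) map_G_tuples[OF g] by auto
  ultimately have "\<k> (map g zs) = \<v> (map \<pi> (map (map g) xss))" using \<k>(1)[of "map (map g) xss"] xss(2) by simp
  also have "map \<pi> (map (map g) xss) = map (\<F> g) (map \<pi> xss)"
   using xss(4) \<a>(3) g by (auto simp: acts_def)
  also have "\<v> (map (\<F> g) (map \<pi> xss)) = \<H> (\<F> g) (\<v> (map \<pi> xss))"
   using \<b>(3) \<F>g xss(5) by (simp add: acts_def del: map_map)
  finally show "\<k> (map g zs) = \<H> (\<F> g) (\<k> zs)" using \<k>(1)[OF xss(2,3)] xss(1) by simp
 qed
 moreover have "\<c> \<in> Itp" using red c interp_iff by blast
 ultimately show thesis using that c unfolding \<c>_def by blast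
qed

section \<open>Interpretations from automorphisms\<close>

definition orb :: "'a => 'a set" where
 "orb x = (\<lambda>g. g x) ` \<G>"

lemma orb_self: "x \<in> U ==> x \<in> orb x"
 unfolding orb_def using G_one[of x] G.one_closed by (metis imageI)

lemma orb_eq:
 assumes x: "x \<in> U" and y: "y \<in> orb x" shows "orb y = orb x"
proof -
 obtain g where g: "g \<in> \<G>" "y = g x" using y by (auto simp: orb_def)
 show ?thesis
 proof (intro equalityI subsetI)
  fix z assume "z \<in> orb y"
  then obtain h where h: "h \<in> \<G>" "z = h y" by (auto simp: orb_def)
  then have "z = (h \<cdot> g) x" using g x by (simp add: G_mult_apply)
  then show "z \<in> orb x" unfolding orb_def using g h by blast
 next
  fix z assume "z \<in> orb x"
  then obtain h where h: "h \<in> \<G>" "z = h x" by (auto simp: orb_def)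
  have "(\<iota> g) y = x" using g x G_inv_apply by simp
  then have "z = (h \<cdot> \<iota> g) y" using g h x G_mult_apply[of h "\<iota> g" y] G_closed[OF g(1) x] by simp
  then show "z \<in> orb y" unfolding orb_def using g h by blast
 qed
qed

text \<open>The finitely many representatives of 1-tuples may repeat orbits; passing to the finite
  set of orbits makes the representative, and so its index, unique.\<close>

lemma orbit_transversal:
 obtains ys where "ys \<noteq> []" "set ys \<subseteq> U" "!!x. x \<in> U ==> \<exists>i<length ys. \<exists>g\<in>\<G>. x = g (ys ! i)"
  "!!i j g. i < length ys ==> j < length ys ==> g \<in> \<G> ==> g (ys ! i) = ys ! j ==> i = j"
proof -
 obtain R where R: "finite R" "R \<subseteq> tuples M 1"
  "!!xs. xs \<in> tuples M 1 ==> \<exists>r\<in>R. \<exists>g\<in>\<G>. xs = map g r"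
  by (rule finite_orbit_reps[of 1]) (rule that)
 have "orb ` U \<subseteq> (\<lambda>r. orb (hd r)) ` R"
 proof
  fix O' assume "O' \<in> orb ` U"
  then obtain x where x: "x \<in> U" "O' = orb x" by blast
  then have "[x] \<in> tuples M 1" by (simp add: tuples_def)
  from R(3)[OF this] obtain r g where r: "r \<in> R" "g \<in> \<G>" "[x] = map g r" by (elim bexE) (rule that)
  then obtain y where y: "r = [y]" "x = g y" by (cases r) auto
  have "y \<in> U" using r(1) R(2) y(1) by (auto simp: tuples_def)
  moreover have "x \<in> orb y" using y(2) r(2) by (auto simp: orb_def)
  ultimately have "orb x = orb y" by (rule orb_eq)
  then show "O' \<in> (\<lambda>r. orb (hd r)) ` R" using x(2) r(1) y(1) by force
 qed
 then have "finite (orb ` U)" using R(1) by (meson finite_imageI finite_subset)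
 then obtain Os where Os: "set Os = orb ` U" "distinct Os" using finite_distinct_list by blast
 define f where "f O' = (SOME x. x \<in> U \<and> orb x = O')" for O'
 have f: "f O' \<in> U \<and> orb (f O') = O'" if "O' \<in> orb ` U" for O'
  unfolding f_def by (rule someI_ex) (use that in blast)
 have fi: "f (Os ! i) \<in> U" "orb (f (Os ! i)) = Os ! i" if "i < length Os" for i
  using f[of "Os ! i"] nth_mem[OF that] Os(1) by auto
 show thesis
 proof (rule that[of "map f Os"])
  show "map f Os \<noteq> []" using Os(1) ne by auto
  show "set (map f Os) \<subseteq> U" using Os(1) f by auto
  fix x assume x: "x \<in> U"
  then obtain i where i: "i < length Os" "Os ! i = orb x" using Os(1) by (metis imageI in_set_conv_nth)
  then have "x \<in> orb (f (Os ! i))" using fi(2)[OF i(1)] orb_self[OF x] by simp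
  then show "\<exists>i<length (map f Os). \<exists>g\<in>\<G>. x = g (map f Os ! i)" using i(1) by (intro exI[of _ i]) (auto simp: orb_def)
 next
  fix i j g assume ij: "i < length (map f Os)" "j < length (map f Os)" "g \<in> \<G>" "g (map f Os ! i) = map f Os ! j"
  then have "f (Os ! j) = g (f (Os ! i))" by simp
  then have mem: "f (Os ! j) \<in> orb (f (Os ! i))" unfolding orb_def using ij(3) by blast
  have l: "i < length Os" "j < length Os" using ij(1,2) by simp_all
  from orb_eq[OF fi(1)[OF l(1)] mem] have "Os ! j = Os ! i" unfolding fi(2)[OF l(1)] fi(2)[OF l(2)] .
  then show "i = j" using Os(2) ij(1,2) by (simp add: nth_eq_iff_index_eq)
 qed
qed

text \<open>The element \<open>\<F> g (y\<^sub>i)\<close> is coded by the image under \<open>g\<close> of the tuple \<open>t\<close>,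
 on which \<open>\<F> g (y\<^sub>1), \<F> g (y\<^sub>2), \<dots>\<close> depend, followed by a tuple that codes the number \<open>i\<close>
 in its equality pattern.\<close>

lemma realize_hom:
 assumes \<F>: "\<F> \<in> hom G G" "\<F> ` \<G> = \<G>" "loc_const \<F>"
 obtains \<a> \<pi> where "\<a> \<in> Itp" "coord L M \<a> M \<pi>" "acts \<a> \<pi> \<F>"
proof -
 obtain ys where ys: "ys \<noteq> []" "set ys \<subseteq> U" "!!x. x \<in> U ==> \<exists>i<length ys. \<exists>g\<in>\<G>. x = g (ys ! i)"
  "!!i j g. i < length ys ==> j < length ys ==> g \<in> \<G> ==> g (ys ! i) = ys ! j ==> i = j"
  by (rule orbit_transversal) (rule that)
 define m where "m = length ys"
 have yU: "ys ! i \<in> U" if "i < m" for i using ys(2) nth_mem that unfolding m_def by blast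
 have \<F>G: "\<F> g \<in> \<G>" if "g \<in> \<G>" for g using \<F>(1) that by (auto simp: hom_def)
 have "\<forall>x\<in>U. \<exists>F. finite F \<and> F \<subseteq> U \<and>
   (\<forall>g\<in>\<G>. \<forall>h\<in>\<G>. (\<forall>z\<in>F. g z = h z) --> \<F> g x = \<F> h x)"
  using \<F>(3) unfolding loc_const_def .
 from bchoice[OF this] obtain F where F: "\<forall>x\<in>U. finite (F x) \<and> F x \<subseteq> U \<and>
   (\<forall>g\<in>\<G>. \<forall>h\<in>\<G>. (\<forall>z\<in>F x. g z = h z) --> \<F> g x = \<F> h x)" by blast
 have "finite (\<Union>x\<in>set ys. F x)" using F ys(2) by blast
 then obtain t where t: "set t = (\<Union>x\<in>set ys. F x)" using finite_list by blast
 have tU: "set t \<subseteq> U" using t F ys(2) by blast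
 have dep: "\<F> g (ys ! i) = \<F> h (ys ! i)" if "i < m" "g \<in> \<G>" "h \<in> \<G>" "map g t = map h t" for i g h
 proof -
  have "ys ! i \<in> set ys" using that(1) by (simp add: m_def)
  then have "\<forall>z\<in>F (ys ! i). g z = h z" using that(4) t by auto
  then show ?thesis using F yU[OF that(1)] that(2,3) by blast
 qed
 \<comment> \<open>Two distinct elements are available for coding \<open>i\<close> unless
   \<open>U\<close> is a singleton; in that case there is one orbit and nothing to code.\<close>
 obtain a b where ab: "a \<in> U" "b \<in> U" "m = 1 \<or> a \<noteq> b"
 proof (cases "\<exists>a\<in>U. \<exists>b\<in>U. a \<noteq> b")
  case True
  then show thesis using that by blast
 next
  case False
  obtain a where a: "a \<in> U" using ne by blast
  have "m = 1"
  proof (rule ccontr)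
   assume "m \<noteq> 1"
   then have m: "0 < m" "1 < m" using ys(1) by (auto simp: m_def Suc_lessI)
   have "ys ! 0 = ys ! 1" using False yU[OF m(1)] yU[OF m(2)] by blast
   then have "\<one>\<^bsub>G\<^esub> (ys ! 0) = ys ! 1" using G_one yU[OF m(1)] by simp
   then show False using ys(4)[of 0 1 "\<one>\<^bsub>G\<^esub>"] m unfolding m_def by simp
  qed
  then show thesis using that a by blast
 qed
 \<comment> \<open>\<open>b\<close> stands exactly at position \<open>i\<close>. Position
   \<open>m\<close> exceeds every index, so it always carries \<open>a\<close> and serves for
   comparison.\<close>
 define c where "c i = map (\<lambda>p. if p = i then b else a) [0..<Suc m]" for i
 define d where "d i = t @ c i" for i
 have dU: "set (d i) \<subseteq> U" for i using ab tU by (auto simp: d_def c_def)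
 define k where "k = length t + Suc m"
 define D where "D = {map g (d i) | g i. g \<in> \<G> \<and> i < m}"
 have same: "i = j \<and> map g t = map h t"
  if "g \<in> \<G>" "h \<in> \<G>" "i < m" "j < m" "map g (d i) = map h (d j)" for g h i j
 proof
  have eq: "map g t = map h t" "map g (c i) = map h (c j)" using that(5) by (auto simp: d_def)
  show "map g t = map h t" by (rule eq(1))
  show "i = j"
  proof (rule ccontr)
   assume ij: "i \<noteq> j"
   then have "m \<noteq> 1" using that(3,4) by auto
   then have "a \<noteq> b" using ab(3) by blast
   have nth: "g (if p = i then b else a) = h (if p = j then b else a)" if "p < Suc m" for p
    using arg_cong[OF eq(2), of "\<lambda>xs. xs ! p"] that by (simp add: c_def del: upt_Suc)
   have "g a = h a" using nth[of m] that(3,4) by simp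
   moreover have "g b = h a" using nth[of i] that(3) ij by simp
   ultimately show False using G_inj[OF that(1) ab(1,2)] \<open>a \<noteq> b\<close> by simp
  qed
 qed
 \<comment> \<open>The choice is harmless: by \<open>same\<close> a tuple determines
   \<open>i\<close> and \<open>map g t\<close>, and by \<open>dep\<close> these determine the
   value.\<close>
 define \<pi> where "\<pi> xs = (SOME y. \<exists>g i. g \<in> \<G> \<and> i < m \<and> xs = map g (d i) \<and> y = \<F> g (ys ! i))" for xs
 have \<pi>: "\<pi> (map g (d i)) = \<F> g (ys ! i)" if "g \<in> \<G>" "i < m" for g i
 proof -
  have "\<exists>y. \<exists>h j. h \<in> \<G> \<and> j < m \<and> map g (d i) = map h (d j) \<and> y = \<F> h (ys ! j)" using that by blast
  from someI_ex[OF this] obtain h j where "h \<in> \<G>" "j < m" "map g (d i) = map h (d j)"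
   "\<pi> (map g (d i)) = \<F> h (ys ! j)" unfolding \<pi>_def by blast
  then show ?thesis using same[OF that(1)] dep that by metis
 qed
 show thesis
 proof (rule realize[of k D \<pi> \<F>])
  show "k \<ge> 1" by (simp add: k_def)
  have "d i \<in> tuples M k" for i using dU[of i] by (simp add: tuples_def d_def c_def k_def)
  then show "D \<subseteq> tuples M k" using map_G_tuples by (auto simp: D_def)
  show mD: "map g xs \<in> D" if g: "g \<in> \<G>" and xs: "xs \<in> D" for g xs
  proof -
   obtain h i where h: "h \<in> \<G>" "i < m" "xs = map h (d i)" using xs by (auto simp: D_def)
   then have "map g xs = map (g \<cdot> h) (d i)" using G_map_mult[OF g h(1) dU] by simp
   then show ?thesis unfolding D_def using g h(1,2) G.m_closed by blast
  qed
  show "\<pi> ` D = U"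
  proof (intro equalityI subsetI)
   fix y assume "y \<in> \<pi> ` D"
   then obtain g i where "g \<in> \<G>" "i < m" "y = \<F> g (ys ! i)" using \<pi> by (auto simp: D_def)
   then show "y \<in> U" using G_closed \<F>G yU by blast
  next
   fix y assume "y \<in> U"
   then obtain i h where i: "i < m" "h \<in> \<G>" "y = h (ys ! i)" using ys(3) unfolding m_def by blast
   \<comment> \<open>Surjectivity of \<open>\<F>\<close> makes the coded values exhaust the orbit of
     \<open>ys ! i\<close>.\<close>
   obtain g where g: "g \<in> \<G>" "h = \<F> g" using i(2) \<F>(2) by blast
   then have "y = \<pi> (map g (d i))" using \<pi> i by simp
   then show "y \<in> \<pi> ` D" using g i(1) by (auto simp: D_def)
  qed
  show "\<F> g \<in> \<G>" if "g \<in> \<G>" for g using \<F>G that .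
  show "\<pi> (map g xs) = \<F> g (\<pi> xs)" if g: "g \<in> \<G>" and xs: "xs \<in> D" for g xs
  proof -
   obtain h i where h: "h \<in> \<G>" "i < m" "xs = map h (d i)" using xs by (auto simp: D_def)
   have "map g xs = map (g \<cdot> h) (d i)" using G_map_mult[OF g h(1) dU] h(3) by simp
   then have "\<pi> (map g xs) = \<F> (g \<cdot> h) (ys ! i)" using \<pi> g h(1,2) by simp
   also have "\<F> (g \<cdot> h) = \<F> g \<cdot> \<F> h" using \<F>(1) g h(1) by (simp add: hom_def)
   finally show ?thesis using G_mult_apply[OF \<F>G[OF g] \<F>G[OF h(1)] yU[OF h(2)]] \<pi>[OF h(1,2)] h(3) by simp
  qed
 qed (rule that)
qed

end

section \<open>Quotients and spaces of functions\<close>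

lemma openin_quotient_topology:
 "openin (quotient_topology X q) U <-> U \<subseteq> q ` topspace X \<and> openin X {x \<in> topspace X. q x \<in> U}"
proof -
 have "istopology (\<lambda>U. U \<subseteq> q ` topspace X \<and> openin X {x \<in> topspace X. q x \<in> U})"
  unfolding istopology_def
 proof (intro conjI allI impI)
  fix S T assume "S \<subseteq> q ` topspace X \<and> openin X {x \<in> topspace X. q x \<in> S}"
   "T \<subseteq> q ` topspace X \<and> openin X {x \<in> topspace X. q x \<in> T}"
  moreover have "{x \<in> topspace X. q x \<in> S \<inter> T} = {x \<in> topspace X. q x \<in> S} \<inter> {x \<in> topspace X. q x \<in> T}"
   by auto
  ultimately show "S \<inter> T \<subseteq> q ` topspace X" "openin X {x \<in> topspace X. q x \<in> S \<inter> T}" by auto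
 next
  fix K assume K: "\<forall>S\<in>K. S \<subseteq> q ` topspace X \<and> openin X {x \<in> topspace X. q x \<in> S}"
  then show "\<Union> K \<subseteq> q ` topspace X" by blast
  have "{x \<in> topspace X. q x \<in> \<Union> K} = (\<Union>S\<in>K. {x \<in> topspace X. q x \<in> S})" by auto
  then show "openin X {x \<in> topspace X. q x \<in> \<Union> K}" using K by auto
 qed
 then show ?thesis by (simp add: quotient_topology_def)
qed

lemma topspace_quotient_topology: "topspace (quotient_topology X q) = q ` topspace X"
proof
 show "topspace (quotient_topology X q) \<subseteq> q ` topspace X"
  using openin_topspace[of "quotient_topology X q"] openin_quotient_topology by metis
 have "{x \<in> topspace X. q x \<in> q ` topspace X} = topspace X" by blast
 then have "openin (quotient_topology X q) (q ` topspace X)"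
  by (simp add: openin_quotient_topology)
 then show "q ` topspace X \<subseteq> topspace (quotient_topology X q)" by (rule openin_subset)
qed

section \<open>Spaces of functions into a discrete set\<close>

lemma openin_product_discrete:
 "openin (product_topology (\<lambda>j. discrete_topology (D j)) J) S <->
  S \<subseteq> (Pi\<^sub>E J D) \<and> (\<forall>s\<in>S. \<exists>F. finite F \<and> F \<subseteq> J \<and> {t \<in> Pi\<^sub>E J D. \<forall>j\<in>F. t j = s j} \<subseteq> S)"
proof (intro iffI conjI ballI)
 assume S: "openin (product_topology (\<lambda>j. discrete_topology (D j)) J) S"
 show "S \<subseteq> Pi\<^sub>E J D"
  using openin_subset[OF S] by auto
 fix s assume "s \<in> S"
 then obtain V where V: "finite {i \<in> J. V i \<noteq> D i}" "s \<in> Pi\<^sub>E J V" "Pi\<^sub>E J V \<subseteq> S"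
  using S unfolding openin_product_topology_alt by (auto simp: topspace_discrete_topology)
 have "{t \<in> Pi\<^sub>E J D. \<forall>j\<in>{i \<in> J. V i \<noteq> D i}. t j = s j} \<subseteq> Pi\<^sub>E J V"
 proof
  fix t assume t: "t \<in> {t \<in> Pi\<^sub>E J D. \<forall>j\<in>{i \<in> J. V i \<noteq> D i}. t j = s j}"
  have "t i \<in> V i" if "i \<in> J" for i
   using t that V(2) by (cases "V i = D i") (auto dest: PiE_mem)
  then show "t \<in> Pi\<^sub>E J V" using t by (auto simp: PiE_iff)
 qed
 then show "\<exists>F. finite F \<and> F \<subseteq> J \<and> {t \<in> Pi\<^sub>E J D. \<forall>j\<in>F. t j = s j} \<subseteq> S"
  using V by (intro exI[of _ "{i \<in> J. V i \<noteq> D i}"]) auto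
next
 assume S: "S \<subseteq> (Pi\<^sub>E J D) \<and>
  (\<forall>s\<in>S. \<exists>F. finite F \<and> F \<subseteq> J \<and> {t \<in> Pi\<^sub>E J D. \<forall>j\<in>F. t j = s j} \<subseteq> S)"
 show "openin (product_topology (\<lambda>j. discrete_topology (D j)) J) S"
  unfolding openin_product_topology_alt
 proof (intro ballI)
  fix s assume s: "s \<in> S"
  then obtain F where F: "finite F" "F \<subseteq> J" "{t \<in> Pi\<^sub>E J D. \<forall>j\<in>F. t j = s j} \<subseteq> S"
   using S by blast
  have sJ: "s \<in> Pi\<^sub>E J D" using S s by blast
  define V where "V i = (if i \<in> F then {s i} else D i)" for i
  have "Pi\<^sub>E J V \<subseteq> S"
  proof
   fix t assume t: "t \<in> Pi\<^sub>E J V"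
   have "t i \<in> D i" if "i \<in> J" for i
    using PiE_mem[OF t that] PiE_mem[OF sJ that] by (auto simp: V_def split: if_splits)
   moreover have "t i = s i" if "i \<in> F" for i
    using PiE_mem[OF t, of i] that F(2) by (auto simp: V_def)
   ultimately show "t \<in> S" using F(3) t by (auto simp: PiE_iff)
  qed
  moreover have "finite {i \<in> J. V i \<noteq> D i}" using F(1) by (rule finite_subset[rotated]) (auto simp: V_def)
  moreover have "\<forall>i\<in>J. openin (discrete_topology (D i)) (V i)" using sJ by (auto simp: V_def)
  moreover have "s \<in> Pi\<^sub>E J V" using sJ by (auto simp: V_def PiE_iff)
  ultimately show "\<exists>U. finite {i \<in> J. U i \<noteq> topspace (discrete_topology (D i))} \<and>
    (\<forall>i\<in>J. openin (discrete_topology (D i)) (U i)) \<and> s \<in> Pi\<^sub>E J U \<and> Pi\<^sub>E J U \<subseteq> S"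
   by (intro exI[of _ V]) (auto simp: topspace_discrete_topology)
 qed
qed

text \<open>Pointwise convergence of the functions \<open>e a\<close> from \<open>J\<close> to the
  discrete set \<open>D\<close>. Both \<open>\<G>\<close> and its automorphism group get their
  topologies in this form, for different encodings \<open>e\<close>.\<close>

definition ptop :: "'g set => ('g => 'j => 'd) => 'j set => 'd set => 'g topology" where
 "ptop A e J D = pullback_topology A e (product_topology (\<lambda>_. discrete_topology D) J)"

lemma openin_ptop:
 assumes e: "e \<in> A \<rightarrow> (J \<rightarrow>\<^sub>E D)"
 shows "openin (ptop A e J D) S <->
  S \<subseteq> A \<and> (\<forall>a\<in>S. \<exists>F. finite F \<and> F \<subseteq> J \<and> {b \<in> A. \<forall>j\<in>F. e b j = e a j} \<subseteq> S)"
proof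
 assume "openin (ptop A e J D) S"
 then obtain W where W: "openin (product_topology (\<lambda>_. discrete_topology D) J) W" "S = e -` W \<inter> A"
  unfolding ptop_def openin_pullback_topology by blast
 have "\<exists>F. finite F \<and> F \<subseteq> J \<and> {b \<in> A. \<forall>j\<in>F. e b j = e a j} \<subseteq> S" if "a \<in> S" for a
 proof -
  have "e a \<in> W" using that W(2) by blast
  then obtain F where F: "finite F" "F \<subseteq> J" "{t \<in> J \<rightarrow>\<^sub>E D. \<forall>j\<in>F. t j = e a j} \<subseteq> W"
   using W(1) unfolding openin_product_discrete by blast
  then have "{b \<in> A. \<forall>j\<in>F. e b j = e a j} \<subseteq> S" using W(2) e by blast
  then show ?thesis using F by blast
 qed
 then show "S \<subseteq> A \<and> (\<forall>a\<in>S. \<exists>F. finite F \<and> F \<subseteq> J \<and> {b \<in> A. \<forall>j\<in>F. e b j = e a j} \<subseteq> S)"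
  using W(2) by blast
next
 assume S: "S \<subseteq> A \<and> (\<forall>a\<in>S. \<exists>F. finite F \<and> F \<subseteq> J \<and> {b \<in> A. \<forall>j\<in>F. e b j = e a j} \<subseteq> S)"
 from bchoice[OF conjunct2[OF S]] obtain F
  where F: "\<forall>a\<in>S. finite (F a) \<and> F a \<subseteq> J \<and> {b \<in> A. \<forall>j\<in>F a. e b j = e a j} \<subseteq> S"
  by blast
 define W where "W = (\<Union>a\<in>S. {t \<in> J \<rightarrow>\<^sub>E D. \<forall>j\<in>F a. t j = e a j})"
 have "openin (product_topology (\<lambda>_. discrete_topology D) J) W"
  unfolding openin_product_discrete
 proof (intro conjI ballI)
  show "W \<subseteq> (J \<rightarrow>\<^sub>E D)" by (auto simp: W_def)
  fix s assume "s \<in> W"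
  then obtain a where a: "a \<in> S" "s \<in> {t \<in> J \<rightarrow>\<^sub>E D. \<forall>j\<in>F a. t j = e a j}" by (auto simp: W_def)
  then have "{t \<in> J \<rightarrow>\<^sub>E D. \<forall>j\<in>F a. t j = s j} \<subseteq> W" by (auto simp: W_def)
  then show "\<exists>F. finite F \<and> F \<subseteq> J \<and> {t \<in> J \<rightarrow>\<^sub>E D. \<forall>j\<in>F. t j = s j} \<subseteq> W" using F a(1) by blast
 qed
 moreover have "S = e -` W \<inter> A"
 proof (intro equalityI subsetI)
  show "a \<in> e -` W \<inter> A" if "a \<in> S" for a using that S e by (auto simp: W_def)
  show "b \<in> S" if "b \<in> e -` W \<inter> A" for b using that F by (auto simp: W_def)
 qed
 ultimately show "openin (ptop A e J D) S" unfolding ptop_def openin_pullback_topology by blast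
qed

lemma topspace_ptop: "e \<in> A \<rightarrow> (J \<rightarrow>\<^sub>E D) ==> topspace (ptop A e J D) = A"
 by (auto simp: ptop_def topspace_pullback_topology)

lemma openin_ptop_basic:
 assumes e: "e \<in> A \<rightarrow> (J \<rightarrow>\<^sub>E D)" and F: "finite F" "F \<subseteq> J"
 shows "openin (ptop A e J D) {b \<in> A. \<forall>j\<in>F. e b j = h j}"
 unfolding openin_ptop[OF e]
proof (intro conjI ballI)
 fix a assume "a \<in> {b \<in> A. \<forall>j\<in>F. e b j = h j}"
 then show "\<exists>F'. finite F' \<and> F' \<subseteq> J \<and> {b \<in> A. \<forall>j\<in>F'. e b j = e a j} \<subseteq> {b \<in> A. \<forall>j\<in>F. e b j = h j}"
  using F by (intro exI[of _ F]) auto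
qed auto

lemma second_countable_ptop:
 assumes e: "e \<in> A \<rightarrow> (J \<rightarrow>\<^sub>E D)" and cJ: "countable J" and cD: "countable D"
 shows "second_countable (ptop A e J D)"
proof -
 define \<P> where "\<P> = {P. finite P \<and> P \<subseteq> J \<times> D}"
 define B where "B P = {b \<in> A. \<forall>p\<in>P. e b (fst p) = snd p}" for P
 have "countable (B ` \<P>)"
  unfolding \<P>_def using cJ cD by (intro countable_image) (metis countable_Collect_finite_subset countable_SIGMA Collect_cong)
 moreover have "openin (ptop A e J D) (B P)" if P: "P \<in> \<P>" for P
  unfolding openin_ptop[OF e]
 proof (intro conjI ballI)
  fix a assume "a \<in> B P"
  then have "{b \<in> A. \<forall>j\<in>fst ` P. e b j = e a j} \<subseteq> B P" by (auto simp: B_def)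
  then show "\<exists>F. finite F \<and> F \<subseteq> J \<and> {b \<in> A. \<forall>j\<in>F. e b j = e a j} \<subseteq> B P"
   using P by (intro exI[of _ "fst ` P"]) (auto simp: \<P>_def)
 qed (auto simp: B_def)
 moreover have "\<exists>V\<in>B ` \<P>. a \<in> V \<and> V \<subseteq> S" if S: "openin (ptop A e J D) S" "a \<in> S" for S a
 proof -
  obtain F where F: "finite F" "F \<subseteq> J" "{b \<in> A. \<forall>j\<in>F. e b j = e a j} \<subseteq> S" and a: "a \<in> A"
   using S unfolding openin_ptop[OF e] by blast
  define P where "P = (\<lambda>j. (j, e a j)) ` F"
  have "B P = {b \<in> A. \<forall>j\<in>F. e b j = e a j}" by (auto simp: B_def P_def)
  moreover have "e a j \<in> D" if "j \<in> F" for j using e a F(2) that by (auto dest: PiE_mem)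
  then have "P \<in> \<P>" using F by (auto simp: \<P>_def P_def)
  ultimately show ?thesis using F(3) a by (intro bexI[of _ "B P"]) auto
 qed
 ultimately show ?thesis unfolding second_countable_def by (intro exI[of _ "B ` \<P>"]) auto
qed

text \<open>The hypothesis \<open>closed\<close> says that the image of \<open>e\<close> is closed
  under pointwise limits. So the space is homeomorphic to a closed subspace of a countable product
  of discrete spaces.\<close>

lemma completely_metrizable_ptop:
 assumes e: "e \<in> A \<rightarrow> (J \<rightarrow>\<^sub>E D)" and cJ: "countable J" and inj: "inj_on e A"
  and closed: "!!s. s \<in> J \<rightarrow>\<^sub>E D ==>
   (!!F. finite F ==> F \<subseteq> J ==> \<exists>a\<in>A. \<forall>j\<in>F. e a j = s j) ==> s \<in> e ` A"
 shows "completely_metrizable_space (ptop A e J D)"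
proof -
 let ?P = "product_topology (\<lambda>_. discrete_topology D) J"
 have "closedin ?P (e ` A)"
  unfolding closedin_def
 proof
  show "e ` A \<subseteq> topspace ?P" using e by auto
  show "openin ?P (topspace ?P - e ` A)"
   unfolding openin_product_discrete
  proof (intro conjI ballI)
   fix s assume s: "s \<in> topspace ?P - e ` A"
   then have "s \<in> J \<rightarrow>\<^sub>E D" "s \<notin> e ` A" by auto
   then obtain F where F: "finite F" "F \<subseteq> J" "\<not> (\<exists>a\<in>A. \<forall>j\<in>F. e a j = s j)"
    using closed[of s] by meson
   then show "\<exists>F. finite F \<and> F \<subseteq> J \<and> {t \<in> J \<rightarrow>\<^sub>E D. \<forall>j\<in>F. t j = s j} \<subseteq> topspace ?P - e ` A"
    by (intro exI[of _ F]) auto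
  qed auto
 qed
 moreover have "completely_metrizable_space ?P"
  unfolding completely_metrizable_space_product_topology
  using cJ by (auto simp: completely_metrizable_space_discrete_topology intro: countable_subset)
 ultimately have "completely_metrizable_space (subtopology ?P (e ` A))"
  by (rule completely_metrizable_space_closedin[rotated])
 moreover have "homeomorphic_map (ptop A e J D) (subtopology ?P (e ` A)) e"
 proof (rule bijective_open_imp_homeomorphic_map)
  show "continuous_map (ptop A e J D) (subtopology ?P (e ` A)) e"
   unfolding continuous_map_in_subtopology ptop_def
   using continuous_map_pullback[of ?P ?P "\<lambda>x. x" A e] by (auto simp: topspace_pullback_topology comp_def)
  show "open_map (ptop A e J D) (subtopology ?P (e ` A)) e"
   unfolding open_map_def
  proof (intro allI impI)
   fix S assume "openin (ptop A e J D) S"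
   then obtain W where "openin ?P W" "S = e -` W \<inter> A"
    unfolding ptop_def openin_pullback_topology by blast
   then show "openin (subtopology ?P (e ` A)) (e ` S)"
    unfolding openin_subtopology by (intro exI[of _ W]) auto
  qed
  have "e ` A \<subseteq> J \<rightarrow>\<^sub>E D" using e by blast
  then show "e ` topspace (ptop A e J D) = topspace (subtopology ?P (e ` A))"
   by (auto simp: topspace_ptop[OF e])
  show "inj_on e (topspace (ptop A e J D))" using inj by (simp add: topspace_ptop[OF e])
 qed
 ultimately show ?thesis
  using homeomorphic_completely_metrizable_space homeomorphic_map_imp_homeomorphic_space by blast
qed

section \<open>Open mapping theorems\<close>

lemma shrink_open:
 assumes "Metric_space M d" "openin (Metric_space.mtopology M d) B" "b \<in> B" "\<r> > 0"
 obtains B' where "openin (Metric_space.mtopology M d) B'" "b \<in> B'"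
  "Metric_space.mtopology M d closure_of B' \<subseteq> B"
  "\<exists>a. Metric_space.mtopology M d closure_of B' \<subseteq> Metric_space.mcball M d a \<r>"
proof -
 interpret Metric_space M d by fact
 obtain r where r: "r > 0" "mcball b r \<subseteq> B"
  using assms(2,3) unfolding openin_mtopology_mcball by blast
 have b: "b \<in> M" using assms(2,3) openin_subset by fastforce
 let ?r = "min r \<r>"
 have "mtopology closure_of mball b ?r \<subseteq> mcball b ?r"
  by (intro closure_of_minimal mball_subset_mcball) simp
 moreover have "mcball b ?r \<subseteq> mcball b r" "mcball b ?r \<subseteq> mcball b \<r>"
  by (auto intro: mcball_subset_concentric)
 ultimately show thesis
  using r b assms(4) by (intro that[of "mball b ?r"]) auto
qed

text \<open>Weston's theorem. If \<open>f x\<close> lies in the closure of \<open>f ` B\<close>, then near openness allows one to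
 shrink \<open>B\<close> and a given neighbourhood of \<open>x\<close> alternately in such a way that both shrink to points
 with the same image.\<close>

lemma nearly_open_imp_homeomorphic_map:
 assumes X: "completely_metrizable_space X" and Y: "Hausdorff_space Y"
  and f: "continuous_map X Y f" "inj_on f (topspace X)" "f ` topspace X = topspace Y"
  and near: "!!V x. openin X V ==> x \<in> V ==> f x \<in> Y interior_of (Y closure_of (f ` V))"
 shows "homeomorphic_map X Y f"
proof -
 obtain M d where MS: "Metric_space M d" and compl: "Metric_space.mcomplete M d"
  and X_eq: "X = Metric_space.mtopology M d"
  using X unfolding completely_metrizable_space_def by blast
 interpret Metric_space M d by (rule MS)
 have top: "topspace X = M" by (simp add: X_eq)
 \<comment> \<open>The situation that persists under shrinking: some point of \<open>V\<close> has
   its image in the closure of the image of \<open>B\<close>.\<close>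
 define invt where "invt = (\<lambda>(B, V). openin X B \<and> openin X V \<and> (\<exists>v\<in>V. f v \<in> Y closure_of (f ` B)))"
 define sub where "sub n B' B <-> X closure_of B' \<subseteq> B \<and> (\<exists>a. X closure_of B' \<subseteq> mcball a (inverse (Suc n)))"
  for n :: nat and B' B
 have shrink: "\<exists>B'. openin X B' \<and> b \<in> B' \<and> sub n B' B" if B: "openin X B" "b \<in> B" for B b n
 proof -
  have "openin mtopology B" "0 < inverse (real (Suc n))" using B(1) by (simp_all add: X_eq)
  from shrink_open[OF MS this(1) B(2) this(2)] show ?thesis
   unfolding sub_def X_eq by (metis (no_types, lifting))
 qed
 \<comment> \<open>The image of \<open>v\<close> is interior to the closure of the image of a small
   \<open>V'\<close>, and it is a limit of images of points of \<open>B\<close>; so some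
   \<open>b\<close> in \<open>B\<close> is mapped into that closure. The roles of the two sets are
   now exchanged.\<close>
 have half: "\<exists>B' V'. invt (V', B') \<and> sub n B' B \<and> sub n V' V" if BV: "invt (B, V)" for B V n
 proof -
  obtain v where v: "openin X B" "openin X V" "v \<in> V" "f v \<in> Y closure_of (f ` B)"
   using BV by (auto simp: invt_def)
  obtain V' where V': "openin X V'" "v \<in> V'" "sub n V' V"
   using shrink[OF v(2,3), of n] by (elim exE conjE) (rule that)
  have "f v \<in> Y interior_of (Y closure_of (f ` V'))" using near V' by blast
  then obtain b where b: "b \<in> B" "f b \<in> Y interior_of (Y closure_of (f ` V'))"
  proof -
   have "\<exists>z. z \<in> f ` B \<and> z \<in> Y interior_of (Y closure_of (f ` V'))"
    using v(4) \<open>f v \<in> Y interior_of _\<close> openin_interior_of unfolding in_closure_of by metis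
   then show thesis using that by blast
  qed
  have fb: "f b \<in> Y closure_of (f ` V')" using b(2) by (rule subsetD[OF interior_of_subset])
  obtain B' where B': "openin X B'" "b \<in> B'" "sub n B' B"
   using shrink[OF v(1) b(1), of n] by (elim exE conjE) (rule that)
  have "invt (V', B')" using V' B' fb by (auto simp: invt_def)
  then show ?thesis using B' V' by blast
 qed
 have sub_self: "B \<subseteq> X closure_of B" if "openin X B" for B
  using that by (simp add: closure_of_subset openin_subset)
 have sub_trans: "sub n B'' B" if "openin X B'" "sub n B'' B'" "sub m B' B" for n m B'' B' B
  using that sub_self[of B'] unfolding sub_def by (meson order_trans)
 have step: "\<exists>B' V'. invt (B', V') \<and> sub n B' B \<and> sub n V' V" if BV: "invt (B, V)" for B V n
 proof -
  obtain B1 V1 where 1: "invt (V1, B1)" "sub n B1 B" "sub n V1 V" using half[OF BV] by blast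
  obtain B2 V2 where 2: "invt (B2, V2)" "sub n B2 B1" "sub n V2 V1" using half[OF 1(1)] by blast
  have "openin X B1" "openin X V1" using 1(1) by (auto simp: invt_def)
  then show ?thesis using 1 2 sub_trans by blast
 qed
 have meet: "B \<inter> V \<noteq> {}" if BV: "invt (B, V)" for B V
 proof -
  have "\<exists>s. \<forall>n. (invt (s n) \<and> (n = 0 --> s n = (B, V))) \<and>
    (sub n (fst (s (Suc n))) (fst (s n)) \<and> sub n (snd (s (Suc n))) (snd (s n)))"
  proof (intro dependent_nat_choice)
   show "\<exists>x. invt x \<and> ((0::nat) = 0 --> x = (B, V))" using BV by auto
   show "\<exists>y. (invt y \<and> (Suc n = 0 --> y = (B, V))) \<and> sub n (fst y) (fst x) \<and> sub n (snd y) (snd x)"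
    if "invt x \<and> (n = 0 --> x = (B, V))" for x n
    using step[of "fst x" "snd x" n] that by auto
  qed
  then obtain s where s: "!!n. invt (s n)" "s 0 = (B, V)"
   "!!n. sub n (fst (s (Suc n))) (fst (s n))" "!!n. sub n (snd (s (Suc n))) (snd (s n))" by blast
  have limit: "\<exists>l\<in>M. (\<Inter>n. X closure_of C n) = {l}"
   if C: "!!n. openin X (C n)" "!!n. C n \<noteq> {}" "!!n. sub n (C (Suc n)) (C n)" for C :: "nat => 'a set"
  proof -
   have "X closure_of C (Suc n) \<subseteq> X closure_of C n" for n
    using C(1,3) sub_self unfolding sub_def by (meson order_trans)
   then have dec: "decseq (\<lambda>n. X closure_of C n)" by (rule decseq_SucI)
   have small: "\<exists>n a. X closure_of C n \<subseteq> mcball a \<r>" if "\<r> > 0" for \<r>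
   proof -
    obtain n where n: "inverse (Suc n) < \<r>" using reals_Archimedean[OF \<open>\<r> > 0\<close>] by auto
    obtain a where "X closure_of C (Suc n) \<subseteq> mcball a (inverse (Suc n))"
     using C(3)[of n] unfolding sub_def by blast
    moreover have "mcball a (inverse (Suc n)) \<subseteq> mcball a \<r>"
     using n by (intro mcball_subset_concentric) simp
    ultimately show ?thesis by blast
   qed
   have nonempty: "X closure_of C n \<noteq> {}" for n using sub_self[OF C(1)] C(2) by blast
   have "\<exists>l. l \<in> M \<and> \<Inter>(range (\<lambda>n. X closure_of C n)) = {l}"
   proof (rule compl[unfolded mcomplete_nest_sing, rule_format], intro conjI allI impI)
    show "closedin mtopology (X closure_of C n)" for n by (simp add: X_eq)
   qed (use dec small nonempty in blast)+
   then show ?thesis by blast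
  qed
  have s_open: "openin X (fst (s n))" "openin X (snd (s n))" for n
   using s(1)[of n] by (auto simp: invt_def split: prod.splits)
  have s_ne: "fst (s n) \<noteq> {}" "snd (s n) \<noteq> {}" for n
   using s(1)[of n] by (auto simp: invt_def split: prod.splits)
  obtain b where b: "b \<in> M" "(\<Inter>n. X closure_of fst (s n)) = {b}"
   using limit[OF s_open(1) s_ne(1) s(3)] by blast
  obtain v where v: "v \<in> M" "(\<Inter>n. X closure_of snd (s n)) = {v}"
   using limit[OF s_open(2) s_ne(2) s(4)] by blast
  have small: "\<exists>n. C n \<subseteq> W"
   if C: "!!n. openin X (C n)" "!!n. sub n (C (Suc n)) (C n)" "(\<Inter>n. X closure_of C n) = {l}"
    and W: "openin X W" "l \<in> W" for C :: "nat => 'a set" and l W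
  proof -
   obtain r where r: "r > 0" "mcball l r \<subseteq> W" using W unfolding X_eq openin_mtopology_mcball by blast
   have "r / 2 > 0" using r by simp
   then obtain n where n: "inverse (Suc n) < r / 2" using reals_Archimedean by blast
   obtain a where a: "X closure_of C (Suc n) \<subseteq> mcball a (inverse (Suc n))"
    using C(2)[of n] unfolding sub_def by blast
   have l: "l \<in> mcball a (inverse (Suc n))" using C(3) a by blast
   have "x \<in> mcball l r" if x: "x \<in> C (Suc n)" for x
   proof -
    have "x \<in> mcball a (inverse (Suc n))" using x a sub_self[OF C(1)] by blast
    then show ?thesis
     using l n triangle[of l a x] commute[of l a] by (auto simp: mcball_def)
   qed
   then show ?thesis using r by blast
  qed
  \<comment> \<open>Disjoint neighbourhoods \<open>P\<close> and \<open>Q\<close> of the two images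
    would contain the images of late members of the two sequences. But some point of a late second
    set has its image in the closure of the image of the first, so \<open>Q\<close> would meet
    \<open>P\<close>.\<close>
  have "f b = f v"
  proof (rule ccontr)
   assume "f b \<noteq> f v"
   moreover have "f b \<in> topspace Y" "f v \<in> topspace Y" using f(3) b(1) v(1) top by auto
   ultimately obtain P Q where PQ: "openin Y P" "openin Y Q" "f b \<in> P" "f v \<in> Q" "disjnt P Q"
    using Y unfolding Hausdorff_space_def by metis
   obtain n where n: "fst (s n) \<subseteq> {x \<in> topspace X. f x \<in> P}"
    using small[OF s_open(1) s(3) b(2)] openin_continuous_map_preimage[OF f(1) PQ(1)] PQ(3) b(1) top by blast
   obtain m where m: "snd (s m) \<subseteq> {x \<in> topspace X. f x \<in> Q}"
    using small[OF s_open(2) s(4) v(2)] openin_continuous_map_preimage[OF f(1) PQ(2)] PQ(4) v(1) top by blast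
   have dec: "fst (s (Suc k)) \<subseteq> fst (s k)" "snd (s (Suc k)) \<subseteq> snd (s k)" for k
    using s(3,4)[of k] sub_self s_open unfolding sub_def by (meson order_trans)+
   have "fst (s (max n m)) \<subseteq> fst (s n)" "snd (s (max n m)) \<subseteq> snd (s m)"
    using lift_Suc_antimono_le[of "\<lambda>k. fst (s k)" n "max n m"] dec
     lift_Suc_antimono_le[of "\<lambda>k. snd (s k)" m "max n m"] by auto
   moreover obtain w where w: "w \<in> snd (s (max n m))" "f w \<in> Y closure_of (f ` fst (s (max n m)))"
    using s(1)[of "max n m"] by (auto simp: invt_def split: prod.splits)
   ultimately have "f w \<in> Q" using m by blast
   then obtain z where "z \<in> fst (s (max n m))" "f z \<in> Q"
    using w(2) PQ(2) unfolding in_closure_of by blast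
   moreover have "f z \<in> P" using n \<open>fst (s (max n m)) \<subseteq> fst (s n)\<close> calculation(1) by blast
   ultimately show False using PQ(5) by (auto simp: disjnt_iff)
  qed
  then have "b = v" using f(2) b(1) v(1) top by (auto simp: inj_on_def)
  moreover have "b \<in> X closure_of fst (s (Suc 0))" "v \<in> X closure_of snd (s (Suc 0))" using b v by blast+
  then have "b \<in> B" "v \<in> V" using s(2) s(3,4)[of 0] by (auto simp: sub_def)
  ultimately show ?thesis by blast
 qed
 have "open_map X Y f"
  unfolding open_map_def
 proof (intro allI impI)
  fix O' assume O': "openin X O'"
  show "openin Y (f ` O')"
  proof (subst openin_subopen, intro ballI)
   fix y assume "y \<in> f ` O'"
   then obtain x where x: "x \<in> O'" "y = f x" by blast
   obtain B where B: "openin X B" "x \<in> B" "X closure_of B \<subseteq> O'"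
    using shrink[OF O' x(1), of 0] unfolding sub_def by blast
   \<comment> \<open>If \<open>f w\<close> lies in this closure, then by \<open>meet\<close> each
     neighbourhood of \<open>w\<close> meets \<open>B\<close>, so \<open>w\<close> lies in the
     closure of \<open>B\<close>.\<close>
   have "Y closure_of (f ` B) \<subseteq> f ` O'"
   proof
    fix z assume z: "z \<in> Y closure_of (f ` B)"
    then obtain w where w: "w \<in> topspace X" "z = f w"
     using f(3) closure_of_subset_topspace by (metis image_iff in_closure_of)
    have "w \<in> X closure_of B"
     unfolding in_closure_of
    proof (intro conjI allI impI)
     fix V assume "w \<in> V \<and> openin X V"
     then have "invt (B, V)" using B(1) z w(2) by (auto simp: invt_def)
     then show "\<exists>y. y \<in> B \<and> y \<in> V" using meet by blast
    qed (rule w(1))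
    then show "z \<in> f ` O'" using B(3) w(2) by blast
   qed
   then show "\<exists>T. openin Y T \<and> y \<in> T \<and> T \<subseteq> f ` O'"
    using near[OF B(1,2)] x(2) interior_of_subset[of Y "Y closure_of (f ` B)"]
    by (intro exI[of _ "Y interior_of (Y closure_of (f ` B))"]) auto
  qed
 qed
 then show ?thesis using f by (intro bijective_open_imp_homeomorphic_map)
qed

section \<open>The open mapping theorem for Polish groups\<close>

lemma topological_group_translation:
 assumes G: "topological_group G X" and a: "a \<in> carrier G"
 shows "continuous_map X X (\<lambda>x. a \<otimes>\<^bsub>G\<^esub> x)"
proof -
 have top: "topspace X = carrier G" using G by (simp add: topological_group_def)
 have "continuous_map X (prod_topology X X) (\<lambda>x. (a, x))"
  using a by (auto simp: continuous_map_pairwise comp_def top)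
 moreover have "continuous_map (prod_topology X X) X (\<lambda>(x, y). x \<otimes>\<^bsub>G\<^esub> y)"
  using G by (simp add: topological_group_def)
 ultimately have "continuous_map X X ((\<lambda>(x, y). x \<otimes>\<^bsub>G\<^esub> y) \<circ> (\<lambda>x. (a, x)))"
  by (rule continuous_map_compose)
 then show ?thesis by (simp add: comp_def)
qed

lemma topological_group_translate_open:
 assumes G: "topological_group G X" and a: "a \<in> carrier G" and V: "openin X V"
 shows "openin X {x \<in> carrier G. a \<otimes>\<^bsub>G\<^esub> x \<in> V}"
 using openin_continuous_map_preimage[OF topological_group_translation[OF G a] V] G
 by (simp add: topological_group_def)

lemma topological_group_quotient_nbhd:
 assumes G: "topological_group G X" and N: "openin X N" "\<one>\<^bsub>G\<^esub> \<in> N"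
 obtains W where "openin X W" "\<one>\<^bsub>G\<^esub> \<in> W" "!!x y. x \<in> W ==> y \<in> W ==> inv\<^bsub>G\<^esub> x \<otimes>\<^bsub>G\<^esub> y \<in> N"
proof -
 interpret group G using G by (simp add: topological_group_def)
 have top: "topspace X = carrier G" using G by (simp add: topological_group_def)
 have inv: "continuous_map X X (\<lambda>x. inv\<^bsub>G\<^esub> x)"
  and mult: "continuous_map (prod_topology X X) X (\<lambda>(x, y). x \<otimes>\<^bsub>G\<^esub> y)"
  using G by (auto simp: topological_group_def)
 have "continuous_map (prod_topology X X) (prod_topology X X) (\<lambda>p. (inv\<^bsub>G\<^esub> fst p, snd p))"
  unfolding continuous_map_pairwise comp_def fst_conv snd_conv
  using continuous_map_compose[OF continuous_map_fst inv] continuous_map_snd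
  by (auto simp: comp_def)
 from continuous_map_compose[OF this mult]
 have "continuous_map (prod_topology X X) X (\<lambda>p. inv\<^bsub>G\<^esub> fst p \<otimes>\<^bsub>G\<^esub> snd p)"
  by (simp add: comp_def case_prod_unfold)
 from openin_continuous_map_preimage[OF this N(1)]
 have op: "openin (prod_topology X X) {p \<in> topspace (prod_topology X X). inv\<^bsub>G\<^esub> fst p \<otimes>\<^bsub>G\<^esub> snd p \<in> N}" .
 have mem: "(\<one>\<^bsub>G\<^esub>, \<one>\<^bsub>G\<^esub>) \<in> {p \<in> topspace (prod_topology X X). inv\<^bsub>G\<^esub> fst p \<otimes>\<^bsub>G\<^esub> snd p \<in> N}"
  using N(2) by (auto simp: top)
 obtain A B where AB: "openin X A" "openin X B" "\<one>\<^bsub>G\<^esub> \<in> A" "\<one>\<^bsub>G\<^esub> \<in> B"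
  "A \<times> B \<subseteq> {p \<in> topspace (prod_topology X X). inv\<^bsub>G\<^esub> fst p \<otimes>\<^bsub>G\<^esub> snd p \<in> N}"
  using op[unfolded openin_prod_topology_alt, rule_format, OF mem] by (elim exE conjE) (rule that)
 show thesis
 proof (rule that[of "A \<inter> B"])
  show "inv\<^bsub>G\<^esub> x \<otimes>\<^bsub>G\<^esub> y \<in> N" if "x \<in> A \<inter> B" "y \<in> A \<inter> B" for x y
   using AB(5) that by auto
 qed (use AB in auto)
qed

text \<open>Baire category gives near openness. Countably many left translates of a small
  neighbourhood \<open>W\<close> of the unit cover \<open>X\<close>, so the closure of the image of
  one of them, \<open>tr g\<close>, has an interior point of the form \<open>f w\<close>. Elements
  \<open>w\<close> and \<open>t\<close> of \<open>tr g\<close> differ by a quotient in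
  \<open>N\<close>, so translating back from \<open>f w\<close> to \<open>f x\<close> moves that
  closure into the closure of the image of \<open>V\<close>.\<close>

lemma bijective_hom_homeomorphic:
 assumes G: "topological_group G X" and H: "topological_group H Y"
  and X: "completely_metrizable_space X" "second_countable X" and Y: "completely_metrizable_space Y"
  and f: "f \<in> iso G H" "continuous_map X Y f"
 shows "homeomorphic_map X Y f"
proof -
 interpret G: group G using G by (simp add: topological_group_def)
 interpret H: group H using H by (simp add: topological_group_def)
 have topX: "topspace X = carrier G" and topY: "topspace Y = carrier H"
  using G H by (simp_all add: topological_group_def)
 have hom: "f \<in> hom G H" and bij: "bij_betw f (carrier G) (carrier H)" using f(1) by (auto simp: iso_def)
 interpret f: group_hom G H f using hom by unfold_locales
 have fG: "f ` carrier G = carrier H" using bij by (simp add: bij_betw_def)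
 show ?thesis
 proof (rule nearly_open_imp_homeomorphic_map[OF X(1) _ f(2)])
  show "Hausdorff_space Y"
   using Y completely_metrizable_imp_metrizable_space metrizable_imp_Hausdorff_space by blast
  show "inj_on f (topspace X)" "f ` topspace X = topspace Y"
   using bij by (auto simp: topX topY bij_betw_def)
  fix V x assume V: "openin X V" and x: "x \<in> V"
  have xG: "x \<in> carrier G" using V x openin_subset topX by blast
  define N where "N = {g \<in> carrier G. x \<otimes>\<^bsub>G\<^esub> g \<in> V}"
  have "openin X N" "\<one>\<^bsub>G\<^esub> \<in> N"
   using topological_group_translate_open[OF G xG V] x xG by (auto simp: N_def)
  then obtain W where W: "openin X W" "\<one>\<^bsub>G\<^esub> \<in> W" "!!a b. a \<in> W ==> b \<in> W ==> inv\<^bsub>G\<^esub> a \<otimes>\<^bsub>G\<^esub> b \<in> N"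
   using topological_group_quotient_nbhd[OF G] by metis
  have WG: "W \<subseteq> carrier G" using W(1) openin_subset topX by blast
  define tr where "tr g = {y \<in> carrier G. inv\<^bsub>G\<^esub> g \<otimes>\<^bsub>G\<^esub> y \<in> W}" for g
  have "\<exists>\<V>. countable \<V> \<and> \<V> \<subseteq> tr ` carrier G \<and> \<Union>\<V> = topspace X"
  proof -
   have "Lindelof_space X" using X(2) by (rule second_countable_imp_Lindelof_space)
   moreover have "\<forall>A\<in>tr ` carrier G. openin X A"
    unfolding tr_def using topological_group_translate_open[OF G _ W(1)] by blast
   moreover have "\<Union>(tr ` carrier G) = topspace X"
    using W(2) by (auto simp: tr_def topX)
   ultimately show ?thesis unfolding Lindelof_space_def by metis
  qed
  then obtain \<V> where \<V>: "countable \<V>" "\<V> \<subseteq> tr ` carrier G" "\<Union>\<V> = topspace X"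
   by (elim exE conjE) (rule that)
  have "\<exists>A\<in>\<V>. Y interior_of (Y closure_of (f ` A)) \<noteq> {}"
  proof (rule ccontr)
   assume "\<not> ?thesis"
   then have "Y interior_of \<Union>((\<lambda>A. Y closure_of (f ` A)) ` \<V>) = {}"
    using Y \<V>(1) by (intro Baire_category_alt) auto
   moreover have "\<Union>((\<lambda>A. Y closure_of (f ` A)) ` \<V>) = topspace Y"
   proof
    show "\<Union>((\<lambda>A. Y closure_of (f ` A)) ` \<V>) \<subseteq> topspace Y"
     using closure_of_subset_topspace[of Y] by blast
    show "topspace Y \<subseteq> \<Union>((\<lambda>A. Y closure_of (f ` A)) ` \<V>)"
    proof
     fix y assume "y \<in> topspace Y"
     then obtain g where g: "g \<in> carrier G" "y = f g" using fG topY by auto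
     then obtain A where A: "A \<in> \<V>" "g \<in> A" using \<V>(3) topX by blast
     have "f ` A \<subseteq> topspace Y" using A(1) \<V>(3) fG topX topY by auto
     then have "y \<in> Y closure_of (f ` A)" using A(2) g(2) closure_of_subset by blast
     then show "y \<in> \<Union>((\<lambda>A. Y closure_of (f ` A)) ` \<V>)" using A(1) by blast
    qed
   qed
   ultimately have "topspace Y = {}" by simp
   then show False using topY by auto
  qed
  then obtain g where g: "g \<in> carrier G" and ne: "Y interior_of (Y closure_of (f ` tr g)) \<noteq> {}"
   using \<V>(2) by blast
  let ?I = "Y interior_of (Y closure_of (f ` tr g))"
  obtain y where y: "y \<in> ?I" using ne by blast
  then have "y \<in> Y closure_of (f ` tr g)" by (rule subsetD[OF interior_of_subset])
  then have "\<exists>z. z \<in> f ` tr g \<and> z \<in> ?I"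
   using y openin_interior_of[of Y "Y closure_of (f ` tr g)"] unfolding in_closure_of by metis
  then obtain w where w: "w \<in> tr g" "f w \<in> ?I" by auto
  have wG: "w \<in> carrier G" using w(1) by (simp add: tr_def)
  \<comment> \<open>Left translation by \<open>h\<close> takes \<open>f x\<close> to the interior
    point \<open>f w\<close>.\<close>
  define h where "h = f (w \<otimes>\<^bsub>G\<^esub> inv\<^bsub>G\<^esub> x)"
  have hH: "h \<in> carrier H" using wG xG by (simp add: h_def)
  define O' where "O' = {z \<in> carrier H. h \<otimes>\<^bsub>H\<^esub> z \<in> ?I}"
  have "openin Y O'" unfolding O'_def by (rule topological_group_translate_open[OF H hH openin_interior_of])
  moreover have "h \<otimes>\<^bsub>H\<^esub> f x = f w"
   using wG xG by (simp add: h_def H.m_assoc)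
  then have "f x \<in> O'" using w(2) xG by (simp add: O'_def)
  moreover have "O' \<subseteq> Y closure_of (f ` V)"
  proof
   fix z assume z: "z \<in> O'"
   have zH: "z \<in> carrier H" using z by (simp add: O'_def)
   show "z \<in> Y closure_of (f ` V)"
    unfolding in_closure_of
   proof (intro conjI allI impI)
    show "z \<in> topspace Y" using zH topY by simp
    fix P assume P: "z \<in> P \<and> openin Y P"
    have ih: "inv\<^bsub>H\<^esub> h \<in> carrier H" using hH by simp
    let ?Q = "{u \<in> carrier H. inv\<^bsub>H\<^esub> h \<otimes>\<^bsub>H\<^esub> u \<in> P}"
    have "openin Y ?Q" using topological_group_translate_open[OF H ih] P by blast
    moreover have "h \<otimes>\<^bsub>H\<^esub> z \<in> ?Q" using hH zH P by (simp add: H.m_assoc[symmetric])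
    moreover have "h \<otimes>\<^bsub>H\<^esub> z \<in> Y closure_of (f ` tr g)"
    proof -
     have "h \<otimes>\<^bsub>H\<^esub> z \<in> ?I" using z by (simp add: O'_def)
     then show ?thesis by (rule subsetD[OF interior_of_subset])
    qed
    ultimately have "\<exists>u. u \<in> f ` tr g \<and> u \<in> ?Q" unfolding in_closure_of by metis
    then obtain t where t: "t \<in> tr g" "f t \<in> ?Q" by auto
    have tG: "t \<in> carrier G" using t(1) by (simp add: tr_def)
    have "inv\<^bsub>G\<^esub> (inv\<^bsub>G\<^esub> g \<otimes>\<^bsub>G\<^esub> w) \<otimes>\<^bsub>G\<^esub> (inv\<^bsub>G\<^esub> g \<otimes>\<^bsub>G\<^esub> t) \<in> N"
     using W(3) w(1) t(1) by (simp add: tr_def)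
    also have "inv\<^bsub>G\<^esub> (inv\<^bsub>G\<^esub> g \<otimes>\<^bsub>G\<^esub> w) \<otimes>\<^bsub>G\<^esub> (inv\<^bsub>G\<^esub> g \<otimes>\<^bsub>G\<^esub> t) = inv\<^bsub>G\<^esub> w \<otimes>\<^bsub>G\<^esub> t"
    proof -
     have "g \<otimes>\<^bsub>G\<^esub> (inv\<^bsub>G\<^esub> g \<otimes>\<^bsub>G\<^esub> t) = t"
      using g tG by (simp add: G.m_assoc[symmetric])
     then show ?thesis using g wG tG by (simp add: G.inv_mult_group G.m_assoc)
    qed
    finally have xwt: "x \<otimes>\<^bsub>G\<^esub> (inv\<^bsub>G\<^esub> w \<otimes>\<^bsub>G\<^esub> t) \<in> V" by (simp add: N_def)
    have "inv\<^bsub>H\<^esub> h \<otimes>\<^bsub>H\<^esub> f t = f (x \<otimes>\<^bsub>G\<^esub> (inv\<^bsub>G\<^esub> w \<otimes>\<^bsub>G\<^esub> t))"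
     using wG xG tG by (simp add: h_def H.inv_mult_group H.m_assoc)
    then show "\<exists>y. y \<in> f ` V \<and> y \<in> P" using t(2) xwt by auto
   qed
  qed
  ultimately show "f x \<in> Y interior_of (Y closure_of (f ` V))" unfolding interior_of_def by blast
 qed
qed

section \<open>Open homomorphisms of topological groups\<close>

text \<open>Points of the image are lifted, continuity is applied upstairs, and the open map pushes
  the resulting neighbourhoods down again.\<close>

lemma topological_group_image:
 assumes A: "topological_group A X" and B: "group B" and p: "p \<in> hom A B" "p ` carrier A = carrier B"
  and Y: "topspace Y = carrier B" "continuous_map X Y p" "open_map X Y p"
 shows "topological_group B Y"
proof -
 interpret A: group A using A by (simp add: topological_group_def)
 interpret B: group B by (rule B)
 interpret p: group_hom A B p using p(1) by unfold_locales
 have top: "topspace X = carrier A" using A by (simp add: topological_group_def)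
 have "continuous_map (prod_topology Y Y) Y (\<lambda>(x, y). x \<otimes>\<^bsub>B\<^esub> y)"
  unfolding continuous_map_def
 proof (intro conjI allI impI)
  show "(\<lambda>(x, y). x \<otimes>\<^bsub>B\<^esub> y) \<in> topspace (prod_topology Y Y) \<rightarrow> topspace Y" by (auto simp: Y(1))
  fix W assume W: "openin Y W"
  let ?S = "{z \<in> topspace (prod_topology Y Y). (case z of (x, y) => x \<otimes>\<^bsub>B\<^esub> y) \<in> W}"
  have "\<exists>V V'. openin Y V \<and> openin Y V' \<and> a \<in> V \<and> b \<in> V' \<and> V \<times> V' \<subseteq> ?S" if ab: "(a, b) \<in> ?S" for a b
  proof -
   obtain x y where x: "x \<in> carrier A" "a = p x" and y: "y \<in> carrier A" "b = p y"
   proof -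
    have "a \<in> p ` carrier A" "b \<in> p ` carrier A" using ab p(2) Y(1) by auto
    then show thesis using that by blast
   qed
   have "continuous_map (prod_topology X X) Y (p \<circ> (\<lambda>(x, y). x \<otimes>\<^bsub>A\<^esub> y))"
    using A Y(2) by (intro continuous_map_compose) (auto simp: topological_group_def)
   from openin_continuous_map_preimage[OF this W]
   have op: "openin (prod_topology X X) {z \<in> topspace (prod_topology X X). p (fst z \<otimes>\<^bsub>A\<^esub> snd z) \<in> W}"
    by (simp add: case_prod_unfold)
   have mem: "(x, y) \<in> {z \<in> topspace (prod_topology X X). p (fst z \<otimes>\<^bsub>A\<^esub> snd z) \<in> W}"
    using ab x y by (simp add: top)
   obtain V V' where V: "openin X V" "openin X V'" "x \<in> V" "y \<in> V'"
    "V \<times> V' \<subseteq> {z \<in> topspace (prod_topology X X). p (fst z \<otimes>\<^bsub>A\<^esub> snd z) \<in> W}"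
    using op[unfolded openin_prod_topology_alt, rule_format, OF mem] by (elim exE conjE) (rule that)
   have "openin Y (p ` V)" "openin Y (p ` V')" using V Y(3) by (auto simp: open_map_def)
   moreover have "p ` V \<times> p ` V' \<subseteq> ?S"
   proof
    fix z assume "z \<in> p ` V \<times> p ` V'"
    then obtain u v where uv: "u \<in> V" "v \<in> V'" "z = (p u, p v)" by auto
    then have "p (u \<otimes>\<^bsub>A\<^esub> v) \<in> W" "u \<in> carrier A" "v \<in> carrier A" using V(5) top by auto
    then show "z \<in> ?S" using uv Y(1) by simp
   qed
   ultimately show ?thesis using V x y by blast
  qed
  then show "openin (prod_topology Y Y) ?S" unfolding openin_prod_topology_alt by blast
 qed
 moreover have "continuous_map Y Y (\<lambda>x. inv\<^bsub>B\<^esub> x)"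
  unfolding continuous_map_def
 proof (intro conjI allI impI)
  show "(\<lambda>x. inv\<^bsub>B\<^esub> x) \<in> topspace Y \<rightarrow> topspace Y" by (auto simp: Y(1))
  fix W assume W: "openin Y W"
  have "continuous_map X Y (p \<circ> (\<lambda>x. inv\<^bsub>A\<^esub> x))"
   using A Y(2) by (intro continuous_map_compose) (auto simp: topological_group_def)
  from openin_continuous_map_preimage[OF this W]
  have "openin Y (p ` {x \<in> topspace X. p (inv\<^bsub>A\<^esub> x) \<in> W})" using Y(3) by (simp add: open_map_def)
  also have "p ` {x \<in> topspace X. p (inv\<^bsub>A\<^esub> x) \<in> W} = {x \<in> topspace Y. inv\<^bsub>B\<^esub> x \<in> W}"
  proof (intro equalityI subsetI)
   fix y assume y: "y \<in> {x \<in> topspace Y. inv\<^bsub>B\<^esub> x \<in> W}"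
   then have "y \<in> p ` carrier A" using p(2) Y(1) by simp
   then obtain x where "x \<in> carrier A" "y = p x" by blast
   then show "y \<in> p ` {x \<in> topspace X. p (inv\<^bsub>A\<^esub> x) \<in> W}" using y by (simp add: top)
  qed (auto simp: Y(1) top)
  finally show "openin Y {x \<in> topspace Y. inv\<^bsub>B\<^esub> x \<in> W}" .
 qed
 ultimately show ?thesis using B Y(1) by (simp add: topological_group_def)
qed

text \<open>The first isomorphism theorem. The bijection induced on cosets is continuous since
  \<open>p\<close> is, and open since \<open>p\<close> is; its inverse is the required
  isomorphism.\<close>

lemma topologically_isomorphic_quotient:
 assumes A: "group A" "topspace X = carrier A" and B: "group B" and p: "p \<in> hom A B" "p ` carrier A = carrier B"
  and Y: "topspace Y = carrier B" "continuous_map X Y p" "open_map X Y p"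
  and K: "kernel A B p = K"
 shows "topologically_isomorphic B Y (A Mod K) (quotient_topology X (\<lambda>x. K #>\<^bsub>A\<^esub> x))"
proof -
 interpret A: group A by (rule A(1))
 interpret B: group B by (rule B)
 interpret p: group_hom A B p using p(1) by unfold_locales
 define h where "h C = the_elem (p ` C)" for C
 have normal: "K \<lhd> A" unfolding K[symmetric] by (rule p.normal_kernel)
 have h: "h \<in> iso (A Mod K) B" using p.FactGroup_iso_set[OF p(2)] unfolding K h_def .
 have gM: "group (A Mod K)" using normal by (rule normal.factorgroup_is_group)
 have car: "carrier (A Mod K) = (\<lambda>x. K #>\<^bsub>A\<^esub> x) ` carrier A"
  by (auto simp: FactGroup_def RCOSETS_def)
 have h_coset: "h (K #>\<^bsub>A\<^esub> x) = p x" if x: "x \<in> carrier A" for x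
 proof -
  have "p ` (K #>\<^bsub>A\<^esub> x) = {p x}"
  proof (intro equalityI subsetI)
   fix z assume "z \<in> p ` (K #>\<^bsub>A\<^esub> x)"
   then obtain k where "k \<in> K" "z = p (k \<otimes>\<^bsub>A\<^esub> x)" by (auto simp: r_coset_def)
   then show "z \<in> {p x}" using x by (auto simp: K[symmetric] kernel_def)
  next
   fix z assume "z \<in> {p x}"
   moreover have "x \<in> K #>\<^bsub>A\<^esub> x"
    using x normal by (simp add: A.rcos_self normal_imp_subgroup)
   ultimately show "z \<in> p ` (K #>\<^bsub>A\<^esub> x)" by auto
  qed
  then show ?thesis by (simp add: h_def)
 qed
 let ?Q = "quotient_topology X (\<lambda>x. K #>\<^bsub>A\<^esub> x)"
 have topQ: "topspace ?Q = carrier (A Mod K)" by (simp add: topspace_quotient_topology car A(2))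
 have bij: "bij_betw h (carrier (A Mod K)) (carrier B)" using h by (simp add: iso_def)
 have "homeomorphic_map ?Q Y h"
 proof (rule bijective_open_imp_homeomorphic_map)
  show "continuous_map ?Q Y h"
   unfolding continuous_map_def
  proof (intro conjI allI impI)
   show "h \<in> topspace ?Q \<rightarrow> topspace Y" using bij by (auto simp: topQ Y(1) bij_betw_def)
   fix W assume W: "openin Y W"
   have "{x \<in> topspace X. K #>\<^bsub>A\<^esub> x \<in> {C \<in> topspace ?Q. h C \<in> W}} = {x \<in> topspace X. p x \<in> W}"
    by (auto simp: topQ car A(2) h_coset)
   then show "openin ?Q {C \<in> topspace ?Q. h C \<in> W}"
    using openin_continuous_map_preimage[OF Y(2) W]
    unfolding openin_quotient_topology by (auto simp: topspace_quotient_topology)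
  qed
  show "open_map ?Q Y h"
   unfolding open_map_def
  proof (intro allI impI)
   fix W assume W: "openin ?Q W"
   then have sub: "W \<subseteq> (\<lambda>x. K #>\<^bsub>A\<^esub> x) ` carrier A" and op: "openin X {x \<in> topspace X. K #>\<^bsub>A\<^esub> x \<in> W}"
    by (auto simp: openin_quotient_topology A(2))
   have "h ` W = p ` {x \<in> topspace X. K #>\<^bsub>A\<^esub> x \<in> W}"
   proof (intro equalityI subsetI)
    fix z assume "z \<in> h ` W"
    then obtain x where "x \<in> carrier A" "K #>\<^bsub>A\<^esub> x \<in> W" "z = h (K #>\<^bsub>A\<^esub> x)" using sub by blast
    then show "z \<in> p ` {x \<in> topspace X. K #>\<^bsub>A\<^esub> x \<in> W}" by (auto simp: h_coset A(2))
   next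
    fix z assume "z \<in> p ` {x \<in> topspace X. K #>\<^bsub>A\<^esub> x \<in> W}"
    then obtain x where "x \<in> carrier A" "K #>\<^bsub>A\<^esub> x \<in> W" "z = p x" by (auto simp: A(2))
    then show "z \<in> h ` W" using h_coset[of x] by force
   qed
   then show "openin Y (h ` W)" using op Y(3) by (simp add: open_map_def)
  qed
  show "h ` topspace ?Q = topspace Y" "inj_on h (topspace ?Q)"
   using bij by (auto simp: topQ Y(1) bij_betw_def)
 qed
 then obtain h' where "homeomorphic_maps ?Q Y h h'" by (auto simp: homeomorphic_map_maps)
 then have h': "homeomorphic_map Y ?Q h'" "!!x. x \<in> carrier (A Mod K) ==> h' (h x) = x"
  by (auto simp: homeomorphic_maps_map topQ)
 have "inv_into (carrier (A Mod K)) h \<in> iso B (A Mod K)"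
  using group.iso_set_sym[OF gM h] .
 moreover have "homeomorphic_map Y ?Q (inv_into (carrier (A Mod K)) h)"
 proof (rule homeomorphic_map_eq[OF h'(1)])
  fix y assume "y \<in> topspace Y"
  then obtain C where "C \<in> carrier (A Mod K)" "y = h C" using bij by (auto simp: Y(1) bij_betw_def)
  then show "h' y = inv_into (carrier (A Mod K)) h y"
   using h'(2) bij by (simp add: bij_betw_def inv_into_f_f)
 qed
 ultimately show ?thesis unfolding topologically_isomorphic_def by blast
qed

lemma continuous_map_into_ptop:
 assumes e: "e \<in> A \<rightarrow> (J \<rightarrow>\<^sub>E D)" and f: "f \<in> topspace Z \<rightarrow> A"
  and sub: "!!j z. j \<in> J ==> z \<in> topspace Z ==> openin Z {w \<in> topspace Z. e (f w) j = e (f z) j}"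
 shows "continuous_map Z (ptop A e J D) f"
 unfolding continuous_map_def topspace_ptop[OF e]
proof (intro conjI allI impI)
 fix S assume S: "openin (ptop A e J D) S"
 show "openin Z {z \<in> topspace Z. f z \<in> S}"
 proof (subst openin_subopen, intro ballI)
  fix z assume z: "z \<in> {z \<in> topspace Z. f z \<in> S}"
  then have zS: "f z \<in> S" and zZ: "z \<in> topspace Z" by auto
  obtain F where F: "finite F" "F \<subseteq> J" "{b \<in> A. \<forall>j\<in>F. e b j = e (f z) j} \<subseteq> S"
   using bspec[OF conjunct2[OF S[unfolded openin_ptop[OF e]]] zS] by blast
  let ?W = "topspace Z \<inter> (\<Inter>j\<in>F. {w \<in> topspace Z. e (f w) j = e (f z) j})"
  have "openin Z ?W"
  proof (cases "F = {}")
   case False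
   have "openin Z (\<Inter>j\<in>F. {w \<in> topspace Z. e (f w) j = e (f z) j})"
    using F(1,2) False sub zZ by (intro openin_Inter) auto
   then show ?thesis by blast
  qed simp
  moreover have "?W \<subseteq> {z \<in> topspace Z. f z \<in> S}" using F(3) f by auto
  ultimately show "\<exists>W. openin Z W \<and> z \<in> W \<and> W \<subseteq> {z \<in> topspace Z. f z \<in> S}"
   using zZ by (intro exI[of _ ?W]) auto
 qed
qed (rule f)

context omega_cat
begin

section \<open>The automorphism group as a Polish group\<close>

abbreviation "X \<equiv> automorphism_topology L M"

lemma G_funcset: "(\<lambda>g. g) \<in> \<G> \<rightarrow> (U \<rightarrow>\<^sub>E U)"
 using G_closed by (auto simp: G_iff PiE_iff)

lemma X_ptop: "X = ptop (\<G>) (\<lambda>g. g) U U"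
 unfolding automorphism_topology_def ptop_def topology_eq openin_subtopology openin_pullback_topology by simp

lemma topspace_X: "topspace X = \<G>"
 unfolding X_ptop by (rule topspace_ptop[OF G_funcset])

lemma openin_X: "openin X S <-> S \<subseteq> \<G> \<and>
  (\<forall>g\<in>S. \<exists>F. finite F \<and> F \<subseteq> U \<and> {h \<in> \<G>. \<forall>x\<in>F. h x = g x} \<subseteq> S)"
 unfolding X_ptop by (rule openin_ptop[OF G_funcset])

lemma openin_X_basic: "x \<in> U ==> openin X {h \<in> \<G>. h x = y}"
 unfolding X_ptop using openin_ptop_basic[OF G_funcset, of "{x}" "\<lambda>_. y"] by simp

text \<open>Records a permutation together with its inverse. A pointwise limit of permutations can
  fail to be onto, whereas a limit of such pairs is again a permutation with its inverse; this makes
  the image of \<open>e2\<close> closed.\<close>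

definition e2 :: "('a => 'a) => 'a \<times> bool => 'a" where
 "e2 g = (\<lambda>j\<in>U \<times> UNIV. if snd j then g (fst j) else (\<iota> g) (fst j))"

lemma e2_funcset: "e2 \<in> \<G> \<rightarrow> (U \<times> UNIV \<rightarrow>\<^sub>E U)"
 unfolding e2_def using G_closed G.inv_closed
 by (intro Pi_I restrict_PiE_iff[THEN iffD2] ballI) auto

text \<open>The inverse of \<open>h\<close> agrees with that of \<open>g\<close> at \<open>x\<close>
  as soon as \<open>h\<close> and \<open>g\<close> agree at the preimage of \<open>x\<close> under
  \<open>g\<close>, so recording inverses adds no open sets.\<close>

lemma X_ptop2: "X = ptop (\<G>) e2 (U \<times> UNIV) U"
 unfolding topology_eq
proof
 fix S
 show "openin X S = openin (ptop (\<G>) e2 (U \<times> UNIV) U) S"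
  unfolding openin_X openin_ptop[OF e2_funcset]
 proof (intro conj_cong refl ball_cong)
  fix g assume S: "S \<subseteq> \<G>" and "g \<in> S"
  then have g: "g \<in> \<G>" by blast
  show "(\<exists>F. finite F \<and> F \<subseteq> U \<and> {h \<in> \<G>. \<forall>x\<in>F. h x = g x} \<subseteq> S) <->
   (\<exists>F. finite F \<and> F \<subseteq> U \<times> UNIV \<and> {b \<in> \<G>. \<forall>j\<in>F. e2 b j = e2 g j} \<subseteq> S)"
  proof
   assume "\<exists>F. finite F \<and> F \<subseteq> U \<and> {h \<in> \<G>. \<forall>x\<in>F. h x = g x} \<subseteq> S"
   then obtain F where F: "finite F" "F \<subseteq> U" "{h \<in> \<G>. \<forall>x\<in>F. h x = g x} \<subseteq> S" by blast
   have "{b \<in> \<G>. \<forall>j\<in>F \<times> {True}. e2 b j = e2 g j} \<subseteq> {h \<in> \<G>. \<forall>x\<in>F. h x = g x}"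
    using F(2) by (auto simp: e2_def)
   then show "\<exists>F. finite F \<and> F \<subseteq> U \<times> UNIV \<and> {b \<in> \<G>. \<forall>j\<in>F. e2 b j = e2 g j} \<subseteq> S"
    using F by (intro exI[of _ "F \<times> {True}"]) auto
  next
   assume "\<exists>F. finite F \<and> F \<subseteq> U \<times> UNIV \<and> {b \<in> \<G>. \<forall>j\<in>F. e2 b j = e2 g j} \<subseteq> S"
   then obtain F where F: "finite F" "F \<subseteq> U \<times> UNIV" "{b \<in> \<G>. \<forall>j\<in>F. e2 b j = e2 g j} \<subseteq> S" by blast
   define F' where "F' = (\<lambda>j. if snd j then fst j else (\<iota> g) (fst j)) ` F"
   have "e2 h j = e2 g j" if h: "h \<in> \<G>" "\<forall>x\<in>F'. h x = g x" and j: "j \<in> F" for h j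
   proof (cases "snd j")
    case True
    then have "fst j \<in> F'" using j unfolding F'_def by force
    then show ?thesis using h(2) True F(2) j by (auto simp: e2_def)
   next
    case False
    have ju: "fst j \<in> U" using F(2) j by auto
    have "(\<iota> g) (fst j) \<in> F'" using j False unfolding F'_def by force
    then have "h ((\<iota> g) (fst j)) = fst j" using h(2) G_apply_inv[OF g ju] by simp
    then have "(\<iota> h) (fst j) = (\<iota> g) (fst j)"
     using G_inv_apply[OF h(1) G_closed[OF G.inv_closed[OF g] ju]] by simp
    then show ?thesis using False by (simp add: e2_def)
   qed
   then have "{h \<in> \<G>. \<forall>x\<in>F'. h x = g x} \<subseteq> S" using F(3) by blast
   moreover have "F' \<subseteq> U" using F(2) G_closed[OF G.inv_closed[OF g]] by (auto simp: F'_def)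
   ultimately show "\<exists>F. finite F \<and> F \<subseteq> U \<and> {h \<in> \<G>. \<forall>x\<in>F. h x = g x} \<subseteq> S"
    using F(1) by (intro exI[of _ F']) (auto simp: F'_def)
  qed
 qed
qed

lemma countable_U_bool: "countable (U \<times> (UNIV :: bool set))"
 using cnt by (intro countable_SIGMA) auto

lemma second_countable_X: "second_countable X"
 unfolding X_ptop by (rule second_countable_ptop[OF G_funcset cnt cnt])

lemma completely_metrizable_X: "completely_metrizable_space X"
 unfolding X_ptop2
proof (rule completely_metrizable_ptop[OF e2_funcset countable_U_bool])
 show "inj_on e2 (\<G>)"
 proof (rule inj_onI)
  fix g h assume g: "g \<in> \<G>" and h: "h \<in> \<G>" and eq: "e2 g = e2 h"
  show "g = h"
  proof (rule G_ext[OF g h])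
   show "g x = h x" if "x \<in> U" for x using fun_cong[OF eq, of "(x, True)"] that by (simp add: e2_def)
  qed
 qed
 fix s assume s: "s \<in> U \<times> UNIV \<rightarrow>\<^sub>E U"
  and appr: "!!F. finite F ==> F \<subseteq> U \<times> UNIV ==> \<exists>a\<in>\<G>. \<forall>j\<in>F. e2 a j = s j"
 define g where "g = (\<lambda>x\<in>U. s (x, True))"
 define g' where "g' x = s (x, False)" for x
 have gU: "g x \<in> U" "g' x \<in> U" if "x \<in> U" for x
  using PiE_mem[OF s, of "(x, True)"] PiE_mem[OF s, of "(x, False)"] that by (auto simp: g_def g'_def)
 have approx: "\<exists>h\<in>\<G>. (\<forall>x\<in>F. h x = g x) \<and> (\<forall>x\<in>F. (\<iota> h) x = g' x)" if "finite F" "F \<subseteq> U" for F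
 proof -
  have "finite (F \<times> (UNIV :: bool set))" "F \<times> (UNIV :: bool set) \<subseteq> U \<times> UNIV" using that by auto
  from appr[OF this] obtain h where h: "h \<in> \<G>" "\<forall>j\<in>F \<times> UNIV. e2 h j = s j" by blast
  have "h x = g x \<and> (\<iota> h) x = g' x" if "x \<in> F" for x
   using bspec[OF h(2), of "(x, True)"] bspec[OF h(2), of "(x, False)"] that \<open>F \<subseteq> U\<close>
   by (auto simp: e2_def g_def g'_def)
  then show ?thesis using h(1) by blast
 qed
 have g'g: "g' (g x) = x" if x: "x \<in> U" for x
 proof -
  obtain h where h: "h \<in> \<G>" "h x = g x" "(\<iota> h) (g x) = g' (g x)"
   using approx[of "{x, g x}"] x gU by auto
  then show ?thesis using G_inv_apply[OF h(1) x] by simp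
 qed
 have gg': "g (g' x) = x" if x: "x \<in> U" for x
 proof -
  obtain h where h: "h \<in> \<G>" "h (g' x) = g (g' x)" "(\<iota> h) x = g' x"
   using approx[of "{x, g' x}"] x gU by auto
  then show ?thesis using G_apply_inv[OF h(1) x] by simp
 qed
 have "bij_betw g U U" using g'g gg' gU by (intro bij_betw_byWitness[where f' = g']) auto
 moreover have "map g zs \<in> interp_rel M r <-> zs \<in> interp_rel M r"
  if r: "r \<in> symbols L" and zs: "zs \<in> tuples M (arity L r)" for r zs
 proof -
  obtain h where h: "h \<in> \<G>" "\<forall>x\<in>set zs. h x = g x"
   using approx[of "set zs"] zs by (auto simp: tuples_def)
  then have eq: "map h zs = map g zs" by simp
  show ?thesis using G_rel[OF h(1) r zs] unfolding eq .
 qed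
 ultimately have g: "g \<in> \<G>" by (auto simp: G_iff iso_by_def g_def)
 have "e2 g = s"
 proof (rule extensionalityI[of _ "U \<times> UNIV"])
  show "e2 g \<in> extensional (U \<times> UNIV)" by (simp add: e2_def)
  show "s \<in> extensional (U \<times> UNIV)" using s by (simp add: PiE_iff)
  fix j assume j: "j \<in> U \<times> (UNIV :: bool set)"
  obtain x b where xb: "j = (x, b)" by (cases j)
  have "(\<iota> g) x = g' x" using G_inv_apply[OF g gU(2)] gg' j xb by force
  then show "e2 g j = s j" using j xb by (cases b) (auto simp: e2_def g_def g'_def)
 qed
 then show "s \<in> e2 ` \<G>" using g by blast
qed

lemma topological_group_G: "topological_group G X"
 unfolding topological_group_def
proof (intro conjI)
 show "group G" by (rule G_group)
 show "topspace X = \<G>" by (rule topspace_X)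
 have "continuous_map (prod_topology X X) (ptop (\<G>) (\<lambda>g. g) U U) (\<lambda>(x, y). x \<cdot> y)"
 proof (rule continuous_map_into_ptop[OF G_funcset])
  show "(\<lambda>(x, y). x \<cdot> y) \<in> topspace (prod_topology X X) \<rightarrow> \<G>" by (auto simp: topspace_X)
  fix x p assume x: "x \<in> U" and p: "p \<in> topspace (prod_topology X X)"
  obtain g h where gh: "p = (g, h)" by (cases p)
  define y where "y = (g \<cdot> h) x"
  have "{w \<in> topspace (prod_topology X X). (case w of (x, y) => x \<cdot> y) x = y} =
    (\<Union>u\<in>U. {a \<in> \<G>. a u = y} \<times> {b \<in> \<G>. b x = u})"
   using x by (auto simp: topspace_X G_mult_apply G_closed)
  also have "openin (prod_topology X X) \<dots>"
   using x by (intro openin_Union) (auto simp: openin_prod_Times_iff openin_X_basic)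
  finally show "openin (prod_topology X X) {w \<in> topspace (prod_topology X X). (case w of (x, y) => x \<cdot> y) x = (case p of (x, y) => x \<cdot> y) x}"
   unfolding gh y_def by simp
 qed
 then show "continuous_map (prod_topology X X) X (\<lambda>(x, y). x \<cdot> y)"
  unfolding X_ptop[symmetric] .
 have "continuous_map X (ptop (\<G>) (\<lambda>g. g) U U) (\<lambda>x. \<iota> x)"
 proof (rule continuous_map_into_ptop[OF G_funcset])
  show "(\<lambda>x. \<iota> x) \<in> topspace X \<rightarrow> \<G>" by (auto simp: topspace_X)
  fix x g assume x: "x \<in> U" and "g \<in> topspace X"
  then have g: "g \<in> \<G>" by (simp add: topspace_X)
  have y: "(\<iota> g) x \<in> U" using g x by (simp add: G_closed)
  have "(\<iota> w) x = (\<iota> g) x <-> w ((\<iota> g) x) = x" if "w \<in> \<G>" for w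
   using G_inv_apply[OF that y] G_apply_inv[OF that x] by metis
  then have "{w \<in> topspace X. (\<iota> w) x = (\<iota> g) x} = {w \<in> \<G>. w ((\<iota> g) x) = x}"
   by (auto simp: topspace_X)
  then show "openin X {w \<in> topspace X. (\<iota> w) x = (\<iota> g) x}" using openin_X_basic[OF y] by simp
 qed
 then show "continuous_map X X (\<lambda>x. \<iota> x)" unfolding X_ptop[symmetric] .
qed

section \<open>Topological automorphisms\<close>

abbreviation "A \<equiv> Aut G X"

abbreviation "\<A> \<equiv> carrier A"

abbreviation "invA \<equiv> m_inv A"

abbreviation amult (infixl "\<star>" 70) where "\<F> \<star> \<H> \<equiv> \<F> \<otimes>\<^bsub>A\<^esub> \<H>"

lemma A_iff: "\<F> \<in> \<A> <-> \<F> \<in> hom G G \<and> \<F> \<in> Bij (\<G>) \<and> continuous_map X X \<F>"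
 by (auto simp: Aut_def auto_def)

lemma A_eq: "A = BijGroup (\<G>)\<lparr>carrier := \<A>\<rparr>"
 by (simp add: Aut_def AutoGroup_def)

lemma A_bij: "\<F> \<in> \<A> ==> bij_betw \<F> (\<G>) (\<G>)"
 by (simp add: A_iff Bij_def)

lemma A_closed: "\<F> \<in> \<A> ==> g \<in> \<G> ==> \<F> g \<in> \<G>"
 using A_bij bij_betwE by blast

text \<open>\<open>Aut\<close> asks for continuity only; openness comes from the open mapping
  theorem. This is what makes inverses of continuous automorphisms continuous.\<close>

lemma A_homeomorphic: "\<F> \<in> \<A> ==> homeomorphic_map X X \<F>"
 by (rule bijective_hom_homeomorphic[OF topological_group_G topological_group_G
    completely_metrizable_X second_countable_X completely_metrizable_X])
  (auto simp: A_iff iso_def Bij_def)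

lemma A_group: "group A"
proof -
 interpret BG: group "BijGroup (\<G>)" by (rule group_BijGroup)
 have auto: "subgroup (auto G) (BijGroup (\<G>))" by (rule G.subgroup_auto)
 have "subgroup (\<A>) (BijGroup (\<G>))"
 proof (rule BG.subgroupI)
  show "\<A> \<subseteq> carrier (BijGroup (\<G>))" by (auto simp: A_iff BijGroup_def)
  have "\<one>\<^bsub>BijGroup (\<G>)\<^esub> \<in> auto G" by (rule subgroup.one_closed[OF auto])
  moreover have "continuous_map X X (\<lambda>x\<in>\<G>. x)"
   by (rule continuous_map_eq[OF continuous_map_id]) (simp add: topspace_X)
  ultimately show "\<A> \<noteq> {}" by (auto simp: A_iff auto_def BijGroup_def)
  fix \<F> assume \<F>: "\<F> \<in> \<A>"
  then have \<F>a: "\<F> \<in> auto G" by (simp add: A_iff auto_def)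
  have "inv\<^bsub>BijGroup (\<G>)\<^esub> \<F> \<in> auto G" by (rule subgroup.m_inv_closed[OF auto \<F>a])
  moreover have "continuous_map X X (inv\<^bsub>BijGroup (\<G>)\<^esub> \<F>)"
  proof -
   obtain \<H> where \<H>: "homeomorphic_maps X X \<F> \<H>"
    using A_homeomorphic[OF \<F>] by (auto simp: homeomorphic_map_maps)
   have \<H>_eq: "\<H> y = inv_into (\<G>) \<F> y" if y: "y \<in> \<G>" for y
   proof -
    have "\<H> y \<in> \<G>" "\<F> (\<H> y) = y"
     using \<H> y by (auto simp: homeomorphic_maps_def topspace_X continuous_map_def)
    then show ?thesis using A_bij[OF \<F>] by (metis bij_betw_inv_into_left)
   qed
   have "continuous_map X X (\<lambda>y\<in>\<G>. inv_into (\<G>) \<F> y)"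
   proof -
    have "continuous_map X X \<H>" using \<H> by (simp add: homeomorphic_maps_def)
    then show ?thesis by (rule continuous_map_eq) (simp add: topspace_X \<H>_eq)
   qed
   then show ?thesis using \<F> by (simp add: inv_BijGroup A_iff)
  qed
  ultimately show "inv\<^bsub>BijGroup (\<G>)\<^esub> \<F> \<in> \<A>" by (simp add: A_iff auto_def)
  fix \<H> assume \<H>: "\<H> \<in> \<A>"
  then have \<H>a: "\<H> \<in> auto G" by (simp add: A_iff auto_def)
  have "\<F> \<otimes>\<^bsub>BijGroup (\<G>)\<^esub> \<H> \<in> auto G" by (rule subgroup.m_closed[OF auto \<F>a \<H>a])
  moreover have "\<F> \<otimes>\<^bsub>BijGroup (\<G>)\<^esub> \<H> = compose (\<G>) \<F> \<H>"
   using \<F> \<H> by (simp add: BijGroup_def A_iff)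
  moreover have "continuous_map X X (compose (\<G>) \<F> \<H>)"
  proof -
   have "continuous_map X X (\<F> \<circ> \<H>)"
    using \<F> \<H> by (intro continuous_map_compose[of X X \<H> X \<F>]) (simp_all add: A_iff)
   then show ?thesis by (rule continuous_map_eq) (simp add: topspace_X compose_def)
  qed
  ultimately show "\<F> \<otimes>\<^bsub>BijGroup (\<G>)\<^esub> \<H> \<in> \<A>" by (simp add: A_iff auto_def)
 qed
 then have "group (BijGroup (\<G>)\<lparr>carrier := \<A>\<rparr>)"
  by (rule subgroup.subgroup_is_group[OF _ group_BijGroup])
 then show ?thesis using A_eq by simp
qed

sublocale A: group A by (rule A_group)

lemma A_mult: "\<F> \<in> \<A> ==> \<H> \<in> \<A> ==> \<F> \<star> \<H> = compose (\<G>) \<F> \<H>"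
 by (subst A_eq) (simp add: BijGroup_def A_iff)

lemma A_mult_apply: "\<F> \<in> \<A> ==> \<H> \<in> \<A> ==> g \<in> \<G> ==> (\<F> \<star> \<H>) g = \<F> (\<H> g)"
 by (simp add: A_mult compose_def)

lemma A_one: "g \<in> \<G> ==> \<one>\<^bsub>A\<^esub> g = g"
 by (subst A_eq) (simp add: BijGroup_def)

lemma A_inv_apply: "\<F> \<in> \<A> ==> g \<in> \<G> ==> (invA \<F>) (\<F> g) = g"
 using A_mult_apply[of "invA \<F>" \<F> g] by (simp add: A_one)

lemma A_apply_inv: "\<F> \<in> \<A> ==> g \<in> \<G> ==> \<F> ((invA \<F>) g) = g"
 using A_mult_apply[of \<F> "invA \<F>" g] by (simp add: A_one)

lemma A_ext: "\<F> \<in> \<A> ==> \<H> \<in> \<A> ==> (!!g. g \<in> \<G> ==> \<F> g = \<H> g) ==> \<F> = \<H>"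
 by (rule extensionalityI[of _ "\<G>"]) (simp_all add: A_iff Bij_def)

lemma A_hom: "\<F> \<in> \<A> ==> \<F> \<in> hom G G"
 by (simp add: A_iff)

lemma A_hom_mult: "\<F> \<in> \<A> ==> g \<in> \<G> ==> h \<in> \<G> ==> \<F> (g \<cdot> h) = \<F> g \<cdot> \<F> h"
 by (simp add: A_iff hom_def)

lemma A_group_hom: "\<F> \<in> \<A> ==> group_hom G G \<F>"
 by (simp add: group_hom_def group_hom_axioms_def G_group A_hom)

lemma A_onto: "\<F> \<in> \<A> ==> \<F> ` \<G> = \<G>"
 using A_bij by (simp add: bij_betw_def)

lemma loc_const_continuous:
 assumes "\<F> \<in> \<G> \<rightarrow> \<G>" "loc_const \<F>" shows "continuous_map X X \<F>"
proof -
 have "continuous_map X (ptop (\<G>) (\<lambda>g. g) U U) \<F>"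
 proof (rule continuous_map_into_ptop[OF G_funcset])
  show "\<F> \<in> topspace X \<rightarrow> \<G>" using assms(1) by (simp add: topspace_X)
  fix x g assume x: "x \<in> U" and "g \<in> topspace X"
  obtain F where F: "finite F" "F \<subseteq> U" "\<forall>g\<in>\<G>. \<forall>h\<in>\<G>. (\<forall>z\<in>F. g z = h z) --> \<F> g x = \<F> h x"
   using assms(2) x unfolding loc_const_def by meson
  show "openin X {w \<in> topspace X. \<F> w x = \<F> g x}"
   unfolding openin_X topspace_X
  proof (intro conjI ballI exI[of _ F])
   fix k assume k: "k \<in> {w \<in> \<G>. \<F> w x = \<F> g x}"
   show "{h \<in> \<G>. \<forall>x\<in>F. h x = k x} \<subseteq> {w \<in> \<G>. \<F> w x = \<F> g x}"
   proof
    fix h assume h: "h \<in> {h \<in> \<G>. \<forall>x\<in>F. h x = k x}"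
    then have "\<F> h x = \<F> k x" using F(3) k by blast
    then show "h \<in> {w \<in> \<G>. \<F> w x = \<F> g x}" using h k by simp
   qed
  qed (use F in auto)
 qed
 then show ?thesis by (simp only: X_ptop[symmetric])
qed

text \<open>Continuity at the unit yields a finite set \<open>F\<close> such that elements fixing
  \<open>F\<close> are mapped into the stabilizer of \<open>x\<close>. Two elements that agree on
  \<open>F\<close> differ on the right by such an element.\<close>

lemma A_loc_const:
 assumes \<F>: "\<F> \<in> \<A>" shows "loc_const \<F>"
 unfolding loc_const_def
proof
 interpret \<F>: group_hom G G \<F> using \<F> by (rule A_group_hom)
 fix x assume x: "x \<in> U"
 have "openin X {g \<in> topspace X. \<F> g \<in> {h \<in> \<G>. h x = x}}"
  using \<F> openin_X_basic[OF x] by (intro openin_continuous_map_preimage[of X X]) (simp_all add: A_iff)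
 moreover have "\<one>\<^bsub>G\<^esub> \<in> {g \<in> topspace X. \<F> g \<in> {h \<in> \<G>. h x = x}}"
  using G_one[OF x] by (simp add: topspace_X)
 ultimately obtain F where F: "finite F" "F \<subseteq> U"
  "{h \<in> \<G>. \<forall>x\<in>F. h x = \<one>\<^bsub>G\<^esub> x} \<subseteq> {g \<in> topspace X. \<F> g \<in> {h \<in> \<G>. h x = x}}"
  unfolding openin_X by meson
 have "\<F> g x = \<F> h x" if g: "g \<in> \<G>" and h: "h \<in> \<G>" and eq: "\<forall>z\<in>F. g z = h z" for g h
 proof -
  let ?k = "\<iota> h \<cdot> g"
  have k: "?k \<in> \<G>" using g h by simp
  have "?k z = \<one>\<^bsub>G\<^esub> z" if "z \<in> F" for z
  proof -
   have "z \<in> U" using F(2) that by blast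
   then show ?thesis using G_mult_apply[of "\<iota> h" g z] g h eq that by (simp add: G_inv_apply G_one)
  qed
  then have "\<F> ?k x = x" using F(3) k by blast
  moreover have "h \<cdot> ?k = g" using g h by (simp add: G.m_assoc[symmetric])
  then have "\<F> g = \<F> h \<cdot> \<F> ?k" using A_hom_mult[OF \<F> h k] by simp
  ultimately show ?thesis using G_mult_apply[OF A_closed[OF \<F> h] A_closed[OF \<F> k] x] by simp
 qed
 then show "\<exists>F. finite F \<and> F \<subseteq> U \<and>
   (\<forall>g\<in>\<G>. \<forall>h\<in>\<G>. (\<forall>z\<in>F. g z = h z) --> \<F> g x = \<F> h x)"
  using F(1,2) by (intro exI[of _ F] conjI ballI impI)
qed

section \<open>Open cosets\<close>

text \<open>Chosen because it is countable (\<open>countable_cosets\<close>), is permuted by the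
  continuous automorphisms (\<open>open_coset_image\<close>), and contains the sets prescribing one
  value (\<open>basic_coset\<close>), so that an automorphism is determined by its action.\<close>

definition cosets :: "('a => 'a) set set" where
 "cosets = {g <#\<^bsub>G\<^esub> V | g V. g \<in> \<G> \<and> subgroup V G \<and> openin X V}"

lemma open_coset_subset: "B \<in> cosets ==> B \<subseteq> \<G>"
 unfolding cosets_def by (elim CollectE exE conjE) (simp add: G.l_coset_subset_G subgroup.subset)

lemma l_coset_mem:
 assumes V: "subgroup V G" and g: "g \<in> \<G>" and h: "h \<in> \<G>"
 shows "h \<in> g <#\<^bsub>G\<^esub> V <-> \<iota> g \<cdot> h \<in> V"
proof -
 have *: "h = g \<cdot> v <-> v = \<iota> g \<cdot> h" if "v \<in> V" for v
  using G.inv_solve_left[OF subgroup.mem_carrier[OF V that] g h] by simp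
 have "h \<in> g <#\<^bsub>G\<^esub> V <-> (\<exists>v\<in>V. h = g \<cdot> v)" unfolding l_coset_def by blast
 also have "\<dots> <-> (\<exists>v\<in>V. v = \<iota> g \<cdot> h)" using * by blast
 finally show ?thesis by blast
qed

lemma open_subgroup_support:
 assumes "subgroup V G" "openin X V"
 obtains F where "finite F" "F \<subseteq> U" "!!g. g \<in> \<G> ==> (!!z. z \<in> F ==> g z = z) ==> g \<in> V"
proof -
 have "\<one>\<^bsub>G\<^esub> \<in> V" using assms(1) by (rule subgroup.one_closed)
 then obtain F where F: "finite F" "F \<subseteq> U" "{h \<in> \<G>. \<forall>x\<in>F. h x = \<one>\<^bsub>G\<^esub> x} \<subseteq> V"
  using assms(2) unfolding openin_X by meson
 have "g \<in> V" if "g \<in> \<G>" "!!z. z \<in> F ==> g z = z" for g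
  using F(2,3) that G_one by (auto simp: subset_iff)
 then show thesis using that F(1,2) by blast
qed

lemma open_coset_support:
 assumes "B \<in> cosets"
 obtains F where "finite F" "F \<subseteq> U"
  "!!g h. g \<in> \<G> ==> h \<in> \<G> ==> (!!z. z \<in> F ==> g z = h z) ==> g \<in> B <-> h \<in> B"
proof -
 obtain k V where k: "k \<in> \<G>" and V: "subgroup V G" "openin X V" and B: "B = k <#\<^bsub>G\<^esub> V"
  using assms by (auto simp: cosets_def)
 obtain F where F: "finite F" "F \<subseteq> U" "!!g. g \<in> \<G> ==> (!!z. z \<in> F ==> g z = z) ==> g \<in> V"
  using open_subgroup_support[OF V] by metis
 have imp: "h \<in> B" if g: "g \<in> \<G>" and h: "h \<in> \<G>" and eq: "!!z. z \<in> F ==> g z = h z" and gB: "g \<in> B" for g h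
 proof -
  have "\<iota> g \<cdot> h \<in> V"
  proof (rule F(3))
   show "\<iota> g \<cdot> h \<in> \<G>" using g h by simp
   fix z assume z: "z \<in> F"
   then have "z \<in> U" using F(2) by blast
   then show "(\<iota> g \<cdot> h) z = z"
    using G_mult_apply[of "\<iota> g" h z] g h eq[OF z, symmetric] by (simp add: G_inv_apply)
  qed
  moreover have "\<iota> k \<cdot> g \<in> V" using l_coset_mem[OF V(1) k g] gB B by simp
  ultimately have "(\<iota> k \<cdot> g) \<cdot> (\<iota> g \<cdot> h) \<in> V"
   by (rule subgroup.m_closed[OF V(1), rotated])
  moreover have "(\<iota> k \<cdot> g) \<cdot> (\<iota> g \<cdot> h) = \<iota> k \<cdot> h"
  proof -
   have "g \<cdot> (\<iota> g \<cdot> h) = h" using g h by (simp add: G.m_assoc[symmetric])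
   then show ?thesis using g h k by (simp add: G.m_assoc)
  qed
  ultimately show ?thesis using l_coset_mem[OF V(1) k h] B by simp
 qed
 show thesis
 proof (rule that[OF F(1,2)])
  fix g h assume g: "g \<in> \<G>" and h: "h \<in> \<G>" and eq: "!!z. z \<in> F ==> g z = h z"
  show "g \<in> B <-> h \<in> B" using imp[OF g h eq] imp[OF h g eq[symmetric]] by blast
 qed
qed

text \<open>If the open subgroup \<open>V\<close> contains every element fixing \<open>t\<close>,
  then the pairs of tuples \<open>map a t\<close>, \<open>map (a \<cdot> v) t\<close> with
  \<open>v\<close> in \<open>V\<close> form an invariant, hence definable set. A coset is thus given
  by two tuples and a formula, which yields countability and later makes cosets respond to
  permutations preserving that formula.\<close>

lemma open_coset_definable:
 assumes "B \<in> cosets"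
 obtains n s t \<f> where "s \<in> tuples M n" "t \<in> tuples M n" "wff L (n + n) \<f>"
  "B = {h \<in> \<G>. sat M (s @ map h t) \<f>}"
proof -
 obtain g V where g: "g \<in> \<G>" and V: "subgroup V G" "openin X V" and B: "B = g <#\<^bsub>G\<^esub> V"
  using assms by (auto simp: cosets_def)
 obtain F where F: "finite F" "F \<subseteq> U" "!!g. g \<in> \<G> ==> (!!z. z \<in> F ==> g z = z) ==> g \<in> V"
  using open_subgroup_support[OF V] by metis
 obtain t where t: "set t = F" using finite_list[OF F(1)] by blast
 define n where "n = length t"
 have tt: "t \<in> tuples M n" using t F(2) by (simp add: tuples_def n_def)
 have VG: "v \<in> \<G>" if "v \<in> V" for v using V(1) that by (rule subgroup.mem_carrier)
 \<comment> \<open>Elements agreeing on \<open>t\<close> lie in the same left coset of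
   \<open>V\<close>.\<close>
 have fixV: "\<iota> a \<cdot> b \<in> V" if a: "a \<in> \<G>" and b: "b \<in> \<G>" and eq: "map a t = map b t" for a b
 proof (rule F(3))
  show "\<iota> a \<cdot> b \<in> \<G>" using a b by simp
  fix z assume "z \<in> F"
  then have "z \<in> U" "a z = b z" using F(2) t eq by auto
  then show "(\<iota> a \<cdot> b) z = z"
   using G_mult_apply[of "\<iota> a" b z] a b G_inv_apply[OF a, of z] by simp
 qed
 define S where "S = {map a t @ map (a \<cdot> v) t | a v. a \<in> \<G> \<and> v \<in> V}"
 have S_sub: "S \<subseteq> tuples M (n + n)"
 proof
  fix zs assume "zs \<in> S"
  then obtain a v where av: "a \<in> \<G>" "v \<in> V" "zs = map a t @ map (a \<cdot> v) t" by (auto simp: S_def)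
  have "map a t \<in> tuples M n" "map (a \<cdot> v) t \<in> tuples M n"
   using map_G_tuples tt av(1,2) VG by auto
  then show "zs \<in> tuples M (n + n)" unfolding av(3) by (simp add: tuples_def)
 qed
 have S_inv: "map b zs \<in> S" if b: "b \<in> \<G>" and zs: "zs \<in> S" for b zs
 proof -
  obtain a v where av: "a \<in> \<G>" "v \<in> V" "zs = map a t @ map (a \<cdot> v) t"
   using zs by (auto simp: S_def)
  have "map b zs = map (b \<cdot> a) t @ map ((b \<cdot> a) \<cdot> v) t"
   using av b VG[OF av(2)] G_map_mult[OF b av(1), of t] G_map_mult[OF b G.m_closed[OF av(1) VG[OF av(2)]], of t] tt
   by (simp add: tuples_def G.m_assoc del: map_map map_eq_conv)
  then show ?thesis unfolding S_def using b av by blast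
 qed
 have mem: "h \<in> B <-> map g t @ map h t \<in> S" if h: "h \<in> \<G>" for h
 proof
  assume "h \<in> B"
  then obtain v where "v \<in> V" "h = g \<cdot> v" using B by (auto simp: l_coset_def)
  then show "map g t @ map h t \<in> S" using g by (auto simp: S_def)
 next
  assume "map g t @ map h t \<in> S"
  then obtain a v where av: "a \<in> \<G>" "v \<in> V" "map g t @ map h t = map a t @ map (a \<cdot> v) t"
   by (auto simp: S_def)
  have v: "v \<in> \<G>" by (rule VG[OF av(2)])
  have eq: "map g t = map a t" "map (a \<cdot> v) t = map h t" using av(3) by auto
  have "\<iota> g \<cdot> a \<in> V" using fixV[OF g av(1) eq(1)] .
  moreover have "\<iota> (a \<cdot> v) \<cdot> h \<in> V" using fixV[OF _ h eq(2)] av(1) v by simp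
  ultimately have "(\<iota> g \<cdot> a) \<cdot> (v \<cdot> (\<iota> (a \<cdot> v) \<cdot> h)) \<in> V"
   using av(2) subgroup.m_closed[OF V(1)] by blast
  moreover have "(\<iota> g \<cdot> a) \<cdot> (v \<cdot> (\<iota> (a \<cdot> v) \<cdot> h)) =
    \<iota> g \<cdot> ((a \<cdot> v) \<cdot> (\<iota> (a \<cdot> v) \<cdot> h))"
   using g h av(1) v by (simp add: G.m_assoc)
  moreover have "(a \<cdot> v) \<cdot> (\<iota> (a \<cdot> v) \<cdot> h) = h"
   using h av(1) v G.m_assoc[of "a \<cdot> v" "\<iota> (a \<cdot> v)" h] by simp
  ultimately show "h \<in> B" using l_coset_mem[OF V(1) g h] B by simp
 qed
 show thesis
 proof (rule definable[OF S_sub])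
  show "map b zs \<in> S" if "b \<in> \<G>" "zs \<in> S" for b zs using S_inv that .
  fix \<f> assume \<f>: "wff L (n + n) \<f>" and sat: "!!xs. xs \<in> tuples M (n + n) ==> sat M xs \<f> <-> xs \<in> S"
  have "h \<in> B <-> sat M (map g t @ map h t) \<f>" if h: "h \<in> \<G>" for h
  proof -
   have "map g t @ map h t \<in> tuples M (n + n)"
    using map_G_tuples[OF g tt] map_G_tuples[OF h tt] by (auto simp: tuples_def)
   then show ?thesis using mem[OF h] sat by simp
  qed
  then have "B = {h \<in> \<G>. sat M (map g t @ map h t) \<f>}" using open_coset_subset[OF assms] by blast
  then show thesis using that[OF map_G_tuples[OF g tt] tt \<f>] by blast
 qed
qed

lemma countable_cosets: "countable cosets"
proof -
 define E where "E = (\<lambda>(s, t, \<f>). {h \<in> \<G>. sat M (s @ map h t) \<f>})"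
 have "cosets \<subseteq> E ` (lists U \<times> lists U \<times> {\<f>. \<exists>n. wff L n \<f>})"
 proof
  fix B assume "B \<in> cosets"
  then obtain n s t \<f> where B: "s \<in> tuples M n" "t \<in> tuples M n" "wff L (n + n) \<f>"
   "B = {h \<in> \<G>. sat M (s @ map h t) \<f>}" by (rule open_coset_definable)
  then have "B = E (s, t, \<f>)" "(s, t, \<f>) \<in> lists U \<times> lists U \<times> {\<f>. \<exists>n. wff L n \<f>}"
   by (auto simp: E_def tuples_def)
  then show "B \<in> E ` (lists U \<times> lists U \<times> {\<f>. \<exists>n. wff L n \<f>})" by blast
 qed
 moreover have "countable (lists U \<times> lists U \<times> {\<f>. \<exists>n. wff L n \<f>})"
  using cnt countable_fms by (intro countable_SIGMA countable_lists)
 ultimately show ?thesis using countable_subset countable_image by meson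
qed

lemma basic_coset: "x \<in> U ==> g \<in> \<G> ==> {h \<in> \<G>. h x = g x} \<in> cosets"
proof -
 assume x: "x \<in> U" and g: "g \<in> \<G>"
 define V where "V = {h \<in> \<G>. h x = x}"
 have V: "subgroup V G"
 proof (rule G.subgroupI)
  show "V \<noteq> {}" using G_one[OF x] by (auto simp: V_def)
  show "\<iota> a \<in> V" if "a \<in> V" for a using that G_inv_apply[of a x] x by (auto simp: V_def)
  show "a \<cdot> b \<in> V" if "a \<in> V" "b \<in> V" for a b using that x by (auto simp: V_def G_mult_apply)
 qed (auto simp: V_def)
 have "g <#\<^bsub>G\<^esub> V = {h \<in> \<G>. h x = g x}"
 proof (intro equalityI subsetI)
  fix h assume "h \<in> g <#\<^bsub>G\<^esub> V"
  then show "h \<in> {h \<in> \<G>. h x = g x}" using g x by (auto simp: l_coset_def V_def G_mult_apply)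
 next
  fix h assume h: "h \<in> {h \<in> \<G>. h x = g x}"
  then have "\<iota> g \<cdot> h \<in> V" using g x by (simp add: V_def G_mult_apply G_inv_apply)
  then show "h \<in> g <#\<^bsub>G\<^esub> V" using l_coset_mem[OF V g] h by blast
 qed
 moreover have "openin X V" unfolding V_def using x by (rule openin_X_basic)
 ultimately show ?thesis unfolding cosets_def using V g by blast
qed

lemma open_coset_image:
 assumes \<F>: "\<F> \<in> \<A>" and B: "B \<in> cosets" shows "\<F> ` B \<in> cosets"
proof -
 interpret \<F>: group_hom G G \<F> using \<F> by (rule A_group_hom)
 obtain g V where g: "g \<in> \<G>" and V: "subgroup V G" "openin X V" and B': "B = g <#\<^bsub>G\<^esub> V"
  using B by (auto simp: cosets_def)
 have VG: "V \<subseteq> \<G>" using V(1) by (rule subgroup.subset)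
 have "\<F> ` B = \<F> g <#\<^bsub>G\<^esub> (\<F> ` V)"
 proof -
  have "\<F> ` B = (\<lambda>v. \<F> (g \<cdot> v)) ` V" unfolding B' l_coset_def by auto
  also have "\<dots> = (\<lambda>v. \<F> g \<cdot> \<F> v) ` V" using g VG by (intro image_cong) auto
  finally show ?thesis unfolding l_coset_def by auto
 qed
 moreover have "subgroup (\<F> ` V) G" using V(1) by (rule \<F>.subgroup_img_is_subgroup)
 moreover have "openin X (\<F> ` V)"
  using A_homeomorphic[OF \<F>] V(2) homeomorphic_imp_open_map open_map_def by blast
 ultimately show ?thesis unfolding cosets_def using A_closed[OF \<F> g] by blast
qed

lemma vimage_A:
 assumes \<F>: "\<F> \<in> \<A>" and B: "B \<subseteq> \<G>"
 shows "{x \<in> \<G>. \<F> x \<in> B} = (invA \<F>) ` B" "{x \<in> \<G>. (invA \<F>) x \<in> B} = \<F> ` B"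
proof -
 have *: "{x \<in> \<G>. \<F> x \<in> B} = (invA \<F>) ` B" if \<F>: "\<F> \<in> \<A>" for \<F>
 proof (intro equalityI subsetI)
  fix x assume "x \<in> {x \<in> \<G>. \<F> x \<in> B}"
  then show "x \<in> (invA \<F>) ` B" using A_inv_apply[OF \<F>, of x] by (metis (no_types, lifting) imageI mem_Collect_eq)
 next
  fix x assume "x \<in> (invA \<F>) ` B"
  then show "x \<in> {x \<in> \<G>. \<F> x \<in> B}" using \<F> B A_apply_inv[OF \<F>] A_closed[OF A.inv_closed[OF \<F>]] by auto
 qed
 show "{x \<in> \<G>. \<F> x \<in> B} = (invA \<F>) ` B" by (rule *[OF \<F>])
 show "{x \<in> \<G>. (invA \<F>) x \<in> B} = \<F> ` B" using *[OF A.inv_closed[OF \<F>]] \<F> by simp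
qed

lemma open_coset_vimage:
 "\<F> \<in> \<A> ==> B \<in> cosets ==> {x \<in> \<G>. \<F> x \<in> B} \<in> cosets"
 using vimage_A(1)[OF _ open_coset_subset] open_coset_image[OF A.inv_closed] by simp

section \<open>The topology of the group of automorphisms\<close>

text \<open>The Boolean selects images or preimages. As with \<open>e2\<close>, recording both
  directions makes the set of actions closed; it also makes inversion a mere swap of
  coordinates.\<close>

definition act :: "(('a => 'a) => 'a => 'a) => ('a => 'a) set \<times> bool => ('a => 'a) set" where
 "act \<F> = (\<lambda>j\<in>cosets \<times> UNIV. if snd j then \<F> ` fst j else {x \<in> \<G>. \<F> x \<in> fst j})"

abbreviation "J \<equiv> cosets \<times> (UNIV :: bool set)"

definition AT :: "(('a => 'a) => 'a => 'a) topology" where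
 "AT = ptop (\<A>) act J cosets"

lemma act_True: "B \<in> cosets ==> act \<F> (B, True) = \<F> ` B"
 by (simp add: act_def)

lemma act_False: "B \<in> cosets ==> act \<F> (B, False) = {x \<in> \<G>. \<F> x \<in> B}"
 by (simp add: act_def)

lemma act_funcset: "act \<in> \<A> \<rightarrow> (J \<rightarrow>\<^sub>E cosets)"
 unfolding act_def
 by (intro Pi_I restrict_PiE_iff[THEN iffD2] ballI) (auto intro: open_coset_image open_coset_vimage)

lemma topspace_AT: "topspace AT = \<A>"
 unfolding AT_def by (rule topspace_ptop[OF act_funcset])

lemma openin_AT: "openin AT S <-> S \<subseteq> \<A> \<and>
  (\<forall>\<F>\<in>S. \<exists>F. finite F \<and> F \<subseteq> J \<and> {\<H> \<in> \<A>. \<forall>j\<in>F. act \<H> j = act \<F> j} \<subseteq> S)"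
 unfolding AT_def by (rule openin_ptop[OF act_funcset])

lemma openin_coset_basic: "j \<in> J ==> openin AT {\<F> \<in> \<A>. act \<F> j = C}"
 unfolding AT_def
 using openin_ptop_basic[OF act_funcset, of "{j}" "\<lambda>_. C"] by simp

lemma act_inv:
 assumes "\<F> \<in> \<A>" "B \<in> cosets"
 shows "act (invA \<F>) (B, b) = act \<F> (B, \<not> b)"
 using vimage_A[OF assms(1) open_coset_subset[OF assms(2)]] assms(2)
 by (cases b) (simp_all add: act_def)

lemma act_mult:
 assumes "\<F> \<in> \<A>" "\<H> \<in> \<A>" "B \<in> cosets"
 shows "act (\<F> \<star> \<H>) (B, True) = act \<F> (act \<H> (B, True), True)"
  and "act (\<F> \<star> \<H>) (B, False) = act \<H> (act \<F> (B, False), False)"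
proof -
 have B: "B \<subseteq> \<G>" using assms(3) by (rule open_coset_subset)
 have "(\<F> \<star> \<H>) ` B = \<F> ` \<H> ` B"
  unfolding image_image using B assms(1,2) by (intro image_cong refl) (auto simp: A_mult_apply)
 then show "act (\<F> \<star> \<H>) (B, True) = act \<F> (act \<H> (B, True), True)"
  using assms by (simp add: act_True open_coset_image)
 have "{x \<in> \<G>. (\<F> \<star> \<H>) x \<in> B} = {x \<in> \<G>. \<H> x \<in> {x \<in> \<G>. \<F> x \<in> B}}"
  using assms(1,2) by (auto simp: A_mult_apply A_closed)
 then show "act (\<F> \<star> \<H>) (B, False) = act \<H> (act \<F> (B, False), False)"
  using assms by (simp add: act_False open_coset_vimage)
qed

lemma topological_group_coset: "topological_group A AT"
 unfolding topological_group_def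
proof (intro conjI)
 let ?Y = AT
 show "group A" by (rule A_group)
 show "topspace ?Y = \<A>" by (rule topspace_AT)
 have "continuous_map (prod_topology ?Y ?Y) (ptop (\<A>) act J cosets) (\<lambda>(x, y). x \<star> y)"
 proof (rule continuous_map_into_ptop[OF act_funcset])
  show "(\<lambda>(x, y). x \<star> y) \<in> topspace (prod_topology ?Y ?Y) \<rightarrow> \<A>"
   by (auto simp: topspace_AT)
  fix j p assume j: "j \<in> J" and "p \<in> topspace (prod_topology ?Y ?Y)"
  obtain B b where B: "j = (B, b)" "B \<in> cosets" using j by (cases j) auto
  define C where "C = act (case p of (x, y) => x \<star> y) j"
  have m: "act \<F> (B', b') \<in> cosets" if "\<F> \<in> \<A>" "B' \<in> cosets" for \<F> B' b'
   using act_funcset that by (auto dest!: funcset_mem PiE_mem)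
  \<comment> \<open>Split according to the intermediate coset \<open>D\<close>; each piece is a
    rectangle of basic open sets.\<close>
  have eq: "{w \<in> topspace (prod_topology ?Y ?Y). act (case w of (x, y) => x \<star> y) j = C} =
   (if b then \<Union>D\<in>cosets. {\<F> \<in> \<A>. act \<F> (D, True) = C} \<times> {\<H> \<in> \<A>. act \<H> (B, True) = D}
    else \<Union>D\<in>cosets. {\<F> \<in> \<A>. act \<F> (B, False) = D} \<times> {\<H> \<in> \<A>. act \<H> (D, False) = C})" (is "_ = ?R")
   using B m by (cases b) (auto simp: topspace_AT act_mult)
  have op: "openin (prod_topology ?Y ?Y) ?R"
   using B(2) by (cases b) (auto intro!: openin_Union simp: openin_prod_Times_iff openin_coset_basic)
  show "openin (prod_topology ?Y ?Y) {w \<in> topspace (prod_topology ?Y ?Y).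
    act (case w of (x, y) => x \<star> y) j = act (case p of (x, y) => x \<star> y) j}"
   unfolding C_def[symmetric] eq by (rule op)
 qed
 then show "continuous_map (prod_topology ?Y ?Y) ?Y (\<lambda>(x, y). x \<star> y)"
  unfolding AT_def .
 have "continuous_map ?Y (ptop (\<A>) act J cosets) (\<lambda>x. invA x)"
 proof (rule continuous_map_into_ptop[OF act_funcset])
  show "(\<lambda>x. invA x) \<in> topspace ?Y \<rightarrow> \<A>" by (auto simp: topspace_AT)
  fix j \<F> assume j: "j \<in> J"
  obtain B b where B: "j = (B, b)" "B \<in> cosets" using j by (cases j) auto
  define C where "C = act (invA \<F>) j"
  have "act (invA w) j = act w (B, \<not> b)" if "w \<in> \<A>" for w
   unfolding B(1) by (rule act_inv[OF that B(2)])
  then have "{w \<in> topspace ?Y. act (invA w) j = C} = {w \<in> \<A>. act w (B, \<not> b) = C}"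
   unfolding topspace_AT by (intro Collect_cong conj_cong refl) simp
  moreover have "openin ?Y {w \<in> \<A>. act w (B, \<not> b) = C}"
   by (rule openin_coset_basic) (simp add: B(2))
  ultimately show "openin ?Y {w \<in> topspace ?Y. act (invA w) j = act (invA \<F>) j}"
   unfolding C_def[symmetric] by (simp only:)
 qed
 then show "continuous_map ?Y ?Y (\<lambda>x. invA x)" unfolding AT_def .
qed

lemma coset_value:
 assumes \<F>: "\<F> \<in> \<A>" and g: "g \<in> \<G>" and x: "x \<in> U"
 shows "{h \<in> \<G>. \<F> h x = \<F> g x} \<in> cosets"
  "{k \<in> \<G>. \<F> k \<in> {h \<in> \<G>. h x = \<F> g x}} = {h \<in> \<G>. \<F> h x = \<F> g x}"
proof -
 show e: "{k \<in> \<G>. \<F> k \<in> {h \<in> \<G>. h x = \<F> g x}} = {h \<in> \<G>. \<F> h x = \<F> g x}"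
  using A_closed[OF \<F>] by auto
 show "{h \<in> \<G>. \<F> h x = \<F> g x} \<in> cosets"
  using open_coset_vimage[OF \<F> basic_coset[OF x A_closed[OF \<F> g]]] unfolding e .
qed

lemma continuous_action: "continuous_map (prod_topology AT X) X (\<lambda>(\<F>, g). \<F> g)"
proof -
 let ?P = "prod_topology AT X"
 have "continuous_map ?P (ptop (\<G>) (\<lambda>g. g) U U) (\<lambda>(\<F>, g). \<F> g)"
 proof (rule continuous_map_into_ptop[OF G_funcset])
  show "(\<lambda>(\<F>, g). \<F> g) \<in> topspace ?P \<rightarrow> \<G>"
   by (auto simp: topspace_AT topspace_X A_closed)
  fix x p assume x: "x \<in> U" and p: "p \<in> topspace ?P"
  show "openin ?P {w \<in> topspace ?P. (case w of (\<F>, g) => \<F> g) x = (case p of (\<F>, g) => \<F> g) x}"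
  proof (subst openin_subopen, intro ballI)
   fix w assume w: "w \<in> {w \<in> topspace ?P. (case w of (\<F>, g) => \<F> g) x = (case p of (\<F>, g) => \<F> g) x}"
   obtain \<F> g where \<F>g: "w = (\<F>, g)" by (cases w)
   have \<F>: "\<F> \<in> \<A>" and g: "g \<in> \<G>"
    using w \<F>g by (auto simp: topspace_AT topspace_X)
   have eq: "(case p of (\<F>, g) => \<F> g) x = \<F> g x" using w \<F>g by auto
   define B where "B = {h \<in> \<G>. h x = \<F> g x}"
   define C where "C = {h \<in> \<G>. \<F> h x = \<F> g x}"
   have B: "B \<in> cosets" unfolding B_def by (rule basic_coset[OF x A_closed[OF \<F> g]])
   have C: "C \<in> cosets" unfolding C_def by (rule coset_value[OF \<F> g x])
   have act: "act \<F> (B, False) = C"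
    unfolding act_False[OF B] unfolding B_def C_def by (rule coset_value(2)[OF \<F> g x])
   \<comment> \<open>An automorphism for which \<open>B\<close> has preimage \<open>C\<close> maps
     all of \<open>C\<close> into \<open>B\<close>, so the value at \<open>x\<close> is constant on
     this open rectangle.\<close>
   define O' where "O' = {\<H> \<in> \<A>. act \<H> (B, False) = C} \<times> C"
   have "openin ?P O'"
   proof -
    have "openin X C" using coset_value[OF \<F> g x] \<F> openin_X_basic[OF x, of "\<F> g x"]
      openin_continuous_map_preimage[of X X \<F> "{h \<in> \<G>. h x = \<F> g x}"]
     by (simp add: A_iff topspace_X C_def)
    then show ?thesis unfolding O'_def using B by (simp add: openin_prod_Times_iff openin_coset_basic)
   qed
   moreover have "w \<in> O'" using \<F> g act by (simp add: \<F>g O'_def C_def)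
   moreover have "O' \<subseteq> {w \<in> topspace ?P. (case w of (\<F>, g) => \<F> g) x = (case p of (\<F>, g) => \<F> g) x}"
   proof
    fix v assume "v \<in> O'"
    then obtain \<H> h where v: "v = (\<H>, h)" "\<H> \<in> \<A>" "act \<H> (B, False) = C" "h \<in> C"
     by (auto simp: O'_def)
    then have "h \<in> {x \<in> \<G>. \<H> x \<in> B}" by (simp add: act_False[OF B])
    then show "v \<in> {w \<in> topspace ?P. (case w of (\<F>, g) => \<F> g) x = (case p of (\<F>, g) => \<F> g) x}"
     using v(1,2) by (auto simp: B_def eq topspace_AT topspace_X)
   qed
   ultimately show "\<exists>O'. openin ?P O' \<and> w \<in> O' \<and> O' \<subseteq> {w \<in> topspace ?P. (case w of (\<F>, g) => \<F> g) x = (case p of (\<F>, g) => \<F> g) x}"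
    by blast
  qed
 qed
 then show ?thesis unfolding X_ptop[symmetric] .
qed

lemma second_countable_coset: "second_countable AT"
 unfolding AT_def
 using countable_cosets
 by (intro second_countable_ptop[OF act_funcset] countable_SIGMA) auto

text \<open>Here \<open>s\<close> is a limit of actions of automorphisms on the open cosets. The value of the
 limiting automorphism at \<open>g\<close> is read off from the images of the cosets of the preimages of the
 stabilizers.\<close>

lemma limit_values:
 assumes appr: "!!F. finite F ==> F \<subseteq> J ==> \<exists>\<F>\<in>\<A>. \<forall>j\<in>F. act \<F> j = s j"
 obtains \<W> where "\<W> \<in> extensional (\<G>)"
  "!!g x. g \<in> \<G> ==> x \<in> U ==> \<exists>F. finite F \<and> F \<subseteq> J \<and>
   (\<forall>\<F>\<in>\<A>. (\<forall>j\<in>F. act \<F> j = s j) --> \<F> g x = \<W> g x)"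
  "loc_const \<W>"
proof -
 define stab where "stab x = {h \<in> \<G>. h x = x}" for x
 have stab: "stab x \<in> cosets" if "x \<in> U" for x
  using basic_coset[OF that G.one_closed] G_one[OF that] by (simp add: stab_def)
 \<comment> \<open>A single coordinate of \<open>s\<close> is attained by an actual automorphism, so
   the limit of the preimages of the stabilizer of \<open>x\<close> is an open subgroup.\<close>
 have "\<exists>V. \<forall>x\<in>U. s (stab x, False) = V x \<and> V x \<in> cosets \<and> subgroup (V x) G \<and> openin X (V x)"
 proof (intro exI[of _ "\<lambda>x. s (stab x, False)"] ballI)
  fix x assume x: "x \<in> U"
  obtain \<F> where \<F>: "\<F> \<in> \<A>" "act \<F> (stab x, False) = s (stab x, False)"
  proof -
   have "\<exists>\<F>\<in>\<A>. \<forall>j\<in>{(stab x, False)}. act \<F> j = s j"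
    by (rule appr) (simp_all add: stab[OF x])
   then show thesis by (elim bexE) (rule that, simp_all)
  qed
  interpret \<F>: group_hom G G \<F> using \<F>(1) by (rule A_group_hom)
  have V: "s (stab x, False) = {g \<in> \<G>. \<F> g x = x}"
  proof -
   have "s (stab x, False) = {k \<in> \<G>. \<F> k \<in> stab x}"
    unfolding \<F>(2)[symmetric] by (rule act_False[OF stab[OF x]])
   also have "\<dots> = {g \<in> \<G>. \<F> g x = x}" using A_closed[OF \<F>(1)] unfolding stab_def by blast
   finally show ?thesis .
  qed
  have "subgroup {g \<in> \<G>. \<F> g x = x} G"
  proof (rule G.subgroupI)
   show "{g \<in> \<G>. \<F> g x = x} \<noteq> {}" using G_one[OF x] \<F>.hom_one by force
   show "\<iota> a \<in> {g \<in> \<G>. \<F> g x = x}" if "a \<in> {g \<in> \<G>. \<F> g x = x}" for a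
    using that G_inv_apply[OF A_closed[OF \<F>(1)], of a x] x by simp
   show "a \<cdot> b \<in> {g \<in> \<G>. \<F> g x = x}"
    if "a \<in> {g \<in> \<G>. \<F> g x = x}" "b \<in> {g \<in> \<G>. \<F> g x = x}" for a b
    using that x A_closed[OF \<F>(1)] by (simp add: G_mult_apply)
  qed auto
  moreover have "openin X {g \<in> \<G>. \<F> g x = x}"
  proof -
   have "openin X {g \<in> topspace X. \<F> g \<in> stab x}"
    using \<F>(1) openin_X_basic[OF x, of x] unfolding stab_def
    by (intro openin_continuous_map_preimage[of X X]) (simp_all add: A_iff)
   moreover have "{g \<in> topspace X. \<F> g \<in> stab x} = {g \<in> \<G>. \<F> g x = x}"
    using A_closed[OF \<F>(1)] by (auto simp: topspace_X stab_def)
   ultimately show ?thesis by simp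
  qed
  moreover have "s (stab x, False) \<in> cosets"
   unfolding \<F>(2)[symmetric]
   by (rule PiE_mem[OF funcset_mem[OF act_funcset \<F>(1)]]) (simp add: stab[OF x])
  ultimately show "s (stab x, False) = s (stab x, False) \<and> s (stab x, False) \<in> cosets \<and>
   subgroup (s (stab x, False)) G \<and> openin X (s (stab x, False))" using V by simp
 qed
 then obtain V where V: "!!x. x \<in> U ==> s (stab x, False) = V x" "!!x. x \<in> U ==> V x \<in> cosets"
  "!!x. x \<in> U ==> subgroup (V x) G" "!!x. x \<in> U ==> openin X (V x)" by blast
 have cosetV: "g <#\<^bsub>G\<^esub> V x \<in> cosets" if "x \<in> U" "g \<in> \<G>" for x g
  unfolding cosets_def using V(3,4)[OF that(1)] that(2) by blast
 \<comment> \<open>All members of the image coset take the same value at \<open>x\<close>, so it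
   does not matter which \<open>h\<close> is chosen.\<close>
 define \<W> where "\<W> = (\<lambda>g\<in>\<G>. \<lambda>x\<in>U. SOME y. \<exists>h\<in>s (g <#\<^bsub>G\<^esub> V x, True). y = h x)"
 have key: "\<F> g x = \<W> g x"
  if g: "g \<in> \<G>" and x: "x \<in> U" and \<F>: "\<F> \<in> \<A>"
   and eq: "\<forall>j\<in>{(stab x, False), (g <#\<^bsub>G\<^esub> V x, True)}. act \<F> j = s j" for \<F> g x
 proof -
  have Vx: "V x = {h \<in> \<G>. \<F> h \<in> stab x}"
   using eq V(1)[OF x] by (simp add: act_False[OF stab[OF x]])
  have im: "s (g <#\<^bsub>G\<^esub> V x, True) = \<F> ` (g <#\<^bsub>G\<^esub> V x)"
   using eq by (simp add: act_True[OF cosetV[OF x g]])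
  have val: "h x = \<F> g x" if h: "h \<in> s (g <#\<^bsub>G\<^esub> V x, True)" for h
  proof -
   obtain v where v: "v \<in> V x" "h = \<F> (g \<cdot> v)" 
    using h[unfolded im] by (elim imageE) (unfold l_coset_def, blast intro: that)
   then have "v \<in> \<G>" "\<F> v x = x" using Vx by (auto simp: stab_def)
   then show ?thesis using v(2) g x \<F> by (simp add: A_hom_mult G_mult_apply A_closed)
  qed
  have "g \<in> g <#\<^bsub>G\<^esub> V x" using l_coset_mem[OF V(3)[OF x] g g] g subgroup.one_closed[OF V(3)[OF x]] by simp
  then have "\<exists>y. \<exists>h\<in>s (g <#\<^bsub>G\<^esub> V x, True). y = h x" unfolding im by blast
  from someI_ex[OF this] show ?thesis using val g x by (auto simp: \<W>_def)
 qed
 show thesis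
 proof (rule that)
  show "\<W> \<in> extensional (\<G>)" by (simp add: \<W>_def)
  show "\<exists>F. finite F \<and> F \<subseteq> J \<and>
   (\<forall>\<F>\<in>\<A>. (\<forall>j\<in>F. act \<F> j = s j) --> \<F> g x = \<W> g x)"
   if g: "g \<in> \<G>" and x: "x \<in> U" for g x
   using key[OF g x] stab[OF x] cosetV[OF x g]
   by (intro exI[of _ "{(stab x, False), (g <#\<^bsub>G\<^esub> V x, True)}"] conjI) auto
  show "loc_const \<W>"
   unfolding loc_const_def
  proof
   fix x assume x: "x \<in> U"
   obtain F where F: "finite F" "F \<subseteq> U" "!!g. g \<in> \<G> ==> (!!z. z \<in> F ==> g z = z) ==> g \<in> V x"
    by (rule open_subgroup_support[OF V(3)[OF x] V(4)[OF x]]) (rule that, assumption, assumption, blast)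
   have "\<W> g x = \<W> h x" if g: "g \<in> \<G>" and h: "h \<in> \<G>" and eq: "\<forall>z\<in>F. g z = h z" for g h
   proof -
    have gh: "\<iota> g \<cdot> h \<in> V x"
    proof (rule F(3))
     show "\<iota> g \<cdot> h \<in> \<G>" using g h by simp
     fix z assume z: "z \<in> F"
     then have "z \<in> U" using F(2) by blast
     then show "(\<iota> g \<cdot> h) z = z"
      using G_mult_apply[of "\<iota> g" h z] g h bspec[OF eq z, symmetric] by (simp add: G_inv_apply)
    qed
    have "h \<in> g <#\<^bsub>G\<^esub> V x" using l_coset_mem[OF V(3)[OF x] g h] gh by simp
    then have "h <#\<^bsub>G\<^esub> V x = g <#\<^bsub>G\<^esub> V x" using G.l_repr_independence[of h g "V x"] g V(3)[OF x] by simp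
    then show ?thesis using g h by (simp add: \<W>_def)
   qed
   then show "\<exists>F. finite F \<and> F \<subseteq> U \<and> (\<forall>g\<in>\<G>. \<forall>h\<in>\<G>. (\<forall>z\<in>F. g z = h z) --> \<W> g x = \<W> h x)"
    using F(1,2) by (intro exI[of _ F] conjI ballI impI)
  qed
 qed
qed

text \<open>A pointwise limit \<open>s\<close> of actions has to be shown to be an action. It
  determines a limit \<open>\<W>\<close> of the automorphisms and, with the two directions swapped,
  a limit \<open>\<W>'\<close> of their inverses. Identities involving finitely many values pass to
  these limits, which gives an automorphism acting as \<open>s\<close>.\<close>

lemma completely_metrizable_coset: "completely_metrizable_space AT"
 unfolding AT_def
proof (rule completely_metrizable_ptop[OF act_funcset])
 show "countable J" using countable_cosets by (intro countable_SIGMA) auto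
 show "inj_on act (\<A>)"
 proof (rule inj_onI)
  fix \<F> \<H> assume \<F>: "\<F> \<in> \<A>" and \<H>: "\<H> \<in> \<A>" and eq: "act \<F> = act \<H>"
  show "\<F> = \<H>"
  proof (rule A_ext[OF \<F> \<H>])
   fix g assume g: "g \<in> \<G>"
   show "\<F> g = \<H> g"
   proof (rule G_ext)
    fix x assume x: "x \<in> U"
    define B where "B = {h \<in> \<G>. h x = \<F> g x}"
    have B: "B \<in> cosets" unfolding B_def by (rule basic_coset[OF x A_closed[OF \<F> g]])
    have "g \<in> {k \<in> \<G>. \<F> k \<in> B}" using g A_closed[OF \<F> g] by (simp add: B_def)
    also have "\<dots> = {k \<in> \<G>. \<H> k \<in> B}"
     using fun_cong[OF eq, of "(B, False)"] by (simp add: act_False[OF B])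
    finally show "\<F> g x = \<H> g x" by (simp add: B_def)
   qed (use A_closed \<F> \<H> g in auto)
  qed
 qed
 fix s assume s: "s \<in> J \<rightarrow>\<^sub>E cosets"
  and appr: "!!F. finite F ==> F \<subseteq> J ==> \<exists>\<F>\<in>\<A>. \<forall>j\<in>F. act \<F> j = s j"
 obtain \<W> where \<W>ext: "\<W> \<in> extensional (\<G>)"
  and \<W>: "!!g x. g \<in> \<G> ==> x \<in> U ==> \<exists>F. finite F \<and> F \<subseteq> J \<and>
   (\<forall>\<F>\<in>\<A>. (\<forall>j\<in>F. act \<F> j = s j) --> \<F> g x = \<W> g x)"
  and \<W>loc: "loc_const \<W>"
  by (rule limit_values[OF appr]) (assumption | rule that)+
 \<comment> \<open>Swapping images and preimages replaces the actions of automorphisms by those of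
   their inverses, so \<open>s'\<close> is a limit of actions as well.\<close>
 define s' where "s' j = s (fst j, \<not> snd j)" for j
 have appr': "\<exists>\<F>\<in>\<A>. \<forall>j\<in>F. act \<F> j = s' j" if F: "finite F" "F \<subseteq> J" for F
 proof -
  have F': "finite ((\<lambda>j. (fst j, \<not> snd j)) ` F)" "(\<lambda>j. (fst j, \<not> snd j)) ` F \<subseteq> J" using F by auto
  obtain \<F> where \<F>: "\<F> \<in> \<A>" "\<forall>j\<in>(\<lambda>j. (fst j, \<not> snd j)) ` F. act \<F> j = s j"
   using appr[OF F'] by blast
  have "act (invA \<F>) j = s' j" if j: "j \<in> F" for j
  proof -
   have "fst j \<in> cosets" using F(2) j by auto
   then have "act (invA \<F>) (fst j, snd j) = act \<F> (fst j, \<not> snd j)"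
    by (rule act_inv[OF \<F>(1)])
   then show ?thesis using \<F>(2) j by (simp add: s'_def)
  qed
  then show ?thesis using A.inv_closed[OF \<F>(1)] by blast
 qed
 obtain \<W>' where \<W>': "!!g x. g \<in> \<G> ==> x \<in> U ==> \<exists>F. finite F \<and> F \<subseteq> J \<and>
   (\<forall>\<F>\<in>\<A>. (\<forall>j\<in>F. act \<F> j = s' j) --> \<F> g x = \<W>' g x)"
  by (rule limit_values[OF appr']) (assumption | rule that)+
 \<comment> \<open>A single automorphism matches finitely many values of both limits and finitely
   many coordinates of \<open>s\<close> at once.\<close>
 define good where "good \<F> P Q F <-> \<F> \<in> \<A> \<and> (\<forall>(g, x)\<in>P. \<F> g x = \<W> g x) \<and>
  (\<forall>(g, x)\<in>Q. (invA \<F>) g x = \<W>' g x) \<and> (\<forall>j\<in>F. act \<F> j = s j)" for \<F> P Q F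
 have good: "\<exists>\<F>. good \<F> P Q F"
  if P: "finite P" "P \<subseteq> \<G> \<times> U" and Q: "finite Q" "Q \<subseteq> \<G> \<times> U" and F: "finite F" "F \<subseteq> J" for P Q F
 proof -
  have "\<forall>p\<in>P. \<exists>F. finite F \<and> F \<subseteq> J \<and>
   (\<forall>\<F>\<in>\<A>. (\<forall>j\<in>F. act \<F> j = s j) --> \<F> (fst p) (snd p) = \<W> (fst p) (snd p))"
   using P(2) by (intro ballI \<W>) auto
  from bchoice[OF this] obtain f where f: "\<forall>p\<in>P. finite (f p) \<and> f p \<subseteq> J \<and>
   (\<forall>\<F>\<in>\<A>. (\<forall>j\<in>f p. act \<F> j = s j) --> \<F> (fst p) (snd p) = \<W> (fst p) (snd p))" by blast
  have "\<forall>p\<in>Q. \<exists>F. finite F \<and> F \<subseteq> J \<and>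
   (\<forall>\<F>\<in>\<A>. (\<forall>j\<in>F. act \<F> j = s' j) --> \<F> (fst p) (snd p) = \<W>' (fst p) (snd p))"
   using Q(2) by (intro ballI \<W>') auto
  from bchoice[OF this] obtain f' where f': "\<forall>p\<in>Q. finite (f' p) \<and> f' p \<subseteq> J \<and>
   (\<forall>\<F>\<in>\<A>. (\<forall>j\<in>f' p. act \<F> j = s' j) --> \<F> (fst p) (snd p) = \<W>' (fst p) (snd p))" by blast
  define H where "H = F \<union> (\<Union>p\<in>P. f p) \<union> (\<Union>p\<in>Q. (\<lambda>j. (fst j, \<not> snd j)) ` f' p)"
  have "finite H" unfolding H_def using P(1) Q(1) F(1) f f' by blast
  moreover have "H \<subseteq> J" unfolding H_def using F(2) f f' by fastforce
  ultimately obtain \<F> where \<F>: "\<F> \<in> \<A>" "\<forall>j\<in>H. act \<F> j = s j" using appr by blast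
  have "\<F> (fst p) (snd p) = \<W> (fst p) (snd p)" if "p \<in> P" for p
   using f \<F> that unfolding H_def by blast
  moreover have "(invA \<F>) (fst p) (snd p) = \<W>' (fst p) (snd p)" if p: "p \<in> Q" for p
  proof -
   have "act (invA \<F>) j = s' j" if j: "j \<in> f' p" for j
   proof -
    have "fst j \<in> cosets"
    proof -
     have "f' p \<subseteq> J" using f' p by blast
     then show ?thesis using j by (cases j) auto
    qed
    then have "act (invA \<F>) (fst j, snd j) = act \<F> (fst j, \<not> snd j)"
     by (rule act_inv[OF \<F>(1)])
    moreover have "(fst j, \<not> snd j) \<in> H" unfolding H_def using p j by blast
    ultimately show ?thesis using \<F>(2) by (simp add: s'_def)
   qed
   then show ?thesis using f' p A.inv_closed[OF \<F>(1)] by blast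
  qed
  ultimately have "good \<F> P Q F" unfolding good_def using \<F> unfolding H_def by fastforce
  then show ?thesis by blast
 qed
 have goodD: "\<F> \<in> \<A>" "!!g x. (g, x) \<in> P ==> \<F> g x = \<W> g x"
  "!!g x. (g, x) \<in> Q ==> (invA \<F>) g x = \<W>' g x" "!!j. j \<in> F ==> act \<F> j = s j"
  if "good \<F> P Q F" for \<F> P Q F using that unfolding good_def by blast+
 have \<W>U: "\<W> g x \<in> U" "\<W>' g x \<in> U" if g: "g \<in> \<G>" and x: "x \<in> U" for g x
 proof -
  obtain \<F> where "good \<F> {(g, x)} {(g, x)} {}" using good[of "{(g, x)}" "{(g, x)}" "{}"] g x by auto
  from goodD[OF this] show "\<W> g x \<in> U" "\<W>' g x \<in> U"
   using G_closed[OF A_closed[of \<F> g] x] G_closed[OF A_closed[of "invA \<F>" g] x] g by auto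
 qed
 have mult: "\<W> (g \<cdot> h) x = \<W> g (\<W> h x)" if g: "g \<in> \<G>" and h: "h \<in> \<G>" and x: "x \<in> U" for g h x
 proof -
  obtain \<F> where "good \<F> {(g \<cdot> h, x), (h, x), (g, \<W> h x)} {} {}"
   using good[of "{(g \<cdot> h, x), (h, x), (g, \<W> h x)}" "{}" "{}"] g h x \<W>U by auto
  note \<F> = goodD(1,2)[OF this]
  have "\<W> (g \<cdot> h) x = \<F> (g \<cdot> h) x" using \<F>(2) by simp
  also have "\<dots> = \<F> g (\<F> h x)" using \<F>(1) g h x by (simp add: A_hom_mult G_mult_apply A_closed)
  also have "\<dots> = \<W> g (\<W> h x)" using \<F>(2) by simp
  finally show ?thesis .
 qed
 have one: "\<W> \<one>\<^bsub>G\<^esub> x = x" if x: "x \<in> U" for x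
 proof -
  obtain \<F> where "good \<F> {(\<one>\<^bsub>G\<^esub>, x)} {} {}" using good[of "{(\<one>\<^bsub>G\<^esub>, x)}" "{}" "{}"] x by auto
  note \<F> = goodD(1,2)[OF this]
  interpret \<F>: group_hom G G \<F> using \<F>(1) by (rule A_group_hom)
  show ?thesis using \<F>(2)[of "\<one>\<^bsub>G\<^esub>" x] G_one[OF x] by simp
 qed
 define \<W>\<^sub>1 where "\<W>\<^sub>1 = (\<lambda>g\<in>\<G>. \<lambda>x\<in>U. \<W> g x)"
 define \<W>\<^sub>2 where "\<W>\<^sub>2 g = (\<lambda>x\<in>U. \<W>' g x)" for g
 have list_appr: "\<exists>\<F>. good \<F> ({g} \<times> set zs) ({g} \<times> set zs) F"
  if "g \<in> \<G>" "set zs \<subseteq> U" "finite F" "F \<subseteq> J" for g zs F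
  using that by (intro good) auto
 have rel: "map (\<W> g) zs \<in> interp_rel M r <-> zs \<in> interp_rel M r"
  "map (\<W>' g) zs \<in> interp_rel M r <-> zs \<in> interp_rel M r"
  if g: "g \<in> \<G>" and r: "r \<in> symbols L" and zs: "zs \<in> tuples M (arity L r)" for g r zs
 proof -
  have "set zs \<subseteq> U" using zs by (simp add: tuples_def)
  then obtain \<F> where "good \<F> ({g} \<times> set zs) ({g} \<times> set zs) {}" using list_appr[OF g, of zs "{}"] by auto
  note \<F> = goodD[OF this]
  have "map (\<W> g) zs = map (\<F> g) zs" "map (\<W>' g) zs = map ((invA \<F>) g) zs" using \<F>(2,3) by auto
  then show "map (\<W> g) zs \<in> interp_rel M r <-> zs \<in> interp_rel M r"
   "map (\<W>' g) zs \<in> interp_rel M r <-> zs \<in> interp_rel M r"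
   using G_rel[OF A_closed[OF \<F>(1) g] r zs] G_rel[OF A_closed[OF A.inv_closed[OF \<F>(1)] g] r zs]
   by (simp_all del: map_eq_conv)
 qed
 have mult': "\<W>' (g \<cdot> h) x = \<W>' g (\<W>' h x)" if g: "g \<in> \<G>" and h: "h \<in> \<G>" and x: "x \<in> U" for g h x
 proof -
  obtain \<F> where "good \<F> {} {(g \<cdot> h, x), (h, x), (g, \<W>' h x)} {}"
   using good[of "{}" "{(g \<cdot> h, x), (h, x), (g, \<W>' h x)}" "{}"] g h x \<W>U by auto
  note \<F> = goodD(1,3)[OF this]
  have i: "invA \<F> \<in> \<A>" using \<F>(1) by simp
  have "\<W>' (g \<cdot> h) x = (invA \<F>) (g \<cdot> h) x" using \<F>(2) by simp
  also have "\<dots> = (invA \<F>) g ((invA \<F>) h x)" using i g h x by (simp add: A_hom_mult G_mult_apply A_closed)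
  also have "\<dots> = \<W>' g (\<W>' h x)" using \<F>(2) by simp
  finally show ?thesis .
 qed
 have one': "\<W>' \<one>\<^bsub>G\<^esub> x = x" if x: "x \<in> U" for x
 proof -
  obtain \<F> where "good \<F> {} {(\<one>\<^bsub>G\<^esub>, x)} {}" using good[of "{}" "{(\<one>\<^bsub>G\<^esub>, x)}" "{}"] x by auto
  note \<F> = goodD(1,3)[OF this]
  interpret i: group_hom G G "invA \<F>" using A.inv_closed[OF \<F>(1)] by (rule A_group_hom)
  show ?thesis using \<F>(2)[of "\<one>\<^bsub>G\<^esub>" x] G_one[OF x] by simp
 qed
 have \<W>\<^sub>1G: "\<W>\<^sub>1 g \<in> \<G>" if g: "g \<in> \<G>" for g
 proof -
  have "\<W> g (\<W> (\<iota> g) x) = x" "\<W> (\<iota> g) (\<W> g x) = x" if "x \<in> U" for x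
   using mult[of g "\<iota> g" x] mult[of "\<iota> g" g x] g one that by auto
  then have "bij_betw (\<W> g) U U" using \<W>U g
   by (intro bij_betw_byWitness[where f' = "\<W> (\<iota> g)"]) auto
  then have "iso_by L (\<W> g) M M" using rel(1)[OF g] by (simp add: iso_by_def)
  then show ?thesis using iso_by_cong[of M "\<W>\<^sub>1 g" "\<W> g" L M] g by (simp add: G_iff \<W>\<^sub>1_def)
 qed
 have \<W>\<^sub>2G: "\<W>\<^sub>2 g \<in> \<G>" if g: "g \<in> \<G>" for g
 proof -
  have "\<W>' g (\<W>' (\<iota> g) x) = x" "\<W>' (\<iota> g) (\<W>' g x) = x" if "x \<in> U" for x
   using mult'[of g "\<iota> g" x] mult'[of "\<iota> g" g x] g one' that by auto
  then have "bij_betw (\<W>' g) U U" using \<W>U g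
   by (intro bij_betw_byWitness[where f' = "\<W>' (\<iota> g)"]) auto
  then have "iso_by L (\<W>' g) M M" using rel(2)[OF g] by (simp add: iso_by_def)
  then show ?thesis using iso_by_cong[of M "\<W>\<^sub>2 g" "\<W>' g" L M] g by (simp add: G_iff \<W>\<^sub>2_def)
 qed
 \<comment> \<open>Membership in an open coset depends on finitely many values, so it can be tested
   on an approximating automorphism. The Boolean \<open>b\<close> tells whether \<open>s\<close>
   prescribes \<open>B\<close> as the image of \<open>B0\<close> or \<open>B0\<close> as the
   preimage of \<open>B\<close>.\<close>
 have mem: "\<W>\<^sub>1 a \<in> B <-> (if b then a \<in> B0 else a \<in> B0)"
  if a: "a \<in> \<G>" and B: "B \<in> cosets" and B0: "B0 \<subseteq> \<G>" "B0 \<in> cosets"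
   and s: "(b \<and> s (B0, True) = B) \<or> (\<not> b \<and> s (B, False) = B0)" for a B B0 b
 proof -
  obtain F where F: "finite F" "F \<subseteq> U" "!!g h. g \<in> \<G> ==> h \<in> \<G> ==> (!!z. z \<in> F ==> g z = h z) ==> g \<in> B <-> h \<in> B"
   using open_coset_support[OF B] by metis
  have "\<exists>\<F>. good \<F> ({a} \<times> F) {} {(if b then B0 else B, b)}"
   by (rule good) (use F(1,2) a B B0 in \<open>auto split: if_splits\<close>)
  then obtain \<F> where "good \<F> ({a} \<times> F) {} {(if b then B0 else B, b)}" by (elim exE) (rule that)
  note \<F> = goodD(1,2,4)[OF this]
  have "\<F> a \<in> B <-> \<W>\<^sub>1 a \<in> B"
   using \<F>(2) F(2) a by (intro F(3) A_closed[OF \<F>(1) a] \<W>\<^sub>1G[OF a]) (auto simp: \<W>\<^sub>1_def subset_iff)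
  moreover have "\<F> a \<in> B <-> a \<in> B0"
  proof (cases b)
   case True
   then have "\<F> ` B0 = B" using \<F>(3)[of "(B0, True)"] s by (simp add: act_True[OF B0(2)])
   then show ?thesis using A_bij[OF \<F>(1)] a B0(1) by (auto simp: bij_betw_def inj_on_def)
  next
   case False
   then have "{x \<in> \<G>. \<F> x \<in> B} = B0" using \<F>(3)[of "(B, False)"] s by (simp add: act_False[OF B])
   then show ?thesis using a by blast
  qed
  ultimately show ?thesis by simp
 qed
 have hom: "\<W>\<^sub>1 \<in> hom G G"
 proof (rule homI)
  show "\<W>\<^sub>1 (g \<cdot> h) = \<W>\<^sub>1 g \<cdot> \<W>\<^sub>1 h" if "g \<in> \<G>" "h \<in> \<G>" for g h
   using that \<W>\<^sub>1G mult \<W>U by (intro G_ext) (auto simp: G_mult_apply, auto simp: \<W>\<^sub>1_def)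
 qed (rule \<W>\<^sub>1G)
 have inj: "inj_on \<W>\<^sub>1 (\<G>)"
 proof (rule inj_onI, rule ccontr)
  fix a b assume a: "a \<in> \<G>" and b: "b \<in> \<G>" and eq: "\<W>\<^sub>1 a = \<W>\<^sub>1 b" and "a \<noteq> b"
  then obtain x where x: "x \<in> U" "a x \<noteq> b x" using G_ext[OF a b] by blast
  define B0 where "B0 = {h \<in> \<G>. h x = a x}"
  have B0: "B0 \<in> cosets" unfolding B0_def by (rule basic_coset[OF x(1) a])
  have B: "s (B0, True) \<in> cosets" using s B0 by (auto dest: PiE_mem)
  have "a \<in> B0 <-> b \<in> B0"
   using mem[OF a B open_coset_subset[OF B0] B0, of True] mem[OF b B open_coset_subset[OF B0] B0, of True] eq by simp
  then show False using a b x by (simp add: B0_def)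
 qed
 \<comment> \<open>The limit of the inverses supplies the preimage. The values at \<open>x\<close>
   agree because \<open>\<W>\<^sub>2 h\<close> lies in the coset that \<open>s\<close> prescribes as
   preimage of the maps sending \<open>x\<close> to \<open>h x\<close>.\<close>
 have surj: "\<exists>g\<in>\<G>. \<W>\<^sub>1 g = h" if h: "h \<in> \<G>" for h
 proof (intro bexI[of _ "\<W>\<^sub>2 h"])
  show "\<W>\<^sub>2 h \<in> \<G>" by (rule \<W>\<^sub>2G[OF h])
  show "\<W>\<^sub>1 (\<W>\<^sub>2 h) = h"
  proof (rule G_ext[OF \<W>\<^sub>1G[OF \<W>\<^sub>2G[OF h]] h])
   fix x assume x: "x \<in> U"
   define B where "B = {k \<in> \<G>. k x = h x}"
   have B: "B \<in> cosets" unfolding B_def by (rule basic_coset[OF x h])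
   have B0: "s (B, False) \<in> cosets" using s B by (auto dest: PiE_mem)
   obtain F where F: "finite F" "F \<subseteq> U" "!!g h. g \<in> \<G> ==> h \<in> \<G> ==> (!!z. z \<in> F ==> g z = h z) ==> g \<in> s (B, False) <-> h \<in> s (B, False)"
    using open_coset_support[OF B0] by metis
   obtain \<F> where "good \<F> {} ({h} \<times> F) {(B, False)}"
    using good[of "{}" "{h} \<times> F" "{(B, False)}"] F(1,2) h B by auto
   note \<F> = goodD(1,3,4)[OF this]
   have s_eq: "s (B, False) = {y \<in> \<G>. \<F> y \<in> B}" using \<F>(3)[of "(B, False)"] by (simp add: act_False[OF B])
   have i: "(invA \<F>) h \<in> \<G>" using A_closed[OF A.inv_closed[OF \<F>(1)] h] .
   have "(invA \<F>) h \<in> s (B, False) <-> \<W>\<^sub>2 h \<in> s (B, False)"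
    using \<F>(2) F(2) by (intro F(3) i \<W>\<^sub>2G[OF h]) (auto simp: \<W>\<^sub>2_def subset_iff)
   moreover have "(invA \<F>) h \<in> s (B, False)" unfolding s_eq using i A_apply_inv[OF \<F>(1) h] h by (simp add: B_def)
   ultimately have "\<W>\<^sub>2 h \<in> s (B, False)" by simp
   then have "\<W>\<^sub>1 (\<W>\<^sub>2 h) \<in> B"
    using mem[OF \<W>\<^sub>2G[OF h] B open_coset_subset[OF B0] B0, of False] by simp
   then show "\<W>\<^sub>1 (\<W>\<^sub>2 h) x = h x" by (simp add: B_def)
  qed
 qed
 have "loc_const \<W>\<^sub>1"
  unfolding loc_const_def
 proof
  fix x assume x: "x \<in> U"
  obtain F where F: "finite F" "F \<subseteq> U" "\<forall>g\<in>\<G>. \<forall>h\<in>\<G>. (\<forall>z\<in>F. g z = h z) --> \<W> g x = \<W> h x"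
   using \<W>loc x unfolding loc_const_def by meson
  have "\<W>\<^sub>1 g x = \<W>\<^sub>1 h x" if "g \<in> \<G>" "h \<in> \<G>" "\<forall>z\<in>F. g z = h z" for g h
   using bspec[OF bspec[OF F(3) that(1)] that(2)] that x by (simp add: \<W>\<^sub>1_def)
  then show "\<exists>F. finite F \<and> F \<subseteq> U \<and> (\<forall>g\<in>\<G>. \<forall>h\<in>\<G>. (\<forall>z\<in>F. g z = h z) --> \<W>\<^sub>1 g x = \<W>\<^sub>1 h x)"
   using F(1,2) by (intro exI[of _ F] conjI ballI impI)
 qed
 moreover have "\<W>\<^sub>1 \<in> \<G> \<rightarrow> \<G>" using \<W>\<^sub>1G by blast
 ultimately have cont: "continuous_map X X \<W>\<^sub>1" by (intro loc_const_continuous)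
 have "bij_betw \<W>\<^sub>1 (\<G>) (\<G>)"
  unfolding bij_betw_def using inj surj \<W>\<^sub>1G by (auto simp: image_iff)
 then have \<W>\<^sub>1A: "\<W>\<^sub>1 \<in> \<A>" using hom cont by (simp add: A_iff Bij_def \<W>\<^sub>1_def)
 have "act \<W>\<^sub>1 = s"
 proof (rule extensionalityI[of _ J])
  show "act \<W>\<^sub>1 \<in> extensional J" by (simp add: act_def)
  show "s \<in> extensional J" using s by (simp add: PiE_iff)
  fix j assume j: "j \<in> J"
  obtain B b where B: "j = (B, b)" "B \<in> cosets" using j by (cases j) auto
  have sB: "s (B, b) \<in> cosets" using s B by (auto dest: PiE_mem)
  show "act \<W>\<^sub>1 j = s j"
  proof (cases b)
   case True
   have m: "\<W>\<^sub>1 a \<in> s (B, True) <-> a \<in> B" if "a \<in> \<G>" for a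
    using mem[OF that _ open_coset_subset[OF B(2)] B(2), of "s (B, True)" True] sB True by simp
   have "\<W>\<^sub>1 ` B = s (B, True)"
   proof (intro equalityI subsetI)
    fix y assume "y \<in> \<W>\<^sub>1 ` B"
    then show "y \<in> s (B, True)" using m open_coset_subset[OF B(2)] by blast
   next
    fix y assume y: "y \<in> s (B, True)"
    then have "y \<in> \<G>" using open_coset_subset[OF sB] True by auto
    then obtain g where "g \<in> \<G>" "\<W>\<^sub>1 g = y" using surj by blast
    then show "y \<in> \<W>\<^sub>1 ` B" using m y by blast
   qed
   then show ?thesis using True B by (simp add: act_True)
  next
   case False
   have m: "\<W>\<^sub>1 a \<in> B <-> a \<in> s (B, False)" if "a \<in> \<G>" for a
    using mem[OF that B(2) open_coset_subset _, of "s (B, False)" False] sB False by simp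
   have "s (B, False) \<subseteq> \<G>" using open_coset_subset[OF sB] False by simp
   then have "{x \<in> \<G>. \<W>\<^sub>1 x \<in> B} = s (B, False)" using m by blast
   then show ?thesis using False B by (simp add: act_False)
  qed
 qed
 then show "s \<in> act ` \<A>" using \<W>\<^sub>1A by blast
qed

lemma polish_group_coset: "polish_group A AT"
 by (simp add: polish_group_def topological_group_coset completely_metrizable_coset second_countable_coset)

text \<open>Evaluations are continuous and open cosets are clopen, so the set \<open>E B C\<close>
  of automorphisms mapping \<open>B\<close> onto \<open>C\<close> is closed. For fixed
  \<open>B\<close> these sets form a countable cover, so by Baire category one of them has interior,
  and left translation makes all of them open. They determine the coordinates of
  \<open>act\<close>.\<close>

lemma AT_coarsest:
 assumes Y: "polish_group A Y" and act: "continuous_map (prod_topology Y X) X (\<lambda>(\<F>, g). \<F> g)"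
  and S: "openin AT S"
 shows "openin Y S"
proof -
 have tg: "topological_group A Y" and cm: "completely_metrizable_space Y" using Y by (auto simp: polish_group_def)
 have top: "topspace Y = \<A>" using tg by (simp add: topological_group_def)
 have ev: "continuous_map Y X (\<lambda>\<F>. \<F> g)" if g: "g \<in> \<G>" for g
 proof -
  have "continuous_map Y (prod_topology Y X) (\<lambda>\<F>. (\<F>, g))"
   using g by (auto simp: continuous_map_pairwise comp_def topspace_X)
  from continuous_map_compose[OF this act] show ?thesis by (simp add: comp_def)
 qed
 have clopen: "openin X B" if B: "B \<in> cosets" for B
 proof -
  obtain F where F: "finite F" "F \<subseteq> U" "!!g h. g \<in> \<G> ==> h \<in> \<G> ==> (!!z. z \<in> F ==> g z = h z) ==> g \<in> B <-> h \<in> B"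
   using open_coset_support[OF B] by metis
  have "{h \<in> \<G>. \<forall>x\<in>F. h x = g x} \<subseteq> B" if "g \<in> B" for g
   using F(3)[of g] that open_coset_subset[OF B] by (auto simp: subset_iff)
  then show ?thesis unfolding openin_X using F(1,2) open_coset_subset[OF B] by blast
 qed
 have clopen': "openin X (\<G> - B)" if B: "B \<in> cosets" for B
 proof -
  obtain F where F: "finite F" "F \<subseteq> U" "!!g h. g \<in> \<G> ==> h \<in> \<G> ==> (!!z. z \<in> F ==> g z = h z) ==> g \<in> B <-> h \<in> B"
   using open_coset_support[OF B] by metis
  have "{h \<in> \<G>. \<forall>x\<in>F. h x = g x} \<subseteq> \<G> - B" if "g \<in> \<G> - B" for g
   using F(3)[of g] that by auto
  then show ?thesis unfolding openin_X using F(1,2) by blast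
 qed
 define E where "E B C = {\<F> \<in> \<A>. \<F> ` B = C}" for B C
 have closed: "closedin Y (E B C)" if B: "B \<in> cosets" and C: "C \<in> cosets" for B C
 proof -
  have BG: "B \<subseteq> \<G>" and CG: "C \<subseteq> \<G>" using B C open_coset_subset by auto
  have "\<A> - E B C = (\<Union>g\<in>B. {\<F> \<in> topspace Y. \<F> g \<in> \<G> - C}) \<union>
    (\<Union>g\<in>\<G> - B. {\<F> \<in> topspace Y. \<F> g \<in> C})"
  proof (intro equalityI subsetI)
   fix \<F> assume "\<F> \<in> \<A> - E B C"
   then have \<F>: "\<F> \<in> \<A>" "\<F> ` B \<noteq> C" by (auto simp: E_def)
   show "\<F> \<in> (\<Union>g\<in>B. {\<F> \<in> topspace Y. \<F> g \<in> \<G> - C}) \<union>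
    (\<Union>g\<in>\<G> - B. {\<F> \<in> topspace Y. \<F> g \<in> C})"
   proof (cases "\<F> ` B \<subseteq> C")
    case True
    then obtain c where c: "c \<in> C" "c \<notin> \<F> ` B" using \<F>(2) by blast
    then obtain g where "g \<in> \<G>" "\<F> g = c" using A_onto[OF \<F>(1)] CG by (metis imageE subsetD)
    then show ?thesis using c \<F>(1) top by blast
   next
    case False
    then show ?thesis using \<F>(1) top BG A_closed[OF \<F>(1)] by blast
   qed
  next
   fix \<F> assume a: "\<F> \<in> (\<Union>g\<in>B. {\<F> \<in> topspace Y. \<F> g \<in> \<G> - C}) \<union>
    (\<Union>g\<in>\<G> - B. {\<F> \<in> topspace Y. \<F> g \<in> C})"
   then have \<F>: "\<F> \<in> \<A>" using top by blast
   have "\<F> ` B \<noteq> C"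
   proof
    assume eq: "\<F> ` B = C"
    have inj: "inj_on \<F> (\<G>)" using A_bij[OF \<F>] by (simp add: bij_betw_def)
    show False using a eq inj BG by (auto simp: inj_on_def subset_iff)
   qed
   then show "\<F> \<in> \<A> - E B C" using \<F> by (simp add: E_def)
  qed
  also have "openin Y \<dots>"
   using clopen[OF C] clopen'[OF C] BG
   by (intro openin_Un openin_Union; elim imageE; hypsubst; intro openin_continuous_map_preimage[OF ev]; blast)
  finally show ?thesis by (auto simp: closedin_def top E_def)
 qed
 have E_open: "openin Y (E B C)" if B: "B \<in> cosets" and C: "C \<in> cosets" for B C
 proof -
  have "\<exists>D\<in>cosets. Y interior_of (E B D) \<noteq> {}"
  proof (rule ccontr)
   assume "\<not> ?thesis"
   then have "Y interior_of \<Union>((\<lambda>D. E B D) ` cosets) = {}"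
    using cm countable_cosets closed[OF B] by (intro Baire_category_alt) auto
   moreover have "\<Union>((\<lambda>D. E B D) ` cosets) = topspace Y"
    using open_coset_image[OF _ B] by (auto simp: E_def top)
   ultimately show False using A.one_closed top by (metis empty_iff interior_of_topspace)
  qed
  then obtain D \<H> where D: "D \<in> cosets" "\<H> \<in> Y interior_of (E B D)" by blast
  then have \<H>: "\<H> \<in> \<A>" "\<H> ` B = D" using interior_of_subset[of Y "E B D"] by (auto simp: E_def)
  show ?thesis
  proof (subst openin_subopen, intro ballI)
   fix \<F> assume "\<F> \<in> E B C"
   then have \<F>: "\<F> \<in> \<A>" "\<F> ` B = C" by (auto simp: E_def)
   \<comment> \<open>This automorphism maps \<open>C\<close> onto \<open>D\<close>, so left
     translation by it takes \<open>E B C\<close> to \<open>E B D\<close>.\<close>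
   let ?a = "\<H> \<star> invA \<F>"
   have a: "?a \<in> \<A>" using \<F> \<H> by simp
   let ?W = "{\<T> \<in> \<A>. ?a \<star> \<T> \<in> Y interior_of (E B D)}"
   have "openin Y ?W" by (rule topological_group_translate_open[OF tg a openin_interior_of])
   moreover have "\<F> \<in> ?W" using D(2) \<F>(1) \<H>(1) by (simp add: A.m_assoc)
   moreover have "?W \<subseteq> E B C"
   proof
    fix \<T> assume "\<T> \<in> ?W"
    then have \<T>: "\<T> \<in> \<A>" "?a \<star> \<T> \<in> E B D" using interior_of_subset[of Y "E B D"] by auto
    have BG: "B \<subseteq> \<G>" using B by (rule open_coset_subset)
    have "(?a \<star> \<T>) ` B = ?a ` \<T> ` B"
     unfolding image_image using BG a \<T>(1) by (intro image_cong refl) (auto simp: A_mult_apply)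
    moreover have "?a ` C = D"
    proof -
     have "?a ` C = (\<lambda>g. ?a (\<F> g)) ` B" using \<F>(2) by auto
     also have "\<dots> = \<H> ` B"
      using BG \<F>(1) \<H>(1) by (intro image_cong refl) (auto simp: A_mult_apply A_closed A_inv_apply subset_iff)
     finally show ?thesis using \<H>(2) by simp
    qed
    moreover have "?a ` \<T> ` B = D" using \<T>(2) calculation(1) by (simp add: E_def)
    moreover have "inj_on ?a (\<G>)" using A_bij[OF a] by (simp add: bij_betw_def)
    moreover have "\<T> ` B \<subseteq> \<G>" using BG A_closed[OF \<T>(1)] by blast
    ultimately have "\<T> ` B = C"
     using inj_on_image_eq_iff[of ?a "\<G>" "\<T> ` B" C] open_coset_subset[OF C] by simp
    then show "\<T> \<in> E B C" using \<T>(1) by (simp add: E_def)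
   qed
   ultimately show "\<exists>W. openin Y W \<and> \<F> \<in> W \<and> W \<subseteq> E B C" by blast
  qed
 qed
 have basic: "openin Y {\<H> \<in> \<A>. act \<H> j = act \<F> j}" if \<F>: "\<F> \<in> \<A>" and j: "j \<in> J" for \<F> j
 proof -
  obtain B b where B: "j = (B, b)" "B \<in> cosets" using j by (cases j) auto
  show ?thesis
  proof (cases b)
   case True
   then have "{\<H> \<in> \<A>. act \<H> j = act \<F> j} = E B (\<F> ` B)"
    using B by (simp add: act_True E_def)
   then show ?thesis using E_open[OF B(2) open_coset_image[OF \<F> B(2)]] by simp
  next
   case False
   define C where "C = {x \<in> \<G>. \<F> x \<in> B}"
   have C: "C \<in> cosets" unfolding C_def by (rule open_coset_vimage[OF \<F> B(2)])
   have "{x \<in> \<G>. \<H> x \<in> B} = C <-> \<H> ` C = B" if \<H>: "\<H> \<in> \<A>" for \<H>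
   proof
    assume "{x \<in> \<G>. \<H> x \<in> B} = C"
    then show "\<H> ` C = B" using A_onto[OF \<H>] open_coset_subset[OF B(2)] by (auto simp: image_iff subset_iff)
   next
    assume "\<H> ` C = B"
    then show "{x \<in> \<G>. \<H> x \<in> B} = C"
     using A_bij[OF \<H>] open_coset_subset[OF C] by (auto simp: bij_betw_def inj_on_def subset_iff)
   qed
   then have "{\<H> \<in> \<A>. act \<H> j = act \<F> j} = E C B"
    using B False by (auto simp: act_False E_def C_def)
   then show ?thesis using E_open[OF C B(2)] by simp
  qed
 qed
 have J: "act \<in> \<A> \<rightarrow> (J \<rightarrow>\<^sub>E cosets)" by (rule act_funcset)
 have "continuous_map Y AT (\<lambda>\<F>. \<F>)"
  unfolding AT_def using basic top by (intro continuous_map_into_ptop[OF J]) auto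
 from openin_continuous_map_preimage[OF this S]
 show ?thesis using openin_subset[OF S] top topspace_AT by (simp add: Collect_conj_eq Int_absorb1)
qed

text \<open>By \<open>AT_coarsest\<close> the identity is continuous from any competing Polish
  topology to \<open>AT\<close>; by the open mapping theorem it is then a homeomorphism, which
  settles uniqueness in the description of \<open>Aut_topology\<close>.\<close>

lemma Aut_topology_eq: "Aut_topology G X = AT"
 unfolding Aut_topology_def
proof (rule the_equality)
 show "polish_group A AT \<and> continuous_map (prod_topology AT X) X (\<lambda>(\<F>, g). \<F> g)"
  using polish_group_coset continuous_action by blast
 fix Y assume Y: "polish_group A Y \<and> continuous_map (prod_topology Y X) X (\<lambda>(\<F>, g). \<F> g)"
 then have tg: "topological_group A Y" and p: "completely_metrizable_space Y" "second_countable Y"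
  by (auto simp: polish_group_def)
 have top: "topspace Y = \<A>" using tg by (simp add: topological_group_def)
 have "continuous_map Y AT (\<lambda>\<F>. \<F>)"
  unfolding continuous_map_def
 proof (intro conjI allI impI)
  show "(\<lambda>\<F>. \<F>) \<in> topspace Y \<rightarrow> topspace AT" by (simp add: top topspace_AT)
  fix S assume S: "openin AT S"
  have "{x \<in> topspace Y. x \<in> S} = S" using openin_subset[OF S] by (auto simp: top topspace_AT)
  then show "openin Y {x \<in> topspace Y. x \<in> S}" using AT_coarsest S Y by simp
 qed
 moreover have "(\<lambda>\<F>. \<F>) \<in> iso A A" by (auto simp: iso_def hom_def bij_betw_def)
 ultimately have "homeomorphic_map Y AT (\<lambda>\<F>. \<F>)"
  by (intro bijective_hom_homeomorphic[OF tg topological_group_coset p completely_metrizable_coset])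
 then have om: "open_map Y AT (\<lambda>\<F>. \<F>)" by (rule homeomorphic_imp_open_map)
 show "Y = AT"
  unfolding topology_eq
 proof
  fix S show "openin Y S = openin AT S"
  proof
   assume "openin Y S"
   then have "openin AT ((\<lambda>\<F>. \<F>) ` S)" using om unfolding open_map_def by blast
   then show "openin AT S" by simp
  qed (use AT_coarsest Y in blast)
 qed
qed

section \<open>Interpretations up to homotopy\<close>

definition conj_by :: "('a => 'a) => (('a => 'a) => 'a => 'a) => (('a => 'a) => 'a => 'a) => bool" where
 "conj_by s \<F> \<H> <-> bij_betw s U U \<and> (\<forall>g\<in>\<G>. \<forall>y\<in>U. \<H> g (s y) = s (\<F> g y))"

lemma conj_by_closed: "conj_by s \<F> \<H> ==> y \<in> U ==> s y \<in> U"
 unfolding conj_by_def using bij_betwE by blast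

lemma conj_by_eq: "conj_by s \<F> \<H> ==> g \<in> \<G> ==> y \<in> U ==> \<H> g (s y) = s (\<F> g y)"
 by (simp add: conj_by_def)

lemma conj_by_onto: "conj_by s \<F> \<H> ==> y \<in> U ==> \<exists>x\<in>U. s x = y"
 unfolding conj_by_def by (metis bij_betw_imp_surj_on imageE)

lemma conj_by_inj: "conj_by s \<F> \<H> ==> x \<in> U ==> y \<in> U ==> s x = s y <-> x = y"
 unfolding conj_by_def bij_betw_def inj_on_def by blast

lemma conj_by_id: "conj_by (\<lambda>x. x) \<F> \<F>"
 by (simp add: conj_by_def bij_betw_def)

lemma conj_by_cong:
 assumes "!!g. g \<in> \<G> ==> \<F> g = \<F>' g" "!!g. g \<in> \<G> ==> \<H> g = \<H>' g"
 shows "conj_by s \<F> \<H> <-> conj_by s \<F>' \<H>'"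
 using assms by (simp add: conj_by_def)

lemma conj_by_sym:
 assumes s: "conj_by s \<F> \<H>" and \<F>: "\<F> \<in> \<G> \<rightarrow> \<G>"
 shows "conj_by (inv_into U s) \<H> \<F>"
 unfolding conj_by_def
proof (intro conjI ballI)
 have b: "bij_betw s U U" using s by (simp add: conj_by_def)
 then show "bij_betw (inv_into U s) U U" by (rule bij_betw_inv_into)
 fix g y assume g: "g \<in> \<G>" and y: "y \<in> U"
 obtain x where x: "x \<in> U" "s x = y" using conj_by_onto[OF s y] by blast
 have "\<F> g x \<in> U" using G_closed[OF funcset_mem[OF \<F> g] x(1)] .
 then show "\<F> g (inv_into U s y) = inv_into U s (\<H> g y)"
  using conj_by_eq[OF s g x(1)] x(2) bij_betw_inv_into_left[OF b x(1)] bij_betw_inv_into_left[OF b] by simp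
qed

lemma conj_by_trans:
 assumes s: "conj_by s \<F> \<H>" and t: "conj_by t \<H> \<T>" shows "conj_by (t \<circ> s) \<F> \<T>"
 unfolding conj_by_def
proof (intro conjI ballI)
 show "bij_betw (t \<circ> s) U U" using s t unfolding conj_by_def by (blast intro: bij_betw_trans)
 fix g y assume g: "g \<in> \<G>" and y: "y \<in> U"
 show "\<T> g ((t \<circ> s) y) = (t \<circ> s) (\<F> g y)"
  using conj_by_eq[OF t g conj_by_closed[OF s y]] conj_by_eq[OF s g y] by simp
qed

lemma preserves_id: "preserves n (\<lambda>x. x)"
 by (simp add: preserves_def)

lemma map_tuples: "s ` U \<subseteq> U ==> zs \<in> tuples M m ==> map s zs \<in> tuples M m"
 by (auto simp: tuples_def)

lemma preserves_comp:
 assumes s: "s ` U \<subseteq> U" "preserves n s" and t: "preserves n t" shows "preserves n (t \<circ> s)"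
 unfolding preserves_def
proof (intro ballI impI)
 fix r zs assume r: "r \<in> symbols L" "sym_index L r < n" and zs: "zs \<in> tuples M (arity L r)"
 have "map (t \<circ> s) zs = map t (map s zs)" by simp
 then show "map (t \<circ> s) zs \<in> interp_rel M r <-> zs \<in> interp_rel M r"
  using t map_tuples[OF s(1) zs] s(2) r zs unfolding preserves_def by metis
qed

lemma preserves_inv:
 assumes s: "bij_betw s U U" "preserves n s" shows "preserves n (inv_into U s)"
 unfolding preserves_def
proof (intro ballI impI)
 fix r zs assume r: "r \<in> symbols L" "sym_index L r < n" and zs: "zs \<in> tuples M (arity L r)"
 have "inv_into U s ` U \<subseteq> U" using bij_betw_inv_into[OF s(1)] by (simp add: bij_betw_def)
 then have m: "map (inv_into U s) zs \<in> tuples M (arity L r)" using zs by (rule map_tuples)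
 have "map s (map (inv_into U s) zs) = map (\<lambda>x. x) zs"
  unfolding map_map by (rule map_cong) (use zs bij_betw_inv_into_right[OF s(1)] in \<open>auto simp: tuples_def\<close>)
 then show "map (inv_into U s) zs \<in> interp_rel M r <-> zs \<in> interp_rel M r"
  using s(2) m r unfolding preserves_def by (metis list.map_ident)
qed

lemma preserves_mono: "m \<le> n ==> preserves n s ==> preserves m s"
 by (auto simp: preserves_def)

lemma G_preserves: "g \<in> \<G> ==> preserves n g"
 by (simp add: preserves_def G_rel)

lemma preserves_all_G:
 assumes s: "bij_betw s U U" "!!n. preserves n s" shows "restrict s U \<in> \<G>"
proof -
 have "iso_by L s M M" using s unfolding iso_by_def preserves_def by blast
 moreover have "iso_by L (restrict s U) M M = iso_by L s M M" by (rule iso_by_cong) simp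
 ultimately show ?thesis by (simp add: G_iff)
qed

definition near :: "nat => (('a => 'a) => 'a => 'a) => (('a => 'a) => 'a => 'a) => bool" where
 "near n \<F> \<H> <-> (\<exists>s. conj_by s \<F> \<H> \<and> preserves n s)"

lemma near_sym:
 assumes n: "near n \<F> \<H>" and \<F>: "\<F> \<in> \<G> \<rightarrow> \<G>" shows "near n \<H> \<F>"
proof -
 obtain s where s: "conj_by s \<F> \<H>" "preserves n s" using n by (auto simp: near_def)
 moreover have "bij_betw s U U" using s(1) by (simp add: conj_by_def)
 ultimately show ?thesis unfolding near_def using conj_by_sym[OF s(1) \<F>] preserves_inv by blast
qed

lemma near_trans:
 assumes "near n \<F> \<H>" "near n \<H> \<T>" shows "near n \<F> \<T>"
proof -
 obtain s t where st: "conj_by s \<F> \<H>" "preserves n s" "conj_by t \<H> \<T>" "preserves n t"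
  using assms by (auto simp: near_def)
 have "s ` U \<subseteq> U" using conj_by_closed[OF st(1)] by blast
 then show ?thesis unfolding near_def using conj_by_trans[OF st(1,3)] preserves_comp st(2,4) by blast
qed

definition conj_eq :: "(('a => 'a) => 'a => 'a) => (('a => 'a) => 'a => 'a) => bool" where
 "conj_eq \<F> \<H> <-> (\<exists>h\<in>\<G>. conj_by h \<F> \<H>)"

lemma conj_eq_near: "conj_eq \<F> \<H> ==> near n \<F> \<H>"
 unfolding conj_eq_def near_def using G_preserves by blast

lemma conj_eq_iff:
 assumes "\<F> \<in> \<G> \<rightarrow> \<G>" "\<H> \<in> \<G> \<rightarrow> \<G>"
 shows "conj_eq \<F> \<H> <-> (\<exists>h\<in>\<G>. \<forall>g\<in>\<G>. \<H> g \<cdot> h = h \<cdot> \<F> g)"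
proof -
 have "conj_by h \<F> \<H> <-> (\<forall>g\<in>\<G>. \<H> g \<cdot> h = h \<cdot> \<F> g)" if h: "h \<in> \<G>" for h
 proof -
  have "\<H> g \<cdot> h = h \<cdot> \<F> g <-> (\<forall>y\<in>U. \<H> g (h y) = h (\<F> g y))" if g: "g \<in> \<G>" for g
  proof -
   note gg = funcset_mem[OF assms(1) g] funcset_mem[OF assms(2) g]
   show ?thesis
   proof
    assume eq: "\<H> g \<cdot> h = h \<cdot> \<F> g"
    show "\<forall>y\<in>U. \<H> g (h y) = h (\<F> g y)"
     using G_mult_apply[OF gg(2) h] G_mult_apply[OF h gg(1)] eq by simp
   next
    assume "\<forall>y\<in>U. \<H> g (h y) = h (\<F> g y)"
    then show "\<H> g \<cdot> h = h \<cdot> \<F> g"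
     using gg h by (intro G_ext) (simp_all add: G_mult_apply)
   qed
  qed
  then show ?thesis using G_bij[OF h] by (simp add: conj_by_def)
 qed
 then show ?thesis by (simp add: conj_eq_def)
qed

lemma conj_eq_refl: "conj_eq \<F> \<F>"
 if "\<F> \<in> \<G> \<rightarrow> \<G>"
 unfolding conj_eq_iff[OF that that]
 by (rule bexI[OF _ G.one_closed]) (use funcset_mem[OF that] in simp)

lemma conj_eq_cong:
 assumes "!!g. g \<in> \<G> ==> \<F> g = \<F>' g" "!!g. g \<in> \<G> ==> \<H> g = \<H>' g"
 shows "conj_eq \<F> \<H> <-> conj_eq \<F>' \<H>'"
 unfolding conj_eq_def using conj_by_cong[of \<F> \<F>' \<H> \<H>'] assms by simp

lemma conj_eq_sym:
 assumes c: "conj_eq \<F> \<H>" and maps: "\<F> \<in> \<G> \<rightarrow> \<G>" "\<H> \<in> \<G> \<rightarrow> \<G>"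
 shows "conj_eq \<H> \<F>"
proof -
 obtain h where h: "h \<in> \<G>" "!!g. g \<in> \<G> ==> \<H> g \<cdot> h = h \<cdot> \<F> g"
  using c conj_eq_iff[OF maps] by blast
 have "\<F> g \<cdot> \<iota> h = \<iota> h \<cdot> \<H> g" if g: "g \<in> \<G>" for g
 proof -
  note gg = funcset_mem[OF maps(1) g] funcset_mem[OF maps(2) g]
  have "\<iota> h \<cdot> \<H> g = \<iota> h \<cdot> (\<H> g \<cdot> h) \<cdot> \<iota> h"
   using gg h(1) by (simp add: G.m_assoc)
  also have "\<dots> = (\<iota> h \<cdot> h) \<cdot> \<F> g \<cdot> \<iota> h"
   using gg h(1) unfolding h(2)[OF g] by (simp only: G.m_assoc G.inv_closed G.m_closed)
  finally show ?thesis using gg h(1) by simp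
 qed
 then show ?thesis unfolding conj_eq_iff[OF maps(2,1)] using h(1) G.inv_closed by blast
qed

lemma conj_eq_trans:
 assumes "conj_eq \<F> \<H>" "conj_eq \<H> \<T>" and maps: "\<F> \<in> \<G> \<rightarrow> \<G>"
 shows "conj_eq \<F> \<T>"
proof -
 obtain h k where hk: "h \<in> \<G>" "conj_by h \<F> \<H>" "k \<in> \<G>" "conj_by k \<H> \<T>"
  using assms by (auto simp: conj_eq_def)
 note c = conj_by_trans[OF hk(2,4)]
 have U: "\<F> g y \<in> U" if "g \<in> \<G>" "y \<in> U" for g y
  using G_closed[OF funcset_mem[OF maps that(1)] that(2)] .
 have "conj_by (k \<cdot> h) \<F> \<T>"
  unfolding conj_by_def using hk(1,3) G_bij conj_by_eq[OF c] U by (simp add: G_mult_apply)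
 then show ?thesis unfolding conj_eq_def using hk by blast
qed

text \<open>A relation rather than a function: the coordinates of \<open>\<a>\<close> are not
  unique, and other coordinates may yield a conjugate of \<open>\<F>\<close> under
  \<open>\<G>\<close>.\<close>

definition induces :: "('r, 'r) interp => (('a => 'a) => 'a => 'a) => bool" where
 "induces \<a> \<F> <-> \<a> \<in> Itp \<and> (\<exists>\<pi>. coord L M \<a> M \<pi> \<and> acts \<a> \<pi> \<F>)"

lemma induces_Itp: "induces \<a> \<F> ==> \<a> \<in> Itp"
 by (simp add: induces_def)

lemma inducesE:
 assumes "induces \<a> \<F>" obtains \<pi> where "\<a> \<in> Itp" "coord L M \<a> M \<pi>" "acts \<a> \<pi> \<F>"
 using assms by (auto simp: induces_def)

lemma induces_ex: "\<a> \<in> Itp ==> \<exists>\<F>. induces \<a> \<F>"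
 unfolding induces_def by (meson interp_coord interp_wf coord_imp_acts)

lemma induces_hom: "induces \<a> \<F> ==> \<F> \<in> hom G G"
 by (erule inducesE) (rule acts_hom[OF interp_wf])

lemma induces_funcset: "induces \<a> \<F> ==> \<F> \<in> \<G> \<rightarrow> \<G>"
 using induces_hom by (auto simp: hom_def)

lemma induces_loc_const: "induces \<a> \<F> ==> loc_const \<F>"
 by (erule inducesE) (rule acts_loc_const)

lemma induces_cong: "induces \<a> \<F> ==> (!!g. g \<in> \<G> ==> \<F> g = \<H> g) ==> induces \<a> \<H>"
 by (simp add: induces_def acts_def)

section \<open>The monoid of homotopy classes in terms of endomorphisms\<close>

abbreviation "hrel \<equiv> homotopy_rel L T L T"

abbreviation "cls \<a> \<equiv> hrel `` {\<a>}"

abbreviation "Mo \<equiv> Mor_monoid L T"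

abbreviation "BG \<equiv> BT L T"

lemma hrel_iff:
 assumes "induces \<a> \<F>" "induces \<b> \<H>" shows "(\<a>, \<b>) \<in> hrel <-> conj_eq \<F> \<H>"
proof -
 obtain \<pi> where \<pi>: "\<a> \<in> Itp" "coord L M \<a> M \<pi>" "acts \<a> \<pi> \<F>" using assms(1) by (rule inducesE)
 obtain \<v> where \<v>: "\<b> \<in> Itp" "coord L M \<b> M \<v>" "acts \<b> \<v> \<H>" using assms(2) by (rule inducesE)
 show ?thesis using homotopic_iff_conj[OF \<pi> \<v>] \<pi>(1) \<v>(1) G_bij
  by (auto simp: homotopy_rel_def conj_eq_def conj_by_def)
qed

lemma equiv_hrel: "equiv Itp hrel"
proof (rule equivI)
 show "hrel \<subseteq> Itp \<times> Itp" by (auto simp: homotopy_rel_def)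
 show "refl_on Itp hrel"
 proof (rule refl_onI)
  fix \<a> assume "\<a> \<in> Itp"
  then obtain \<F> where \<F>: "induces \<a> \<F>" using induces_ex by blast
  show "(\<a>, \<a>) \<in> hrel" unfolding hrel_iff[OF \<F> \<F>] by (rule conj_eq_refl[OF induces_funcset[OF \<F>]])
 qed
 show "sym hrel"
 proof (rule symI)
  fix \<a> \<b> assume h: "(\<a>, \<b>) \<in> hrel"
  then have "\<a> \<in> Itp" "\<b> \<in> Itp" by (auto simp: homotopy_rel_def)
  then obtain \<F> \<H> where i: "induces \<a> \<F>" "induces \<b> \<H>" using induces_ex by blast
  show "(\<b>, \<a>) \<in> hrel"
   using h unfolding hrel_iff[OF i] hrel_iff[OF i(2,1)] by (rule conj_eq_sym[OF _ induces_funcset[OF i(1)] induces_funcset[OF i(2)]])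
 qed
 show "trans hrel"
 proof (rule transI)
  fix \<a> \<b> \<c> assume h: "(\<a>, \<b>) \<in> hrel" "(\<b>, \<c>) \<in> hrel"
  then have "\<a> \<in> Itp" "\<b> \<in> Itp" "\<c> \<in> Itp" by (auto simp: homotopy_rel_def)
  then obtain \<F> \<H> \<T> where i: "induces \<a> \<F>" "induces \<b> \<H>" "induces \<c> \<T>" using induces_ex by metis
  have "conj_eq \<F> \<H>" "conj_eq \<H> \<T>" using h hrel_iff[OF i(1,2)] hrel_iff[OF i(2,3)] by simp_all
  then show "(\<a>, \<c>) \<in> hrel" unfolding hrel_iff[OF i(1,3)] by (rule conj_eq_trans[OF _ _ induces_funcset[OF i(1)]])
 qed
qed

lemma cls_eq_iff: "induces \<a> \<F> ==> induces \<b> \<H> ==> cls \<a> = cls \<b> <-> conj_eq \<F> \<H>"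
 using eq_equiv_class_iff[OF equiv_hrel induces_Itp induces_Itp] hrel_iff by metis

lemma induces_comp:
 assumes "induces \<a> \<F>" "induces \<b> \<H>" shows "induces (comp_interp L T L \<a> \<b>) (\<lambda>g. \<H> (\<F> g))"
proof -
 obtain \<pi> where \<pi>: "\<a> \<in> Itp" "coord L M \<a> M \<pi>" "acts \<a> \<pi> \<F>" using assms(1) by (rule inducesE)
 obtain \<v> where \<v>: "\<b> \<in> Itp" "coord L M \<b> M \<v>" "acts \<b> \<v> \<H>" using assms(2) by (rule inducesE)
 show ?thesis by (rule comp_interp_coord[OF \<pi> \<v>]) (auto simp: induces_def)
qed

text \<open>In the inner factor, the homomorphism \<open>\<H>'\<close> turns conjugacy by
  \<open>h\<close> into conjugacy by \<open>\<H>' h\<close>; in the outer factor the conjugating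
  element can be kept.\<close>

lemma conj_eq_comp:
 assumes c: "conj_eq \<F> \<F>'" "conj_eq \<H> \<H>'"
  and maps: "\<F> \<in> \<G> \<rightarrow> \<G>" "\<F>' \<in> \<G> \<rightarrow> \<G>" "\<H> \<in> \<G> \<rightarrow> \<G>"
  and \<H>': "\<H>' \<in> hom G G"
 shows "conj_eq (\<lambda>g. \<H> (\<F> g)) (\<lambda>g. \<H>' (\<F>' g))"
proof (rule conj_eq_trans)
 have \<H>'m: "\<H>' \<in> \<G> \<rightarrow> \<G>" using \<H>' by (auto simp: hom_def)
 show "(\<lambda>g. \<H> (\<F> g)) \<in> \<G> \<rightarrow> \<G>" using maps by auto
 show "conj_eq (\<lambda>g. \<H> (\<F> g)) (\<lambda>g. \<H>' (\<F> g))"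
  using c(2) maps(1) unfolding conj_eq_def conj_by_def by blast
 obtain h where h: "h \<in> \<G>" "!!g. g \<in> \<G> ==> \<F>' g \<cdot> h = h \<cdot> \<F> g"
  using c(1) conj_eq_iff[OF maps(1,2)] by blast
 have "\<H>' (\<F>' g) \<cdot> \<H>' h = \<H>' h \<cdot> \<H>' (\<F> g)" if g: "g \<in> \<G>" for g
  using arg_cong[OF h(2)[OF g], of \<H>'] funcset_mem[OF maps(1) g] funcset_mem[OF maps(2) g] h(1)
  by (simp add: hom_mult[OF \<H>'])
 then have e: "\<exists>k\<in>\<G>. \<forall>g\<in>\<G>. \<H>' (\<F>' g) \<cdot> k = k \<cdot> \<H>' (\<F> g)"
  using funcset_mem[OF \<H>'m h(1)] by blast
 have m: "(\<lambda>g. \<H>' (\<F> g)) \<in> \<G> \<rightarrow> \<G>" "(\<lambda>g. \<H>' (\<F>' g)) \<in> \<G> \<rightarrow> \<G>"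
  using maps \<H>'m by auto
 show "conj_eq (\<lambda>g. \<H>' (\<F> g)) (\<lambda>g. \<H>' (\<F>' g))"
  unfolding conj_eq_iff[OF m] by (rule e)
qed

text \<open>The product of classes is a union over all representatives; by
  \<open>conj_eq_comp\<close> all their composites lie in one class.\<close>

lemma cls_mult:
 assumes \<a>: "\<a> \<in> Itp" and \<b>: "\<b> \<in> Itp"
 shows "cls \<a> \<otimes>\<^bsub>Mo\<^esub> cls \<b> = cls (comp_interp L T L \<a> \<b>)"
proof -
 obtain \<F> \<H> where i: "induces \<a> \<F>" "induces \<b> \<H>" using \<a> \<b> induces_ex by blast
 have eq: "cls (comp_interp L T L \<a>' \<b>') = cls (comp_interp L T L \<a> \<b>)" if "\<a>' \<in> cls \<a>" "\<b>' \<in> cls \<b>" for \<a>' \<b>'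
 proof -
  have h: "(\<a>, \<a>') \<in> hrel" "(\<b>, \<b>') \<in> hrel" using that by simp_all
  then have "\<a>' \<in> Itp" "\<b>' \<in> Itp" by (auto simp: homotopy_rel_def)
  then obtain \<F>' \<H>' where i': "induces \<a>' \<F>'" "induces \<b>' \<H>'" using induces_ex by blast
  have "conj_eq \<F> \<F>'" "conj_eq \<H> \<H>'" using h hrel_iff[OF i(1) i'(1)] hrel_iff[OF i(2) i'(2)] by simp_all
  then have "conj_eq (\<lambda>g. \<H> (\<F> g)) (\<lambda>g. \<H>' (\<F>' g))"
   by (rule conj_eq_comp[OF _ _ induces_funcset[OF i(1)] induces_funcset[OF i'(1)]
      induces_funcset[OF i(2)] induces_hom[OF i'(2)]])
  then have "cls (comp_interp L T L \<a> \<b>) = cls (comp_interp L T L \<a>' \<b>')"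
   using cls_eq_iff[OF induces_comp[OF i] induces_comp[OF i']] by simp
  then show ?thesis by (rule sym)
 qed
 have "\<a> \<in> cls \<a>" "\<b> \<in> cls \<b>" by (rule equiv_class_self[OF equiv_hrel \<a>], rule equiv_class_self[OF equiv_hrel \<b>])
 then have "(\<Union>\<a>'\<in>cls \<a>. \<Union>\<b>'\<in>cls \<b>. cls (comp_interp L T L \<a>' \<b>')) = cls (comp_interp L T L \<a> \<b>)"
  using eq by blast
 then show ?thesis by (simp add: Mor_monoid_def)
qed

lemma MorE:
 assumes "a \<in> carrier Mo" obtains \<a> \<F> where "induces \<a> \<F>" "a = cls \<a>"
proof -
 have "a \<in> Itp // hrel" using assms by (simp add: Mor_monoid_def Mor_def)
 then obtain \<a> where "\<a> \<in> Itp" "a = cls \<a>" by (rule quotientE)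
 then show thesis using induces_ex that by blast
qed

lemma cls_Mor: "\<a> \<in> Itp ==> cls \<a> \<in> carrier Mo"
 by (simp add: Mor_monoid_def Mor_def quotientI)

lemma induces_id: "induces (id_interp L T) (\<lambda>g. g)"
 by (rule id_interp) (auto simp: induces_def)

lemma Mo_one: "\<one>\<^bsub>Mo\<^esub> = cls (id_interp L T)"
 by (simp add: Mor_monoid_def)

lemma cls_mult_induces:
 assumes "induces \<a> \<F>" "induces \<b> \<H>" "induces \<c> (\<lambda>g. \<H> (\<F> g))"
 shows "cls \<a> \<otimes>\<^bsub>Mo\<^esub> cls \<b> = cls \<c>"
 unfolding cls_mult[OF induces_Itp[OF assms(1)] induces_Itp[OF assms(2)]]
  cls_eq_iff[OF induces_comp[OF assms(1,2)] assms(3)]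
 by (rule conj_eq_refl[OF induces_funcset[OF assms(3)]])

text \<open>Interpretations inducing the same endomorphism are homotopic, so the laws are inherited
  from composition of functions.\<close>

lemma Mo_monoid: "monoid Mo"
proof (rule monoidI)
 show "\<one>\<^bsub>Mo\<^esub> \<in> carrier Mo" unfolding Mo_one by (rule cls_Mor[OF induces_Itp[OF induces_id]])
 fix a assume "a \<in> carrier Mo"
 then obtain \<a> \<F> where a: "induces \<a> \<F>" "a = cls \<a>" by (rule MorE)
 show "\<one>\<^bsub>Mo\<^esub> \<otimes>\<^bsub>Mo\<^esub> a = a" unfolding Mo_one a(2) 
  by (rule cls_mult_induces[where \<F> = "\<lambda>g. g" and \<H> = \<F>, OF induces_id a(1) a(1)])
 show "a \<otimes>\<^bsub>Mo\<^esub> \<one>\<^bsub>Mo\<^esub> = a" unfolding Mo_one a(2) 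
  by (rule cls_mult_induces[where \<F> = \<F> and \<H> = "\<lambda>g. g", OF a(1) induces_id a(1)])
 fix b assume "b \<in> carrier Mo"
 then obtain \<b> \<H> where b: "induces \<b> \<H>" "b = cls \<b>" by (rule MorE)
 have ab: "a \<otimes>\<^bsub>Mo\<^esub> b = cls (comp_interp L T L \<a> \<b>)"
  unfolding a(2) b(2) by (rule cls_mult[OF induces_Itp[OF a(1)] induces_Itp[OF b(1)]])
 show "a \<otimes>\<^bsub>Mo\<^esub> b \<in> carrier Mo" unfolding ab by (rule cls_Mor[OF induces_Itp[OF induces_comp[OF a(1) b(1)]]])
 fix c assume "c \<in> carrier Mo"
 then obtain \<c> \<T> where c: "induces \<c> \<T>" "c = cls \<c>" by (rule MorE)
 have bc: "b \<otimes>\<^bsub>Mo\<^esub> c = cls (comp_interp L T L \<b> \<c>)"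
  unfolding c(2) b(2) by (rule cls_mult[OF induces_Itp[OF b(1)] induces_Itp[OF c(1)]])
 show "a \<otimes>\<^bsub>Mo\<^esub> b \<otimes>\<^bsub>Mo\<^esub> c = a \<otimes>\<^bsub>Mo\<^esub> (b \<otimes>\<^bsub>Mo\<^esub> c)"
 proof -
  let ?d = "comp_interp L T L (comp_interp L T L \<a> \<b>) \<c>"
  have ab': "induces (comp_interp L T L \<a> \<b>) (\<lambda>g. \<H> (\<F> g))" by (rule induces_comp[OF a(1) b(1)])
  have bc': "induces (comp_interp L T L \<b> \<c>) (\<lambda>g. \<T> (\<H> g))" by (rule induces_comp[OF b(1) c(1)])
  have d: "induces ?d (\<lambda>g. \<T> (\<H> (\<F> g)))"
   by (rule induces_comp[where \<F> = "\<lambda>g. \<H> (\<F> g)" and \<H> = \<T>, OF ab' c(1)])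
  have "cls (comp_interp L T L \<a> \<b>) \<otimes>\<^bsub>Mo\<^esub> cls \<c> = cls ?d"
   by (rule cls_mult_induces[where \<F> = "\<lambda>g. \<H> (\<F> g)" and \<H> = \<T>, OF ab' c(1) d])
  moreover have "cls \<a> \<otimes>\<^bsub>Mo\<^esub> cls (comp_interp L T L \<b> \<c>) = cls ?d"
   by (rule cls_mult_induces[where \<F> = \<F> and \<H> = "\<lambda>g. \<T> (\<H> g)", OF a(1) bc' d])
  ultimately show ?thesis unfolding ab bc unfolding a(2) c(2) by (simp only:)
 qed
qed

section \<open>From automorphisms to homotopy classes\<close>

definition q :: "(('a => 'a) => 'a => 'a) => ('r, 'r) interp set" where
 "q \<F> = {\<b>. \<exists>\<H>. induces \<b> \<H> \<and> conj_eq \<F> \<H>}"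

text \<open>\<open>q\<close> is defined without choosing an interpretation; this identifies its
  value as soon as some interpretation inducing \<open>\<F>\<close> is at hand.\<close>

lemma q_cls:
 assumes "induces \<a> \<F>" shows "q \<F> = cls \<a>"
proof -
 have "\<b> \<in> q \<F> <-> (\<a>, \<b>) \<in> hrel" for \<b>
 proof
  assume "\<b> \<in> q \<F>"
  then obtain \<H> where "induces \<b> \<H>" "conj_eq \<F> \<H>" by (auto simp: q_def)
  then show "(\<a>, \<b>) \<in> hrel" using hrel_iff[OF assms] by blast
 next
  assume h: "(\<a>, \<b>) \<in> hrel"
  then have "\<b> \<in> Itp" by (auto simp: homotopy_rel_def)
  then obtain \<H> where "induces \<b> \<H>" using induces_ex by blast
  then show "\<b> \<in> q \<F>" using h hrel_iff[OF assms] by (auto simp: q_def)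
 qed
 then show ?thesis by blast
qed

lemma A_funcset: "\<F> \<in> \<A> ==> \<F> \<in> \<G> \<rightarrow> \<G>"
 using A_closed by blast

lemma A_induced:
 assumes "\<F> \<in> \<A>" obtains \<a> where "induces \<a> \<F>"
 by (rule realize_hom[OF A_hom[OF assms] A_onto[OF assms] A_loc_const[OF assms]]) (auto simp: induces_def intro: that)

lemma q_eq_iff:
 assumes "\<F> \<in> \<A>" "\<H> \<in> \<A>" shows "q \<F> = q \<H> <-> conj_eq \<F> \<H>"
proof -
 obtain \<a> where \<a>: "induces \<a> \<F>" using assms(1) by (rule A_induced)
 obtain \<b> where \<b>: "induces \<b> \<H>" using assms(2) by (rule A_induced)
 show ?thesis unfolding q_cls[OF \<a>] q_cls[OF \<b>] by (rule cls_eq_iff[OF \<a> \<b>])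
qed

lemma q_mult:
 assumes "\<F> \<in> \<A>" "\<H> \<in> \<A>" shows "q \<F> \<otimes>\<^bsub>Mo\<^esub> q \<H> = q (\<H> \<star> \<F>)"
proof -
 obtain \<a> where \<a>: "induces \<a> \<F>" using assms(1) by (rule A_induced)
 obtain \<b> where \<b>: "induces \<b> \<H>" using assms(2) by (rule A_induced)
 obtain \<c> where \<c>: "induces \<c> (\<H> \<star> \<F>)" using A.m_closed[OF assms(2,1)] by (rule A_induced)
 have "induces \<c> (\<lambda>g. \<H> (\<F> g))" by (rule induces_cong[OF \<c>]) (rule A_mult_apply[OF assms(2,1)])
 then show ?thesis unfolding q_cls[OF \<a>] q_cls[OF \<b>] q_cls[OF \<c>] by (rule cls_mult_induces[OF \<a> \<b>])
qed

lemma q_one: "q \<one>\<^bsub>A\<^esub> = \<one>\<^bsub>Mo\<^esub>"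
proof -
 have "induces (id_interp L T) \<one>\<^bsub>A\<^esub>" by (rule induces_cong[OF induces_id]) (simp add: A_one)
 then show ?thesis unfolding Mo_one by (rule q_cls)
qed

lemma q_Mor: "\<F> \<in> \<A> ==> q \<F> \<in> carrier Mo"
 by (erule A_induced) (simp add: q_cls cls_Mor induces_Itp)

lemma q_inverse:
 assumes "\<F> \<in> \<A>"
 shows "q \<F> \<otimes>\<^bsub>Mo\<^esub> q (invA \<F>) = \<one>\<^bsub>Mo\<^esub>" "q (invA \<F>) \<otimes>\<^bsub>Mo\<^esub> q \<F> = \<one>\<^bsub>Mo\<^esub>"
 using assms by (simp_all add: q_mult q_one)

lemma q_Units:
 assumes \<F>: "\<F> \<in> \<A>" shows "q \<F> \<in> carrier BG"
proof -
 have "\<exists>x\<in>carrier Mo. x \<otimes>\<^bsub>Mo\<^esub> q \<F> = \<one>\<^bsub>Mo\<^esub> \<and> q \<F> \<otimes>\<^bsub>Mo\<^esub> x = \<one>\<^bsub>Mo\<^esub>"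
  using q_inverse[OF \<F>] q_Mor[OF A.inv_closed[OF \<F>]] by blast
 then show ?thesis using q_Mor[OF \<F>] by (simp add: BT_def units_of_def Units_def)
qed

lemma q_inv:
 assumes "\<F> \<in> \<A>" shows "inv\<^bsub>Mo\<^esub> (q \<F>) = q (invA \<F>)"
 using monoid.inv_unique'[OF Mo_monoid q_Mor[OF assms] q_Mor[OF A.inv_closed[OF assms]] q_inverse[OF assms]] by simp

lemma restrict_A:
 assumes \<F>: "induces \<a> \<F>" "inj_on \<F> (\<G>)" "\<G> \<subseteq> \<F> ` \<G>"
 shows "restrict \<F> (\<G>) \<in> \<A>" "induces \<a> (restrict \<F> (\<G>))"
proof -
 let ?R = "restrict \<F> (\<G>)"
 show i: "induces \<a> ?R" by (rule induces_cong[OF \<F>(1)]) simp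
 have "bij_betw \<F> (\<G>) (\<G>)"
  using \<F>(2,3) induces_funcset[OF \<F>(1)] by (auto simp: bij_betw_def)
 then have "bij_betw ?R (\<G>) (\<G>)" by (simp cong: bij_betw_cong)
 moreover have "continuous_map X X ?R"
  by (rule loc_const_continuous[OF induces_funcset[OF i] induces_loc_const[OF i]])
 ultimately show "?R \<in> \<A>" unfolding A_iff using induces_hom[OF i] by (simp add: Bij_def)
qed

text \<open>Both composites with a representative of the inverse class are homotopic to the
  identity, hence induce inner automorphisms. One composite makes \<open>\<F>\<close> injective, the
  other makes it onto.\<close>

lemma BG_E:
 assumes "a \<in> carrier BG" obtains \<F> where "\<F> \<in> \<A>" "a = q \<F>"
proof -
 obtain b where ab: "a \<in> carrier Mo" "b \<in> carrier Mo" "a \<otimes>\<^bsub>Mo\<^esub> b = \<one>\<^bsub>Mo\<^esub>" "b \<otimes>\<^bsub>Mo\<^esub> a = \<one>\<^bsub>Mo\<^esub>"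
  using assms unfolding BT_def units_of_def Units_def by auto
 obtain \<a> \<F> where \<a>: "induces \<a> \<F>" "a = cls \<a>" using ab(1) by (rule MorE)
 obtain \<b> \<H> where \<b>: "induces \<b> \<H>" "b = cls \<b>" using ab(2) by (rule MorE)
 have inner: "\<exists>h\<in>\<G>. \<forall>g\<in>\<G>. \<H>' (\<F>' g) = h \<cdot> g \<cdot> \<iota> h"
  if i: "induces \<a>' \<F>'" "induces \<b>' \<H>'" "cls \<a>' \<otimes>\<^bsub>Mo\<^esub> cls \<b>' = \<one>\<^bsub>Mo\<^esub>" for \<a>' \<b>' \<F>' \<H>'
 proof -
  have m: "(\<lambda>g. g) \<in> \<G> \<rightarrow> \<G>" "(\<lambda>g. \<H>' (\<F>' g)) \<in> \<G> \<rightarrow> \<G>"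
   using induces_funcset[OF i(1)] induces_funcset[OF i(2)] by auto
  have "cls (id_interp L T) = cls (comp_interp L T L \<a>' \<b>')"
   using i(3) cls_mult[OF induces_Itp[OF i(1)] induces_Itp[OF i(2)]] Mo_one by simp
  then have "conj_eq (\<lambda>g. g) (\<lambda>g. \<H>' (\<F>' g))" using cls_eq_iff[OF induces_id induces_comp[OF i(1,2)]] by simp
  then obtain h where h: "h \<in> \<G>" "!!g. g \<in> \<G> ==> \<H>' (\<F>' g) \<cdot> h = h \<cdot> g"
   unfolding conj_eq_iff[OF m] by blast
  have "\<H>' (\<F>' g) = h \<cdot> g \<cdot> \<iota> h" if g: "g \<in> \<G>" for g
   using h(1) h(2)[OF g] funcset_mem[OF m(2) g] g
   by (metis G.inv_closed G.m_assoc G.r_inv G.r_one)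
  then show ?thesis using h(1) by blast
 qed
 obtain h where h: "h \<in> \<G>" "!!g. g \<in> \<G> ==> \<H> (\<F> g) = h \<cdot> g \<cdot> \<iota> h"
  using inner[OF \<a>(1) \<b>(1)] ab(3) \<a>(2) \<b>(2) by blast
 obtain k where k: "k \<in> \<G>" "!!g. g \<in> \<G> ==> \<F> (\<H> g) = k \<cdot> g \<cdot> \<iota> k"
  using inner[OF \<b>(1) \<a>(1)] ab(4) \<a>(2) \<b>(2) by blast
 have "inj_on \<F> (\<G>)"
 proof (rule inj_onI)
  fix x y assume xy: "x \<in> \<G>" "y \<in> \<G>" "\<F> x = \<F> y"
  then have "h \<cdot> x \<cdot> \<iota> h = h \<cdot> y \<cdot> \<iota> h"
   using h(2)[OF xy(1)] h(2)[OF xy(2)] by simp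
  then show "x = y" using xy h(1) by simp
 qed
 moreover have "\<G> \<subseteq> \<F> ` \<G>"
 proof
  fix y assume y: "y \<in> \<G>"
  define x where "x = \<iota> k \<cdot> y \<cdot> k"
  have x: "x \<in> \<G>" using y k(1) by (simp add: x_def)
  have "k \<cdot> x \<cdot> \<iota> k = (k \<cdot> \<iota> k) \<cdot> y \<cdot> (k \<cdot> \<iota> k)"
   unfolding x_def using y k(1) by (simp only: G.m_assoc G.inv_closed G.m_closed)
  also have "\<dots> = y" using y k(1) by simp
  finally have "\<F> (\<H> x) = y" using k(2)[OF x] by simp
  then show "y \<in> \<F> ` \<G>" using funcset_mem[OF induces_funcset[OF \<b>(1)] x] by blast
 qed
 ultimately have "restrict \<F> (\<G>) \<in> \<A>" "induces \<a> (restrict \<F> (\<G>))"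
  using restrict_A[OF \<a>(1)] by simp_all
 then show thesis using that q_cls \<a>(2) by metis
qed

lemma BG_group: "group BG"
 unfolding BT_def by (rule monoid.units_group[OF Mo_monoid])

lemma q_eq_one_iff:
 assumes \<F>: "\<F> \<in> \<A>" shows "q \<F> = \<one>\<^bsub>Mo\<^esub> <-> \<F> \<in> Inn G"
proof -
 have m: "(\<lambda>g. g) \<in> \<G> \<rightarrow> \<G>" by simp
 have "q \<F> = \<one>\<^bsub>Mo\<^esub> <-> conj_eq \<one>\<^bsub>A\<^esub> \<F>"
  unfolding q_one[symmetric] using q_eq_iff[OF A.one_closed \<F>] by metis
 also have "\<dots> <-> conj_eq (\<lambda>g. g) \<F>" by (rule conj_eq_cong) (simp_all add: A_one)
 also have "\<dots> <-> (\<exists>h\<in>\<G>. \<forall>g\<in>\<G>. \<F> g = h \<cdot> g \<cdot> \<iota> h)"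
  unfolding conj_eq_iff[OF m A_funcset[OF \<F>]]
 proof (intro bex_cong refl ball_cong)
  fix h g assume hg: "h \<in> \<G>" "g \<in> \<G>"
  then show "\<F> g \<cdot> h = h \<cdot> g <-> \<F> g = h \<cdot> g \<cdot> \<iota> h"
   using G.inv_solve_right[of "\<F> g" "h \<cdot> g" h] A_closed[OF \<F>] by (metis G.m_closed)
 qed
 also have "\<dots> <-> \<F> \<in> Inn G"
 proof -
  have "(\<forall>g\<in>\<G>. \<F> g = h \<cdot> g \<cdot> \<iota> h) <-> \<F> = (\<lambda>x\<in>\<G>. h \<cdot> x \<cdot> \<iota> h)" for h
  proof
   have ext: "\<F> \<in> extensional (\<G>)" using \<F> by (simp add: A_iff Bij_def)
   assume "\<forall>g\<in>\<G>. \<F> g = h \<cdot> g \<cdot> \<iota> h"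
   then show "\<F> = (\<lambda>x\<in>\<G>. h \<cdot> x \<cdot> \<iota> h)"
    by (intro extensionalityI[OF ext]) auto
  qed simp
  then show ?thesis unfolding Inn_def by blast
 qed
 finally show ?thesis .
qed

text \<open>Composition of interpretations corresponds to composition of automorphisms in the opposite
 order, hence the inverse.\<close>

definition p :: "(('a => 'a) => 'a => 'a) => ('r, 'r) interp set" where
 "p \<F> = q (invA \<F>)"

lemma BG_simps: "mult BG = mult Mo" "one BG = one Mo"
 by (simp_all add: BT_def units_of_def)

lemma p_hom: "p \<in> hom A BG"
proof (rule homI)
 fix \<F> \<H> assume a: "\<F> \<in> \<A>" "\<H> \<in> \<A>"
 show "p \<F> \<in> carrier BG" unfolding p_def using a by (simp add: q_Units)
 show "p (\<F> \<star> \<H>) = p \<F> \<otimes>\<^bsub>BG\<^esub> p \<H>"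
  unfolding p_def BG_simps using a by (simp add: q_mult A.inv_mult_group)
qed

lemma p_onto: "p ` \<A> = carrier BG"
proof
 show "p ` \<A> \<subseteq> carrier BG" unfolding p_def using q_Units by auto
 show "carrier BG \<subseteq> p ` \<A>"
 proof
  fix a assume "a \<in> carrier BG"
  then obtain \<F> where \<F>: "\<F> \<in> \<A>" "a = q \<F>" by (rule BG_E)
  then have "a = p (invA \<F>)" by (simp add: p_def)
  then show "a \<in> p ` \<A>" using A.inv_closed[OF \<F>(1)] by blast
 qed
qed

text \<open>Composing the coordinates of the identity interpretation with \<open>h\<close> realises
  conjugation by \<open>h\<close>, and maps induced by interpretations are continuous
  homomorphisms.\<close>

lemma inner_A:
 assumes h: "h \<in> \<G>" shows "(\<lambda>x\<in>\<G>. h \<cdot> x \<cdot> \<iota> h) \<in> \<A>"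
proof -
 define \<F> where "\<F> = (\<lambda>x\<in>\<G>. h \<cdot> x \<cdot> \<iota> h)"
 have \<F>: "\<F> g = h \<cdot> g \<cdot> \<iota> h" if "g \<in> \<G>" for g using that by (simp add: \<F>_def)
 obtain \<pi> where i: "id_interp L T \<in> Itp" "coord L M (id_interp L T) M \<pi>" "acts (id_interp L T) \<pi> (\<lambda>g. g)"
  by (rule id_interp)
 have "bij_betw h U U" "preserves 0 h" using h by (simp_all add: G_bij G_preserves)
 moreover have "\<F> g \<in> \<G>" "x \<in> U ==> \<F> g (h x) = h (g x)" if "g \<in> \<G>" for g x
  using that h by (simp_all add: \<F> G_mult_apply G_closed G_inv_apply)
 ultimately obtain \<b> where "\<b> \<in> basic_nbhd (id_interp L T) 0" "coord L M \<b> M (h \<circ> \<pi>)" "acts \<b> (h \<circ> \<pi>) \<F>"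
  by (rule realize_nearby[OF i])
 then have ind: "induces \<b> \<F>" by (auto simp: induces_def basic_nbhd_def)
 have "inj_on \<F> (\<G>)" by (rule inj_onI) (use h in \<open>simp add: \<F>\<close>)
 moreover have "\<G> \<subseteq> \<F> ` \<G>"
 proof
  fix y assume y: "y \<in> \<G>"
  have "h \<cdot> (\<iota> h \<cdot> y \<cdot> h) \<cdot> \<iota> h = (h \<cdot> \<iota> h) \<cdot> y \<cdot> (h \<cdot> \<iota> h)"
   using y h by (simp only: G.m_assoc G.inv_closed G.m_closed)
  then have "\<F> (\<iota> h \<cdot> y \<cdot> h) = y" using y h by (simp add: \<F>)
  then show "y \<in> \<F> ` \<G>" using y h by (metis G.inv_closed G.m_closed imageI)
 qed
 ultimately have "restrict \<F> (\<G>) \<in> \<A>" by (rule restrict_A[OF ind])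
 moreover have "restrict \<F> (\<G>) = \<F>" by (simp add: \<F>_def)
 ultimately show ?thesis by (simp add: \<F>_def)
qed

lemma Inn_A: "Inn G \<subseteq> \<A>"
 using inner_A by (auto simp: Inn_def)

lemma p_kernel: "kernel A BG p = Inn G"
proof -
 have "p \<F> = \<one>\<^bsub>BG\<^esub> <-> \<F> \<in> Inn G" if \<F>: "\<F> \<in> \<A>" for \<F>
 proof -
  have "q (invA \<F>) = \<one>\<^bsub>Mo\<^esub> <-> q \<F> = \<one>\<^bsub>Mo\<^esub>"
   using q_inverse[OF \<F>] monoid.l_one[OF Mo_monoid] q_Mor[OF \<F>] q_Mor[OF A.inv_closed[OF \<F>]] by metis
  then show ?thesis unfolding p_def BG_simps using q_eq_one_iff[OF \<F>] by simp
 qed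
 then show ?thesis using Inn_A unfolding kernel_def by blast
qed

end

lemma wff_mono_symbols:
 assumes "wff (L\<lparr>symbols := S\<rparr>) m \<f>" "S \<subseteq> S'" shows "wff (L\<lparr>symbols := S'\<rparr>) m \<f>"
 using assms(1) by (induction \<f> arbitrary: m) (use assms(2) in auto)

context omega_cat
begin

section \<open>The topology of the group of homotopy classes\<close>

abbreviation "symbs n \<equiv> {r \<in> symbols L. sym_index L r < n}"

lemma finite_symbs: "finite (symbs n)"
proof (rule inj_on_finite[where B = "{..<n}"])
 show "inj_on (sym_index L) (symbs n)"
  using lang by (auto simp: countable_language_def intro: inj_on_subset)
qed auto

lemma wff_symbs: "wff L m \<f> ==> \<exists>n. wff (L\<lparr>symbols := symbs n\<rparr>) m \<f>"
proof (induction \<f> arbitrary: m)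
 case (Rel r vs)
 then show ?case by (intro exI[of _ "Suc (sym_index L r)"]) simp
next
 case (Conj \<f> \<p>)
 obtain n where n: "wff (L\<lparr>symbols := symbs n\<rparr>) m \<f>" using Conj.IH(1) Conj.prems by auto
 obtain n' where n': "wff (L\<lparr>symbols := symbs n'\<rparr>) m \<p>" using Conj.IH(2) Conj.prems by auto
 have "symbs n \<subseteq> symbs (max n n')" "symbs n' \<subseteq> symbs (max n n')" by auto
 then have "wff (L\<lparr>symbols := symbs (max n n')\<rparr>) m (Conj \<f> \<p>)"
  using wff_mono_symbols[OF n] wff_mono_symbols[OF n'] by simp
 then show ?case by (rule exI)
qed auto

text \<open>A formula contains finitely many symbols, and a permutation preserving these is an
  automorphism of the corresponding reduct.\<close>

lemma preserves_formula:
 assumes "wff L m \<f>"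
 shows "\<exists>n. \<forall>s zs. bij_betw s U U --> preserves n s --> zs \<in> tuples M m --> sat M (map s zs) \<f> = sat M zs \<f>"
proof -
 obtain n where n: "wff (L\<lparr>symbols := symbs n\<rparr>) m \<f>" using wff_symbs[OF assms] by blast
 have "sat M (map s zs) \<f> = sat M zs \<f>" if s: "bij_betw s U U" "preserves n s" and zs: "zs \<in> tuples M m" for s zs
 proof -
  have "iso_by (L\<lparr>symbols := symbs n\<rparr>) s M M" using s by (simp add: iso_by_def preserves_def)
  then show ?thesis by (rule sat_iso[OF _ n zs ne])
 qed
 then show ?thesis by blast
qed

section \<open>The topologies of interpretations and of their classes\<close>

abbreviation "IT \<equiv> interp_topology L T L T"

abbreviation "MT \<equiv> Mor_topology L T L T"

abbreviation "BY \<equiv> BT_topology L T"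

lemma basic_nbhd_self: "\<a> \<in> Itp ==> \<a> \<in> basic_nbhd \<a> n"
 by (simp add: basic_nbhd_def)

lemma basic_nbhd_eq: "\<b> \<in> basic_nbhd \<a> n ==> basic_nbhd \<b> n = basic_nbhd \<a> n"
 unfolding basic_nbhd_def by (intro Collect_cong) auto

lemma basic_nbhd_mono: "m \<le> n ==> basic_nbhd \<a> n \<subseteq> basic_nbhd \<a> m"
 by (auto simp: basic_nbhd_def)

lemma basic_nbhd_Itp: "basic_nbhd \<a> n \<subseteq> Itp"
 by (auto simp: basic_nbhd_def)

text \<open>Any member of a basic set may serve as its centre, and the sets shrink with
  \<open>n\<close>; so the generating sets already form a basis.\<close>

lemma openin_IT: "openin IT V <-> V \<subseteq> Itp \<and> (\<forall>\<a>\<in>V. \<exists>n. basic_nbhd \<a> n \<subseteq> V)"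
proof -
 let ?S = "{basic_nbhd \<a> n | \<a> n. \<a> \<in> Itp}"
 have IT: "IT = topology_generated_by ?S" by (simp add: interp_topology_def basic_nbhd_def)
 have "V \<subseteq> Itp \<and> (\<forall>\<a>\<in>V. \<exists>n. basic_nbhd \<a> n \<subseteq> V)" if "generate_topology_on ?S V" for V
  using that
 proof (induction V)
  case Empty
  show ?case by simp
 next
  case (Int a b)
  show ?case
  proof (intro conjI ballI)
   show "a \<inter> b \<subseteq> Itp" using Int.IH(1) by blast
   fix \<a> assume "\<a> \<in> a \<inter> b"
   then obtain m n where "basic_nbhd \<a> m \<subseteq> a" "basic_nbhd \<a> n \<subseteq> b" using Int.IH by blast
   then have "basic_nbhd \<a> (max m n) \<subseteq> a \<inter> b"
    using basic_nbhd_mono[of m "max m n" \<a>] basic_nbhd_mono[of n "max m n" \<a>] by simp blast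
   then show "\<exists>n. basic_nbhd \<a> n \<subseteq> a \<inter> b" by (rule exI)
  qed
 next
  case (UN K)
  show ?case
  proof (intro conjI ballI)
   show "\<Union> K \<subseteq> Itp" using UN.IH by blast
   fix \<a> assume "\<a> \<in> \<Union> K"
   then obtain k where k: "k \<in> K" "\<a> \<in> k" by blast
   then obtain n where "basic_nbhd \<a> n \<subseteq> k" using UN.IH by blast
   then show "\<exists>n. basic_nbhd \<a> n \<subseteq> \<Union> K" using k(1) by blast
  qed
 next
  case (Basis s)
  then obtain \<a> n where s: "s = basic_nbhd \<a> n" by blast
  show ?case unfolding s
  proof (intro conjI ballI exI)
   fix \<b> assume "\<b> \<in> basic_nbhd \<a> n"
   from basic_nbhd_eq[OF this] show "basic_nbhd \<b> n \<subseteq> basic_nbhd \<a> n" by simp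
  qed (rule basic_nbhd_Itp)
 qed
 moreover have "openin IT V" if V: "V \<subseteq> Itp" "\<forall>\<a>\<in>V. \<exists>n. basic_nbhd \<a> n \<subseteq> V"
 proof (rule openin_subopen[THEN iffD2], intro ballI)
  fix \<a> assume \<a>: "\<a> \<in> V"
  then have \<a>I: "\<a> \<in> Itp" using V(1) by blast
  obtain n where n: "basic_nbhd \<a> n \<subseteq> V" using V(2) \<a> by blast
  have "openin IT (basic_nbhd \<a> n)"
   unfolding IT by (rule topology_generated_by_Basis) (use \<a>I in blast)
  then show "\<exists>W. openin IT W \<and> \<a> \<in> W \<and> W \<subseteq> V" using basic_nbhd_self[OF \<a>I] n by blast
 qed
 ultimately show ?thesis unfolding IT openin_topology_generated_by_iff by blast
qed

lemma topspace_IT: "topspace IT = Itp"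
proof
 show "topspace IT \<subseteq> Itp" using openin_topspace[of IT] unfolding openin_IT by blast
 have "openin IT Itp" unfolding openin_IT using basic_nbhd_Itp by blast
 then show "Itp \<subseteq> topspace IT" by (rule openin_subset)
qed

lemma openin_MT: "openin MT V <-> V \<subseteq> cls ` Itp \<and> openin IT {\<a> \<in> Itp. cls \<a> \<in> V}"
 unfolding Mor_topology_def openin_quotient_topology topspace_IT ..

lemma topspace_MT: "topspace MT = carrier Mo"
 unfolding Mor_topology_def topspace_quotient_topology topspace_IT
 by (auto simp: Mor_monoid_def Mor_def quotient_def)

text \<open>Equal domains and equalities mean that the two coordinate maps have the same kernel, so
  they differ by a permutation \<open>s\<close>. It intertwines the two actions, and it preserves
  the first \<open>n\<close> symbols since their formulas coincide.\<close>

lemma basic_nbhd_near: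
 assumes \<a>: "induces \<a> \<F>" and \<b>: "induces \<b> \<H>" "\<b> \<in> basic_nbhd \<a> n"
 shows "near n \<F> \<H>"
proof -
 obtain \<pi> where \<pi>: "coord L M \<a> M \<pi>" "acts \<a> \<pi> \<F>" using \<a> by (rule inducesE)
 obtain \<v> where \<v>: "coord L M \<b> M \<v>" "acts \<b> \<v> \<H>" using \<b>(1) by (rule inducesE)
 let ?D = "dom_set \<a> M"
 have D: "dom_set \<b> M = ?D" "eq_rel \<b> M = eq_rel \<a> M" using basic_nbhd_dom[OF \<b>(2)] by auto
 have eq: "\<pi> xs = \<pi> ys <-> \<v> xs = \<v> ys" if "xs \<in> ?D" "ys \<in> ?D" for xs ys
  using coord_eq[OF \<pi>(1), of xs ys] coord_eq[OF \<v>(1), of xs ys] that unfolding D by simp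
 define s where "s y = \<v> (SOME xs. xs \<in> ?D \<and> \<pi> xs = y)" for y
 have s: "s (\<pi> xs) = \<v> xs" if xs: "xs \<in> ?D" for xs
 proof -
  have "(SOME ys. ys \<in> ?D \<and> \<pi> ys = \<pi> xs) \<in> ?D \<and> \<pi> (SOME ys. ys \<in> ?D \<and> \<pi> ys = \<pi> xs) = \<pi> xs"
   by (rule someI[of "\<lambda>ys. ys \<in> ?D \<and> \<pi> ys = \<pi> xs" xs]) (simp add: xs)
  then show ?thesis unfolding s_def using eq xs by blast
 qed
 have bij: "bij_betw s U U"
  unfolding bij_betw_def
 proof
  show "inj_on s U"
  proof (rule inj_onI)
   fix x y assume xy: "x \<in> U" "y \<in> U" "s x = s y"
   obtain xs where xs: "xs \<in> ?D" "\<pi> xs = x" using coord_onto[OF \<pi>(1) xy(1)] by blast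
   obtain ys where ys: "ys \<in> ?D" "\<pi> ys = y" using coord_onto[OF \<pi>(1) xy(2)] by blast
   show "x = y" using xy(3) s[OF xs(1)] s[OF ys(1)] eq[OF xs(1) ys(1)] xs(2) ys(2) by simp
  qed
  show "s ` U = U"
  proof (intro equalityI subsetI)
   fix y assume "y \<in> s ` U"
   then obtain x where x: "x \<in> U" "y = s x" by blast
   obtain xs where xs: "xs \<in> ?D" "\<pi> xs = x" using coord_onto[OF \<pi>(1) x(1)] by blast
   show "y \<in> U" using s[OF xs(1)] xs coord_dom[OF \<v>(1), of xs] x(2) unfolding D by simp
  next
   fix y assume "y \<in> U"
   then obtain xs where xs: "xs \<in> ?D" "\<v> xs = y" using coord_onto[OF \<v>(1)] unfolding D by blast
   then have "y = s (\<pi> xs)" "\<pi> xs \<in> U" using s coord_dom[OF \<pi>(1)] by simp_all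
   then show "y \<in> s ` U" by (rule image_eqI)
  qed
 qed
 have "conj_by s \<F> \<H>"
  unfolding conj_by_def
 proof (intro conjI bij ballI)
  fix g y assume g: "g \<in> \<G>" and y: "y \<in> U"
  obtain xs where xs: "xs \<in> ?D" "\<pi> xs = y" using coord_onto[OF \<pi>(1) y] by blast
  have gxs: "map g xs \<in> ?D" by (rule dom_set_invariant[OF interp_wf[OF induces_Itp[OF \<a>]] g xs(1)])
  have "\<H> g (s y) = \<H> g (\<v> xs)" using s[OF xs(1)] xs(2) by simp
  also have "\<dots> = \<v> (map g xs)" using \<v>(2) g xs(1) unfolding acts_def D by simp
  also have "\<dots> = s (\<pi> (map g xs))" using s[OF gxs] by simp
  also have "\<pi> (map g xs) = \<F> g y" using \<pi>(2) g xs unfolding acts_def by simp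
  finally show "\<H> g (s y) = s (\<F> g y)" .
 qed
 moreover have "preserves n s"
  unfolding preserves_def
 proof (intro ballI impI)
  fix r zs assume r: "r \<in> symbols L" "sym_index L r < n" and zs: "zs \<in> tuples M (arity L r)"
  have "set zs \<subseteq> U" "length zs = arity L r" using zs by (auto simp: tuples_def)
  then obtain xss where xss: "length xss = arity L r" "set xss \<subseteq> ?D" "map \<pi> xss = zs"
   using coord_onto_list[OF \<pi>(1)] by metis
  have "map s zs = map \<v> xss"
   unfolding xss(3)[symmetric] map_map by (rule map_cong) (use s xss(2) in auto)
  moreover have "sym_fm \<b> r = sym_fm \<a> r" using \<b>(2) r by (simp add: basic_nbhd_def)
  ultimately show "map s zs \<in> interp_rel M r <-> zs \<in> interp_rel M r"
   using coord_rel[OF \<pi>(1) r(1) xss(1,2)] coord_rel[OF \<v>(1) r(1) xss(1)] xss(2,3) unfolding D by simp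
 qed
 ultimately show ?thesis unfolding near_def by blast
qed

definition q_ball :: "nat => (('a => 'a) => 'a => 'a) => ('r, 'r) interp set set" where
 "q_ball n \<F> = q ` {\<H> \<in> \<A>. near n \<F> \<H>}"

lemma openin_BY:
 assumes "openin MT V" shows "openin BY (carrier BG \<inter> V)"
proof -
 have "openin (prod_topology MT MT) (V \<times> topspace MT)" using assms by (simp add: openin_prod_Times_iff)
 moreover have "carrier BG \<inter> V = (\<lambda>a. (a, inv\<^bsub>Mo\<^esub> a)) -` (V \<times> topspace MT) \<inter> carrier BG"
 proof -
  have "inv\<^bsub>Mo\<^esub> a \<in> topspace MT" if a: "a \<in> carrier BG" for a
  proof -
   obtain \<F> where \<F>: "\<F> \<in> \<A>" "a = q \<F>" using a by (rule BG_E)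
   show ?thesis unfolding \<F>(2) q_inv[OF \<F>(1)] topspace_MT by (rule q_Mor[OF A.inv_closed[OF \<F>(1)]])
  qed
  then show ?thesis by auto
 qed
 ultimately show ?thesis unfolding BT_topology_def openin_pullback_topology by blast
qed

text \<open>The interpretations inducing maps near \<open>\<F>\<close> form a union of homotopy
  classes, as conjugacy under \<open>\<G>\<close> implies \<open>near n\<close>, and an open set by
  \<open>basic_nbhd_near\<close>.\<close>

lemma q_ball_open:
 assumes \<F>: "\<F> \<in> \<A>" shows "openin BY (q_ball n \<F>)"
proof -
 define W where "W = {\<a>. \<exists>\<H>. induces \<a> \<H> \<and> near n \<F> \<H>}"
 have WI: "W \<subseteq> Itp" using induces_Itp by (auto simp: W_def)
 have W: "near n \<F> \<H>" if \<a>: "\<a> \<in> W" "induces \<a> \<H>" for \<a> \<H>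
 proof -
  obtain \<H>' where \<H>': "induces \<a> \<H>'" "near n \<F> \<H>'" using \<a>(1) by (auto simp: W_def)
  have "conj_eq \<H>' \<H>" using cls_eq_iff[OF \<H>'(1) \<a>(2)] by simp
  then show ?thesis using near_trans[OF \<H>'(2)] conj_eq_near by blast
 qed
 have sat: "\<b> \<in> W" if ab: "\<a> \<in> W" "\<b> \<in> Itp" "cls \<b> = cls \<a>" for \<a> \<b>
 proof -
  obtain \<H> where \<H>: "induces \<a> \<H>" "near n \<F> \<H>" using ab(1) by (auto simp: W_def)
  obtain \<T> where \<T>: "induces \<b> \<T>" using induces_ex[OF ab(2)] by blast
  have "conj_eq \<H> \<T>" using cls_eq_iff[OF \<H>(1) \<T>] ab(3) by simp
  then show ?thesis unfolding W_def using near_trans[OF \<H>(2)] conj_eq_near \<T> by blast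
 qed
 have "openin IT W"
  unfolding openin_IT
 proof (intro conjI WI ballI exI subsetI)
  fix \<a> \<b> assume \<a>: "\<a> \<in> W" and \<b>: "\<b> \<in> basic_nbhd \<a> n"
  obtain \<H> where \<H>: "induces \<a> \<H>" "near n \<F> \<H>" using \<a> by (auto simp: W_def)
  obtain \<T> where \<T>: "induces \<b> \<T>" using induces_ex subsetD[OF basic_nbhd_Itp \<b>] by blast
  show "\<b> \<in> W" unfolding W_def using near_trans[OF \<H>(2) basic_nbhd_near[OF \<H>(1) \<T> \<b>]] \<T> by blast
 qed
 moreover have "{\<a> \<in> Itp. cls \<a> \<in> cls ` W} = W" using sat WI by blast
 ultimately have "openin MT (cls ` W)" unfolding openin_MT using WI by auto
 moreover have "q_ball n \<F> = carrier BG \<inter> cls ` W"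
 proof (intro equalityI subsetI)
  fix a assume "a \<in> q_ball n \<F>"
  then obtain \<H> where \<H>: "\<H> \<in> \<A>" "near n \<F> \<H>" "a = q \<H>" by (auto simp: q_ball_def)
  obtain \<a> where \<a>: "induces \<a> \<H>" using \<H>(1) by (rule A_induced)
  then show "a \<in> carrier BG \<inter> cls ` W"
   using q_Units[OF \<H>(1)] q_cls[OF \<a>] \<H>(2,3) by (auto simp: W_def)
 next
  fix a assume a: "a \<in> carrier BG \<inter> cls ` W"
  then obtain \<H> where \<H>: "\<H> \<in> \<A>" "a = q \<H>" using BG_E by blast
  obtain \<a> where \<a>: "induces \<a> \<H>" using \<H>(1) by (rule A_induced)
  obtain \<b> where \<b>: "\<b> \<in> W" "cls \<b> = cls \<a>" using a \<H>(2) q_cls[OF \<a>] by blast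
  have "\<a> \<in> W" by (rule sat[OF \<b>(1) induces_Itp[OF \<a>] \<b>(2)[symmetric]])
  then show "a \<in> q_ball n \<F>" unfolding q_ball_def using W[OF _ \<a>] \<H> by blast
 qed
 ultimately show ?thesis using openin_BY by simp
qed

text \<open>If \<open>s\<close> preserves finitely many formulas defining \<open>B\<close> and the orbit of its parameters, then
 after composing \<open>s\<close> with an automorphism, it fixes the parameters, and conjugation by it maps
 \<open>B\<close> to itself.\<close>

lemma cosets_absorb:
 assumes fin: "finite \<B>" and B: "\<B> \<subseteq> cosets"
 shows "\<exists>n. \<forall>s \<s>. conj_by s (\<lambda>g. g) \<s> --> preserves n s --> \<s> \<in> \<G> \<rightarrow> \<G> -->
  (\<exists>h\<in>\<G>. \<forall>B\<in>\<B>. \<forall>g\<in>\<G>. h \<cdot> \<s> g \<cdot> \<iota> h \<in> B <-> g \<in> B)"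
proof -
 define P where "P B a b \<f> n <-> set a \<subseteq> U \<and> set b \<subseteq> U \<and> B = {h \<in> \<G>. sat M (a @ map h b) \<f>} \<and>
  (\<forall>s g. bij_betw s U U --> preserves n s --> g \<in> \<G> --> sat M (map s (a @ map g b)) \<f> = sat M (a @ map g b) \<f>)"
  for B a b \<f> n
 have "\<exists>d. P B (fst d) (fst (snd d)) (fst (snd (snd d))) (snd (snd (snd d)))"
  if BB: "B \<in> \<B>" for B
 proof -
  obtain m a b \<f> where d: "a \<in> tuples M m" "b \<in> tuples M m" "wff L (m + m) \<f>"
   "B = {h \<in> \<G>. sat M (a @ map h b) \<f>}"
   by (rule open_coset_definable[OF subsetD[OF B BB]]) (rule that)
  obtain n where n: "!!s zs. bij_betw s U U ==> preserves n s ==> zs \<in> tuples M (m + m) ==>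
   sat M (map s zs) \<f> = sat M zs \<f>" using preserves_formula[OF d(3)] by blast
  have t: "a @ map g b \<in> tuples M (m + m)" if "g \<in> \<G>" for g
   using d(1) map_G_tuples[OF that d(2)] by (auto simp: tuples_def)
  have "set a \<subseteq> U" "set b \<subseteq> U" using d(1,2) by (auto simp: tuples_def)
  then have "P B a b \<f> n" unfolding P_def using d(4) n t by blast
  then show ?thesis by (intro exI[of _ "(a, b, \<f>, n)"]) simp
 qed
 then have "\<forall>B\<in>\<B>. \<exists>d. P B (fst d) (fst (snd d)) (fst (snd (snd d))) (snd (snd (snd d)))" by blast
 from bchoice[OF this] obtain d
  where d: "\<forall>B\<in>\<B>. P B (fst (d B)) (fst (snd (d B))) (fst (snd (snd (d B)))) (snd (snd (snd (d B))))" ..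
 define a where "a B = fst (d B)" for B
 define b where "b B = fst (snd (d B))" for B
 define \<f> where "\<f> B = fst (snd (snd (d B)))" for B
 define nn where "nn B = snd (snd (snd (d B)))" for B
 have PB: "P B (a B) (b B) (\<f> B) (nn B)" if "B \<in> \<B>" for B
  unfolding a_def b_def \<f>_def nn_def by (rule bspec[OF d that])
 note dB = PB[unfolded P_def, THEN conjunct1] PB[unfolded P_def, THEN conjunct2, THEN conjunct1]
  PB[unfolded P_def, THEN conjunct2, THEN conjunct2, THEN conjunct1]
  PB[unfolded P_def, THEN conjunct2, THEN conjunct2, THEN conjunct2, rule_format]
 have "finite (\<Union>B\<in>\<B>. set (a B) \<union> set (b B))" using fin by blast
 then obtain t where t: "set t = (\<Union>B\<in>\<B>. set (a B) \<union> set (b B))" using finite_list by blast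
 define m where "m = length t"
 have "set t \<subseteq> U" unfolding t using dB(1,2) by blast
 then have tt: "t \<in> tuples M m" by (simp add: m_def tuples_def)
 \<comment> \<open>The orbit of all parameters, listed in one tuple. Since \<open>s\<close>
   preserves the formula defining it, \<open>s\<close> moves \<open>t\<close> within its
   orbit.\<close>
 let ?S = "{map g t | g. g \<in> \<G>}"
 have S: "?S \<subseteq> tuples M m" using map_G_tuples[OF _ tt] by blast
 have Sinv: "map k xs \<in> ?S" if k: "k \<in> \<G>" and xs: "xs \<in> ?S" for k xs
 proof -
  obtain g where g: "g \<in> \<G>" "xs = map g t" using xs by blast
  have "map k xs = map (k \<cdot> g) t" using G_map_mult[OF k g(1) \<open>set t \<subseteq> U\<close>] g(2) by simp
  then show ?thesis using G.m_closed[OF k g(1)] by blast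
 qed
 obtain \<t> where \<t>: "wff L m \<t>" "!!xs. xs \<in> tuples M m ==> sat M xs \<t> <-> xs \<in> ?S"
  by (rule definable[OF S Sinv]) (assumption | rule that)+
 obtain n0 where n0: "!!s zs. bij_betw s U U ==> preserves n0 s ==> zs \<in> tuples M m ==>
   sat M (map s zs) \<t> = sat M zs \<t>" using preserves_formula[OF \<t>(1)] by blast
 \<comment> \<open>The sum serves as a common upper bound.\<close>
 define n where "n = n0 + (\<Sum>B\<in>\<B>. nn B)"
 have "\<exists>h\<in>\<G>. \<forall>B\<in>\<B>. \<forall>g\<in>\<G>. h \<cdot> \<s> g \<cdot> \<iota> h \<in> B <-> g \<in> B"
  if s: "conj_by s (\<lambda>g. g) \<s>" "preserves n s" and \<s>: "\<s> \<in> \<G> \<rightarrow> \<G>" for s \<s>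
 proof -
  have bij: "bij_betw s U U" using s(1) by (simp add: conj_by_def)
  have sU: "s ` U \<subseteq> U" using conj_by_closed[OF s(1)] by blast
  have "t \<in> ?S"
  proof -
   have "map \<one>\<^bsub>G\<^esub> t = t" using \<open>set t \<subseteq> U\<close> by (intro map_idI) (auto simp: G_one)
   then show ?thesis using G.one_closed by force
  qed
  then have "sat M (map s t) \<t>" using n0[OF bij preserves_mono[OF _ s(2)] tt] \<t>(2)[OF tt] by (simp add: n_def)
  then have "map s t \<in> ?S" using \<t>(2)[OF map_tuples[OF sU tt]] by simp
  \<comment> \<open>On \<open>t\<close>, the permutation \<open>s\<close> agrees with some
    \<open>k\<close> in \<open>\<G>\<close>; its inverse \<open>h\<close> is the correction that
    makes the composite fix all parameters.\<close>
  then obtain k where k: "k \<in> \<G>" "map s t = map k t" by blast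
  define h where "h = \<iota> k"
  have h: "h \<in> \<G>" using k(1) by (simp add: h_def)
  have hs: "h (s z) = z" if "z \<in> set t" for z
  proof -
   have "s z = k z" using k(2) that by (simp add: map_eq_conv)
   then show ?thesis using G_inv_apply[OF k(1)] that \<open>set t \<subseteq> U\<close> by (auto simp: h_def)
  qed
  have bij': "bij_betw (h \<circ> s) U U" by (rule bij_betw_trans[OF bij G_bij[OF h]])
  have "h \<cdot> \<s> g \<cdot> \<iota> h \<in> B <-> g \<in> B" if B: "B \<in> \<B>" and g: "g \<in> \<G>" for B g
  proof -
   let ?k = "h \<cdot> \<s> g \<cdot> \<iota> h"
   note \<s>g = funcset_mem[OF \<s> g]
   have kG: "?k \<in> \<G>" using h \<s>g by simp
   have sub: "set (a B) \<subseteq> set t" "set (b B) \<subseteq> set t" unfolding t using B by blast+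
   have "?k z = (h \<circ> s) (g z)" if z: "z \<in> set (b B)" for z
   proof -
    have zt: "z \<in> set t" and zU: "z \<in> U" using z sub(2) \<open>set t \<subseteq> U\<close> by blast+
    have "s z \<in> U" using conj_by_closed[OF s(1) zU] .
    then have "(\<iota> h) z = s z" using G_inv_apply[OF h, of "s z"] hs[OF zt] by simp
    then have "?k z = h (\<s> g (s z))" using h \<s>g zU \<open>s z \<in> U\<close> by (simp add: G_mult_apply)
    then show ?thesis using conj_by_eq[OF s(1) g zU] by simp
   qed
   then have mb: "map ?k (b B) = map (h \<circ> s) (map g (b B))" by simp
   have "map (h \<circ> s) (a B) = a B" by (rule map_idI) (use hs sub(1) in auto)
   then have "a B @ map ?k (b B) = map (h \<circ> s) (a B @ map g (b B))" unfolding mb map_append by (rule arg_cong[OF sym])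
   moreover have "preserves (nn B) (h \<circ> s)"
   proof (rule preserves_comp[OF sU _ G_preserves[OF h]])
    have "nn B \<le> (\<Sum>B\<in>\<B>. nn B)" using B fin by (intro member_le_sum) auto
    then show "preserves (nn B) s" using preserves_mono[OF _ s(2)] by (simp add: n_def)
   qed
   then have "sat M (map (h \<circ> s) (a B @ map g (b B))) (\<f> B) = sat M (a B @ map g (b B)) (\<f> B)"
    by (rule dB(4)[OF B bij' _ g])
   ultimately have "sat M (a B @ map ?k (b B)) (\<f> B) = sat M (a B @ map g (b B)) (\<f> B)" by (simp only:)
   moreover have "x \<in> B <-> sat M (a B @ map x (b B)) (\<f> B)" if "x \<in> \<G>" for x
    using dB(3)[OF B] that by blast
   ultimately show ?thesis using kG g by blast
  qed
  then show ?thesis using h by blast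
 qed
 then show ?thesis by blast
qed

text \<open>If \<open>\<H>\<close> is near \<open>\<F>\<close> through \<open>s\<close>, then
  \<open>\<H>\<close> is \<open>\<F>\<close> followed by conjugation by \<open>s\<close>. For large
  \<open>n\<close>, \<open>cosets_absorb\<close> corrects this by an inner automorphism until it
  agrees with \<open>\<F>\<close> on finitely many cosets. The corrected automorphism lies in
  \<open>S\<close> and has the same class as \<open>\<H>\<close>.\<close>

lemma q_ball_subset:
 assumes S: "openin AT S" "\<F> \<in> S" shows "\<exists>n. q_ball n \<F> \<subseteq> q ` S"
proof -
 obtain F where F: "finite F" "F \<subseteq> J" "{\<H> \<in> \<A>. \<forall>j\<in>F. act \<H> j = act \<F> j} \<subseteq> S"
  using S unfolding openin_AT by meson
 have \<F>: "\<F> \<in> \<A>" using S openin_subset topspace_AT by blast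
 \<comment> \<open>For a coordinate recording an image, the image under \<open>\<F>\<close> is
   taken; for one recording a preimage, the coset itself. Both lie on the side of the values of
   \<open>\<F>\<close>, where the conjugation acts.\<close>
 define \<B> where "\<B> = (\<lambda>j. if snd j then \<F> ` fst j else fst j) ` F"
 have fin: "finite \<B>" using F(1) by (simp add: \<B>_def)
 have "\<B> \<subseteq> cosets" using F(2) open_coset_image[OF \<F>] by (auto simp: \<B>_def)
 from cosets_absorb[OF fin this] obtain n where n: "\<forall>s \<s>. conj_by s (\<lambda>g. g) \<s> --> preserves n s --> \<s> \<in> \<G> \<rightarrow> \<G> -->
  (\<exists>h\<in>\<G>. \<forall>B\<in>\<B>. \<forall>g\<in>\<G>. h \<cdot> \<s> g \<cdot> \<iota> h \<in> B <-> g \<in> B)"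
  by (elim exE) (rule that)
 have "q \<H> \<in> q ` S" if \<H>: "\<H> \<in> \<A>" "near n \<F> \<H>" for \<H>
 proof -
  obtain s where s: "conj_by s \<F> \<H>" "preserves n s" using \<H>(2) by (auto simp: near_def)
  \<comment> \<open>This is conjugation by \<open>s\<close>, and it takes values in
    \<open>\<G>\<close>.\<close>
  define \<s> where "\<s> g = \<H> ((invA \<F>) g)" for g
  have iG: "(invA \<F>) g \<in> \<G>" if "g \<in> \<G>" for g
   using A_closed[OF A.inv_closed[OF \<F>] that] .
  have c: "conj_by s (\<lambda>g. g) \<s>"
   unfolding conj_by_def
  proof (intro conjI ballI)
   show "bij_betw s U U" using s(1) by (simp add: conj_by_def)
   fix g y assume g: "g \<in> \<G>" and y: "y \<in> U"
   show "\<s> g (s y) = s (g y)"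
    unfolding \<s>_def conj_by_eq[OF s(1) iG[OF g] y] A_apply_inv[OF \<F> g] ..
  qed
  have \<s>: "\<s> \<in> \<G> \<rightarrow> \<G>" using iG A_closed[OF \<H>(1)] by (simp add: \<s>_def)
  obtain h where h: "h \<in> \<G>"
   and hB: "!!B g. B \<in> \<B> ==> g \<in> \<G> ==> h \<cdot> \<s> g \<cdot> \<iota> h \<in> B <-> g \<in> B"
   using n[rule_format, OF c s(2) \<s>] by blast
  define \<C> where "\<C> = (\<lambda>x\<in>\<G>. h \<cdot> x \<cdot> \<iota> h)"
  have \<C>: "\<C> \<in> \<A>" unfolding \<C>_def by (rule inner_A[OF h])
  let ?\<H>' = "\<C> \<star> \<H>"
  have \<H>': "?\<H>' \<in> \<A>" using \<C> \<H>(1) by simp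
  have val: "?\<H>' g = h \<cdot> \<H> g \<cdot> \<iota> h" if "g \<in> \<G>" for g
   using A_mult_apply[OF \<C> \<H>(1) that] A_closed[OF \<H>(1) that] by (simp add: \<C>_def)
  have mem: "?\<H>' g \<in> B <-> \<F> g \<in> B" if B: "B \<in> \<B>" and g: "g \<in> \<G>" for B g
  proof -
   have "\<s> (\<F> g) = \<H> g" using A_inv_apply[OF \<F> g] by (simp add: \<s>_def)
   then show ?thesis using hB[OF B A_closed[OF \<F> g]] val[OF g] by simp
  qed
  have "act ?\<H>' j = act \<F> j" if j: "j \<in> F" for j
  proof -
   obtain B b where Bb: "j = (B, b)" "B \<in> cosets" using j F(2) by (cases j) auto
   have j\<B>: "(if snd j then \<F> ` fst j else fst j) \<in> \<B>" unfolding \<B>_def using j by (rule imageI)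
   note BG = open_coset_subset[OF Bb(2)]
   show ?thesis
   proof (cases b)
    case True
    have "\<F> ` B \<in> \<B>" using j\<B> Bb(1) True by simp
    note m = mem[OF this]
    have inj: "inj_on \<F> (\<G>)" using A_bij[OF \<F>] by (simp add: bij_betw_def)
    have m': "?\<H>' g \<in> \<F> ` B <-> g \<in> B" if "g \<in> \<G>" for g
     using m[OF that] inj_on_image_mem_iff[OF inj that BG] by simp
    have "?\<H>' ` B = \<F> ` B"
    proof (intro equalityI subsetI)
     fix y assume "y \<in> ?\<H>' ` B"
     then show "y \<in> \<F> ` B" using m' BG by blast
    next
     fix y assume y: "y \<in> \<F> ` B"
     then have "y \<in> \<G>" using BG A_closed[OF \<F>] by blast
     then obtain g where "g \<in> \<G>" "?\<H>' g = y" using A_onto[OF \<H>'] by (metis imageE)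
     then show "y \<in> ?\<H>' ` B" using m' y by blast
    qed
    then show ?thesis unfolding Bb(1) using True by (simp add: act_True[OF Bb(2)])
   next
    case False
    have "B \<in> \<B>" using j\<B> Bb(1) False by simp
    note m = mem[OF this]
    have "{x \<in> \<G>. ?\<H>' x \<in> B} = {x \<in> \<G>. \<F> x \<in> B}" using m by blast
    then show ?thesis unfolding Bb(1) using False by (simp add: act_False[OF Bb(2)])
   qed
  qed
  then have "?\<H>' \<in> S" using F(3) \<H>' by blast
  moreover have "q ?\<H>' = q \<H>"
  proof -
   have "conj_eq \<H> ?\<H>'"
    unfolding conj_eq_iff[OF A_funcset[OF \<H>(1)] A_funcset[OF \<H>']]
    using h A_closed[OF \<H>(1)] by (intro bexI[of _ h] ballI) (simp_all add: val G.m_assoc)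
   then show ?thesis using q_eq_iff[OF \<H>(1) \<H>'] by simp
  qed
  ultimately show ?thesis by (metis imageI)
 qed
 then show ?thesis unfolding q_ball_def by blast
qed

text \<open>An automorphism \<open>\<H>\<close> fixing finitely many cosets of point stabilizers
  fixes the stabilizers of orbit representatives \<open>y\<close>, so sending \<open>g y\<close> to
  \<open>\<H> g y\<close> defines a permutation \<open>s\<close> of \<open>U\<close> that
  intertwines the identity with \<open>\<H>\<close>. If \<open>s\<close> also fixes the entries of
  representatives \<open>t\<close> of all orbits of tuples for the first \<open>n\<close> symbols,
  it maps \<open>g t\<close> to \<open>\<H> g t\<close> and preserves these symbols.\<close>

lemma near_one:
 obtains O' where "openin AT O'" "\<one>\<^bsub>A\<^esub> \<in> O'" "!!\<H>. \<H> \<in> O' ==> near n (\<lambda>g. g) \<H>"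
proof -
 obtain ys where ys: "set ys \<subseteq> U" "!!x. x \<in> U ==> \<exists>i<length ys. \<exists>g\<in>\<G>. x = g (ys ! i)"
  "!!i j g. i < length ys ==> j < length ys ==> g \<in> \<G> ==> g (ys ! i) = ys ! j ==> i = j"
  by (rule orbit_transversal) (assumption | rule that)+
 have ex: "\<exists>g\<in>\<G>. \<exists>y\<in>set ys. x = g y" if "x \<in> U" for x
  using ys(2)[OF that] nth_mem by blast
 have uniq: "y = y'" if y: "y \<in> set ys" "y' \<in> set ys" and g: "g \<in> \<G>" "g' \<in> \<G>" "g y = g' y'" for y y' g g'
 proof -
  obtain i j where ij: "i < length ys" "j < length ys" "y = ys ! i" "y' = ys ! j" using y by (metis in_set_conv_nth)
  have U: "y \<in> U" "y' \<in> U" using y ys(1) by blast+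
  have "(\<iota> g' \<cdot> g) y = y'" using g U by (simp add: G_mult_apply G_inv_apply)
  then show ?thesis using ys(3)[OF ij(1,2), of "\<iota> g' \<cdot> g"] g ij by simp
 qed
 have "\<exists>R. finite R \<and> R \<subseteq> tuples M m \<and> (\<forall>xs\<in>tuples M m. \<exists>r\<in>R. \<exists>g\<in>\<G>. xs = map g r)" for m
  using finite_orbit_reps[of m] by metis
 then obtain R where R: "!!m. finite (R m)" "!!m. R m \<subseteq> tuples M m"
  "!!m xs. xs \<in> tuples M m ==> \<exists>r\<in>R m. \<exists>g\<in>\<G>. xs = map g r" by metis
 \<comment> \<open>The points that \<open>s\<close> has to fix: the orbit representatives, which
   brings their stabilizers among the cosets, and the entries of representatives of the tuples for
   the first \<open>n\<close> symbols.\<close>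
 define Z where "Z = set ys \<union> (\<Union>r\<in>symbs n. \<Union>t\<in>R (arity L r). set t)"
 have "finite Z" unfolding Z_def using finite_symbs R(1) by auto
 moreover have "set t \<subseteq> U" if "t \<in> R m" for t m using R(2)[of m] that by (auto simp: tuples_def)
 then have "Z \<subseteq> U" unfolding Z_def using ys(1) by blast
 ultimately have Z: "finite Z" "Z \<subseteq> U" by simp_all
 define \<B> where "\<B> = {B. \<exists>y\<in>set ys. \<exists>g\<in>\<G>. g y \<in> Z \<and> B = {k \<in> \<G>. k y = g y}}"
 have "\<B> \<subseteq> (\<lambda>(y, z). {k \<in> \<G>. k y = z}) ` (set ys \<times> Z)" unfolding \<B>_def by auto
 then have fin: "finite \<B>" by (rule finite_subset) (simp add: Z(1))
 have \<B>: "\<B> \<subseteq> cosets"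
 proof
  fix B assume "B \<in> \<B>"
  then obtain y g where "y \<in> set ys" "g \<in> \<G>" "B = {k \<in> \<G>. k y = g y}" by (auto simp: \<B>_def)
  then show "B \<in> cosets" using basic_coset[of y g] ys(1) by auto
 qed
 define O' where "O' = {\<H> \<in> \<A>. \<forall>B\<in>\<B>. \<H> ` B = B}"
 have "openin AT O'"
  unfolding openin_AT
 proof (intro conjI ballI exI[of _ "\<B> \<times> {True}"])
  show "O' \<subseteq> \<A>" by (auto simp: O'_def)
  fix \<F> assume \<F>: "\<F> \<in> O'"
  show "finite (\<B> \<times> {True})" using fin by simp
  show "\<B> \<times> {True} \<subseteq> J" using \<B> by blast
  show "{\<H> \<in> \<A>. \<forall>j\<in>\<B> \<times> {True}. act \<H> j = act \<F> j} \<subseteq> O'"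
  proof
   fix \<H> assume \<H>: "\<H> \<in> {\<H> \<in> \<A>. \<forall>j\<in>\<B> \<times> {True}. act \<H> j = act \<F> j}"
   have "\<H> ` B = B" if B: "B \<in> \<B>" for B
   proof -
    have "act \<H> (B, True) = act \<F> (B, True)" using \<H> B by simp
    then have "\<H> ` B = \<F> ` B" unfolding act_True[OF subsetD[OF \<B> B]] .
    then show ?thesis using \<F> B by (simp add: O'_def)
   qed
   then show "\<H> \<in> O'" using \<H> by (simp add: O'_def)
  qed
 qed
 moreover have "\<one>\<^bsub>A\<^esub> \<in> O'"
 proof -
  have "\<one>\<^bsub>A\<^esub> ` B = B" if "B \<in> \<B>" for B
  proof -
   have "B \<subseteq> \<G>" using open_coset_subset that \<B> by blast
   then have "\<one>\<^bsub>A\<^esub> ` B = (\<lambda>g. g) ` B" by (intro image_cong) (auto simp: A_one)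
   then show ?thesis by simp
  qed
  then show ?thesis by (simp add: O'_def)
 qed
 moreover have "near n (\<lambda>g. g) \<H>" if \<H>O: "\<H> \<in> O'" for \<H>
 proof -
  have \<H>: "\<H> \<in> \<A>" using \<H>O by (simp add: O'_def)
  interpret \<H>: group_hom G G \<H> using \<H> by (rule A_group_hom)
  note cl = A_closed[OF \<H>]
  have Byg: "\<H> ` {k \<in> \<G>. k y = g y} = {k \<in> \<G>. k y = g y}"
   if yg: "y \<in> set ys" "g \<in> \<G>" "g y \<in> Z" for y g
  proof -
   have "{k \<in> \<G>. k y = g y} \<in> \<B>"
    unfolding \<B>_def by (intro CollectI bexI[of _ y] bexI[of _ g] conjI refl yg)
   moreover have "\<forall>B\<in>\<B>. \<H> ` B = B" using \<H>O by (simp add: O'_def)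
   ultimately show ?thesis by (rule bspec[rotated])
  qed
  have fix1: "\<H> g y = g y" if gy: "g \<in> \<G>" "y \<in> set ys" "g y \<in> Z" for g y
  proof -
   have "\<H> g \<in> \<H> ` {k \<in> \<G>. k y = g y}" by (rule imageI) (simp add: gy(1))
   then show ?thesis unfolding Byg[OF gy(2,1,3)] by simp
  qed
  have yZ: "y \<in> Z" "y \<in> U" if "y \<in> set ys" for y using that ys(1) by (auto simp: Z_def)
  have fix2: "g y = y" if g: "g \<in> \<G>" and y: "y \<in> set ys" and e: "\<H> g y = y" for g y
  proof -
   have "\<one>\<^bsub>G\<^esub> y = y" by (rule G_one[OF yZ(2)[OF y]])
   then have "\<H> ` {k \<in> \<G>. k y = y} = {k \<in> \<G>. k y = y}"
    using Byg[OF y G.one_closed] yZ(1)[OF y] by simp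
   then obtain k where k: "k \<in> \<G>" "k y = y" "\<H> g = \<H> k" using e cl[OF g] by blast
   have "g = k" using A_bij[OF \<H>] g k by (auto simp: bij_betw_def inj_on_def)
   then show ?thesis using k(2) by simp
  qed
  have key: "g y = g' y <-> \<H> g y = \<H> g' y" if g: "g \<in> \<G>" "g' \<in> \<G>" and y: "y \<in> set ys" for g g' y
  proof -
   have st: "(\<iota> k \<cdot> k') y = y <-> k y = k' y" if k: "k \<in> \<G>" "k' \<in> \<G>" for k k'
   proof
    have U: "k' y \<in> U" using G_closed[OF k(2) yZ(2)[OF y]] .
    assume "(\<iota> k \<cdot> k') y = y"
    then have "(\<iota> k) (k' y) = y" using k yZ(2)[OF y] by (simp add: G_mult_apply)
    then show "k y = k' y" using G_apply_inv[OF k(1) U] by simp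
   next
    assume e: "k y = k' y"
    show "(\<iota> k \<cdot> k') y = y"
     using G_mult_apply[OF G.inv_closed[OF k(1)] k(2) yZ(2)[OF y]] G_inv_apply[OF k(1) yZ(2)[OF y]] e by simp
   qed
   let ?k = "\<iota> g \<cdot> g'"
   have kG: "?k \<in> \<G>" using g by simp
   have "?k y = y <-> \<H> ?k y = y" using fix1[OF kG y] fix2[OF kG y] yZ(1)[OF y] by auto
   moreover have "\<H> ?k = \<iota> (\<H> g) \<cdot> \<H> g'" using g by simp
   ultimately show ?thesis using st[OF g] st[OF cl[OF g(1)] cl[OF g(2)]] by simp
  qed
  \<comment> \<open>Independence of the choice: \<open>uniq\<close> recovers \<open>y\<close> from
    \<open>x\<close>, and by \<open>key\<close> the value depends only on
    \<open>g y\<close>.\<close>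
  define s where "s x = (SOME w. \<exists>g\<in>\<G>. \<exists>y\<in>set ys. x = g y \<and> w = \<H> g y)" for x
  have s: "s (g y) = \<H> g y" if g: "g \<in> \<G>" and y: "y \<in> set ys" for g y
   unfolding s_def
  proof (rule some_equality)
   show "\<exists>g'\<in>\<G>. \<exists>y'\<in>set ys. g y = g' y' \<and> \<H> g y = \<H> g' y'" using g y by blast
   fix w assume "\<exists>g'\<in>\<G>. \<exists>y'\<in>set ys. g y = g' y' \<and> w = \<H> g' y'"
   then obtain g' y' where w: "g' \<in> \<G>" "y' \<in> set ys" "g y = g' y'" "w = \<H> g' y'" by blast
   have "y = y'" by (rule uniq[OF y w(2) g w(1,3)])
   then show "w = \<H> g y" using key[OF g w(1) y] w(3,4) by simp
  qed
  have "conj_by s (\<lambda>g. g) \<H>"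
   unfolding conj_by_def bij_betw_def
  proof (intro conjI ballI inj_onI equalityI subsetI)
   fix x x' assume x: "x \<in> U" "x' \<in> U" "s x = s x'"
   obtain g y where gy: "g \<in> \<G>" "y \<in> set ys" "x = g y" using ex[OF x(1)] by blast
   obtain g' y' where gy': "g' \<in> \<G>" "y' \<in> set ys" "x' = g' y'" using ex[OF x(2)] by blast
   have e: "\<H> g y = \<H> g' y'" using x(3) s[OF gy(1,2)] s[OF gy'(1,2)] gy(3) gy'(3) by simp
   have "y = y'" by (rule uniq[OF gy(2) gy'(2) cl[OF gy(1)] cl[OF gy'(1)] e])
   then show "x = x'" using e key[OF gy(1) gy'(1) gy(2)] gy(3) gy'(3) by simp
  next
   fix w assume "w \<in> s ` U"
   then obtain x where x: "x \<in> U" "w = s x" by blast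
   obtain g y where gy: "g \<in> \<G>" "y \<in> set ys" "x = g y" using ex[OF x(1)] by blast
   show "w \<in> U" unfolding x(2) gy(3) s[OF gy(1,2)] by (rule G_closed[OF cl[OF gy(1)] yZ(2)[OF gy(2)]])
  next
   fix x assume x: "x \<in> U"
   obtain g y where gy: "g \<in> \<G>" "y \<in> set ys" "x = g y" using ex[OF x] by blast
   obtain g0 where g0: "g0 \<in> \<G>" "\<H> g0 = g" using A_onto[OF \<H>] gy(1) by (metis imageE)
   have "x = s (g0 y)" using s[OF g0(1) gy(2)] g0(2) gy(3) by simp
   then show "x \<in> s ` U" using G_closed[OF g0(1) yZ(2)[OF gy(2)]] by (rule image_eqI)
  next
   fix g x assume g: "g \<in> \<G>" and x: "x \<in> U"
   obtain g' y where gy: "g' \<in> \<G>" "y \<in> set ys" "x = g' y" using ex[OF x] by blast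
   note yU = yZ(2)[OF gy(2)]
   have "\<H> g (s x) = \<H> g (\<H> g' y)" unfolding gy(3) s[OF gy(1,2)] ..
   also have "\<dots> = \<H> (g \<cdot> g') y"
    unfolding A_hom_mult[OF \<H> g gy(1)] G_mult_apply[OF cl[OF g] cl[OF gy(1)] yU] ..
   also have "\<dots> = s ((g \<cdot> g') y)" by (rule s[OF G.m_closed[OF g gy(1)] gy(2), symmetric])
   also have "\<dots> = s (g x)" unfolding G_mult_apply[OF g gy(1) yU] gy(3) ..
   finally show "\<H> g (s x) = s (g x)" .
  qed
  moreover have "preserves n s"
   unfolding preserves_def
  proof (intro ballI impI)
   fix r zs assume r: "r \<in> symbols L" "sym_index L r < n" and zs: "zs \<in> tuples M (arity L r)"
   obtain t g where t: "t \<in> R (arity L r)" "g \<in> \<G>" "zs = map g t" using R(3)[OF zs] by blast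
   have tt: "t \<in> tuples M (arity L r)" using R(2) t(1) by blast
   have tZ: "z \<in> Z" if "z \<in> set t" for z unfolding Z_def using that t(1) r by blast
   have "s (g z) = \<H> g z" if z: "z \<in> set t" for z
   proof -
    have zU: "z \<in> U" using tZ[OF z] Z(2) by blast
    obtain k y where k: "k \<in> \<G>" "y \<in> set ys" "z = k y" using ex[OF zU] by blast
    have sz: "s z = z" unfolding k(3) s[OF k(1,2)] by (rule fix1[OF k(1,2)]) (use tZ[OF z] k(3) in simp)
    have "\<H> g (s z) = s (g z)" using \<open>conj_by s (\<lambda>g. g) \<H>\<close> conj_by_eq t(2) zU by blast
    then show ?thesis unfolding sz by (rule sym)
   qed
   then have m: "map s zs = map (\<H> g) t" unfolding t(3) by simp
   show "map s zs \<in> interp_rel M r <-> zs \<in> interp_rel M r"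
    unfolding m unfolding t(3) G_rel[OF cl[OF t(2)] r(1) tt] G_rel[OF t(2) r(1) tt] ..
  qed
  ultimately show ?thesis unfolding near_def by blast
 qed
 ultimately show thesis by (rule that)
qed

text \<open>Right translation of the neighbourhood from \<open>near_one\<close>: if \<open>s\<close>
  conjugates the identity to \<open>\<H>\<close> after the inverse of \<open>\<F>\<close>, it
  conjugates \<open>\<F>\<close> to \<open>\<H>\<close>.\<close>

lemma near_nbhd:
 assumes \<F>: "\<F> \<in> \<A>"
 obtains O' where "openin AT O'" "\<F> \<in> O'" "!!\<H>. \<H> \<in> O' ==> near n \<F> \<H>"
proof -
 let ?Y = AT
 obtain O1 where O1: "openin ?Y O1" "\<one>\<^bsub>A\<^esub> \<in> O1" "!!\<H>. \<H> \<in> O1 ==> near n (\<lambda>g. g) \<H>"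
  using near_one[of n] by metis
 define O' where "O' = {\<H> \<in> topspace ?Y. \<H> \<star> invA \<F> \<in> O1}"
 have iA: "invA \<F> \<in> \<A>" using \<F> by simp
 have mult: "continuous_map (prod_topology ?Y ?Y) ?Y (\<lambda>(x, y). x \<star> y)"
  using topological_group_coset by (simp add: topological_group_def)
 have pair: "continuous_map ?Y (prod_topology ?Y ?Y) (\<lambda>x. (x, invA \<F>))"
  by (rule continuous_map_pairedI) (use iA in \<open>simp_all add: topspace_AT\<close>)
 have "continuous_map ?Y ?Y ((\<lambda>(x, y). x \<star> y) \<circ> (\<lambda>x. (x, invA \<F>)))"
  by (rule continuous_map_compose[OF pair mult])
 then have "continuous_map ?Y ?Y (\<lambda>x. x \<star> invA \<F>)" by (simp add: comp_def)
 then have "openin ?Y O'" unfolding O'_def by (rule openin_continuous_map_preimage[OF _ O1(1)])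
 moreover have "\<F> \<in> O'" using \<F> O1(2) by (simp add: O'_def topspace_AT)
 moreover have "near n \<F> \<H>" if "\<H> \<in> O'" for \<H>
 proof -
  have \<H>: "\<H> \<in> \<A>" using that by (simp add: O'_def topspace_AT)
  have "near n (\<lambda>g. g) (\<H> \<star> invA \<F>)" using O1(3) that by (simp add: O'_def)
  then obtain s where s: "conj_by s (\<lambda>g. g) (\<H> \<star> invA \<F>)" "preserves n s" by (auto simp: near_def)
  have "conj_by s \<F> \<H>"
   unfolding conj_by_def
  proof (intro conjI ballI)
   show "bij_betw s U U" using s(1) by (simp add: conj_by_def)
   fix g y assume g: "g \<in> \<G>" and y: "y \<in> U"
   note \<F>g = A_closed[OF \<F> g]
   have "(\<H> \<star> invA \<F>) (\<F> g) = \<H> g"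
    using A_mult_apply[OF \<H> iA \<F>g] A_inv_apply[OF \<F> g] by simp
   then show "\<H> g (s y) = s (\<F> g y)" using conj_by_eq[OF s(1) \<F>g y] by simp
  qed
  then show ?thesis unfolding near_def using s(2) by blast
 qed
 ultimately show thesis by (rule that)
qed

lemma near_realized:
 assumes \<a>: "induces \<a> \<F>" and \<H>: "\<H> \<in> \<G> \<rightarrow> \<G>" "near n \<F> \<H>"
 obtains \<b> where "\<b> \<in> basic_nbhd \<a> n" "induces \<b> \<H>"
proof -
 obtain \<pi> where \<pi>: "\<a> \<in> Itp" "coord L M \<a> M \<pi>" "acts \<a> \<pi> \<F>" using \<a> by (rule inducesE)
 obtain s where s: "conj_by s \<F> \<H>" "preserves n s" using \<H>(2) by (auto simp: near_def)
 have "bij_betw s U U" using s(1) by (simp add: conj_by_def)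
 moreover note s(2)
 moreover have "\<H> g \<in> \<G>" if "g \<in> \<G>" for g by (rule funcset_mem[OF \<H>(1) that])
 moreover have "\<H> g (s x) = s (\<F> g x)" if "g \<in> \<G>" "x \<in> U" for g x by (rule conj_by_eq[OF s(1) that])
 ultimately obtain \<b> where \<b>: "\<b> \<in> basic_nbhd \<a> n" "coord L M \<b> M (s \<circ> \<pi>)" "acts \<b> (s \<circ> \<pi>) \<H>"
  by (rule realize_nearby[OF \<pi>])
 moreover have "induces \<b> \<H>" unfolding induces_def using \<b> basic_nbhd_Itp by blast
 ultimately show thesis using that by blast
qed

text \<open>Every automorphism near \<open>\<F>\<close> is induced by an interpretation in the
  prescribed basic neighbourhood of one inducing \<open>\<F>\<close>, so its class stays in the open
  set.\<close>

lemma q_continuous_MT: "continuous_map AT MT q"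
 unfolding continuous_map
proof (intro conjI allI impI)
 show "q ` topspace AT \<subseteq> topspace MT"
  using q_Mor by (auto simp: topspace_AT topspace_MT)
 fix V assume V: "openin MT V"
 show "openin AT {\<F> \<in> topspace AT. q \<F> \<in> V}"
 proof (rule openin_subopen[THEN iffD2], intro ballI)
  fix \<F> assume "\<F> \<in> {\<F> \<in> topspace AT. q \<F> \<in> V}"
  then have \<F>: "\<F> \<in> \<A>" "q \<F> \<in> V" by (simp_all add: topspace_AT)
  obtain \<a> where \<a>: "induces \<a> \<F>" using \<F>(1) by (rule A_induced)
  have "openin IT {\<a> \<in> Itp. cls \<a> \<in> V}" using V by (simp add: openin_MT)
  moreover have "\<a> \<in> {\<a> \<in> Itp. cls \<a> \<in> V}" using induces_Itp[OF \<a>] q_cls[OF \<a>] \<F>(2) by simp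
  ultimately obtain n where n: "basic_nbhd \<a> n \<subseteq> {\<a> \<in> Itp. cls \<a> \<in> V}" unfolding openin_IT by meson
  obtain O' where O': "openin AT O'" "\<F> \<in> O'" "!!\<H>. \<H> \<in> O' ==> near n \<F> \<H>"
   using near_nbhd[OF \<F>(1), of n] by metis
  have "q \<H> \<in> V" if \<H>: "\<H> \<in> O'" for \<H>
  proof -
   have "\<H> \<in> \<A>" using openin_subset[OF O'(1)] \<H> topspace_AT by blast
   from near_realized[OF \<a> A_funcset[OF this] O'(3)[OF \<H>]] obtain \<b>
    where \<b>: "\<b> \<in> basic_nbhd \<a> n" "induces \<b> \<H>" .
   then show ?thesis unfolding q_cls[OF \<b>(2)] using n by blast
  qed
  then have "O' \<subseteq> {\<F> \<in> topspace AT. q \<F> \<in> V}" using openin_subset[OF O'(1)] by blast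
  then show "\<exists>W. openin AT W \<and> \<F> \<in> W \<and> W \<subseteq> {\<F> \<in> topspace AT. q \<F> \<in> V}"
   using O'(1,2) by blast
 qed
qed

lemma A_inv_continuous: "continuous_map AT AT (\<lambda>\<F>. invA \<F>)"
 using topological_group_coset by (simp add: topological_group_def)

text \<open>The topology of \<open>BT\<close> is that of the pairs of a class and its inverse; the
  second component is continuous because inversion is continuous in the automorphism group.\<close>

lemma q_continuous: "continuous_map AT BY q"
 unfolding BT_topology_def
proof (rule continuous_map_pullback')
 have "continuous_map AT MT (q \<circ> (\<lambda>\<F>. invA \<F>))"
  by (rule continuous_map_compose[OF A_inv_continuous q_continuous_MT])
 then have "continuous_map AT (prod_topology MT MT) (\<lambda>\<F>. (q \<F>, (q \<circ> (\<lambda>\<F>. invA \<F>)) \<F>))"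
  by (rule continuous_map_pairedI[OF q_continuous_MT])
 then show "continuous_map AT (prod_topology MT MT) ((\<lambda>a. (a, inv\<^bsub>Mo\<^esub> a)) \<circ> q)"
  by (rule continuous_map_eq) (simp add: topspace_AT q_inv)
 show "topspace AT \<subseteq> q -` carrier (BT L T)" using q_Units by (auto simp: topspace_AT)
qed

lemma topspace_BY: "topspace BY = carrier BG"
proof
 show "topspace BY \<subseteq> carrier BG" by (simp add: BT_topology_def topspace_pullback_topology)
 have "openin BY (carrier BG \<inter> topspace MT)" by (rule openin_BY) simp
 moreover have "carrier BG \<subseteq> topspace MT" unfolding topspace_MT BT_def units_of_def Units_def by auto
 ultimately show "carrier BG \<subseteq> topspace BY" by (metis Int_absorb2 openin_subset)
qed

lemma q_open: "openin AT S ==> openin BY (q ` S)"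
proof (rule openin_subopen[THEN iffD2], intro ballI)
 fix a assume S: "openin AT S" and "a \<in> q ` S"
 then obtain \<F> where \<F>: "\<F> \<in> S" "a = q \<F>" by blast
 have \<F>A: "\<F> \<in> \<A>" using openin_subset[OF S] \<F>(1) topspace_AT by blast
 obtain n where n: "q_ball n \<F> \<subseteq> q ` S" using q_ball_subset[OF S \<F>(1)] by blast
 have "near n \<F> \<F>" unfolding near_def using conj_by_id preserves_id by blast
 then have "a \<in> q_ball n \<F>" unfolding q_ball_def using \<F>(2) \<F>A by blast
 then show "\<exists>W. openin BY W \<and> a \<in> W \<and> W \<subseteq> q ` S" using q_ball_open[OF \<F>A] n by blast
qed

lemma p_continuous: "continuous_map AT BY p"
proof -
 have "continuous_map AT BY (q \<circ> (\<lambda>\<F>. invA \<F>))"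
  by (rule continuous_map_compose[OF A_inv_continuous q_continuous])
 moreover have "q \<circ> (\<lambda>\<F>. invA \<F>) = p" by (auto simp: p_def)
 ultimately show ?thesis by simp
qed

lemma p_open: "open_map AT BY p"
 unfolding open_map_def
proof (intro allI impI)
 fix S assume S: "openin AT S"
 let ?S = "{\<F> \<in> topspace AT. invA \<F> \<in> S}"
 have SA: "S \<subseteq> \<A>" using openin_subset[OF S] topspace_AT by blast
 have "openin BY (q ` ?S)" by (rule q_open[OF openin_continuous_map_preimage[OF A_inv_continuous S]])
 moreover have "p ` S = q ` ?S"
 proof (intro equalityI subsetI)
  fix a assume "a \<in> p ` S"
  then obtain \<F> where \<F>: "\<F> \<in> S" "a = q (invA \<F>)" unfolding p_def by blast
  have "\<F> \<in> \<A>" using SA \<F>(1) by blast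
  then have "invA \<F> \<in> ?S" using \<F>(1) by (simp add: topspace_AT)
  then show "a \<in> q ` ?S" using \<F>(2) by blast
 next
  fix a assume "a \<in> q ` ?S"
  then obtain \<F> where \<F>: "\<F> \<in> \<A>" "invA \<F> \<in> S" "a = q \<F>" by (auto simp: topspace_AT)
  have "a = p (invA \<F>)" using \<F>(1,3) by (simp add: p_def)
  then show "a \<in> p ` S" using \<F>(2) by blast
 qed
 ultimately show "openin BY (p ` S)" by simp
qed

lemma topological_group_BT: "topological_group BG BY"
 by (rule topological_group_image[OF topological_group_coset BG_group p_hom p_onto topspace_BY p_continuous p_open])

lemma BT_iso_Out: "topologically_isomorphic BG BY (Out G X) (Out_topology G X)"
 unfolding Out_def Out_topology_def Aut_topology_eq
 by (rule topologically_isomorphic_quotient[OF A_group topspace_AT BG_group p_hom p_onto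
    topspace_BY p_continuous p_open p_kernel])

end

lemma translate_cong:
 assumes "idim \<b> = idim \<a>" "dom_fm \<b> = dom_fm \<a>" "eq_fm \<b> = eq_fm \<a>" "!!r. r \<in> set_fm \<p> ==> sym_fm \<b> r = sym_fm \<a> r"
 shows "translate \<b> \<p> = translate \<a> \<p>"
 using assms by (induction \<p>) simp_all

lemma finite_set_fm: "finite (set_fm \<p>)"
 by (induction \<p>) simp_all

context omega_cat
begin

section \<open>Normalizing permutations\<close>

text \<open>These are the definable sets of \<open>m\<close>-tuples; the invariant description is
  the one that can be compared under permutations.\<close>

definition inv_sets :: "nat => 'a list set set" where
 "inv_sets m = {S. S \<subseteq> tuples M m \<and> (\<forall>g\<in>\<G>. \<forall>xs\<in>S. map g xs \<in> S)}"

lemma finite_inv_sets: "finite (inv_sets m)"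
proof (rule finite_subset)
 show "inv_sets m \<subseteq> (\<lambda>\<f>. {xs \<in> tuples M m. sat M xs \<f>}) ` reduced_formulas L T m"
 proof
  fix S assume "S \<in> inv_sets m"
  then have S: "S \<subseteq> tuples M m" "!!g xs. g \<in> \<G> ==> xs \<in> S ==> map g xs \<in> S" by (auto simp: inv_sets_def)
  obtain \<f> where \<f>: "\<f> \<in> reduced_formulas L T m" "!!xs. xs \<in> tuples M m ==> sat M xs \<f> <-> xs \<in> S"
   by (rule definable_reduced[OF S]) (assumption | rule that)+
  have "S = {xs \<in> tuples M m. sat M xs \<f>}" using \<f>(2) S(1) by blast
  then show "S \<in> (\<lambda>\<f>. {xs \<in> tuples M m. sat M xs \<f>}) ` reduced_formulas L T m" using \<f>(1) by (rule image_eqI)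
 qed
qed (intro finite_imageI finite_reduced_formulas)

lemma inv_sets_iff:
 assumes S: "S \<in> inv_sets m" and g: "g \<in> \<G>" and xs: "xs \<in> tuples M m" shows "map g xs \<in> S <-> xs \<in> S"
proof
 assume "map g xs \<in> S"
 then have "map (\<iota> g) (map g xs) \<in> S" using S G.inv_closed[OF g] unfolding inv_sets_def by blast
 moreover have "set xs \<subseteq> U" using xs by (simp add: tuples_def)
 ultimately show "xs \<in> S" unfolding G_map_inv[OF g \<open>set xs \<subseteq> U\<close>] by simp
qed (use S g in \<open>simp add: inv_sets_def\<close>)

text \<open>Taking preimages under \<open>s\<close> is injective on the finite set of invariant sets of tuples, hence
 surjective. So the image of an invariant set under \<open>s\<close> is invariant.\<close>

lemma normalizes:
 assumes s: "bij_betw s U U" and N: "!!g. g \<in> \<G> ==> \<exists>g'\<in>\<G>. \<forall>y\<in>U. g' (s y) = s (g y)"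
  and g: "g \<in> \<G>"
 shows "\<exists>g'\<in>\<G>. \<forall>y\<in>U. g (s y) = s (g' y)"
proof -
 have sU: "s ` U \<subseteq> U" using s by (simp add: bij_betw_def)
 define pre where "pre m S = {xs \<in> tuples M m. map s xs \<in> S}" for m and S :: "'a list set"
 have pre: "pre m S \<in> inv_sets m" if S: "S \<in> inv_sets m" for m S
 proof -
  have "map k xs \<in> pre m S" if k: "k \<in> \<G>" and xs: "xs \<in> pre m S" for k xs
  proof -
   have xt: "xs \<in> tuples M m" "map s xs \<in> S" using xs by (simp_all add: pre_def)
   obtain k' where k': "k' \<in> \<G>" "!!y. y \<in> U ==> k' (s y) = s (k y)" using N[OF k] by blast
   have "map s (map k xs) = map k' (map s xs)"
    unfolding map_map by (rule map_cong) (use k'(2) xt(1) in \<open>auto simp: tuples_def\<close>)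
   also have "\<dots> \<in> S" using S k'(1) xt(2) unfolding inv_sets_def by blast
   finally show ?thesis using map_G_tuples[OF k xt(1)] by (simp add: pre_def)
  qed
  then show ?thesis by (auto simp: inv_sets_def pre_def)
 qed
 have surj: "pre m ` inv_sets m = inv_sets m" for m
 proof (rule endo_inj_surj[OF finite_inv_sets])
  show "pre m ` inv_sets m \<subseteq> inv_sets m" using pre by blast
  \<comment> \<open>As \<open>s\<close> is onto, a set is recovered from its preimage by applying
    \<open>s\<close>.\<close>
  show "inj_on (pre m) (inv_sets m)"
  proof (rule inj_on_inverseI[where g = "\<lambda>S. map s ` S"])
   fix S assume S: "S \<in> inv_sets m"
   show "map s ` pre m S = S"
   proof (intro equalityI subsetI)
    fix xs assume xs: "xs \<in> S"
    then have xt: "set xs \<subseteq> U" "length xs = m" using S by (auto simp: inv_sets_def tuples_def)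
    let ?ys = "map (inv_into U s) xs"
    have "map s ?ys = xs"
     unfolding map_map by (rule map_idI) (use xt(1) bij_betw_inv_into_right[OF s] in auto)
    moreover have "?ys \<in> tuples M m"
     using bij_betw_inv_into[OF s] xt by (auto simp: tuples_def bij_betw_def)
    ultimately show "xs \<in> map s ` pre m S" using xs by (intro image_eqI[of _ _ ?ys]) (simp_all add: pre_def)
   qed (auto simp: pre_def)
  qed
 qed
 define g' where "g' = restrict (inv_into U s \<circ> g \<circ> s) U"
 have g': "s (g' y) = g (s y)" if y: "y \<in> U" for y
 proof -
  have "g (s y) \<in> U" using G_closed[OF g] sU y by blast
  then show ?thesis using y bij_betw_inv_into_right[OF s] by (simp add: g'_def)
 qed
 have bij: "bij_betw (inv_into U s \<circ> g \<circ> s) U U"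
  by (intro bij_betw_trans[OF s] bij_betw_trans[OF G_bij[OF g]] bij_betw_inv_into[OF s])
 then have bij': "bij_betw g' U U" unfolding g'_def by (simp cong: bij_betw_cong)
 have g'U: "g' ` U \<subseteq> U" using bij' by (simp add: bij_betw_def)
 have "iso_by L g' M M"
  unfolding iso_by_def
 proof (intro conjI bij' ballI)
  fix r zs assume r: "r \<in> symbols L" and zs: "zs \<in> tuples M (arity L r)"
  let ?R = "interp_rel M r" and ?m = "arity L r"
  have Rt: "?R \<subseteq> tuples M ?m" using struct r by (simp add: is_structure_def)
  then have "?R \<in> inv_sets ?m" using G_rel[OF _ r] by (auto simp: inv_sets_def)
  \<comment> \<open>The relation is the preimage of an invariant set \<open>S\<close> under
    \<open>s\<close>, so the conjugate \<open>g'\<close> preserves it because \<open>g\<close>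
    preserves \<open>S\<close>.\<close>
  then obtain S where S: "S \<in> inv_sets ?m" "?R = pre ?m S" using surj by blast
  have R: "ws \<in> ?R <-> map s ws \<in> S" if "ws \<in> tuples M ?m" for ws using S(2) that by (simp add: pre_def)
  have m: "map s (map g' zs) = map g (map s zs)"
   unfolding map_map by (rule map_cong) (use g' zs in \<open>auto simp: tuples_def\<close>)
  show "map g' zs \<in> ?R <-> zs \<in> ?R"
   unfolding R[OF map_tuples[OF g'U zs]] R[OF zs] m by (rule inv_sets_iff[OF S(1) g map_tuples[OF sU zs]])
 qed
 then have "g' \<in> \<G>" unfolding G_iff by (simp add: g'_def)
 then show ?thesis using g' by (intro bexI[of _ g']) simp_all
qed

text \<open>Injectivity passes from \<open>\<F>\<close> to \<open>\<H>\<close> through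
  \<open>s\<close>. For surjectivity, conjugation by \<open>s\<close> maps \<open>\<G>\<close> into
  itself as \<open>\<F>\<close> is onto; by \<open>normalizes\<close> it then reaches all of
  \<open>\<G>\<close>, hence so does \<open>\<H>\<close>.\<close>

lemma near_A:
 assumes \<F>: "\<F> \<in> \<A>" and \<H>: "induces \<a> \<H>" "near n \<F> \<H>"
 obtains \<H>' where "\<H>' \<in> \<A>" "induces \<a> \<H>'"
proof -
 obtain s where s: "conj_by s \<F> \<H>" using \<H>(2) by (auto simp: near_def)
 have bij: "bij_betw s U U" using s by (simp add: conj_by_def)
 note cl = funcset_mem[OF induces_funcset[OF \<H>(1)]]
 have N: "\<exists>g'\<in>\<G>. \<forall>y\<in>U. g' (s y) = s (g y)" if g: "g \<in> \<G>" for g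
 proof -
  obtain x where x: "x \<in> \<G>" "\<F> x = g" using A_onto[OF \<F>] g by (metis imageE)
  show ?thesis using conj_by_eq[OF s x(1)] x(2) cl[OF x(1)] by (intro bexI[of _ "\<H> x"]) simp_all
 qed
 have "\<G> \<subseteq> \<H> ` \<G>"
 proof
  fix g assume g: "g \<in> \<G>"
  obtain g' where g': "g' \<in> \<G>" "!!y. y \<in> U ==> g (s y) = s (g' y)" using normalizes[OF bij N g] by blast
  obtain x where x: "x \<in> \<G>" "\<F> x = g'" using A_onto[OF \<F>] g'(1) by (metis imageE)
  have "\<H> x = g"
  proof (rule G_ext[OF cl[OF x(1)] g])
   fix w assume "w \<in> U"
   then obtain y where y: "y \<in> U" "s y = w" using conj_by_onto[OF s] by blast
   show "\<H> x w = g w" using conj_by_eq[OF s x(1) y(1)] g'(2)[OF y(1)] x(2) y(2) by simp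
  qed
  then show "g \<in> \<H> ` \<G>" using x(1) by blast
 qed
 moreover have "inj_on \<H> (\<G>)"
 proof (rule inj_onI)
  fix x x' assume x: "x \<in> \<G>" "x' \<in> \<G>" "\<H> x = \<H> x'"
  note \<F>x = A_closed[OF \<F> x(1)] A_closed[OF \<F> x(2)]
  have "\<F> x = \<F> x'"
  proof (rule G_ext[OF \<F>x])
   fix y assume y: "y \<in> U"
   have "s (\<F> x y) = s (\<F> x' y)" using conj_by_eq[OF s x(1) y] conj_by_eq[OF s x(2) y] x(3) by simp
   then show "\<F> x y = \<F> x' y" using conj_by_inj[OF s G_closed[OF \<F>x(1) y] G_closed[OF \<F>x(2) y]] by simp
  qed
  then show "x = x'" using A_bij[OF \<F>] x(1,2) by (auto simp: bij_betw_def inj_on_def)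
 qed
 ultimately show thesis using restrict_A[OF \<H>(1)] that by blast
qed

section \<open>Total disconnectedness\<close>

text \<open>Only finitely many permutations conjugate \<open>\<F>\<close> to \<open>\<H>\<close>, so
  some \<open>s n0\<close> recurs for infinitely many \<open>n\<close>. It preserves every symbol
  and therefore belongs to \<open>\<G>\<close>.\<close>

lemma near_all:
 assumes \<F>: "\<F> \<in> \<A>" and near: "!!n. near n \<F> \<H>"
 shows "conj_eq \<F> \<H>"
proof -
 have "\<forall>n. \<exists>s. conj_by s \<F> \<H> \<and> preserves n s" using near by (simp add: near_def)
 then obtain s0 where s0: "!!n. conj_by (s0 n) \<F> \<H>" "!!n. preserves n (s0 n)" by metis
 define s where "s n = restrict (s0 n) U" for n
 have s: "conj_by (s n) \<F> \<H>" for n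
  unfolding conj_by_def
 proof (intro conjI ballI)
  have "bij_betw (s0 n) U U" using s0(1) by (simp add: conj_by_def)
  then show "bij_betw (s n) U U" unfolding s_def by (simp cong: bij_betw_cong)
  fix g y assume g: "g \<in> \<G>" and y: "y \<in> U"
  have "\<F> g y \<in> U" by (rule G_closed[OF A_closed[OF \<F> g] y])
  then show "\<H> g (s n y) = s n (\<F> g y)" using conj_by_eq[OF s0(1) g y] y by (simp add: s_def)
 qed
 have ps: "preserves n (s n)" for n
  unfolding preserves_def
 proof (intro ballI impI)
  fix r zs assume r: "r \<in> symbols L" "sym_index L r < n" and zs: "zs \<in> tuples M (arity L r)"
  have m: "map (s n) zs = map (s0 n) zs" using zs by (intro map_cong) (auto simp: s_def tuples_def)
  show "map (s n) zs \<in> interp_rel M r <-> zs \<in> interp_rel M r"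
   unfolding m using s0(2)[of n] r zs unfolding preserves_def by blast
 qed
 define C where "C = {s. s \<in> extensional U \<and> conj_by s \<F> \<H>}"
 \<comment> \<open>The graph of \<open>c\<close> followed by the inverse of \<open>s 0\<close>. Both
   maps conjugate \<open>\<F>\<close> to \<open>\<H>\<close> and \<open>\<F>\<close> is onto, so the
   composite commutes with \<open>\<G>\<close> and its graph is invariant.\<close>
 define \<C> where "\<C> c = {zs \<in> tuples M 2. s 0 (zs ! 1) = c (zs ! 0)}" for c
 have nth: "zs ! 0 \<in> U" "zs ! 1 \<in> U" if "zs \<in> tuples M 2" for zs
  using that nth_mem[of 0 zs] nth_mem[of 1 zs] unfolding tuples_def by auto
 have "\<C> c \<in> inv_sets 2" if c: "c \<in> C" for c
 proof -
  have cb: "conj_by c \<F> \<H>" using c by (simp add: C_def)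
  have "map g zs \<in> \<C> c" if g: "g \<in> \<G>" and z: "zs \<in> \<C> c" for g zs
  proof -
   have zs: "zs \<in> tuples M 2" "s 0 (zs ! 1) = c (zs ! 0)" using z by (simp_all add: \<C>_def)
   obtain x where x: "x \<in> \<G>" "\<F> x = g" using A_onto[OF \<F>] g by (metis imageE)
   have len: "length zs = 2" using zs(1) by (simp add: tuples_def)
   have "s 0 (g (zs ! 1)) = \<H> x (s 0 (zs ! 1))" using conj_by_eq[OF s x(1) nth(2)[OF zs(1)]] x(2) by simp
   also have "\<dots> = c (g (zs ! 0))" unfolding zs(2) using conj_by_eq[OF cb x(1) nth(1)[OF zs(1)]] x(2) by simp
   finally show ?thesis using map_G_tuples[OF g zs(1)] len by (simp add: \<C>_def)
  qed
  then show ?thesis by (auto simp: inv_sets_def \<C>_def)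
 qed
 moreover have "inj_on \<C> C"
 proof (rule inj_onI)
  fix c c' assume c: "c \<in> C" "c' \<in> C" "\<C> c = \<C> c'"
  have cb: "conj_by c \<F> \<H>" "c \<in> extensional U" "c' \<in> extensional U" using c by (simp_all add: C_def)
  show "c = c'"
  proof (rule extensionalityI[OF cb(2,3)])
   fix x assume x: "x \<in> U"
   obtain y where y: "y \<in> U" "s 0 y = c x" using conj_by_onto[OF s conj_by_closed[OF cb(1) x]] by blast
   have "[x, y] \<in> \<C> c" using x y by (simp add: \<C>_def tuples_def)
   then have "[x, y] \<in> \<C> c'" unfolding c(3) .
   then show "c x = c' x" using y(2) by (simp add: \<C>_def)
  qed
 qed
 ultimately have "finite C" using finite_inv_sets[of 2] by (meson image_subsetI inj_on_finite)
 moreover have "s ` UNIV \<subseteq> C" using s by (auto simp: C_def s_def)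
 ultimately have "finite (s ` UNIV)" by (rule finite_subset[rotated])
 then obtain n0 where "infinite {n \<in> UNIV. s n = s n0}" using pigeonhole_infinite[OF infinite_UNIV_nat] by blast
 then have inf: "infinite {n. s n = s n0}" by simp
 have "preserves m (s n0)" for m
 proof -
  obtain n where "n \<ge> m" "s n = s n0" using inf unfolding infinite_nat_iff_unbounded_le by blast
  then show ?thesis using preserves_mono[OF _ ps[of n]] by simp
 qed
 moreover have "bij_betw (s n0) U U" using s by (simp add: conj_by_def)
 ultimately have "restrict (s n0) U \<in> \<G>" by (intro preserves_all_G)
 then have "s n0 \<in> \<G>" by (simp add: s_def)
 then show ?thesis unfolding conj_eq_def using s by blast
qed

lemma q_ball_iff:
 assumes \<H>: "\<H> \<in> \<A>" shows "q \<H> \<in> q_ball n \<F> <-> near n \<F> \<H>"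
proof
 assume "q \<H> \<in> q_ball n \<F>"
 then obtain \<H>' where \<H>': "\<H>' \<in> \<A>" "near n \<F> \<H>'" "q \<H>' = q \<H>" unfolding q_ball_def by fastforce
 then have "conj_eq \<H>' \<H>" using q_eq_iff[OF \<H>'(1) \<H>] by simp
 then show "near n \<F> \<H>" using near_trans[OF \<H>'(2)] conj_eq_near by blast
qed (use \<H> in \<open>auto simp: q_ball_def\<close>)

lemma near_refl: "near n \<F> \<F>"
 unfolding near_def using conj_by_id preserves_id by blast

text \<open>\<open>near n\<close> is symmetric and transitive on automorphisms, so the complement of
  a ball is a union of balls of the same level.\<close>

lemma q_ball_closed:
 assumes \<F>: "\<F> \<in> \<A>" shows "closedin BY (q_ball n \<F>)"
 unfolding closedin_def
proof
 show "q_ball n \<F> \<subseteq> topspace BY" by (rule openin_subset[OF q_ball_open[OF \<F>]])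
 show "openin BY (topspace BY - q_ball n \<F>)"
 proof (rule openin_subopen[THEN iffD2], intro ballI)
  fix a assume a: "a \<in> topspace BY - q_ball n \<F>"
  then obtain \<T> where \<T>: "\<T> \<in> \<A>" "a = q \<T>" unfolding topspace_BY using BG_E by blast
  have "b \<in> topspace BY - q_ball n \<F>" if b: "b \<in> q_ball n \<T>" for b
  proof -
   obtain \<Xi> where \<Xi>: "\<Xi> \<in> \<A>" "near n \<T> \<Xi>" "b = q \<Xi>" using b by (auto simp: q_ball_def)
   have "\<not> near n \<F> \<Xi>"
   proof
    assume "near n \<F> \<Xi>"
    then have "near n \<F> \<T>" using near_trans near_sym[OF \<Xi>(2) A_funcset[OF \<T>(1)]] by blast
    then show False using a q_ball_iff[OF \<T>(1)] \<T>(2) by blast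
   qed
   then show ?thesis unfolding topspace_BY \<Xi>(3) using q_Units[OF \<Xi>(1)] q_ball_iff[OF \<Xi>(1)] by blast
  qed
  moreover have "a \<in> q_ball n \<T>" unfolding \<T>(2) q_ball_iff[OF \<T>(1)] by (rule near_refl)
  ultimately show "\<exists>W. openin BY W \<and> a \<in> W \<and> W \<subseteq> topspace BY - q_ball n \<F>"
   using q_ball_open[OF \<T>(1)] by blast
 qed
qed

text \<open>By \<open>near_all\<close>, distinct classes are separated by a ball of some level,
  which is clopen.\<close>

lemma totally_disconnected_BT: "totally_disconnected_space BY"
 unfolding totally_disconnected_space_def
proof (intro allI impI)
 fix S assume S: "connectedin BY S"
 have "a = b" if ab: "a \<in> S" "b \<in> S" for a b
 proof (rule ccontr)
  assume ne: "a \<noteq> b"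
  have SB: "S \<subseteq> carrier BG" using connectedin_subset_topspace[OF S] by (simp add: topspace_BY)
  obtain \<F> where \<F>: "\<F> \<in> \<A>" "a = q \<F>" using BG_E SB ab(1) by blast
  obtain \<H> where \<H>: "\<H> \<in> \<A>" "b = q \<H>" using BG_E SB ab(2) by blast
  have "\<not> conj_eq \<F> \<H>" using ne \<F>(2) \<H>(2) q_eq_iff[OF \<F>(1) \<H>(1)] by simp
  then obtain n where "\<not> near n \<F> \<H>" using near_all[OF \<F>(1)] by blast
  then have "a \<in> q_ball n \<F>" "b \<notin> q_ball n \<F>"
   unfolding \<F>(2) \<H>(2) q_ball_iff[OF \<F>(1)] q_ball_iff[OF \<H>(1)] using near_refl by simp_all
  moreover have "S \<subseteq> q_ball n \<F> \<or> disjnt S (q_ball n \<F>)"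
   by (rule connectedin_clopen_cases[OF S q_ball_closed[OF \<F>(1)] q_ball_open[OF \<F>(1)]])
  ultimately show False using ab unfolding disjnt_def by blast
 qed
 then show "\<exists>x. S \<subseteq> {x}" by blast
qed

section \<open>Local compactness\<close>

text \<open>With dimension, domain and equality fixed, an interpretation is a point of a product of
  finite sets of reduced formulas. The interpretations form a closed subset, because each violated
  requirement involves finitely many symbols.\<close>

lemma compactin_basic_nbhd:
 assumes \<a>: "\<a> \<in> Itp" shows "compactin IT (basic_nbhd \<a> 0)"
proof -
 define F where "F = (\<lambda>r. reduced_formulas L T (arity L r * idim \<a>))"
 define P where "P = product_topology (\<lambda>r. discrete_topology (F r)) (symbols L)"
 define upd where "upd \<s> = \<a>\<lparr>sym_fm := \<s>\<rparr>" for \<s>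
 define C where "C = {\<s> \<in> Pi\<^sub>E (symbols L) F. upd \<s> \<in> Itp}"
 have upd_sel: "idim (upd \<s>) = idim \<a>" "dom_fm (upd \<s>) = dom_fm \<a>" "eq_fm (upd \<s>) = eq_fm \<a>" "sym_fm (upd \<s>) = \<s>" for \<s>
  by (simp_all add: upd_def)
 have upd_dom: "dom_set (upd \<s>) N = dom_set \<a> N" "eq_rel (upd \<s>) N = eq_rel \<a> N" for \<s> and N :: "(nat, 'r) struct"
  by (simp_all add: dom_set_def eq_rel_def upd_sel)
 have openP: "openin P S <-> S \<subseteq> Pi\<^sub>E (symbols L) F \<and>
  (\<forall>s\<in>S. \<exists>K. finite K \<and> K \<subseteq> symbols L \<and> {t \<in> Pi\<^sub>E (symbols L) F. \<forall>j\<in>K. t j = s j} \<subseteq> S)" for S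
  unfolding P_def by (rule openin_product_discrete)
 have topP: "topspace P = Pi\<^sub>E (symbols L) F" by (simp add: P_def)
 have img: "basic_nbhd \<a> 0 = upd ` C"
 proof (intro equalityI subsetI)
  fix \<b> assume \<b>: "\<b> \<in> basic_nbhd \<a> 0"
  then have eq: "\<b> = upd (sym_fm \<b>)" by (intro interp.equality) (simp_all add: basic_nbhd_def upd_sel)
  have "red_interp \<b>" using interp_red subsetD[OF basic_nbhd_Itp \<b>] by blast
  then have "sym_fm \<b> \<in> Pi\<^sub>E (symbols L) F" using \<b> by (simp add: red_interp_def F_def basic_nbhd_def)
  moreover have "upd (sym_fm \<b>) \<in> Itp" unfolding eq[symmetric] by (rule subsetD[OF basic_nbhd_Itp \<b>])
  ultimately show "\<b> \<in> upd ` C" using eq unfolding C_def by blast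
 qed (auto simp: C_def basic_nbhd_def upd_sel)
 have "compact_space P"
  unfolding P_def compact_space_product_topology
  by (intro disjI2 ballI) (simp add: compact_space_discrete_topology F_def finite_reduced_formulas)
 moreover have "closedin P C"
  unfolding closedin_def topP openP
 proof (intro conjI ballI)
  show "C \<subseteq> Pi\<^sub>E (symbols L) F" "Pi\<^sub>E (symbols L) F - C \<subseteq> Pi\<^sub>E (symbols L) F" by (auto simp: C_def)
  fix \<s> assume \<s>: "\<s> \<in> Pi\<^sub>E (symbols L) F - C"
  define ok where "ok r \<f> <-> (\<forall>N\<in>countable_models L T. \<forall>xss yss. length xss = arity L r -->
   list_all2 (\<lambda>xs ys. (xs, ys) \<in> eq_rel \<a> N) xss yss --> (sat N (concat xss) \<f> <-> sat N (concat yss) \<f>))" for r \<f>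
  have iff: "upd \<u> \<in> Itp <-> (\<forall>r\<in>symbols L. ok r (\<u> r)) \<and> (\<forall>\<p>\<in>T. translate (upd \<u>) \<p> \<in> T)"
   if "\<u> \<in> Pi\<^sub>E (symbols L) F" for \<u>
  proof -
   have a: "idim \<a> \<ge> 1" "dom_fm \<a> \<in> reduced_formulas L T (idim \<a>)" "eq_fm \<a> \<in> reduced_formulas L T (2 * idim \<a>)"
    "!!N. N \<in> countable_models L T ==> dom_set \<a> N \<noteq> {} \<and> equiv (dom_set \<a> N) (eq_rel \<a> N)"
    using \<a> unfolding interpretations_def mem_Collect_eq by blast+
   have b: "\<u> \<in> (\<Pi>\<^sub>E r\<in>symbols L. reduced_formulas L T (arity L r * idim \<a>))" using that by (simp add: F_def)
   show ?thesis
    unfolding interpretations_def mem_Collect_eq upd_sel upd_dom ok_def using a b by blast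
  qed
  \<comment> \<open>Finitely many symbols witness the failure of \<open>\<s>\<close>: a symbol whose
    formula is not invariant, or the symbols of a sentence of \<open>T\<close> whose translation
    leaves \<open>T\<close>.\<close>
  obtain K where K: "finite K" "!!\<u>. \<u> \<in> Pi\<^sub>E (symbols L) F ==> (!!r. r \<in> K \<inter> symbols L ==> \<u> r = \<s> r) ==> upd \<u> \<notin> Itp"
  proof (cases "\<forall>r\<in>symbols L. ok r (\<s> r)")
   case False
   then obtain r where r: "r \<in> symbols L" "\<not> ok r (\<s> r)" by blast
   show thesis
   proof (rule that[of "{r}"])
    fix \<u> assume \<u>: "\<u> \<in> Pi\<^sub>E (symbols L) F" and "!!r'. r' \<in> {r} \<inter> symbols L ==> \<u> r' = \<s> r'"
    then have "\<u> r = \<s> r" using r(1) by simp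
    then show "upd \<u> \<notin> Itp" using iff[OF \<u>] r by metis
   qed simp
  next
   case True
   have "upd \<s> \<notin> Itp" "\<s> \<in> Pi\<^sub>E (symbols L) F" using \<s> by (auto simp: C_def)
   then obtain \<p> where \<p>: "\<p> \<in> T" "translate (upd \<s>) \<p> \<notin> T" using iff True by blast
   show thesis
   proof (rule that[of "set_fm \<p>"])
    fix \<u> assume \<u>: "\<u> \<in> Pi\<^sub>E (symbols L) F" and eq: "!!r. r \<in> set_fm \<p> \<inter> symbols L ==> \<u> r = \<s> r"
    have "\<u> r = \<s> r" if "r \<in> set_fm \<p>" for r
    proof (cases "r \<in> symbols L")
     case False
     \<comment> \<open>Outside the language both functions have the value
       \<open>undefined\<close>.\<close>
     then show ?thesis using PiE_arb[OF \<u> False] PiE_arb[of \<s> "symbols L" F r] \<s> by simp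
    qed (use eq that in blast)
    then have "translate (upd \<u>) \<p> = translate (upd \<s>) \<p>" by (intro translate_cong) (simp_all add: upd_sel)
    then show "upd \<u> \<notin> Itp" using iff[OF \<u>] \<p> by metis
   qed (rule finite_set_fm)
  qed
  have "{t \<in> Pi\<^sub>E (symbols L) F. \<forall>j\<in>K \<inter> symbols L. t j = \<s> j} \<subseteq> Pi\<^sub>E (symbols L) F - C"
  proof
   fix t assume "t \<in> {t \<in> Pi\<^sub>E (symbols L) F. \<forall>j\<in>K \<inter> symbols L. t j = \<s> j}"
   then have t: "t \<in> Pi\<^sub>E (symbols L) F" "!!r. r \<in> K \<inter> symbols L ==> t r = \<s> r" by simp_all
   have "upd t \<notin> Itp" by (rule K(2)[OF t])
   then show "t \<in> Pi\<^sub>E (symbols L) F - C" using t(1) by (simp add: C_def)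
  qed
  then show "\<exists>K. finite K \<and> K \<subseteq> symbols L \<and>
   {t \<in> Pi\<^sub>E (symbols L) F. \<forall>j\<in>K. t j = \<s> j} \<subseteq> Pi\<^sub>E (symbols L) F - C"
   using K(1) by (intro exI[of _ "K \<inter> symbols L"]) simp
 qed
 ultimately have "compactin P C" by (rule closedin_compact_space)
 then have "compactin (subtopology P C) C" by (simp add: compactin_subtopology)
 moreover have "continuous_map (subtopology P C) IT upd"
  unfolding continuous_map
 proof (intro conjI allI impI)
  have topC: "topspace (subtopology P C) = C" by (auto simp: topP C_def)
  show "upd ` topspace (subtopology P C) \<subseteq> topspace IT" unfolding topC topspace_IT by (auto simp: C_def)
  fix V assume V: "openin IT V"
  show "openin (subtopology P C) {\<s> \<in> topspace (subtopology P C). upd \<s> \<in> V}"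
   unfolding topC
  proof (rule openin_subopen[THEN iffD2], intro ballI)
   fix \<s> assume "\<s> \<in> {\<s> \<in> C. upd \<s> \<in> V}"
   then have \<s>: "\<s> \<in> C" "upd \<s> \<in> V" by simp_all
   obtain n where n: "basic_nbhd (upd \<s>) n \<subseteq> V" using V \<s>(2) unfolding openin_IT by blast
   let ?W = "{\<u> \<in> Pi\<^sub>E (symbols L) F. \<forall>r\<in>symbs n. \<u> r = \<s> r}"
   have "openin P ?W"
    unfolding openP
   proof (intro conjI ballI exI[of _ "symbs n"])
    fix s assume s: "s \<in> ?W"
    show "{t \<in> Pi\<^sub>E (symbols L) F. \<forall>j\<in>symbs n. t j = s j} \<subseteq> ?W"
    proof
     fix t assume t: "t \<in> {t \<in> Pi\<^sub>E (symbols L) F. \<forall>j\<in>symbs n. t j = s j}"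
     then have "t r = \<s> r" if "r \<in> symbs n" for r using s that by simp
     then show "t \<in> ?W" using t by simp
    qed
   qed (use finite_symbs in auto)
   then have "openin (subtopology P C) (?W \<inter> C)" by (rule openin_subtopology_Int)
   moreover have "\<s> \<in> ?W \<inter> C" using \<s>(1) by (simp add: C_def)
   moreover have "?W \<inter> C \<subseteq> {\<s> \<in> C. upd \<s> \<in> V}"
   proof
    fix \<u> assume \<u>: "\<u> \<in> ?W \<inter> C"
    then have "upd \<u> \<in> basic_nbhd (upd \<s>) n" unfolding basic_nbhd_def C_def by (simp add: upd_sel)
    then show "\<u> \<in> {\<s> \<in> C. upd \<s> \<in> V}" using n \<u> by blast
   qed
   ultimately show "\<exists>W. openin (subtopology P C) W \<and> \<s> \<in> W \<and> W \<subseteq> {\<s> \<in> C. upd \<s> \<in> V}" by blast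
  qed
 qed
 ultimately show ?thesis unfolding img by (rule image_compactin)
qed

lemma basic_nbhd_open: "\<a> \<in> Itp ==> openin IT (basic_nbhd \<a> n)"
 unfolding openin_IT using basic_nbhd_Itp basic_nbhd_eq by blast

text \<open>By \<open>near_A\<close> all classes in question come from automorphisms. An open set of
  \<open>BY\<close> is pulled back along \<open>q\<close>, and \<open>q_ball_subset\<close> returns
  a level \<open>n\<close> such that interpretations agreeing up to \<open>n\<close> stay in it;
  this handles the inverses that enter the topology of \<open>BT\<close>.\<close>

lemma continuous_cls:
 assumes \<F>: "\<F> \<in> \<A>" "induces \<a> \<F>"
 shows "continuous_map (subtopology IT (basic_nbhd \<a> 0)) BY cls"
 unfolding continuous_map
proof (intro conjI allI impI)
 let ?N = "basic_nbhd \<a> 0"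
 have top: "topspace (subtopology IT ?N) = ?N" using basic_nbhd_Itp by (auto simp: topspace_IT)
 have ex: "\<exists>\<H>. \<H> \<in> \<A> \<and> induces \<b> \<H>" if \<b>: "\<b> \<in> ?N" for \<b>
 proof -
  obtain \<H> where \<H>: "induces \<b> \<H>" using induces_ex subsetD[OF basic_nbhd_Itp \<b>] by blast
  from near_A[OF \<F>(1) \<H> basic_nbhd_near[OF \<F>(2) \<H> \<b>]] show ?thesis by blast
 qed
 show "cls ` topspace (subtopology IT ?N) \<subseteq> topspace BY"
  unfolding top topspace_BY
 proof
  fix a assume "a \<in> cls ` ?N"
  then obtain \<b> where \<b>: "\<b> \<in> ?N" "a = cls \<b>" by blast
  obtain \<H> where "\<H> \<in> \<A>" "induces \<b> \<H>" using ex[OF \<b>(1)] by blast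
  then show "a \<in> carrier BG" unfolding \<b>(2) using q_Units q_cls by metis
 qed
 fix V assume V: "openin BY V"
 show "openin (subtopology IT ?N) {\<b> \<in> topspace (subtopology IT ?N). cls \<b> \<in> V}"
  unfolding top
 proof (rule openin_subopen[THEN iffD2], intro ballI)
  fix \<b> assume "\<b> \<in> {\<b> \<in> ?N. cls \<b> \<in> V}"
  then have \<b>: "\<b> \<in> ?N" "cls \<b> \<in> V" by simp_all
  obtain \<H> where \<H>: "\<H> \<in> \<A>" "induces \<b> \<H>" using ex[OF \<b>(1)] by blast
  let ?S = "{\<H> \<in> topspace AT. q \<H> \<in> V}"
  have "openin AT ?S" by (rule openin_continuous_map_preimage[OF q_continuous V])
  moreover have "\<H> \<in> ?S" using \<H>(1) \<b>(2) q_cls[OF \<H>(2)] by (simp add: topspace_AT)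
  ultimately obtain n where n: "q_ball n \<H> \<subseteq> q ` ?S" using q_ball_subset by blast
  have "cls \<c> \<in> V" if \<c>: "\<c> \<in> ?N" "\<c> \<in> basic_nbhd \<b> n" for \<c>
  proof -
   obtain \<T> where \<T>: "\<T> \<in> \<A>" "induces \<c> \<T>" using ex[OF \<c>(1)] by blast
   have "q \<T> \<in> q_ball n \<H>" unfolding q_ball_iff[OF \<T>(1)] by (rule basic_nbhd_near[OF \<H>(2) \<T>(2) \<c>(2)])
   then have "q \<T> \<in> q ` ?S" using n by blast
   then have "q \<T> \<in> V" by (elim imageE CollectE conjE) (simp only:)
   then show ?thesis by (simp add: q_cls[OF \<T>(2)])
  qed
  moreover have "openin (subtopology IT ?N) (basic_nbhd \<b> n \<inter> ?N)"
   unfolding openin_subtopology using basic_nbhd_open[OF subsetD[OF basic_nbhd_Itp \<b>(1)]] by blast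
  moreover have "\<b> \<in> basic_nbhd \<b> n" by (rule basic_nbhd_self[OF subsetD[OF basic_nbhd_Itp \<b>(1)]])
  ultimately show "\<exists>W. openin (subtopology IT ?N) W \<and> \<b> \<in> W \<and> W \<subseteq> {\<b> \<in> ?N. cls \<b> \<in> V}"
   using \<b>(1) by (intro exI[of _ "basic_nbhd \<b> n \<inter> ?N"]) blast
 qed
qed

text \<open>The compact neighbourhood consists of the classes of all interpretations sharing
  dimension, domain and equality with one inducing \<open>\<F>\<close>. It contains the open ball of
  level 0, since each automorphism in that ball is induced by such an interpretation.\<close>

lemma locally_compact_BT: "locally_compact_space BY"
 unfolding locally_compact_space_def
proof
 fix a assume "a \<in> topspace BY"
 then obtain \<F> where \<F>: "\<F> \<in> \<A>" "a = q \<F>" unfolding topspace_BY by (rule BG_E)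
 obtain \<a> where \<a>: "induces \<a> \<F>" using \<F>(1) by (rule A_induced)
 let ?N = "basic_nbhd \<a> 0"
 have "compactin (subtopology IT ?N) ?N"
  using compactin_basic_nbhd[OF induces_Itp[OF \<a>]] by (simp add: compactin_subtopology)
 then have "compactin BY (cls ` ?N)" by (rule image_compactin[OF _ continuous_cls[OF \<F>(1) \<a>]])
 moreover have "q_ball 0 \<F> \<subseteq> cls ` ?N"
 proof
  fix b assume "b \<in> q_ball 0 \<F>"
  then obtain \<H> where \<H>: "\<H> \<in> \<A>" "near 0 \<F> \<H>" "b = q \<H>" by (auto simp: q_ball_def)
  obtain \<b> where "\<b> \<in> ?N" "induces \<b> \<H>" by (rule near_realized[OF \<a> A_funcset[OF \<H>(1)] \<H>(2)])
  then show "b \<in> cls ` ?N" using q_cls \<H>(3) by blast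
 qed
 moreover have "a \<in> q_ball 0 \<F>" unfolding \<F>(2) q_ball_iff[OF \<F>(1)] by (rule near_refl)
 ultimately show "\<exists>W K. openin BY W \<and> compactin BY K \<and> a \<in> W \<and> W \<subseteq> K"
  using q_ball_open[OF \<F>(1)] by blast
qed

end

theorem theorem1p3:
  fixes L :: "'r language" and M :: "('a, 'r) struct"
  assumes "countable_language L"
    and "is_structure L M" and "countable (universe M)"
    and "omega_categorical L (Th L M)"
  shows "let G = automorphism_group L M; X = automorphism_topology L M; T = Th L M in
     (topological_group (BT L T) (BT_topology L T) \<and>
      totally_disconnected_space (BT_topology L T) \<and>
      locally_compact_space (BT_topology L T)) \<and>
     topologically_isomorphic (BT L T) (BT_topology L T) (Out G X) (Out_topology G X)"
proof -
  interpret omega_cat L M using assms by unfold_locales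
  show ?thesis unfolding Let_def
    using topological_group_BT totally_disconnected_BT locally_compact_BT BT_iso_Out by blast
qed

end
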